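(* Let $\Omega\subset\mathbb{R}^d$, $d\in\{2,3\}$, be an open, bounded, simply connected domain with Lipschitz boundary, let $\nu>0$, $\alpha>0$, $\beta>0$, $\gamma\in(0,1)$, $\delta\ge1$ (with $\delta\le2$ if $d=3$). Let $\{V_h\}$ be a family of finite-dimensional subspaces of $H_0^1(\Omega)$ with the approximation property given in the context. Assume that $$\nu+\frac{\beta\gamma}{\lambda_1}>\frac{\beta}{\lambda_1}2^{2\delta-1}(1+\gamma)^2(\delta+1)^2+\frac{2C_{GN}\,\alpha}{\lambda_1^{\theta_d}}\sqrt{\frac{\widetilde K}{\beta}},$$ with $\lambda_1,C_{GN},\theta_d,\widetilde K$ as in the context, and that $u\in H_0^1(\Omega)\cap H^2(\Omega)$ satisfies $$-\nu\Delta u+\alpha u^{\delta}\sum_{i=1}^d\frac{\partial u}{\partial x_i}-\beta u(1-u^{\delta})(u^{\delta}-\gamma)=f .$$ Let $u_h\in V_h$ satisfy $$\nu(\nabla u_h,\nabla\chi)+\alpha\int_\Omega u_h^{\delta}\sum_{i=1}^d\frac{\partial u_h}{\partial x_i}\chi\,dx=\beta\int_\Omega u_h(1-u_h^{\delta})(u_h^{\delta}-\gamma)\chi\,dx+\langle f,\chi\rangle\quad\text{for all }\chi\in V_h .$$ Then $$\|u_h-u\|_{H^1(\Omega)}\le Ch,$$ where $C$ is a constant possibly depending on $\nu,\alpha,\beta,\gamma,\delta,\|f\|_{L^2(\Omega)}$, but independent of $h$.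
   Context: $\lambda_1$ is the first eigenvalue of the Dirichlet Laplacian on $\Omega$. $$\widetilde K=\frac{\beta\delta(1+\gamma)^{\frac{2(\delta+1)}{\delta}}}{\delta+1}\left(\frac{\delta+2}{\delta+1}\right)^{\frac{\delta+2}{\delta}}|\Omega|+\frac1\nu\|f\|_{H^{-1}(\Omega)}^2,$$ where $|\Omega|$ is the Lebesgue measure and $\|f\|_{H^{-1}}=\sup_{0\ne v\in H_0^1(\Omega)}\langle f,v\rangle/\|v\|_{H^1(\Omega)}$. $C_{GN}$ and $\theta_d$: for $d=2$, $C_{GN}$ is the constant in the Gagliardo–Nirenberg inequality $\|w\|_{L^{2(\delta+1)}}\le C_{GN}\|\nabla w\|_{L^2}^{\frac{\delta}{\delta+1}}\|w\|_{L^2}^{\frac1{\delta+1}}$ on $H_0^1(\Omega)$ and $\theta_2=\frac{1}{2(\delta+1)}$; for $d=3$, $1\le\delta\le2$, it is the constant in $\|w\|_{L^{2(\delta+1)}}\le C_{GN}\|\nabla w\|_{L^2}^{\frac{3\delta}{2(\delta+1)}}\|w\|_{L^2}^{\frac{2-\delta}{2(\delta+1)}}$ on $H_0^1(\Omega)$ and $\theta_3=\frac{2-\delta}{4(\delta+1)}$. Approximation property of $\{V_h\}$ ($h>0$ sufficiently small is the mesh size of a shape-regular triangular or rectangular mesh of $\Omega$): there are an order of accuracy $r\ge2$ and a constant $c$ independent of $h$ with $$\inf_{\chi\in V_h}\left\{\|v-\chi\|_{L^2}+h\|\nabla(v-\chi)\|_{L^2}\right\}\le c\,h^k\|v\|_{H^k}\quad\text{for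 all }v\in H^r(\Omega)\cap H_0^1(\Omega),\ 1\le k\le r,$$ and the Ritz projection $R^h:H_0^1(\Omega)\to V_h$, defined by $(\nabla R^hv,\nabla\chi)=(\nabla v,\nabla\chi)$ for all $\chi\in V_h$, satisfies $\|R^hv-v\|_{L^2}+h\|\nabla(R^hv-v)\|_{L^2}\le c\,h^s\|v\|_{H^s}$ for all $v\in H^s(\Omega)\cap H_0^1(\Omega)$, $1\le s\le r$. Power convention: if $\delta$ is an integer, $s^\delta$ is the usual power; if $\delta$ is not an integer, $s^{\delta}$ means $|s|^{\delta}$ for $s\in\mathbb{R}$. *)

theory Defs
  imports "HOL-Analysis.Analysis" "HOL-Library.Multiset"
begin

text \<open>
  Functions on \<Omega> are total functions on \<open>real ^ 'n\<close> of which only the values on \<Omega> matter, up to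
  Lebesgue-null sets.  Multi-indices are multisets over the index type \<open>'n\<close> of the coordinates:
  \<open>size \<alpha>\<close> is the order of the multi-index.
\<close>


section \<open>Test functions and weak derivatives\<close>

primrec partials :: "'n::finite list \<Rightarrow> (real ^ 'n \<Rightarrow> real) \<Rightarrow> real ^ 'n \<Rightarrow> real" where
  "partials [] \<phi> = \<phi>"
| "partials (i # is) \<phi> = partials is (\<lambda>x. frechet_derivative \<phi> (at x) (axis i 1))"

definition test_functions :: "(real ^ 'n::finite) set \<Rightarrow> (real ^ 'n \<Rightarrow> real) set" where
  "test_functions \<Omega> =
     {\<phi>. (\<forall>is x. partials is \<phi> differentiable (at x)) \<and>
          (\<exists>K. compact K \<and> K \<subseteq> \<Omega> \<and> (\<forall>x. x \<notin> K \<longrightarrow> \<phi> x = 0))}"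

definition locally_integrable :: "(real ^ 'n::finite) set \<Rightarrow> (real ^ 'n \<Rightarrow> real) \<Rightarrow> bool" where
  "locally_integrable \<Omega> u \<longleftrightarrow> (\<forall>K. compact K \<and> K \<subseteq> \<Omega> \<longrightarrow> integrable (lebesgue_on K) u)"

definition has_weak_deriv ::
  "(real ^ 'n::finite) set \<Rightarrow> 'n multiset \<Rightarrow> (real ^ 'n \<Rightarrow> real) \<Rightarrow> (real ^ 'n \<Rightarrow> real) \<Rightarrow> bool" where
  "has_weak_deriv \<Omega> \<alpha> u g \<longleftrightarrow> locally_integrable \<Omega> u \<and> locally_integrable \<Omega> g \<and>
     (\<forall>\<phi>\<in>test_functions \<Omega>. \<forall>is. mset is = \<alpha> \<longrightarrow>
        (\<integral>x. u x * partials is \<phi> x \<partial>lebesgue_on \<Omega>)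
          = (- 1) ^ size \<alpha> * (\<integral>x. g x * \<phi> x \<partial>lebesgue_on \<Omega>))"

text \<open>Some representative; weak derivatives are unique up to null sets.\<close>

definition weak_deriv ::
  "(real ^ 'n::finite) set \<Rightarrow> 'n multiset \<Rightarrow> (real ^ 'n \<Rightarrow> real) \<Rightarrow> real ^ 'n \<Rightarrow> real" where
  "weak_deriv \<Omega> \<alpha> u = (SOME g. has_weak_deriv \<Omega> \<alpha> u g)"

definition grad :: "(real ^ 'n::finite) set \<Rightarrow> (real ^ 'n \<Rightarrow> real) \<Rightarrow> real ^ 'n \<Rightarrow> real ^ 'n" where
  "grad \<Omega> u x = (\<chi> i. weak_deriv \<Omega> {#i#} u x)"

definition laplacian :: "(real ^ 'n::finite) set \<Rightarrow> (real ^ 'n \<Rightarrow> real) \<Rightarrow> real ^ 'n \<Rightarrow> real" where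
  "laplacian \<Omega> u x = (\<Sum>i\<in>UNIV. weak_deriv \<Omega> {#i, i#} u x)"


section \<open>Lebesgue and Sobolev spaces\<close>

definition L2 :: "(real ^ 'n::finite) set \<Rightarrow> (real ^ 'n \<Rightarrow> real) set" where
  "L2 \<Omega> = {u \<in> borel_measurable (lebesgue_on \<Omega>). integrable (lebesgue_on \<Omega>) (\<lambda>x. (u x)\<^sup>2)}"

definition L2_inner ::
  "(real ^ 'n::finite) set \<Rightarrow> (real ^ 'n \<Rightarrow> real) \<Rightarrow> (real ^ 'n \<Rightarrow> real) \<Rightarrow> real" where
  "L2_inner \<Omega> u v = (\<integral>x. u x * v x \<partial>lebesgue_on \<Omega>)"

definition Lp_norm :: "(real ^ 'n::finite) set \<Rightarrow> real \<Rightarrow> (real ^ 'n \<Rightarrow> real) \<Rightarrow> real" where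
  "Lp_norm \<Omega> p u = (\<integral>x. \<bar>u x\<bar> powr p \<partial>lebesgue_on \<Omega>) powr (1 / p)"

definition grad_inner ::
  "(real ^ 'n::finite) set \<Rightarrow> (real ^ 'n \<Rightarrow> real) \<Rightarrow> (real ^ 'n \<Rightarrow> real) \<Rightarrow> real" where
  "grad_inner \<Omega> u v = (\<integral>x. grad \<Omega> u x \<bullet> grad \<Omega> v x \<partial>lebesgue_on \<Omega>)"

definition grad_norm :: "(real ^ 'n::finite) set \<Rightarrow> (real ^ 'n \<Rightarrow> real) \<Rightarrow> real" where
  "grad_norm \<Omega> u = sqrt (grad_inner \<Omega> u u)"

text \<open>A sum over an infinite set would be 0; the sum over multi-indices in the norm below is finite.\<close>

lemma finite_multi_indices: "finite {\<alpha> :: 'n::finite multiset. size \<alpha> \<le> k}"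
proof (rule finite_subset)
  show "{\<alpha> :: 'n multiset. size \<alpha> \<le> k} \<subseteq> mset ` {is. set is \<subseteq> UNIV \<and> length is \<le> k}"
    by (auto simp: image_iff) (metis ex_mset size_mset)
  show "finite (mset ` {is :: 'n list. set is \<subseteq> UNIV \<and> length is \<le> k})"
    by (intro finite_imageI finite_lists_length_le) simp
qed

definition sobolev :: "(real ^ 'n::finite) set \<Rightarrow> nat \<Rightarrow> (real ^ 'n \<Rightarrow> real) set" where
  "sobolev \<Omega> k = {u \<in> L2 \<Omega>. \<forall>\<alpha>. size \<alpha> \<le> k \<longrightarrow> (\<exists>g\<in>L2 \<Omega>. has_weak_deriv \<Omega> \<alpha> u g)}"

definition sobolev_norm :: "(real ^ 'n::finite) set \<Rightarrow> nat \<Rightarrow> (real ^ 'n \<Rightarrow> real) \<Rightarrow> real" where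
  "sobolev_norm \<Omega> k u = sqrt (\<Sum>\<alpha> | size \<alpha> \<le> k. (Lp_norm \<Omega> 2 (weak_deriv \<Omega> \<alpha> u))\<^sup>2)"

text \<open>\<open>H\<^sub>0\<^sup>1(\<Omega>)\<close>: the closure of the test functions in \<open>H\<^sup>1(\<Omega>)\<close>.\<close>

definition H01 :: "(real ^ 'n::finite) set \<Rightarrow> (real ^ 'n \<Rightarrow> real) set" where
  "H01 \<Omega> = {u \<in> sobolev \<Omega> 1. \<exists>\<phi>. (\<forall>m::nat. \<phi> m \<in> test_functions \<Omega>) \<and>
              (\<lambda>m. sobolev_norm \<Omega> 1 (\<lambda>x. u x - \<phi> m x)) \<longlonglongrightarrow> 0}"

definition Hm1_norm :: "(real ^ 'n::finite) set \<Rightarrow> (real ^ 'n \<Rightarrow> real) \<Rightarrow> real" where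
  "Hm1_norm \<Omega> f = Sup {L2_inner \<Omega> f v / sobolev_norm \<Omega> 1 v | v.
      v \<in> H01 \<Omega> \<and> \<not> (AE x in lebesgue_on \<Omega>. v x = 0)}"


section \<open>The domain and its constants\<close>

text \<open>
  Near each boundary point \<Omega> is, in rotated coordinates, the strict epigraph of a Lipschitz function:
  the unit vector \<open>e\<close> is the vertical direction and the function lives on the hyperplane
  orthogonal to \<open>e\<close>.
\<close>

definition lipschitz_boundary :: "(real ^ 'n::finite) set \<Rightarrow> bool" where
  "lipschitz_boundary \<Omega> \<longleftrightarrow>
     (\<forall>x\<in>frontier \<Omega>. \<exists>e \<rho> L g. norm e = 1 \<and> \<rho> > 0 \<and> L-lipschitz_on {y. y \<bullet> e = 0} g \<and>
        \<Omega> \<inter> ball x \<rho> = {y \<in> ball x \<rho>. g (y - (y \<bullet> e) *\<^sub>R e) < y \<bullet> e})"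

definition dirichlet_eigenvalue :: "(real ^ 'n::finite) set \<Rightarrow> real \<Rightarrow> bool" where
  "dirichlet_eigenvalue \<Omega> \<mu> \<longleftrightarrow>
     (\<exists>w\<in>H01 \<Omega>. \<not> (AE x in lebesgue_on \<Omega>. w x = 0) \<and>
        (\<forall>v\<in>H01 \<Omega>. grad_inner \<Omega> w v = \<mu> * L2_inner \<Omega> w v))"

definition first_dirichlet_eigenvalue :: "(real ^ 'n::finite) set \<Rightarrow> real \<Rightarrow> bool" where
  "first_dirichlet_eigenvalue \<Omega> \<mu> \<longleftrightarrow>
     dirichlet_eigenvalue \<Omega> \<mu> \<and> (\<forall>\<mu>'. dirichlet_eigenvalue \<Omega> \<mu>' \<longrightarrow> \<mu> \<le> \<mu>')"

text \<open>The exponents are those of dimension 2 if \<open>CARD('n) = 2\<close>, and those of dimension 3 otherwise.\<close>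

definition gagliardo_nirenberg_const ::
  "(real ^ 'n::finite) set \<Rightarrow> real \<Rightarrow> real \<Rightarrow> bool" where
  "gagliardo_nirenberg_const \<Omega> \<delta> C \<longleftrightarrow>
     (\<forall>w\<in>H01 \<Omega>. Lp_norm \<Omega> (2 * (\<delta> + 1)) w \<le>
        (if CARD('n) = 2
         then C * grad_norm \<Omega> w powr (\<delta> / (\<delta> + 1)) * Lp_norm \<Omega> 2 w powr (1 / (\<delta> + 1))
         else C * grad_norm \<Omega> w powr (3 * \<delta> / (2 * (\<delta> + 1)))
                * Lp_norm \<Omega> 2 w powr ((2 - \<delta>) / (2 * (\<delta> + 1)))))"

definition gn_theta :: "nat \<Rightarrow> real \<Rightarrow> real" where
  "gn_theta d \<delta> = (if d = 2 then 1 / (2 * (\<delta> + 1)) else (2 - \<delta>) / (4 * (\<delta> + 1)))"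

definition K_tilde ::
  "(real ^ 'n::finite) set \<Rightarrow> real \<Rightarrow> real \<Rightarrow> real \<Rightarrow> real \<Rightarrow> (real ^ 'n \<Rightarrow> real) \<Rightarrow> real" where
  "K_tilde \<Omega> \<nu> \<beta> \<gamma> \<delta> f =
     \<beta> * \<delta> * (1 + \<gamma>) powr (2 * (\<delta> + 1) / \<delta>) / (\<delta> + 1)
       * ((\<delta> + 2) / (\<delta> + 1)) powr ((\<delta> + 2) / \<delta>) * measure lebesgue \<Omega>
     + 1 / \<nu> * (Hm1_norm \<Omega> f)\<^sup>2"


section \<open>The generalized Burgers-Huxley equation\<close>

text \<open>
  The power convention for real bases: the ordinary power for an integer exponent, and
  \<open>\<bar>s\<bar> powr \<delta>\<close> otherwise.
\<close>

definition spow :: "real \<Rightarrow> real \<Rightarrow> real" where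
  "spow s \<delta> = (if \<delta> \<in> \<int> then s ^ nat \<lfloor>\<delta>\<rfloor> else \<bar>s\<bar> powr \<delta>)"

definition advection ::
  "(real ^ 'n::finite) set \<Rightarrow> real \<Rightarrow> (real ^ 'n \<Rightarrow> real) \<Rightarrow> real ^ 'n \<Rightarrow> real" where
  "advection \<Omega> \<delta> u x = spow (u x) \<delta> * (\<Sum>i\<in>UNIV. grad \<Omega> u x $ i)"

definition reaction :: "real \<Rightarrow> real \<Rightarrow> ('a \<Rightarrow> real) \<Rightarrow> 'a \<Rightarrow> real" where
  "reaction \<gamma> \<delta> u x = u x * (1 - spow (u x) \<delta>) * (spow (u x) \<delta> - \<gamma>)"

definition strong_solution ::
  "(real ^ 'n::finite) set \<Rightarrow> real \<Rightarrow> real \<Rightarrow> real \<Rightarrow> real \<Rightarrow> real \<Rightarrow> (real ^ 'n \<Rightarrow> real)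
     \<Rightarrow> (real ^ 'n \<Rightarrow> real) \<Rightarrow> bool" where
  "strong_solution \<Omega> \<nu> \<alpha> \<beta> \<gamma> \<delta> f u \<longleftrightarrow> u \<in> H01 \<Omega> \<inter> sobolev \<Omega> 2 \<and>
     (AE x in lebesgue_on \<Omega>.
        - \<nu> * laplacian \<Omega> u x + \<alpha> * advection \<Omega> \<delta> u x - \<beta> * reaction \<gamma> \<delta> u x = f x)"

definition galerkin_solution ::
  "(real ^ 'n::finite) set \<Rightarrow> real \<Rightarrow> real \<Rightarrow> real \<Rightarrow> real \<Rightarrow> real \<Rightarrow> (real ^ 'n \<Rightarrow> real)
     \<Rightarrow> (real ^ 'n \<Rightarrow> real) set \<Rightarrow> (real ^ 'n \<Rightarrow> real) \<Rightarrow> bool" where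
  "galerkin_solution \<Omega> \<nu> \<alpha> \<beta> \<gamma> \<delta> f V u\<^sub>h \<longleftrightarrow> u\<^sub>h \<in> V \<and>
     (\<forall>\<xi>\<in>V. \<nu> * grad_inner \<Omega> u\<^sub>h \<xi> + \<alpha> * L2_inner \<Omega> (advection \<Omega> \<delta> u\<^sub>h) \<xi>
              = \<beta> * L2_inner \<Omega> (reaction \<gamma> \<delta> u\<^sub>h) \<xi> + L2_inner \<Omega> f \<xi>)"


section \<open>Meshes and approximation spaces\<close>

definition triangular_mesh :: "(real ^ 'n::finite) set set \<Rightarrow> bool" where
  "triangular_mesh \<T> \<longleftrightarrow> triangulation \<T> \<and> (\<forall>K\<in>\<T>. int CARD('n) simplex K)"

definition rectangular_mesh :: "(real ^ 'n::finite) set set \<Rightarrow> bool" where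
  "rectangular_mesh \<T> \<longleftrightarrow> finite \<T> \<and>
     (\<forall>K\<in>\<T>. \<exists>(R :: real ^ 'n \<Rightarrow> real ^ 'n) a b. orthogonal_transformation R \<and> box a b \<noteq> {} \<and> K = R ` cbox a b) \<and>
     (\<forall>K\<in>\<T>. \<forall>K'\<in>\<T>. (K \<inter> K') face_of K \<and> (K \<inter> K') face_of K')"

text \<open>
  The family is indexed by the mesh size.  Shape regularity: every element contains a ball whose
  radius is at least a fixed fraction of the diameter of the element, uniformly in \<open>h\<close>.
\<close>

definition shape_regular_meshes ::
  "(real ^ 'n::finite) set \<Rightarrow> real set \<Rightarrow> (real \<Rightarrow> (real ^ 'n) set set) \<Rightarrow> bool" where
  "shape_regular_meshes \<Omega> H \<T> \<longleftrightarrow>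
     (\<forall>h\<in>H. (triangular_mesh (\<T> h) \<or> rectangular_mesh (\<T> h)) \<and>
            \<Union> (\<T> h) = closure \<Omega> \<and> h = Max (diameter ` \<T> h)) \<and>
     (\<exists>\<sigma>>0. \<forall>h\<in>H. \<forall>K\<in>\<T> h. \<exists>x. cball x (\<sigma> * diameter K) \<subseteq> K)"

text \<open>The subspace is closed under changes on null sets, hence the equality almost everywhere.\<close>

definition fin_dim_subspace_H01 ::
  "(real ^ 'n::finite) set \<Rightarrow> (real ^ 'n \<Rightarrow> real) set \<Rightarrow> bool" where
  "fin_dim_subspace_H01 \<Omega> V \<longleftrightarrow>
     (\<exists>(m::nat) b. (\<forall>j<m. b j \<in> H01 \<Omega>) \<and>
        V = {v. \<exists>a. AE x in lebesgue_on \<Omega>. v x = (\<Sum>j<m. a j * b j x)})"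

definition ritz_projection ::
  "(real ^ 'n::finite) set \<Rightarrow> (real ^ 'n \<Rightarrow> real) set \<Rightarrow> (real ^ 'n \<Rightarrow> real)
     \<Rightarrow> (real ^ 'n \<Rightarrow> real) \<Rightarrow> bool" where
  "ritz_projection \<Omega> V v w \<longleftrightarrow> w \<in> V \<and> (\<forall>\<xi>\<in>V. grad_inner \<Omega> w \<xi> = grad_inner \<Omega> v \<xi>)"

definition scaled_error ::
  "(real ^ 'n::finite) set \<Rightarrow> real \<Rightarrow> (real ^ 'n \<Rightarrow> real) \<Rightarrow> (real ^ 'n \<Rightarrow> real) \<Rightarrow> real" where
  "scaled_error \<Omega> h v w =
     Lp_norm \<Omega> 2 (\<lambda>x. v x - w x) + h * grad_norm \<Omega> (\<lambda>x. v x - w x)"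

definition approximation_property ::
  "(real ^ 'n::finite) set \<Rightarrow> real set \<Rightarrow> (real \<Rightarrow> (real ^ 'n \<Rightarrow> real) set) \<Rightarrow> bool" where
  "approximation_property \<Omega> H V \<longleftrightarrow>
     (\<exists>(r::nat)\<ge>2. \<exists>c::real. \<forall>h\<in>H.
        (\<forall>v\<in>sobolev \<Omega> r \<inter> H01 \<Omega>. \<forall>k\<in>{1..r}.
           (INF \<xi>\<in>V h. scaled_error \<Omega> h v \<xi>) \<le> c * h ^ k * sobolev_norm \<Omega> k v) \<and>
        (\<forall>s\<in>{1..r}. \<forall>v\<in>sobolev \<Omega> s \<inter> H01 \<Omega>. \<forall>w. ritz_projection \<Omega> (V h) v w \<longrightarrow>
           scaled_error \<Omega> h w v \<le> c * h ^ s * sobolev_norm \<Omega> s v))"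

end

theory Submission
 imports Defs "HOL-Complex_Analysis.Great_Picard"
begin

text \<open>
 Write w for the error. Subtracting the equation from the Galerkin scheme gives a form in w that vanishes
 on the discrete space, is Lipschitz in the energy norm, and satisfies a Garding inequality; its
 monotone part absorbs the nonlinear terms. Since the Ritz projection of u is accurate to order h
 times the norm of the Laplacian (by duality, without elliptic regularity), the gradient of w is bounded
 by h plus the L2 norm of w. Energy estimates, one of them with a regularisation of Psi(u) as test
 function, bound all quantities of u in terms of the norm of f.

 If the estimate failed, then errors with h tending to 0, normalised in the energy norm, would have a
 nonzero limit w that solves a linear equation. The test function with sign w, modulus a
 small power of w and weight exp (- k (x1 + ... + xd)) shows that w = 0: the weight absorbs part of the
 drift, and sharp Poincare and the smallness assumption control the rest. The Gagliardo-Nirenberg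
 part of that assumption enters only through its sign.
\<close>

text \<open>The obstacle is the drift. Tested with w, the limit equation charges it with a multiple
  of \<open>\<alpha>^2 c^2 w^2\<close>, where c is the difference quotient of
  \<open>s sg(s)\<close>; the reaction offers \<open>m w^2\<close>, with m the quotient of
  \<open>s |s|^(2 \<delta>)\<close>. Cauchy-Schwarz for averages gives
  \<open>c^2 <= const m\<close>, but \<open>\<alpha>\<close> may be large. With sign w |w|^p as test
  function the charge gains the factor p, so a small p lets the reaction pay for any
  \<open>\<alpha>\<close>. The diffusion that survives is also only of order p; the weight therefore
  has to remove the part of the reaction term linear in c that is not of order p, and the smallness
  assumption balances two quantities of the same order.

  Compactness stands in for a duality argument for the L^2 norm of the error. Data, solutions and
  mesh vary along the contradicting sequence and only the norm of f is fixed, which is why C depends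
  on f through its norm alone. Compactness comes from the discrete spaces themselves: Ritz
  projections have finite rank and, as h tends to 0, approximate uniformly on energy-bounded
  sets.\<close>

abbreviation seqlim :: "(nat => 'a::topological_space) => 'a => bool" (infix "---->" 60) where
 "X ----> L \<equiv> X \<longlonglongrightarrow> L"

section \<open>Square-integrable functions over an arbitrary measure\<close>

definition sqint :: "'a measure => ('a => real) => bool" where
 "sqint M f \<longleftrightarrow> f \<in> borel_measurable M \<and> integrable M (%x. (f x)^2)"

definition nrm :: "'a measure => ('a => real) => real" where
 "nrm M f = sqrt (LINT x|M. (f x)^2)"

lemma sqintD [measurable_dest]: "sqint M f ==> f \<in> borel_measurable M"
 by (simp add: sqint_def)

lemma sqint_sq: "sqint M f ==> integrable M (%x. (f x)^2)"
 by (simp add: sqint_def)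

lemma sqint_dominated:
 assumes "f \<in> borel_measurable M" "integrable M g" "AE x in M. (f x)^2 <= g x"
 shows "sqint M f"
 unfolding sqint_def
proof
 show "integrable M (%x. (f x)^2)"
  by (rule Bochner_Integration.integrable_bound[OF assms(2)])
    (use assms in \<open>auto elim!: eventually_mono\<close>)
qed (use assms in auto)

lemma sqint_mult_integrable:
 assumes "sqint M f" "sqint M g"
 shows "integrable M (%x. f x * g x)"
proof (rule Bochner_Integration.integrable_bound)
 show "integrable M (%x. (f x)^2 + (g x)^2)"
  using assms by (auto simp: sqint_def)
 show "(%x. f x * g x) \<in> borel_measurable M"
  using assms by (auto simp: sqint_def)
 have "\<bar>a * b\<bar> <= a^2 + b^2" for a b :: real
 proof -
  have "0 <= (\<bar>a\<bar> - \<bar>b\<bar>)^2" "0 <= a^2 + b^2" by auto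
  then show ?thesis unfolding power2_diff power2_abs abs_mult by linarith
 qed
 then show "AE x in M. norm (f x * g x) <= norm ((f x)^2 + (g x)^2)"
  by (auto intro!: AE_I2 simp: abs_of_nonneg)
qed

lemma sqint_cmult [intro]: "sqint M f ==> sqint M (%x. a * f x)"
 by (auto simp: sqint_def power_mult_distrib)

lemma sqint_add [intro]:
 assumes "sqint M f" "sqint M g"
 shows "sqint M (%x. f x + g x)"
 using assms sqint_mult_integrable[OF assms]
 by (auto simp: sqint_def power2_sum mult.assoc)

lemma sqint_diff [intro]:
 assumes "sqint M f" "sqint M g"
 shows "sqint M (%x. f x - g x)"
 using sqint_add[OF assms(1) sqint_cmult[OF assms(2), of "-1"]] by simp

lemma sqint_zero [intro, simp]: "sqint M (%x. 0)"
 by (auto simp: sqint_def)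

lemma sqint_sum [intro]:
 "(!!i. i \<in> I ==> sqint M (f i)) ==> sqint M (%x. \<Sum>i\<in>I. f i x)"
 by (induction I rule: infinite_finite_induct) auto

lemma sqint_abs: "sqint M f ==> sqint M (%x. \<bar>f x\<bar>)"
 by (auto simp: sqint_def)

lemma sqint_le:
 assumes "sqint M g" "f \<in> borel_measurable M" "!!x. x \<in> space M ==> \<bar>f x\<bar> <= \<bar>g x\<bar>"
 shows "sqint M f"
 using assms by (intro sqint_dominated[OF _ sqint_sq[OF assms(1)]]) (auto intro!: AE_I2 simp: abs_le_square_iff)

lemma sqint_AE:
 assumes "sqint M g" "f \<in> borel_measurable M" "AE x in M. f x = g x"
 shows "sqint M f"
 using assms(3) by (intro sqint_dominated[OF assms(2) sqint_sq[OF assms(1)]]) (auto elim: eventually_mono)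

lemma (in finite_measure) sqint_integrable:
 assumes "sqint M f" shows "integrable M f"
proof (rule Bochner_Integration.integrable_bound)
 show "integrable M (%x. 1 + (f x)^2)" using assms by (auto simp: sqint_def)
 have "\<bar>a\<bar> <= 1 + a^2" for a :: real
  using zero_le_power2[of "\<bar>a\<bar> - 1"] zero_le_power2[of a] unfolding power2_diff power2_abs one_power2 by linarith
 then show "AE x in M. norm (f x) <= norm (1 + (f x)^2)" by (auto intro!: AE_I2)
qed (use assms in \<open>auto simp: sqint_def\<close>)

lemma nrm_nonneg [simp]: "0 <= nrm M f"
 by (simp add: nrm_def)

lemma nrm_sq: "(nrm M f)^2 = (LINT x|M. (f x)^2)"
 by (simp add: nrm_def)

lemma nrm_zero_AE:
 assumes "sqint M f" "nrm M f = 0"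
 shows "AE x in M. f x = 0"
proof -
 have "(LINT x|M. (f x)^2) = 0" using assms(2) nrm_sq[of M f] by simp
 then have "AE x in M. (f x)^2 = 0"
  using integral_nonneg_eq_0_iff_AE[OF sqint_sq[OF assms(1)]] by simp
 then show ?thesis by simp
qed

lemma nrm_AE_zero:
 assumes "sqint M f" "AE x in M. f x = 0"
 shows "nrm M f = 0"
 using assms(2) unfolding nrm_def
 by (subst integral_cong_AE[of _ M "%x. 0"]) (use assms in \<open>auto elim: eventually_mono\<close>)

lemma nrm_cong_AE:
 assumes "sqint M f" "sqint M g" "AE x in M. f x = g x"
 shows "nrm M f = nrm M g"
 unfolding nrm_def using assms
 by (intro arg_cong[of _ _ sqrt] integral_cong_AE) (auto elim: eventually_mono)

lemma nrm_cmult: "nrm M (%x. a * f x) = \<bar>a\<bar> * nrm M f"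
 by (simp add: nrm_def power_mult_distrib real_sqrt_mult)

lemma cauchy_schwarz:
 assumes "sqint M f" "sqint M g"
 shows "\<bar>(LINT x|M. f x * g x)\<bar> <= nrm M f * nrm M g"
proof (cases "nrm M f = 0 \<or> nrm M g = 0")
 case True
 then have "AE x in M. f x * g x = 0"
  using nrm_zero_AE[OF assms(1)] nrm_zero_AE[OF assms(2)] by (auto elim: eventually_mono)
 then have "(LINT x|M. f x * g x) = (LINT x|M. 0)"
  using assms by (intro integral_cong_AE) auto
 then show ?thesis by simp
next
 case False
 define a b where "a = nrm M f" and "b = nrm M g"
 have ab: "a > 0" "b > 0" using False by (auto simp: a_def b_def less_le)
 \<comment> \<open>Young's inequality with the weights that make each of the two integrated terms
   equal to \<open>a * b / 2\<close>.\<close>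
 have pt: "\<bar>s * t\<bar> <= (b / (2 * a)) * s^2 + (a / (2 * b)) * t^2" for s t :: real
 proof -
  have "0 <= (b * \<bar>s\<bar> - a * \<bar>t\<bar>)^2" by simp
  then have "2 * (a * b) * \<bar>s * t\<bar> <= b^2 * s^2 + a^2 * t^2"
   by (simp add: power2_diff power_mult_distrib abs_mult algebra_simps)
  then show ?thesis using ab by (simp add: field_simps power2_eq_square)
 qed
 have "\<bar>(LINT x|M. f x * g x)\<bar> <= (LINT x|M. \<bar>f x * g x\<bar>)" by (rule integral_abs_bound)
 also have "... <= (LINT x|M. (b / (2 * a)) * (f x)^2 + (a / (2 * b)) * (g x)^2)"
  using assms pt by (intro integral_mono) (auto simp: sqint_sq intro!: sqint_mult_integrable)
 also have "... = (b / (2 * a)) * a^2 + (a / (2 * b)) * b^2"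
  using assms by (simp add: sqint_sq a_def b_def nrm_sq)
 also have "... = a * b" using ab by (simp add: field_simps power2_eq_square)
 finally show ?thesis by (simp add: a_def b_def)
qed

lemma nrm_add_sq:
 assumes "sqint M f" "sqint M g"
 shows "(nrm M (%x. f x + g x))^2 = (nrm M f)^2 + 2 * (LINT x|M. f x * g x) + (nrm M g)^2"
proof -
 have "(LINT x|M. (f x + g x)^2) = (LINT x|M. (f x)^2 + 2 * (f x * g x) + (g x)^2)"
  by (intro Bochner_Integration.integral_cong) (auto simp: power2_sum)
 also have "... = (LINT x|M. (f x)^2) + 2 * (LINT x|M. f x * g x) + (LINT x|M. (g x)^2)"
  using assms sqint_mult_integrable[OF assms] by (simp add: sqint_sq)
 finally show ?thesis by (simp add: nrm_sq)
qed

lemma nrm_triangle: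
 assumes "sqint M f" "sqint M g"
 shows "nrm M (%x. f x + g x) <= nrm M f + nrm M g"
proof (rule power2_le_imp_le)
 show "(nrm M (%x. f x + g x))^2 <= (nrm M f + nrm M g)^2"
  using nrm_add_sq[OF assms] cauchy_schwarz[OF assms] by (simp add: power2_sum)
qed simp

lemma nrm_minus_commute: "nrm M (%x. f x - g x) = nrm M (%x. g x - f x)"
 by (simp add: nrm_def power2_commute)

lemma nrm_triangle_diff:
 assumes "sqint M f" "sqint M g"
 shows "nrm M (%x. f x - g x) <= nrm M f + nrm M g"
 using nrm_triangle[OF assms(1) sqint_cmult[OF assms(2), of "-1"]] nrm_cmult[of M "-1" g] by simp

lemma nrm_diff_triangle:
 assumes "sqint M f" "sqint M g" "sqint M k"
 shows "nrm M (%x. f x - g x) <= nrm M (%x. f x - k x) + nrm M (%x. k x - g x)"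
 using nrm_triangle[OF sqint_diff[OF assms(1,3)] sqint_diff[OF assms(3,2)]] by simp

lemma nrm_le_diff:
 assumes "sqint M f" "sqint M g"
 shows "nrm M f <= nrm M g + nrm M (%x. f x - g x)"
 using nrm_triangle[OF assms(2) sqint_diff[OF assms]] by simp

lemma nrm_sum_le:
 assumes "!!i. i \<in> I ==> sqint M (f i)"
 shows "nrm M (%x. \<Sum>i\<in>I. f i x) <= (\<Sum>i\<in>I. nrm M (f i))"
 using assms
proof (induction I rule: infinite_finite_induct)
 case (insert i I)
 then show ?case
  using nrm_triangle[of M "f i" "%x. \<Sum>j\<in>I. f j x"] sqint_sum[of I M f] by simp
qed (auto simp: nrm_def)

lemma nrm_le_of_sq:
 assumes "sqint M f" "integrable M g" "!!x. x \<in> space M ==> (f x)^2 <= g x"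
 shows "(nrm M f)^2 <= (LINT x|M. g x)"
 unfolding nrm_sq using assms by (intro integral_mono) (auto simp: sqint_sq)

text \<open>Square integrability is part of the notion because \<open>nrm\<close> takes the default
  value 0 when the square is not integrable.\<close>

definition L2lim :: "'a measure => (nat => 'a => real) => ('a => real) => bool" where
 "L2lim M f g \<longleftrightarrow> (\<forall>n. sqint M (f n)) \<and> sqint M g \<and> (%n. nrm M (%x. f n x - g x)) ----> 0"

lemma L2limD:
 assumes "L2lim M f g"
 shows "sqint M (f n)" "sqint M g" "(%n. nrm M (%x. f n x - g x)) ----> 0"
 using assms by (auto simp: L2lim_def)

lemma L2lim_const: "sqint M g ==> L2lim M (%n. g) g"
 by (auto simp: L2lim_def nrm_def)

lemma L2lim_add:
 assumes "L2lim M f f'" "L2lim M g g'"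
 shows "L2lim M (%n x. f n x + g n x) (%x. f' x + g' x)"
proof -
 note D = L2limD[OF assms(1)] L2limD[OF assms(2)]
 have "(%n. nrm M (%x. (f n x + g n x) - (f' x + g' x))) ----> 0"
 proof (rule tendsto_sandwich[OF _ _ tendsto_const])
  show "(%n. nrm M (%x. f n x - f' x) + nrm M (%x. g n x - g' x)) ----> 0"
   using tendsto_add[OF D(3,6)] by simp
  show "\<forall>\<^sub>F n in sequentially. nrm M (%x. (f n x + g n x) - (f' x + g' x)) <=
     nrm M (%x. f n x - f' x) + nrm M (%x. g n x - g' x)"
  proof (intro always_eventually allI)
   fix n
   have "(%x. (f n x + g n x) - (f' x + g' x)) = (%x. (f n x - f' x) + (g n x - g' x))" by auto
   then show "nrm M (%x. (f n x + g n x) - (f' x + g' x)) <=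
     nrm M (%x. f n x - f' x) + nrm M (%x. g n x - g' x)"
    using nrm_triangle[of M "%x. f n x - f' x" "%x. g n x - g' x"] D by auto
  qed
 qed auto
 then show ?thesis using D by (auto simp: L2lim_def)
qed

lemma L2lim_cmult:
 assumes "L2lim M f f'"
 shows "L2lim M (%n x. a * f n x) (%x. a * f' x)"
proof -
 note D = L2limD[OF assms]
 have eq: "nrm M (%x. a * f n x - a * f' x) = \<bar>a\<bar> * nrm M (%x. f n x - f' x)" for n
  using nrm_cmult[of M a "%x. f n x - f' x"] by (simp add: algebra_simps)
 show ?thesis
  using D tendsto_mult[OF tendsto_const[of "\<bar>a\<bar>"] D(3)] by (auto simp: L2lim_def eq)
qed

lemma L2lim_subseq: "L2lim M f g ==> strict_mono r ==> L2lim M (%n. f (r n)) g"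
 by (auto simp: L2lim_def intro: LIMSEQ_subseq_LIMSEQ[unfolded o_def])

lemma L2lim_nrm:
 assumes "L2lim M f g" shows "(%n. nrm M (f n)) ----> nrm M g"
proof (rule LIMSEQ_I)
 note D = L2limD[OF assms]
 fix r :: real assume "0 < r"
 from LIMSEQ_D[OF D(3) this] obtain N where N: "!!n. n \<ge> N ==> nrm M (%x. f n x - g x) < r" by auto
 have "\<bar>nrm M (f n) - nrm M g\<bar> <= nrm M (%x. f n x - g x)" for n
  using nrm_le_diff[OF D(1)[of n] D(2)] nrm_le_diff[OF D(2) D(1)[of n]] nrm_minus_commute[of M "f n" g]
  by simp
 then show "\<exists>N. \<forall>n\<ge>N. norm (nrm M (f n) - nrm M g) < r"
  using N by (metis le_less_trans real_norm_def)
qed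

lemma L2lim_bounded:
 assumes "L2lim M f g" obtains B where "!!n. nrm M (f n) <= B"
proof -
 have "Bseq (%n. nrm M (f n))" using L2lim_nrm[OF assms] by (intro convergent_imp_Bseq) (auto simp: convergent_def)
 then obtain B where "\<forall>n. norm (nrm M (f n)) <= B" by (elim BseqE) blast
 then show ?thesis using that[of B] by simp
qed

text \<open>Polarisation reduces inner products to norms, which converge by the triangle
  inequality.\<close>

lemma L2lim_inner:
 assumes "L2lim M f f'" "L2lim M g g'"
 shows "(%n. (LINT x|M. f n x * g n x)) ----> (LINT x|M. f' x * g' x)"
proof -
 note D = L2limD[OF assms(1)] L2limD[OF assms(2)]
 have pol: "(LINT x|M. u x * v x) = ((nrm M (%x. u x + v x))^2 - (nrm M u)^2 - (nrm M v)^2) / 2"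
  if "sqint M u" "sqint M v" for u v
  using nrm_add_sq[OF that] by simp
 have "(%n. ((nrm M (%x. f n x + g n x))^2 - (nrm M (f n))^2 - (nrm M (g n))^2) / 2) ---->
    ((nrm M (%x. f' x + g' x))^2 - (nrm M f')^2 - (nrm M g')^2) / 2"
  by (intro tendsto_intros L2lim_nrm L2lim_add assms) simp
 then show ?thesis using D by (simp add: pol)
qed

lemma L2lim_AE_subseq:
 assumes "L2lim M f g"
 shows "\<exists>r::nat=>nat. strict_mono r \<and> (AE x in M. (%n. f (r n) x) ----> g x)"
proof -
 note D = L2limD[OF assms]
 have "(%n. (nrm M (%x. f n x - g x))^2) ----> 0^2" by (intro tendsto_intros D(3))
 then have "(%n. (LINT x|M. norm ((f n x - g x)^2))) ----> 0" by (simp add: nrm_sq)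
 from tendsto_L1_AE_subseq[OF _ this] D(1,2)
 obtain r where r: "strict_mono r" "AE x in M. (%n. (f (r n) x - g x)^2) ----> 0"
  by (auto simp: sqint_sq sqint_diff)
 have "AE x in M. (%n. f (r n) x) ----> g x"
  using r(2)
 proof eventually_elim
  case (elim x)
  have "(%n. sqrt ((f (r n) x - g x)^2)) ----> sqrt 0" by (intro tendsto_intros elim)
  then have "(%n. f (r n) x - g x) ----> 0" by (simp add: tendsto_rabs_zero_iff)
  then show ?case by (simp add: LIM_zero_iff)
 qed
 with r(1) show ?thesis by blast
qed

text \<open>Fatou's lemma in the form in which it produces integrability: uniform bounds obtained
  with regularised or smooth approximations pass to the almost-everywhere limit, whose integral is
  not known to exist beforehand.\<close>

lemma fatou_bounded:
 fixes f :: "nat => 'a => real"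
 assumes int: "!!n. integrable M (f n)" and nn: "!!n x. x \<in> space M ==> 0 <= f n x"
  and lim: "AE x in M. (%n. f n x) ----> g x"
  and K: "!!n. (LINT x|M. f n x) <= K" and g: "g \<in> borel_measurable M"
 shows "integrable M g" "(LINT x|M. g x) <= K"
proof -
 have g0: "AE x in M. 0 <= g x"
  using lim AE_space by eventually_elim (rule LIMSEQ_le_const, assumption, auto intro: nn)
 have "(\<integral>\<^sup>+x. ennreal (g x) \<partial>M) = (\<integral>\<^sup>+x. liminf (%n. ennreal (f n x)) \<partial>M)"
 proof (rule nn_integral_cong_AE)
  show "AE x in M. ennreal (g x) = liminf (%n. ennreal (f n x))"
   using lim
  proof eventually_elim
   case (elim x)
   then have "(%n. ennreal (f n x)) ----> ennreal (g x)" by (rule tendsto_ennrealI)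
   then show ?case by (intro lim_imp_Liminf[symmetric]) auto
  qed
 qed
 also have "... <= liminf (%n. \<integral>\<^sup>+x. ennreal (f n x) \<partial>M)"
  by (rule nn_integral_liminf) (use int in auto)
 also have "... <= liminf (%n::nat. ennreal K)"
 proof (intro Liminf_mono always_eventually allI)
  fix n show "(\<integral>\<^sup>+x. ennreal (f n x) \<partial>M) <= ennreal K"
   using K[of n] nn by (subst nn_integral_eq_integral) (auto intro: int ennreal_leI)
 qed
 also have "... = ennreal K" by (simp add: Liminf_const)
 finally have le: "(\<integral>\<^sup>+x. ennreal (g x) \<partial>M) <= ennreal K" .
 show gi: "integrable M g"
  by (rule integrableI_nonneg) (use g g0 le in \<open>auto intro: le_less_trans\<close>)
 have "0 <= (LINT x|M. f 0 x)" using nn by (intro Bochner_Integration.integral_nonneg) auto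
 then have "0 <= K" using K[of 0] by linarith
 have "ennreal (LINT x|M. g x) <= ennreal K"
  using nn_integral_eq_integral[OF gi g0] le by simp
 then show "(LINT x|M. g x) <= K" using \<open>0 <= K\<close> by simp
qed

lemma fatou_L2:
 assumes f: "!!n. sqint M (f n)" and lim: "AE x in M. (%n. f n x) ----> g x"
  and K: "!!n. nrm M (f n) <= K" and g: "g \<in> borel_measurable M"
 shows "sqint M g" "nrm M g <= K"
proof -
 have K0: "0 <= K" using K[of 0] nrm_nonneg[of M "f 0"] by linarith
 have 1: "AE x in M. (%n. (f n x)^2) ----> (g x)^2"
  using lim by eventually_elim (intro tendsto_intros)
 have 2: "(LINT x|M. (f n x)^2) <= K^2" for n
  using power_mono[OF K[of n], of 2] by (simp add: nrm_sq)
 have 3: "(%x. (g x)^2) \<in> borel_measurable M" using g by simp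
 have a: "integrable M (%x. (g x)^2)" "(LINT x|M. (g x)^2) <= K^2"
  by (rule fatou_bounded[OF sqint_sq[OF f] _ 1 2 3], simp)+
 then show "sqint M g" using g by (simp add: sqint_def)
 show "nrm M g <= K" using a(2) K0 by - (rule power2_le_imp_le, simp_all add: nrm_sq)
qed

text \<open>A version of Vitali's theorem: the summand \<open>\<eta> A\<^sub>m\<close> replaces uniform integrability.\<close>

lemma vitali_limit:
 fixes X :: "nat => 'a => real"
 assumes X [measurable]: "!!m. X m \<in> borel_measurable M" and Y [measurable]: "Y \<in> borel_measurable M"
  and lim: "AE x in M. (%m. X m x) ----> Y x"
  and A: "!!m. integrable M (A m)" "!!m x. 0 <= A m x" "!!m. (LINT x|M. A m x) <= K"
  and B: "!!\<eta>. \<eta> > 0 ==> \<exists>B. integrable M B \<and> (\<forall>m. AE x in M. \<bar>X m x\<bar> <= \<eta> * A m x + B x)"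
 shows "integrable M Y" "(%m. (LINT x|M. X m x)) ----> (LINT x|M. Y x)"
proof -
 obtain B1 where B1: "integrable M B1" "!!m. AE x in M. \<bar>X m x\<bar> <= 1 * A m x + B1 x"
  using B[of 1] by auto
 have Xi: "integrable M (X m)" for m
  by (rule Bochner_Integration.integrable_bound[OF Bochner_Integration.integrable_add[OF A(1)[of m] B1(1)]])
    (use B1(2)[of m] in \<open>auto elim: eventually_mono\<close>)
 have "integrable M (%x. \<bar>Y x\<bar>)"
 proof (rule fatou_bounded)
  show "AE x in M. (%m. \<bar>X m x\<bar>) ----> \<bar>Y x\<bar>" using lim by eventually_elim (intro tendsto_intros)
  show "(LINT x|M. \<bar>X m x\<bar>) <= K + (LINT x|M. B1 x)" for m
  proof -
   have "(LINT x|M. \<bar>X m x\<bar>) <= (LINT x|M. A m x + B1 x)"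
    using B1(1) B1(2)[of m] A(1)[of m] Xi[of m] by (intro integral_mono_AE) auto
   also have "... = (LINT x|M. A m x) + (LINT x|M. B1 x)" using A(1)[of m] B1(1) by simp
   finally show ?thesis using A(3)[of m] by linarith
  qed
 qed (use Xi in auto)
 then show Yi: "integrable M Y" using integrable_abs_iff Y by blast
 have K0: "0 <= K" using A(3)[of 0] Bochner_Integration.integral_nonneg[of M "A 0"] A(2) by (meson order_trans)
 show "(%m. (LINT x|M. X m x)) ----> (LINT x|M. Y x)"
 proof (rule LIMSEQ_I)
  fix r :: real assume r: "0 < r"
  define \<eta> where "\<eta> = r / (2 * (K + 1))"
  have \<eta>: "\<eta> > 0" using r K0 by (simp add: \<eta>_def)
  obtain B0 where B0: "integrable M B0" "!!m. AE x in M. \<bar>X m x\<bar> <= \<eta> * A m x + B0 x"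
   using B[OF \<eta>] by auto
  \<comment> \<open>The part of the error that exceeds \<open>\<eta> * A m\<close>. It is dominated
    by \<open>|B0| + |Y|\<close> for all m at once, so dominated convergence applies to it; the part
    left out costs at most \<open>\<eta> * K\<close>.\<close>
  define W where "W m x = max 0 (\<bar>X m x - Y x\<bar> - \<eta> * A m x)" for m x
  have W [measurable]: "W m \<in> borel_measurable M" for m
   unfolding W_def using A(1)[of m] by measurable
  have Wb: "AE x in M. norm (W m x) <= \<bar>B0 x\<bar> + \<bar>Y x\<bar>" for m
   using B0(2)[of m] by eventually_elim (auto simp: W_def)
  have Wint: "integrable M (W m)" for m
   by (rule Bochner_Integration.integrable_bound[of M "%x. \<bar>B0 x\<bar> + \<bar>Y x\<bar>"])
     (use Wb[of m] B0 Yi in \<open>auto elim!: eventually_mono\<close>)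
  have "(%m. (LINT x|M. W m x)) ----> (LINT x|M. 0)"
  proof (rule integral_dominated_convergence[where w = "%x. \<bar>B0 x\<bar> + \<bar>Y x\<bar>"])
   show "AE x in M. (%m. W m x) ----> 0"
    using lim
   proof eventually_elim
    case (elim x)
    have "(%m. \<bar>X m x - Y x\<bar>) ----> 0"
     using elim by (simp add: LIM_zero tendsto_rabs_zero)
    then show ?case
     by (rule tendsto_sandwich[OF _ _ tendsto_const, rotated 2])
       (use A(2) \<eta> in \<open>auto simp: W_def intro!: always_eventually\<close>)
   qed
  qed (use B0 Yi Wb in auto)
  then obtain N where N: "!!m. m \<ge> N ==> \<bar>(LINT x|M. W m x)\<bar> < r / 2"
   using LIMSEQ_D[of _ "0::real" "r / 2"] r by auto
  show "\<exists>no. \<forall>n\<ge>no. norm ((LINT x|M. X n x) - (LINT x|M. Y x)) < r"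
  proof (intro exI[of _ N] allI impI)
   fix n assume n: "N <= n"
   have "norm ((LINT x|M. X n x) - (LINT x|M. Y x)) = \<bar>(LINT x|M. X n x - Y x)\<bar>"
    using Xi Yi by simp
   also have "... <= (LINT x|M. \<bar>X n x - Y x\<bar>)" by (rule integral_abs_bound)
   also have "... <= (LINT x|M. W n x + \<eta> * A n x)"
    using Xi Yi Wint A by (intro integral_mono) (auto simp: W_def)
   also have "... = (LINT x|M. W n x) + \<eta> * (LINT x|M. A n x)" using Wint A by simp
   also have "... < r / 2 + \<eta> * (K + 1)"
    using N[OF n] A(3)[of n] \<eta> by (intro add_less_le_mono mult_left_mono) auto
   also have "... = r" using K0 by (simp add: \<eta>_def field_simps)
   finally show "norm ((LINT x|M. X n x) - (LINT x|M. Y x)) < r" .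
  qed
 qed
qed

text \<open>Along a subsequence the increments have norm at most \<open>(1/2)^k\<close>, so the
  partial sums \<open>S\<close> of their absolute values stay below norm 2 and are finite almost
  everywhere by monotone convergence. This gives a pointwise limit, and Fatou turns the Cauchy
  property of the whole sequence into convergence in norm.\<close>

lemma riesz_fischer:
 assumes f: "!!n. sqint M (f n)"
  and cauchy: "!!e. e > 0 ==> \<exists>N. \<forall>m\<ge>N. \<forall>n\<ge>N. nrm M (%x. f m x - f n x) < e"
 shows "\<exists>g. L2lim M f g"
proof -
 note [measurable] = sqintD[OF f]
 have "\<exists>r. \<forall>k. (\<forall>m\<ge>r k. \<forall>n\<ge>r k. nrm M (%x. f m x - f n x) < (1/2)^k) \<and> r (Suc k) > r k"
 proof (rule dependent_nat_choice)
  show "\<exists>x. \<forall>m\<ge>x. \<forall>n\<ge>x. nrm M (%xa. f m xa - f n xa) < (1/2)^0"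
   using cauchy[of 1] by simp
  fix x k
  obtain N where N: "\<forall>m\<ge>N. \<forall>n\<ge>N. nrm M (%x. f m x - f n x) < (1/2)^Suc k"
   using cauchy[of "(1/2)^Suc k"] by auto
  show "\<exists>y. (\<forall>m\<ge>y. \<forall>n\<ge>y. nrm M (%x. f m x - f n x) < (1/2)^Suc k) \<and> y > x"
   by (rule exI[of _ "max N (Suc x)"]) (use N in auto)
 qed
 then obtain r where r: "!!k m n. m \<ge> r k ==> n \<ge> r k ==> nrm M (%x. f m x - f n x) < (1/2)^k"
  and r_Suc: "!!k. r (Suc k) > r k" by blast
 have smr: "strict_mono r" using r_Suc by (simp add: strict_mono_Suc_iff)
 define d where "d k x = \<bar>f (r (Suc k)) x - f (r k) x\<bar>" for k x
 have d: "sqint M (d k)" for k unfolding d_def by (intro sqint_abs sqint_diff f)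
 note [measurable] = sqintD[OF d]
 have nd: "nrm M (d k) <= (1/2)^k" for k
  using r[of k "r (Suc k)" "r k"] r_Suc[of k] by (simp add: d_def nrm_def)
 define S where "S n x = (\<Sum>k<n. d k x)" for n x
 have S: "sqint M (S n)" for n unfolding S_def by (intro sqint_sum d)
 note [measurable] = sqintD[OF S]
 have nS: "nrm M (S n) <= 2" for n
 proof -
  have "nrm M (S n) <= (\<Sum>k<n. nrm M (d k))" unfolding S_def by (intro nrm_sum_le d)
  also have "... <= (\<Sum>k<n. (1/2)^k)" by (intro sum_mono nd)
  also have "... <= 2" by (simp add: sum_gp_strict)
  finally show ?thesis .
 qed
 have "(\<integral>\<^sup>+x. (SUP n. ennreal ((S n x)^2)) \<partial>M) = (SUP n. \<integral>\<^sup>+x. ennreal ((S n x)^2) \<partial>M)"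
 proof (rule nn_integral_monotone_convergence_SUP)
  show "incseq (%n x. ennreal ((S n x)^2))"
   by (intro incseq_SucI le_funI ennreal_leI power_mono) (auto simp: S_def d_def sum_nonneg)
 qed measurable
 also have "... <= ennreal 4"
 proof (rule SUP_least)
  fix n
  have "(\<integral>\<^sup>+x. ennreal ((S n x)^2) \<partial>M) = ennreal ((nrm M (S n))^2)"
   unfolding nrm_sq by (intro nn_integral_eq_integral sqint_sq S) auto
  also have "... <= ennreal (2^2)" by (intro ennreal_leI power_mono nS) auto
  finally show "(\<integral>\<^sup>+x. ennreal ((S n x)^2) \<partial>M) <= ennreal 4" by simp
 qed
 finally have "(\<integral>\<^sup>+x. (SUP n. ennreal ((S n x)^2)) \<partial>M) ~= \<infinity>"
  by (auto simp: top_unique)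
 then have "AE x in M. (SUP n. ennreal ((S n x)^2)) ~= \<infinity>"
  by (intro nn_integral_PInf_AE) measurable
 then have conv: "AE x in M. convergent (%k. f (r k) x)"
 proof eventually_elim
  case (elim x)
  then obtain c where c: "c \<ge> 0" "(SUP n. ennreal ((S n x)^2)) = ennreal c"
   by (metis ennreal_cases infinity_ennreal_def)
  have Sb: "S n x <= sqrt c" for n
  proof -
   have "ennreal ((S n x)^2) <= ennreal c" unfolding c(2)[symmetric] by (rule SUP_upper) simp
   then have "(S n x)^2 <= c" using c(1) by simp
   then show ?thesis by (rule real_le_rsqrt)
  qed
  have "(\<Sum>k\<le>n. d k x) <= sqrt c" for n
   using Sb[of "Suc n"] by (simp add: S_def lessThan_Suc_atMost)
  then have "summable (%k. d k x)"
   by (intro bounded_imp_summable[of _ "sqrt c"]) (auto simp: d_def)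
  then have "summable (%k. f (r (Suc k)) x - f (r k) x)"
   unfolding d_def by (rule summable_rabs_cancel)
  then obtain l where "(%k. f (r (Suc k)) x - f (r k) x) sums l" by (auto simp: summable_def)
  then have "(%n. \<Sum>k<n. f (r (Suc k)) x - f (r k) x) ----> l" by (simp add: sums_def)
  then have "(%n. f (r n) x - f (r 0) x) ----> l"
   by (simp add: sum_lessThan_telescope[where f = "%k. f (r k) x"])
  then have "(%n. f (r n) x - f (r 0) x + f (r 0) x) ----> l + f (r 0) x" by (intro tendsto_intros)
  then show ?case by (auto simp: convergent_def)
 qed
 define g where "g x = lim (%k. f (r k) x)" for x
 have g [measurable]: "g \<in> borel_measurable M" unfolding g_def by measurable
 have lim: "AE x in M. (%k. f (r k) x) ----> g x"
  using conv by eventually_elim (simp add: g_def convergent_LIMSEQ_iff)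
 have key: "sqint M (%x. f m x - g x) \<and> nrm M (%x. f m x - g x) <= (1/2)^k" if "m \<ge> r k" for m k
 proof -
  have k_le: "r k <= r (n + k)" for n
   using smr by (simp add: strict_mono_less_eq)
  have l: "AE x in M. (%n. f m x - f (r (n + k)) x) ----> f m x - g x"
   using lim by eventually_elim (intro tendsto_intros LIMSEQ_ignore_initial_segment)
  have b: "nrm M (%x. f m x - f (r (n + k)) x) <= (1/2)^k" for n
   using r[OF that k_le[of n]] by simp
  show ?thesis
   using fatou_L2[of M "%n x. f m x - f (r (n + k)) x" "%x. f m x - g x", OF sqint_diff[OF f f] l b] by simp
 qed
 have "sqint M (%x. f (r 0) x - g x)" using key[of 0 "r 0"] by simp
 from sqint_diff[OF f[of "r 0"] this] have gs: "sqint M g" by simp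
 have "(%n. nrm M (%x. f n x - g x)) ----> 0"
 proof (rule LIMSEQ_I)
  fix e :: real assume "0 < e"
  then obtain k where k: "(1/2::real)^k < e" using real_arch_pow_inv[of e "1/2"] by auto
  then show "\<exists>no. \<forall>n\<ge>no. norm (nrm M (%x. f n x - g x) - 0) < e"
   using key[of k] by (intro exI[of _ "r k"]) (auto intro: le_less_trans)
 qed
 then show ?thesis using f gs by (auto simp: L2lim_def)
qed

section \<open>Smooth functions and test functions\<close>

definition pd :: "'n::finite => (real ^ 'n => real) => real ^ 'n => real" where
 "pd i \<phi> x = frechet_derivative \<phi> (at x) (axis i 1)"

definition smooth :: "(real ^ 'n::finite => real) => bool" where
 "smooth \<phi> \<longleftrightarrow> (\<forall>is x. partials is \<phi> differentiable (at x))"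

lemma partials_Cons_pd: "partials (i # is) \<phi> = partials is (pd i \<phi>)"
 by (simp add: pd_def[abs_def])

text \<open>\<open>partials\<close> peels derivatives off one at a time, so it suffices to exhibit
  one class of differentiable functions that is closed under \<open>pd\<close>.\<close>

lemma smooth_coinduct:
 assumes "\<phi> \<in> S" "!!f x. f \<in> S ==> f differentiable (at x)" "!!f i. f \<in> S ==> pd i f \<in> S"
 shows "smooth \<phi>"
proof -
 have "\<forall>f\<in>S. \<forall>x. partials is f differentiable (at x)" for "is"
 proof (induction "is")
  case (Cons i "is")
  then show ?case using assms(3) unfolding partials_Cons_pd by blast
 qed (use assms in auto)
 then show ?thesis using assms(1) by (auto simp: smooth_def)
qed

lemma smooth_differentiable: "smooth \<phi> ==> \<phi> differentiable (at x)"
 unfolding smooth_def by (metis partials.simps(1))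

lemma smooth_pd: "smooth \<phi> ==> smooth (pd i \<phi>)"
 unfolding smooth_def by (metis partials_Cons_pd)

lemma pd_eq:
 assumes "(f has_derivative f') (at x)" shows "pd i f x = f' (axis i 1)"
 unfolding pd_def using frechet_derivative_at[OF assms] by simp

lemma pd_has_derivative:
 "f differentiable (at x) ==> (f has_derivative frechet_derivative f (at x)) (at x)"
 using frechet_derivative_works by blast

lemma pd_eq_add:
 assumes "f differentiable (at x)" "g differentiable (at x)"
 shows "pd i (%x. f x + g x) x = pd i f x + pd i g x"
 using has_derivative_add[OF assms[THEN pd_has_derivative]] by (simp add: pd_eq) (simp add: pd_def)

lemma pd_eq_mult:
 assumes "f differentiable (at x)" "g differentiable (at x)"
 shows "pd i (%x. f x * g x) x = f x * pd i g x + pd i f x * g x"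
 using has_derivative_mult[OF assms[THEN pd_has_derivative]] by (simp add: pd_eq) (simp add: pd_def)

text \<open>The derivatives of \<open>exp (-1/t)\<close>, continued by 0, are combinations of these functions.\<close>

definition bump_fun :: "nat => real => real" where
 "bump_fun j t = (if t > 0 then exp (- (1 / t)) / t ^ j else 0)"

lemma bump_fun_tendsto: "((%t. bump_fun j t) \<longlongrightarrow> 0) (at 0)"
proof -
 have "((%t. exp (- (1 / t)) / t ^ j) \<longlongrightarrow> 0) (at_right (0::real))"
 proof -
  have "((%s::real. s ^ j / exp s) \<longlongrightarrow> 0) at_top" by (rule tendsto_power_div_exp_0)
  from filterlim_compose[OF this filterlim_inverse_at_top_right]
  show ?thesis
   by (rule Lim_transform_eventually)
     (auto simp: eventually_at_right_field exp_minus field_simps intro!: exI[of _ 1])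
 qed
 then have "((%t. bump_fun j t) \<longlongrightarrow> 0) (at_right 0)"
  by (rule Lim_transform_eventually) (auto simp: eventually_at_right_field bump_fun_def intro!: exI[of _ 1])
 moreover have "((%t. bump_fun j t) \<longlongrightarrow> 0) (at_left 0)"
  by (rule Lim_transform_eventually[OF tendsto_const])
    (auto simp: eventually_at_left_field bump_fun_def intro!: exI[of _ "-1"])
 ultimately show ?thesis by (simp add: filterlim_at_split)
qed

lemma bump_fun_deriv:
 "(bump_fun j has_real_derivative bump_fun (j + 2) t - j * bump_fun (j + 1) t) (at t)"
proof (cases "t = 0")
 case True
 \<comment> \<open>At 0 the difference quotient of \<open>bump_fun j\<close> is
   \<open>bump_fun (j + 1)\<close> itself.\<close>
 have "((%h. (bump_fun j (0 + h) - bump_fun j 0) / h) \<longlongrightarrow> 0) (at 0)"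
  using bump_fun_tendsto[of "j + 1"]
  by (rule Lim_transform_eventually) (auto simp: bump_fun_def field_simps intro!: always_eventually)
 then show ?thesis using True by (simp add: DERIV_def) (simp add: bump_fun_def)
next
 case False
 show ?thesis
 proof (cases "t > 0")
  case True
  have "((%t. exp (- (1 / t)) / t ^ j) has_real_derivative
    bump_fun (j + 2) t - j * bump_fun (j + 1) t) (at t)"
   by (cases j; (rule derivative_eq_intros refl | use True in force)+)
     (use True in \<open>auto simp: bump_fun_def field_simps power2_eq_square\<close>)
  then show ?thesis
   by (rule DERIV_cong_ev[THEN iffD1, OF refl _ refl, rotated])
     (use True eventually_nhds_in_open[of "{0<..}" t] in \<open>auto simp: bump_fun_def elim: eventually_mono\<close>)
 next
  case f: False
  have "((%t. 0) has_real_derivative 0) (at t)" by simp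
  then have "(bump_fun j has_real_derivative 0) (at t)"
   by (rule DERIV_cong_ev[THEN iffD1, OF refl _ refl, rotated])
     (use f \<open>t ~= 0\<close> eventually_nhds_in_open[of "{..<0}" t] in \<open>auto simp: bump_fun_def elim: eventually_mono\<close>)
  then show ?thesis using f by (simp add: bump_fun_def)
 qed
qed

inductive_set smooth_alg :: "(real ^ 'n::finite => real) set" where
 const: "(%x. c) \<in> smooth_alg"
| coord: "(%x. x $ i) \<in> smooth_alg"
| base: "smooth \<phi> ==> \<phi> \<in> smooth_alg"
| add: "f \<in> smooth_alg ==> g \<in> smooth_alg ==> (%x. f x + g x) \<in> smooth_alg"
| mult: "f \<in> smooth_alg ==> g \<in> smooth_alg ==> (%x. f x * g x) \<in> smooth_alg"
| powr: "f \<in> smooth_alg ==> (!!x. f x > 0) ==> (%x. f x powr r) \<in> smooth_alg"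
| exp: "f \<in> smooth_alg ==> (%x. exp (f x)) \<in> smooth_alg"
| bump: "f \<in> smooth_alg ==> (%x. bump_fun j (f x)) \<in> smooth_alg"

lemma smooth_alg_step:
 assumes "f \<in> smooth_alg"
 shows "(\<forall>x. f differentiable (at x)) \<and> (\<forall>i. pd i f \<in> smooth_alg)"
 using assms
proof induction
 case (const c)
 have "pd i (%x. c) = (%x. 0)" for i :: 'a by (auto simp: pd_eq[OF has_derivative_const])
 then show ?case by (auto intro: smooth_alg.const)
next
 case (coord i)
 have d: "((%x::real^'a. x $ i) has_derivative (%x. x $ i)) (at x)" for x
  by (simp add: bounded_linear_imp_has_derivative bounded_linear_vec_nth)
 then have "pd k (%x. x $ i) = (%x. axis k 1 $ i)" for k by (auto simp: pd_eq[OF d])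
 then show ?case using d by (auto intro: smooth_alg.const simp: differentiable_def)
next
 case (base \<phi>)
 then show ?case by (auto intro: smooth_alg.base smooth_pd smooth_differentiable)
next
 case (add f g)
 have "pd i (%x. f x + g x) = (%x. pd i f x + pd i g x)" for i
  using add by (auto intro!: pd_eq_add)
 then show ?case using add by (auto intro: smooth_alg.add)
next
 case (mult f g)
 have "pd i (%x. f x * g x) = (%x. f x * pd i g x + pd i f x * g x)" for i
  using mult by (auto intro!: pd_eq_mult)
 then show ?case using mult by (auto intro!: smooth_alg.add smooth_alg.mult)
next
 case (powr f r)
 have d: "((%x. f x powr r) has_derivative (%h. r * f x powr (r - 1) * frechet_derivative f (at x) h)) (at x)" for x
 proof -
  have fd: "(f has_derivative frechet_derivative f (at x)) (at x)"
   using powr frechet_derivative_works by blast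
  have "((%y. y powr r) has_derivative (%h. r * f x powr (r - 1) * h)) (at (f x))"
   using has_real_derivative_powr[OF powr.hyps(2)[of x], of r]
   by (simp add: has_field_derivative_def)
  from has_derivative_compose[OF fd this] show ?thesis by simp
 qed
 have "pd i (%x. f x powr r) = (%x. r * f x powr (r - 1) * pd i f x)" for i
  by (rule ext, subst pd_eq[OF d], simp add: pd_def)
 then show ?case using powr d
  by (auto intro!: smooth_alg.mult smooth_alg.powr smooth_alg.const simp: differentiable_def)
next
 case (exp f)
 have d: "((%x. exp (f x)) has_derivative (%h. exp (f x) * frechet_derivative f (at x) h)) (at x)" for x
 proof -
  have fd: "(f has_derivative frechet_derivative f (at x)) (at x)"
   using exp frechet_derivative_works by blast
  have "(exp has_derivative (%h. exp (f x) * h)) (at (f x))"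
   using DERIV_exp[of "f x"] by (simp add: has_field_derivative_def)
  from has_derivative_compose[OF fd this] show ?thesis by simp
 qed
 have "pd i (%x. exp (f x)) = (%x. exp (f x) * pd i f x)" for i
  by (rule ext, subst pd_eq[OF d], simp add: pd_def)
 then show ?case using exp d
  by (auto intro!: smooth_alg.mult smooth_alg.exp simp: differentiable_def)
next
 case (bump f j)
 have d: "((%x. bump_fun j (f x)) has_derivative
   (%h. (bump_fun (j + 2) (f x) + (- real j) * bump_fun (j + 1) (f x)) * frechet_derivative f (at x) h)) (at x)" for x
 proof -
  have fd: "(f has_derivative frechet_derivative f (at x)) (at x)"
   using bump frechet_derivative_works by blast
  have "(bump_fun j has_derivative (%h. (bump_fun (j + 2) (f x) + (- real j) * bump_fun (j + 1) (f x)) * h)) (at (f x))"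
   using bump_fun_deriv[of j "f x"] by (simp add: has_field_derivative_def)
  from has_derivative_compose[OF fd this] show ?thesis by simp
 qed
 have "pd i (%x. bump_fun j (f x)) = (%x. (bump_fun (j + 2) (f x) + (- real j) * bump_fun (j + 1) (f x)) * pd i f x)" for i
  by (rule ext, subst pd_eq[OF d], simp add: pd_def)
 moreover have "(%x. (bump_fun (j + 2) (f x) + (- real j) * bump_fun (j + 1) (f x)) * pd i f x) \<in> smooth_alg" for i
  using bump by (intro smooth_alg.mult smooth_alg.add smooth_alg.bump smooth_alg.const) auto
 ultimately show ?case using d unfolding differentiable_def by metis
qed

lemma smooth_alg_smooth: "f \<in> smooth_alg ==> smooth f"
 by (rule smooth_coinduct[of f smooth_alg]) (use smooth_alg_step in auto)

lemma smooth_const [intro]: "smooth (%x. c)" by (intro smooth_alg_smooth smooth_alg.const)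
lemma smooth_coord [intro]: "smooth (%x. x $ i)" by (intro smooth_alg_smooth smooth_alg.coord)
lemma smooth_add [intro]: "smooth f ==> smooth g ==> smooth (%x. f x + g x)"
 by (rule smooth_alg_smooth, rule smooth_alg.add; (rule smooth_alg.base)?)
lemma smooth_mult [intro]: "smooth f ==> smooth g ==> smooth (%x. f x * g x)"
 by (rule smooth_alg_smooth, rule smooth_alg.mult; (rule smooth_alg.base)?)
lemma smooth_powr [intro]: "smooth f ==> (!!x. f x > 0) ==> smooth (%x. f x powr r)"
 by (rule smooth_alg_smooth, rule smooth_alg.powr; (rule smooth_alg.base)?)
lemma smooth_exp [intro]: "smooth f ==> smooth (%x. exp (f x))"
 by (rule smooth_alg_smooth, rule smooth_alg.exp; (rule smooth_alg.base)?)
lemma smooth_bump [intro]: "smooth f ==> smooth (%x. bump_fun j (f x))"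
 by (rule smooth_alg_smooth, rule smooth_alg.bump; (rule smooth_alg.base)?)
lemma smooth_uminus [intro]: "smooth f ==> smooth (%x. - f x)"
 using smooth_mult[OF smooth_const[of "-1"], of f] by simp
lemma smooth_diff [intro]: "smooth f ==> smooth g ==> smooth (%x. f x - g x)"
 using smooth_add[OF _ smooth_uminus, of f g] by simp
lemma smooth_prod [intro]: "(!!i. i \<in> I ==> smooth (f i)) ==> smooth (%x. \<Prod>i\<in>I. f i x)"
 by (induction I rule: infinite_finite_induct) auto
lemma smooth_sum [intro]: "(!!i. i \<in> I ==> smooth (f i)) ==> smooth (%x. \<Sum>i\<in>I. f i x)"
 by (induction I rule: infinite_finite_induct) auto

lemma smooth_continuous: "smooth f ==> continuous_on A f"
 by (simp add: continuous_at_imp_continuous_on differentiable_imp_continuous_within smooth_differentiable)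

lemma pd_add: "smooth f ==> smooth g ==> pd i (%x. f x + g x) x = pd i f x + pd i g x"
 by (simp add: pd_eq_add smooth_differentiable)

lemma pd_mult: "smooth f ==> smooth g ==> pd i (%x. f x * g x) x = f x * pd i g x + pd i f x * g x"
 by (simp add: pd_eq_mult smooth_differentiable)

lemma pd_const: "pd i (%x. c) x = 0"
 by (simp add: pd_eq[OF has_derivative_const])

lemma pd_cmult: "smooth f ==> pd i (%x. c * f x) x = c * pd i f x"
 by (simp add: pd_mult smooth_const pd_const)

lemma pd_coord: "pd i (%x. x $ k) x = (if i = k then 1 else 0)"
proof -
 have d: "((%x::real^'a. x $ k) has_derivative (%x. x $ k)) (at x)" for x
  by (simp add: bounded_linear_imp_has_derivative bounded_linear_vec_nth)
 show ?thesis by (simp add: pd_eq[OF d] axis_def)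
qed

lemma pd_compose:
 assumes "smooth f" "(G has_real_derivative G') (at (f x))"
 shows "pd i (%x. G (f x)) x = G' * pd i f x"
proof -
 have fd: "(f has_derivative frechet_derivative f (at x)) (at x)"
  using assms frechet_derivative_works smooth_differentiable by blast
 have "(G has_derivative (%h. G' * h)) (at (f x))"
  using assms(2) by (simp add: has_field_derivative_def)
 from has_derivative_compose[OF fd this] show ?thesis
  by (simp add: pd_eq) (simp add: pd_def)
qed

lemma test_functions_iff:
 "\<phi> \<in> test_functions \<Omega> \<longleftrightarrow> smooth \<phi> \<and> (\<exists>K. compact K \<and> K \<subseteq> \<Omega> \<and> (\<forall>x. x \<notin> K --> \<phi> x = 0))"
 by (auto simp: test_functions_def smooth_def)

lemma pd_zero_outside:
 assumes "closed K" "!!x. x \<notin> K ==> \<phi> x = 0" "x \<notin> K"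
 shows "pd i \<phi> x = 0"
proof -
 have "(\<phi> has_derivative (%h. 0)) (at x)"
  using assms by (intro has_derivative_transform_within_open[of "%x. 0" "%h. 0" x UNIV "- K" \<phi>]) auto
 then show ?thesis by (simp add: pd_eq)
qed

lemma test_pd: "\<phi> \<in> test_functions \<Omega> ==> pd i \<phi> \<in> test_functions \<Omega>"
 unfolding test_functions_iff using pd_zero_outside compact_imp_closed by (blast intro: smooth_pd)

lemma test_mult: "\<phi> \<in> test_functions \<Omega> ==> smooth f ==> (%x. \<phi> x * f x) \<in> test_functions \<Omega>"
 unfolding test_functions_iff by (metis mult_zero_left smooth_mult)

lemma test_add:
 assumes "\<phi> \<in> test_functions \<Omega>" "\<psi> \<in> test_functions \<Omega>"
 shows "(%x. \<phi> x + \<psi> x) \<in> test_functions \<Omega>"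
proof -
 obtain K L where "compact K" "K \<subseteq> \<Omega>" "\<forall>x. x \<notin> K --> \<phi> x = 0" "compact L" "L \<subseteq> \<Omega>" "\<forall>x. x \<notin> L --> \<psi> x = 0"
  using assms by (auto simp: test_functions_iff)
 then have "compact (K \<union> L) \<and> K \<union> L \<subseteq> \<Omega> \<and> (\<forall>x. x \<notin> K \<union> L --> \<phi> x + \<psi> x = 0)" by auto
 then show ?thesis using assms by (auto simp: test_functions_iff)
qed

lemma test_compose:
 assumes "\<phi> \<in> test_functions \<Omega>" "smooth (%x. G (\<phi> x))" "G 0 = 0"
 shows "(%x. G (\<phi> x)) \<in> test_functions \<Omega>"
 using assms unfolding test_functions_iff by metis

lemma test_smooth: "\<phi> \<in> test_functions \<Omega> ==> smooth \<phi>"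
 by (simp add: test_functions_iff)

section \<open>Integration by parts on a bounded open set and the fundamental lemma of the calculus
  of variations\<close>

locale bounded_domain =
 fixes \<Omega> :: "(real ^ 'n::finite) set"
 assumes opn: "open \<Omega>" and bdd: "bounded \<Omega>"
begin

abbreviation "M \<equiv> lebesgue_on \<Omega>"
abbreviation "D i u \<equiv> weak_deriv \<Omega> {#i#} u"
abbreviation "gn \<equiv> grad_norm \<Omega>"
abbreviation "gi \<equiv> grad_inner \<Omega>"
abbreviation "H0 \<equiv> H01 \<Omega>"

lemma sets_Omega [simp, measurable]: "\<Omega> \<in> sets lebesgue" "\<Omega> \<in> sets borel"
 using opn by auto

lemma lmeasurable_Omega: "\<Omega> \<in> lmeasurable"
 using opn bdd by (simp add: lmeasurable_open)

sublocale finite_measure M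
 by (rule finite_measure_lebesgue_on[OF lmeasurable_Omega])

text \<open>Completeness of Lebesgue measure. It is needed because \<open>weak_deriv\<close> is a
  chosen representative, determined only up to null sets.\<close>

lemma meas_AE:
 fixes f g :: "real ^ 'n => real"
 assumes "f \<in> borel_measurable M" "AE x in M. f x = g x"
 shows "g \<in> borel_measurable M"
proof -
 have "(%x. if x \<in> \<Omega> then f x else 0) \<in> borel_measurable lebesgue"
  using assms(1) by (simp add: borel_measurable_if)
 moreover have "AE x in lebesgue. (if x \<in> \<Omega> then f x else 0) = (if x \<in> \<Omega> then g x else 0)"
  using assms(2) by (auto simp: AE_restrict_space_iff elim!: eventually_mono)
 ultimately have "(%x. if x \<in> \<Omega> then g x else 0) \<in> borel_measurable lebesgue"
  by (rule borel_measurable_AE)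
 then show ?thesis by (simp add: borel_measurable_if)
qed

lemma meas_borel:
 fixes f :: "real ^ 'n => real"
 assumes "f \<in> borel_measurable borel" shows "f \<in> borel_measurable M"
 using assms by (intro measurable_restrict_space1 measurable_completion) simp

lemma meas_smooth: "smooth f ==> f \<in> borel_measurable M"
 by (intro meas_borel borel_measurable_continuous_onI smooth_continuous)

lemma continuous_bounded_Omega:
 fixes f :: "real ^ 'n => real"
 assumes "continuous_on UNIV f" obtains B where "B > 0" "!!x. x \<in> \<Omega> ==> \<bar>f x\<bar> <= B"
proof -
 have "compact (f ` closure \<Omega>)"
  using assms bdd by (intro compact_continuous_image) (auto intro: continuous_on_subset)
 then obtain B where "B > 0" "\<forall>y\<in>f ` closure \<Omega>. norm y <= B"
  using compact_imp_bounded bounded_pos by metis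
 then show ?thesis using that[of B] closure_subset by fastforce
qed

lemma smooth_bounded:
 assumes "smooth f" obtains B where "B > 0" "!!x. x \<in> \<Omega> ==> \<bar>f x\<bar> <= B"
 using continuous_bounded_Omega[OF smooth_continuous[OF assms]] by blast

lemma continuous_integrable:
 fixes f :: "real ^ 'n => real"
 assumes "continuous_on UNIV f" shows "integrable M f"
proof -
 obtain B where "B > 0" "!!x. x \<in> \<Omega> ==> \<bar>f x\<bar> <= B" using continuous_bounded_Omega[OF assms] by blast
 then show ?thesis
  using assms by (intro integrable_const_bound[of _ B]) (auto intro!: AE_I2 meas_borel borel_measurable_continuous_onI)
qed

lemma smooth_sqint: "smooth f ==> sqint M f"
 unfolding sqint_def
 by (intro conjI meas_smooth continuous_integrable continuous_on_power smooth_continuous)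

lemma L2_iff: "u \<in> L2 \<Omega> \<longleftrightarrow> sqint M u"
 by (auto simp: L2_def sqint_def)

lemma sqint_mult_bounded:
 assumes "sqint M f" "g \<in> borel_measurable M" "!!x. x \<in> \<Omega> ==> \<bar>g x\<bar> <= B"
 shows "sqint M (%x. f x * g x)"
proof (rule sqint_le[of M "%x. B * f x"])
 show "\<bar>f x * g x\<bar> <= \<bar>B * f x\<bar>" if "x \<in> space M" for x
 proof -
  have "\<bar>g x\<bar> <= \<bar>B\<bar>" using assms(3)[of x] that by simp
  then have "\<bar>f x\<bar> * \<bar>g x\<bar> <= \<bar>f x\<bar> * \<bar>B\<bar>" by (intro mult_left_mono) auto
  then show ?thesis by (simp add: abs_mult mult.commute)
 qed
qed (use assms in auto)

lemma Lp_norm_nrm: "sqint M g ==> Lp_norm \<Omega> 2 g = nrm M g"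
 by (simp add: Lp_norm_def nrm_def powr_half_sqrt)

text \<open>Translation invariance of the integral makes the mean of difference quotients vanish.\<close>

lemma lborel_integral_partial_zero:
 fixes \<psi> :: "real ^ 'n => real"
 assumes der: "!!x. (\<psi> has_derivative \<psi>' x) (at x)"
  and K: "compact K" "!!x. x \<notin> K ==> \<psi> x = 0"
  and cont: "continuous_on UNIV (%x. \<psi>' x (axis i 1))"
 shows "(LINT x|lborel. \<psi>' x (axis i 1)) = 0"
proof -
 let ?e = "axis i 1 :: real ^ 'n"
 let ?g = "%x. \<psi>' x ?e"
 have cpsi: "continuous_on UNIV \<psi>"
  using has_derivative_continuous[OF der] by (intro continuous_at_imp_continuous_on) simp
 then have psim [measurable]: "\<psi> \<in> borel_measurable borel" by (rule borel_measurable_continuous_onI)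
 have gm [measurable]: "?g \<in> borel_measurable borel" using cont by (rule borel_measurable_continuous_onI)
 have line: "((%t. \<psi> (x + t *\<^sub>R ?e)) has_real_derivative ?g (x + t *\<^sub>R ?e)) (at t)" for x t
 proof -
  have "((%t. x + t *\<^sub>R ?e) has_derivative (%h. h *\<^sub>R ?e)) (at t)"
   by (auto intro!: derivative_eq_intros)
  from has_derivative_compose[OF this der]
  have "((%t. \<psi> (x + t *\<^sub>R ?e)) has_derivative (%h. \<psi>' (x + t *\<^sub>R ?e) (h *\<^sub>R ?e))) (at t)" .
  moreover have "\<psi>' (x + t *\<^sub>R ?e) (h *\<^sub>R ?e) = ?g (x + t *\<^sub>R ?e) * h" for h
   using linear_cmul[OF has_derivative_linear[OF der]] by simp
  ultimately show ?thesis by (simp add: has_field_derivative_def)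
 qed
 have g0: "?g x = 0" if "x \<notin> K" for x
 proof -
  have "(\<psi> has_derivative (%h. 0)) (at x)"
   using K that compact_imp_closed[OF K(1)]
   by (intro has_derivative_transform_within_open[of "%x. 0" "%h. 0" x UNIV "- K" \<psi>]) auto
  then show ?thesis using has_derivative_unique[OF der] by metis
 qed
 have "bounded (?g ` K)"
  using K cont by (intro compact_imp_bounded compact_continuous_image) (auto intro: continuous_on_subset)
 then obtain B where B: "B > 0" "!!x. x \<in> K ==> \<bar>?g x\<bar> <= B"
  by (auto simp: bounded_pos)
 have gB: "\<bar>?g x\<bar> <= B" for x using B g0 by (cases "x \<in> K") auto
 obtain R where R: "!!x. x \<in> K ==> norm x <= R" using compact_imp_bounded[OF K(1)] by (auto simp: bounded_iff)
 define q where "q n x = (\<psi> (x + (1 / Suc n) *\<^sub>R ?e) - \<psi> x) * Suc n" for n x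
 have qm [measurable]: "q n \<in> borel_measurable lborel" for n
  unfolding q_def by measurable
 have \<psi>i: "integrable lborel \<psi>"
 proof -
  have "integrable lborel (%x. indicator K x *\<^sub>R \<psi> x)"
   using K cpsi by (intro borel_integrable_compact) (auto intro: continuous_on_subset)
  moreover have "(%x. indicator K x *\<^sub>R \<psi> x) = \<psi>" using K(2) by (intro ext) (auto simp: indicator_def)
  ultimately show ?thesis by simp
 qed
 have q0: "(LINT x|lborel. q n x) = 0" for n
 proof -
  let ?c = "(1 / Suc n) *\<^sub>R ?e"
  have *: "(LINT x|lborel. \<psi> (?c + x)) = (LINT x|lborel. \<psi> x)"
   by (subst (2) lborel_distr_plus[of ?c, symmetric]) (simp add: integral_distr)
  have "integrable (distr lborel borel ((+) ?c)) \<psi>" using \<psi>i by (simp add: lborel_distr_plus)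
  then have "integrable lborel (%x. \<psi> (?c + x))" by (simp add: integrable_distr_eq)
  then show ?thesis using \<psi>i * unfolding q_def by (simp add: add.commute)
 qed
 have qb: "\<bar>q n x\<bar> <= B" for n x
 proof -
  have "\<exists>z>0. z < 1 / Suc n \<and> \<psi> (x + (1 / Suc n) *\<^sub>R ?e) - \<psi> (x + 0 *\<^sub>R ?e) = (1 / Suc n - 0) * ?g (x + z *\<^sub>R ?e)"
   by (rule MVT2[of 0 "1 / Suc n" "%t. \<psi> (x + t *\<^sub>R ?e)"]) (auto intro: line)
  then obtain z where "\<psi> (x + (1 / Suc n) *\<^sub>R ?e) - \<psi> x = (1 / Suc n) * ?g (x + z *\<^sub>R ?e)" by auto
  then have "q n x = ?g (x + z *\<^sub>R ?e)" by (simp add: q_def)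
  then show ?thesis using gB by simp
 qed
 have qout: "q n x = 0" if "x \<notin> cball 0 (R + 1)" for n x
 proof -
  have nx: "norm x > R + 1" using that by simp
  have "norm ((1 / Suc n) *\<^sub>R ?e) <= 1" by (simp add: norm_axis_1)
  then have "norm (x + (1 / Suc n) *\<^sub>R ?e) > R"
   using nx norm_diff_ineq[of x "(1 / Suc n) *\<^sub>R ?e"] by linarith
  then have "x \<notin> K" "x + (1 / Suc n) *\<^sub>R ?e \<notin> K" using R nx by fastforce+
  then show ?thesis using K(2) by (simp add: q_def)
 qed
 have "(%n. (LINT x|lborel. q n x)) ----> (LINT x|lborel. ?g x)"
 proof (rule integral_dominated_convergence[where w = "%x. indicator (cball 0 (R + 1)) x * B"])
  show "integrable lborel (%x :: real ^ 'n. indicator (cball 0 (R + 1)) x * B)"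
   by (intro integrable_mult_left integrable_real_indicator) (use emeasure_bounded_finite[of "cball 0 (R + 1) :: (real ^ 'n) set"] in auto)
  show "AE x in lborel. (%n. q n x) ----> ?g x"
  proof (rule AE_I2)
   fix x
   have "((%h. (\<psi> (x + h *\<^sub>R ?e) - \<psi> x) / h) \<longlongrightarrow> ?g x) (at 0)"
    using line[of x 0] by (simp add: DERIV_def)
   moreover have "filterlim (%n. 1 / real (Suc n)) (at 0) sequentially"
    using LIMSEQ_inverse_real_of_nat by (simp add: filterlim_at inverse_eq_divide)
   ultimately have "(%n. (\<psi> (x + (1 / real (Suc n)) *\<^sub>R ?e) - \<psi> x) / (1 / real (Suc n))) ----> ?g x"
    by (rule filterlim_compose)
   then show "(%n. q n x) ----> ?g x" by (simp add: q_def)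
  qed
  show "AE x in lborel. norm (q n x) <= indicator (cball 0 (R + 1)) x * B" for n
   using qb qout by (intro AE_I2) (auto simp: indicator_def)
 qed auto
 then have "(%n. 0::real) ----> (LINT x|lborel. ?g x)" by (simp only: q0)
 then show ?thesis by (simp add: LIMSEQ_const_iff)
qed

lemma integral_M_lborel:
 fixes g :: "real ^ 'n => real"
 assumes "g \<in> borel_measurable borel" "!!x. x \<notin> \<Omega> ==> g x = 0"
 shows "(LINT x|M. g x) = (LINT x|lborel. g x)"
proof -
 have "(LINT x|M. g x) = (LINT x|lebesgue. indicator \<Omega> x *\<^sub>R g x)"
  by (rule integral_restrict_space) simp
 also have "(%x. indicator \<Omega> x *\<^sub>R g x) = g" using assms(2) by (intro ext) (auto simp: indicator_def)
 finally show ?thesis using assms(1) by (simp add: integral_completion)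
qed

text \<open>Only one continuous partial derivative is required, not smoothness: the lemma is applied
  to compositions with \<open>Phi\<close> and with primitives of continuous functions, which need
  not be test functions.\<close>

lemma integral_partial_zero:
 fixes \<psi> :: "real ^ 'n => real"
 assumes der: "!!x. (\<psi> has_derivative \<psi>' x) (at x)"
  and K: "compact K" "K \<subseteq> \<Omega>" "!!x. x \<notin> K ==> \<psi> x = 0"
  and cont: "continuous_on UNIV (%x. \<psi>' x (axis i 1))"
 shows "(LINT x|M. \<psi>' x (axis i 1)) = 0"
proof -
 have "\<psi>' x (axis i 1) = 0" if "x \<notin> \<Omega>" for x
 proof -
  have "x \<notin> K" using that K(2) by auto
  then have "pd i \<psi> x = 0"
   by (intro pd_zero_outside[of K \<psi>]) (use K compact_imp_closed in auto)
  then show ?thesis by (simp add: pd_eq[OF der])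
 qed
 then have "(LINT x|M. \<psi>' x (axis i 1)) = (LINT x|lborel. \<psi>' x (axis i 1))"
  using cont by (intro integral_M_lborel borel_measurable_continuous_onI) auto
 then show ?thesis using lborel_integral_partial_zero[OF der K(1,3) cont] by simp
qed

lemma test_integral_pd_zero:
 assumes "\<phi> \<in> test_functions \<Omega>" shows "(LINT x|M. pd i \<phi> x) = 0"
proof -
 obtain K where K: "compact K" "K \<subseteq> \<Omega>" "!!x. x \<notin> K ==> \<phi> x = 0" and s: "smooth \<phi>"
  using assms by (auto simp: test_functions_iff)
 have d: "(\<phi> has_derivative frechet_derivative \<phi> (at x)) (at x)" for x
  using s by (simp add: pd_has_derivative smooth_differentiable)
 show ?thesis
  using integral_partial_zero[OF d K, of i] smooth_continuous[OF smooth_pd[OF s, of i]]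
  by (simp add: pd_def[abs_def])
qed

lemma test_parts:
 assumes "\<phi> \<in> test_functions \<Omega>" "smooth \<psi>"
 shows "(LINT x|M. \<phi> x * pd i \<psi> x) = - (LINT x|M. pd i \<phi> x * \<psi> x)"
proof -
 have s: "smooth \<phi>" using assms(1) by (rule test_smooth)
 have "0 = (LINT x|M. pd i (%x. \<phi> x * \<psi> x) x)"
  using test_integral_pd_zero[OF test_mult[OF assms]] by simp
 also have "... = (LINT x|M. \<phi> x * pd i \<psi> x + pd i \<phi> x * \<psi> x)"
  using s assms by (simp add: pd_mult)
 also have "... = (LINT x|M. \<phi> x * pd i \<psi> x) + (LINT x|M. pd i \<phi> x * \<psi> x)"
  using s assms by (intro Bochner_Integration.integral_add sqint_mult_integrable smooth_sqint smooth_pd)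
 finally show ?thesis by simp
qed

lemma integrable_compact_iff:
 fixes f :: "real ^ 'n => real"
 assumes "compact K" "K \<subseteq> \<Omega>"
 shows "integrable (lebesgue_on K) f \<longleftrightarrow> integrable M (%x. indicator K x * f x)"
proof -
 have "K \<in> sets lebesgue" using assms(1) by (simp add: borel_compact)
 then have "integrable (lebesgue_on K) f \<longleftrightarrow> integrable lebesgue (%x. indicator K x *\<^sub>R f x)"
  by (intro integrable_restrict_space) simp
 also have "(%x. indicator K x *\<^sub>R f x) = (%x. indicator \<Omega> x *\<^sub>R (indicator K x * f x))"
  using assms(2) by (intro ext) (auto simp: indicator_def)
 also have "integrable lebesgue ... \<longleftrightarrow> integrable M (%x. indicator K x * f x)"
  by (intro integrable_restrict_space[symmetric]) simp
 finally show ?thesis .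
qed

lemma sqint_locally_integrable:
 assumes "sqint M g" shows "locally_integrable \<Omega> g"
 unfolding locally_integrable_def
proof (intro allI impI)
 fix K assume K: "compact K \<and> K \<subseteq> \<Omega>"
 have gi: "integrable M g" by (rule sqint_integrable[OF assms])
 have "(%x. indicator K x :: real) \<in> borel_measurable M"
  using K by (intro meas_borel borel_measurable_indicator) (auto intro: borel_compact)
 then have "integrable M (%x. indicator K x * g x)"
  using gi by (intro Bochner_Integration.integrable_bound[OF gi]) (auto intro!: AE_I2 simp: indicator_def)
 then show "integrable (lebesgue_on K) g" using K by (simp add: integrable_compact_iff)
qed

lemma locally_integrable_mult:
 fixes \<phi> :: "real ^ 'n => real"
 assumes "locally_integrable \<Omega> g" "compact K" "K \<subseteq> \<Omega>" "!!x. x \<notin> K ==> \<phi> x = 0" "continuous_on UNIV \<phi>"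
 shows "integrable M (%x. g x * \<phi> x)"
proof -
 have gi: "integrable M (%x. indicator K x * g x)"
  using assms by (simp add: locally_integrable_def integrable_compact_iff[symmetric])
 obtain B where B: "B > 0" "!!x. x \<in> \<Omega> ==> \<bar>\<phi> x\<bar> <= B" using continuous_bounded_Omega[OF assms(5)] by blast
 have \<phi>: "\<phi> \<in> borel_measurable M" using assms by (intro meas_borel borel_measurable_continuous_onI)
 have eq: "(%x. g x * \<phi> x) = (%x. (indicator K x * g x) * \<phi> x)"
  using assms(4) by (intro ext) (auto simp: indicator_def)
 show ?thesis unfolding eq
 proof (rule Bochner_Integration.integrable_bound[OF integrable_mult_left[OF gi, of B]])
  show "(%x. (indicator K x * g x) * \<phi> x) \<in> borel_measurable M"
   using borel_measurable_integrable[OF gi] \<phi> by (rule borel_measurable_times)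
  show "AE x in M. norm ((indicator K x * g x) * \<phi> x) <= norm (indicator K x * g x * B)"
   using B by (intro AE_I2) (auto simp: abs_mult intro!: mult_left_mono)
 qed
qed

lemma test_mult_integrable:
 assumes "locally_integrable \<Omega> g" "\<phi> \<in> test_functions \<Omega>"
 shows "integrable M (%x. g x * \<phi> x)"
proof -
 obtain K where "compact K" "K \<subseteq> \<Omega>" "!!x. x \<notin> K ==> \<phi> x = 0" "smooth \<phi>"
  using assms(2) by (auto simp: test_functions_iff)
 then show ?thesis by (intro locally_integrable_mult[OF assms(1), of K]) (auto intro: smooth_continuous)
qed


text \<open>Boxes are an intersection-stable generator of the Borel sets, so the vanishing of the
  integral extends to all Borel sets by a Dynkin argument, for which \<open>tot\<close> supplies the
  complements. The sets where g is positive and where it is negative then finish the proof.\<close>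

lemma integral_borel_zero:
 fixes g :: "real ^ 'n => real"
 assumes gi: "integrable lborel g"
  and tot: "(LINT x|lborel. g x) = 0"
  and boxes: "!!a b. (LINT x|lborel. indicator (box a b) x * g x) = 0"
 shows "AE x in lborel. g x = 0"
proof -
 have gm [measurable]: "g \<in> borel_measurable borel" using gi by auto
 have ind_int: "integrable lborel (%x. indicator A x * g x)" if "A \<in> sets borel" for A
  using that by (intro Bochner_Integration.integrable_bound[OF gi]) (auto intro!: AE_I2 simp: indicator_def)
 have all: "(LINT x|lborel. indicator A x * g x) = 0" if A: "A \<in> sets borel" for A
 proof -
  have "Int_stable (range (%(a, b). box a b :: (real ^ 'n) set))"
   by (auto simp: Int_stable_def box_Int_box)
  moreover have "(range (%(a, b). box a b :: (real ^ 'n) set)) \<subseteq> Pow UNIV" by auto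
  moreover have "A \<in> sigma_sets UNIV (range (%(a, b). box a b))"
   using A unfolding borel_eq_box by simp
  ultimately show ?thesis
  proof (induction rule: sigma_sets_induct_disjoint)
   case (basic A)
   then show ?case using boxes by auto
  next
   case empty
   then show ?case by simp
  next
   case (compl A)
   then have A: "A \<in> sets borel" by (simp add: borel_eq_box)
   have "(LINT x|lborel. indicator (UNIV - A) x * g x) = (LINT x|lborel. g x - indicator A x * g x)"
    by (intro Bochner_Integration.integral_cong) (auto simp: indicator_def)
   also have "... = 0" using gi ind_int[OF A] compl tot by simp
   finally show ?case .
  next
   case (union F)
   then have F: "F i \<in> sets borel" for i by (auto simp: borel_eq_box subset_eq)
   have U: "(\<Union>i. F i) \<in> sets borel" using F by auto
   have "(%n. (LINT x|lborel. (\<Sum>i<n. indicator (F i) x) * g x)) ----> (LINT x|lborel. indicator (\<Union>i. F i) x * g x)"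
   proof (rule integral_dominated_convergence[where w = "%x. \<bar>g x\<bar>"])
    have sums: "(%i. indicator (F i) x :: real) sums indicator (\<Union>i. F i) x" for x
     using union(1) by (intro indicator_sums) (auto simp: disjoint_family_on_def)
    then show "AE x in lborel. (%n. (\<Sum>i<n. indicator (F i) x) * g x) ----> indicator (\<Union>i. F i) x * g x"
     by (intro AE_I2 tendsto_intros) (simp add: sums_def)
    show "AE x in lborel. norm ((\<Sum>i<n. indicator (F i) x) * g x) <= \<bar>g x\<bar>" for n
    proof (intro AE_I2)
     fix x
     have "(\<Sum>i<n. indicator (F i) x) <= (indicator (\<Union>i. F i) x :: real)"
      using sums_unique[OF sums[of x]] sum_le_suminf[OF sums_summable[OF sums[of x]], of "{..<n}"] by simp
     also have "... <= 1" by (simp add: indicator_def)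
     finally have "\<bar>\<Sum>i<n. indicator (F i) x :: real\<bar> <= 1" by (simp add: sum_nonneg)
     then show "norm ((\<Sum>i<n. indicator (F i) x) * g x) <= \<bar>g x\<bar>"
      using mult_right_mono[of "\<bar>\<Sum>i<n. indicator (F i) x :: real\<bar>" 1 "\<bar>g x\<bar>"] by (simp add: abs_mult)
    qed
   qed (use F U gi in auto)
   moreover have "(LINT x|lborel. (\<Sum>i<n. indicator (F i) x) * g x) = 0" for n
   proof -
    have "(LINT x|lborel. (\<Sum>i<n. indicator (F i) x) * g x) = (\<Sum>i<n. (LINT x|lborel. indicator (F i) x * g x))"
     unfolding sum_distrib_right using ind_int[OF F] by (intro Bochner_Integration.integral_sum)
    then show ?thesis using union(3) by simp
   qed
   ultimately show ?case by (simp add: LIMSEQ_const_iff)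
  qed
 qed
 have half: "AE x in lborel. indicator A x * f x = 0"
  if "A \<in> sets borel" "!!x. x \<in> A ==> 0 <= f x" "f = g \<or> f = (%x. - g x)" for A f
 proof -
  have i: "integrable lborel (%x. indicator A x * f x)" using ind_int[OF that(1)] that(3) by auto
  have "(LINT x|lborel. indicator A x * f x) = 0" using all[OF that(1)] that(3) by auto
  then show ?thesis
   using that(2) by (subst (asm) integral_nonneg_eq_0_iff_AE[OF i]) (auto simp: indicator_def)
 qed
 have "AE x in lborel. indicator {x. 0 < g x} x * g x = 0" by (rule half) auto
 moreover have "AE x in lborel. indicator {x. g x < 0} x * - g x = 0" by (rule half) auto
 ultimately show ?thesis by eventually_elim (auto simp: indicator_def split: if_splits)
qed

lemma bump_fun_bounds: "0 <= bump_fun 0 t" "bump_fun 0 t <= 1" "t <= 0 ==> bump_fun 0 t = 0"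
 by (auto simp: bump_fun_def)

lemma bump_fun_limit:
 assumes "t > 0" shows "(%k. bump_fun 0 (real k * t)) ----> 1"
proof -
 have "(%k. exp (- ((1 / t) * (1 / real k)))) ----> exp (- ((1 / t) * 0))"
  by (intro tendsto_intros lim_1_over_n)
 then have "(%k. exp (- ((1 / t) * (1 / real k)))) ----> 1" by simp
 then show ?thesis
  by (rule Lim_transform_eventually)
    (use assms in \<open>auto simp: bump_fun_def eventually_sequentially field_simps intro!: exI[of _ 1]\<close>)
qed

text \<open>Products of one-dimensional bumps, two for each coordinate, are test functions supported
  in the closed box that tend to the indicator of the open box.\<close>

lemma box_integral_zero:
 assumes g: "locally_integrable \<Omega> g" and z: "!!\<phi>. \<phi> \<in> test_functions \<Omega> ==> (LINT x|M. g x * \<phi> x) = 0"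
  and ab: "cbox a b \<subseteq> \<Omega>"
 shows "(LINT x|M. indicator (box a b) x * g x) = 0"
proof -
 define \<phi> where "\<phi> k x = (\<Prod>i\<in>UNIV. bump_fun 0 (real k * (x $ i - a $ i)) * bump_fun 0 (real k * (b $ i - x $ i)))"
  for k :: nat and x :: "real ^ 'n"
 have in_box: "x \<in> box a b \<longleftrightarrow> (\<forall>i. a $ i < x $ i \<and> x $ i < b $ i)" for x by (simp add: mem_box_cart)
 have out: "\<phi> k x = 0" if "x \<notin> box a b" for k x
 proof -
  have "\<not> (\<forall>i. a $ i < x $ i \<and> x $ i < b $ i)" using that by (simp only: in_box not_False_eq_True)
  then obtain i where "\<not> (a $ i < x $ i \<and> x $ i < b $ i)" by (metis (no_types))
  then have "x $ i - a $ i <= 0 \<or> b $ i - x $ i <= 0" by auto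
  then have "real k * (x $ i - a $ i) <= 0 \<or> real k * (b $ i - x $ i) <= 0"
   using mult_nonneg_nonpos[OF of_nat_0_le_iff] by blast
  then have "bump_fun 0 (real k * (x $ i - a $ i)) * bump_fun 0 (real k * (b $ i - x $ i)) = 0"
   using bump_fun_bounds(3) by (metis mult_eq_0_iff)
  then show ?thesis unfolding \<phi>_def by (auto intro!: prod_zero)
 qed
 have bnd: "0 <= \<phi> k x" "\<phi> k x <= 1" for k x
  unfolding \<phi>_def using bump_fun_bounds by (auto intro!: prod_nonneg prod_le_1 mult_le_one)
 have "smooth (\<phi> k)" for k
  unfolding \<phi>_def by (intro smooth_prod smooth_mult smooth_bump smooth_diff smooth_const smooth_coord)
 then have test: "\<phi> k \<in> test_functions \<Omega>" for k
  unfolding test_functions_iff using ab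
  by (intro conjI exI[of _ "cbox a b"]) (auto intro!: out dest: subsetD[OF box_subset_cbox])
 have gi: "integrable M (%x. indicator (cbox a b) x * g x)"
  using g ab by (simp add: locally_integrable_def integrable_compact_iff[symmetric])
 have bm: "(indicator (box a b) :: _ => real) \<in> borel_measurable M" by (intro meas_borel) auto
 have bi: "(%x. indicator (box a b) x * g x) \<in> borel_measurable M"
 proof -
  have "(%x. indicator (box a b) x * g x) = (%x. indicator (box a b) x * (indicator (cbox a b) x * g x))"
   using box_subset_cbox[of a b] by (intro ext) (auto simp: indicator_def)
  then show ?thesis using borel_measurable_times[OF bm borel_measurable_integrable[OF gi]] by simp
 qed
 have "(%k. (LINT x|M. g x * \<phi> k x)) ----> (LINT x|M. indicator (box a b) x * g x)"
 proof (rule integral_dominated_convergence[where w = "%x. \<bar>indicator (cbox a b) x * g x\<bar>"])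
  show "AE x in M. (%k. g x * \<phi> k x) ----> indicator (box a b) x * g x"
  proof (rule AE_I2)
   fix x
   show "(%k. g x * \<phi> k x) ----> indicator (box a b) x * g x"
   proof (cases "x \<in> box a b")
    case True
    have "(%k. \<phi> k x) ----> (\<Prod>i\<in>(UNIV::'n set). 1 * 1)"
     unfolding \<phi>_def using True in_box by (intro tendsto_intros bump_fun_limit) auto
    then have "(%k. g x * \<phi> k x) ----> g x * 1" by (intro tendsto_intros) simp
    then show ?thesis using True by simp
   qed (simp add: out)
  qed
  show "AE x in M. norm (g x * \<phi> k x) <= \<bar>indicator (cbox a b) x * g x\<bar>" for k
  proof (rule AE_I2)
   fix x
   show "norm (g x * \<phi> k x) <= \<bar>indicator (cbox a b) x * g x\<bar>"
   proof (cases "x \<in> box a b")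
    case True
    then have "x \<in> cbox a b" using box_subset_cbox by auto
    then show ?thesis using bnd[of k x] by (simp add: abs_mult mult_left_le)
   qed (simp add: out)
  qed
  show "(%x. g x * \<phi> k x) \<in> borel_measurable M" for k
   using test_mult_integrable[OF g test[of k]] by simp
 qed (use gi bi in auto)
 moreover have "(LINT x|M. g x * \<phi> k x) = 0" for k using z[OF test] .
 ultimately show ?thesis by (simp add: LIMSEQ_const_iff)
qed

text \<open>Cut off to one box, g is integrable over the whole space but only Lebesgue measurable. A
  Borel representative \<open>g'\<close> of it has vanishing integral over every box, because the
  intersection of two boxes is a box inside the domain.\<close>

lemma box_AE_zero:
 assumes g: "locally_integrable \<Omega> g" and z: "!!\<phi>. \<phi> \<in> test_functions \<Omega> ==> (LINT x|M. g x * \<phi> x) = 0"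
  and ab: "cbox a b \<subseteq> \<Omega>"
 shows "AE x in lebesgue. x \<in> box a b --> g x = 0"
proof -
 let ?G = "%x. indicator (box a b) x * g x"
 have "integrable M (%x. indicator (cbox a b) x * g x)"
  using g ab by (simp add: locally_integrable_def integrable_compact_iff[symmetric])
 moreover from this have "(%x. indicator (box a b) x * (indicator (cbox a b) x * g x)) \<in> borel_measurable M"
  by (intro borel_measurable_times[OF meas_borel borel_measurable_integrable]) auto
 ultimately have "integrable M (%x. indicator (box a b) x * (indicator (cbox a b) x * g x))"
  by (rule Bochner_Integration.integrable_bound) (auto intro!: AE_I2 simp: indicator_def)
 moreover have "(%x. indicator (box a b) x * (indicator (cbox a b) x * g x)) = ?G"
  using box_subset_cbox[of a b] by (intro ext) (auto simp: indicator_def)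
 ultimately have "integrable M ?G" by simp
 then have "integrable lebesgue (%x. indicator \<Omega> x *\<^sub>R ?G x)"
  by (subst (asm) integrable_restrict_space) auto
 moreover have om: "(%x. indicator \<Omega> x *\<^sub>R ?G x) = ?G"
  using ab box_subset_cbox[of a b] by (intro ext) (auto simp: indicator_def)
 ultimately have Gi: "integrable lebesgue ?G" by simp
 then obtain g' where g' [measurable]: "g' \<in> borel_measurable lborel" and "AE x in lborel. ?G x = g' x"
  using completion_ex_borel_measurable_real[of ?G lborel] by auto
 then have ae: "AE x in lebesgue. ?G x = g' x" by (rule_tac AE_completion)
 have g'i: "integrable lebesgue g'"
  using integrable_cong_AE[of ?G lebesgue g'] ae Gi measurable_completion[OF g'] by auto
 then have g'l: "integrable lborel g'" using integrable_completion[OF g'] by simp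
 have "(LINT x|lborel. indicator S x * g' x) = (LINT x|M. indicator S x * ?G x)" if "S \<in> sets borel" for S
 proof -
  have Sm: "(%x. indicator S x :: real) \<in> borel_measurable lborel" using that by auto
  have "(LINT x|lborel. indicator S x * g' x) = (LINT x|lebesgue. indicator S x * g' x)"
   using that by (intro integral_completion[symmetric]) auto
  also have "... = (LINT x|lebesgue. indicator S x * ?G x)"
   using ae Gi g'i measurable_completion[OF Sm]
   by (intro integral_cong_AE) (auto intro!: borel_measurable_times elim: eventually_mono)
  also have "... = (LINT x|lebesgue. indicator \<Omega> x *\<^sub>R (indicator S x * ?G x))"
   using om by (intro Bochner_Integration.integral_cong) (auto simp: fun_eq_iff)
  also have "... = (LINT x|M. indicator S x * ?G x)"
   by (intro integral_restrict_space[symmetric]) simp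
  finally show ?thesis .
 qed note tr = this
 have boxes: "(LINT x|lborel. indicator (box c d) x * g' x) = 0" for c d
 proof -
  obtain e f where ef: "box a b \<inter> box c d = box e f" unfolding box_Int_box by blast
  have eq: "(%x. indicator (box c d) x * ?G x) = (%x. indicator (box e f) x * g x)"
   unfolding ef[symmetric] by (intro ext) (auto simp: indicator_def)
  have "(LINT x|M. indicator (box e f) x * g x) = 0"
  proof (cases "box e f = {}")
   case False
   then have "cbox e f = closure (box e f)" by simp
   also have "... \<subseteq> closure (box a b)" using ef by (intro closure_mono) auto
   also have "... \<subseteq> cbox a b" by (rule closure_minimal[OF box_subset_cbox closed_cbox])
   finally show ?thesis using ab by (intro box_integral_zero[OF g z]) auto
  qed simp
  then show ?thesis by (simp add: tr eq)
 qed
 have "(LINT x|lborel. g' x) = 0"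
  using tr[of UNIV] box_integral_zero[OF g z ab] by simp
 from integral_borel_zero[OF g'l this boxes] have "AE x in lebesgue. g' x = 0" by (rule AE_completion)
 with ae show ?thesis by eventually_elim (auto simp: indicator_def split: if_splits)
qed

text \<open>Countably many boxes with rational corners cover the open set, so the exceptional null
  sets have a null union.\<close>

lemma fundamental_lemma:
 assumes g: "locally_integrable \<Omega> g" and z: "!!\<phi>. \<phi> \<in> test_functions \<Omega> ==> (LINT x|M. g x * \<phi> x) = 0"
 shows "AE x in M. g x = 0"
proof -
 define B where "B = {(a, b). cbox a b \<subseteq> \<Omega> \<and> (\<forall>i. a $ i \<in> \<rat> \<and> b $ i \<in> \<rat>)}"
 have "countable {a :: real ^ 'n. \<forall>i. a $ i \<in> \<rat>}" by (rule countable_vector) (simp add: countable_rat)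
 then have "countable ({a :: real ^ 'n. \<forall>i. a $ i \<in> \<rat>} \<times> {a :: real ^ 'n. \<forall>i. a $ i \<in> \<rat>})" by blast
 then have cB: "countable B" by (rule countable_subset[rotated]) (auto simp: B_def)
 have cov: "\<exists>(a, b)\<in>B. x \<in> box a b" if x: "x \<in> \<Omega>" for x
 proof -
  obtain r where r: "r > 0" "ball x r \<subseteq> \<Omega>" using opn x by (auto simp: open_contains_ball)
  \<comment> \<open>Coordinates that differ by at most d from those of x differ in the l1 norm by at
    most \<open>CARD('n) * d = r / 2\<close>, which also bounds the Euclidean distance.\<close>
  define d where "d = r / (2 * real CARD('n))"
  have d: "d > 0" using r by (simp add: d_def)
  have "\<exists>q\<in>\<rat>. x $ i - d < q \<and> q < x $ i" "\<exists>q\<in>\<rat>. x $ i < q \<and> q < x $ i + d" for i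
   using d Rats_dense_in_real[of "x $ i - d" "x $ i"] Rats_dense_in_real[of "x $ i" "x $ i + d"] by auto
  then obtain a b where ab: "!!i. a i \<in> \<rat>" "!!i. x $ i - d < a i" "!!i. a i < x $ i"
    "!!i. b i \<in> \<rat>" "!!i. b i < x $ i + d" "!!i. x $ i < b i" by metis
  have "cbox (\<chi> i. a i) (\<chi> i. b i) \<subseteq> ball x r"
  proof
   fix y assume "y \<in> cbox (\<chi> i. a i) (\<chi> i. b i)"
   then have "a i <= y $ i \<and> y $ i <= b i" for i by (simp add: mem_box_cart)
   then have yi: "a i <= y $ i" "y $ i <= b i" for i by auto
   have "\<bar>(x - y) $ i\<bar> <= d" for i
    using yi[of i] ab(2,5)[of i] by (simp add: abs_le_iff)
   then have "(\<Sum>i\<in>UNIV. \<bar>(x - y) $ i\<bar>) <= (\<Sum>i\<in>(UNIV::'n set). d)" by (intro sum_mono) auto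
   also have "... = r / 2" by (simp add: d_def)
   finally show "y \<in> ball x r" using norm_le_l1_cart[of "x - y"] r by (simp add: dist_norm)
  qed
  then have "((\<chi> i. a i), (\<chi> i. b i)) \<in> B" "x \<in> box (\<chi> i. a i) (\<chi> i. b i)"
   using ab r by (auto simp: B_def mem_box_cart)
  then show ?thesis by blast
 qed
 have "AE x in lebesgue. \<forall>p\<in>B. x \<in> box (fst p) (snd p) --> g x = 0"
  unfolding AE_ball_countable[OF cB]
  using box_AE_zero[OF g z] by (auto simp: B_def)
 then have "AE x in lebesgue. x \<in> \<Omega> --> g x = 0"
 proof eventually_elim
  case (elim x)
  show ?case
  proof
   assume "x \<in> \<Omega>"
   with cov obtain a b where "(a, b) \<in> B" "x \<in> box a b" by blast
   then show "g x = 0" using bspec[OF elim, of "(a, b)"] by simp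
  qed
 qed
 then show ?thesis by (simp add: AE_restrict_space_iff)
qed

lemma has_weak_deriv_unique:
 assumes "has_weak_deriv \<Omega> \<alpha> u g" "has_weak_deriv \<Omega> \<alpha> u k"
 shows "AE x in M. g x = k x"
proof -
 obtain "is" where is_: "mset is = \<alpha>" using ex_mset by blast
 have li: "locally_integrable \<Omega> g" "locally_integrable \<Omega> k" using assms by (auto simp: has_weak_deriv_def)
 have "AE x in M. g x - k x = 0"
 proof (rule fundamental_lemma)
  show "locally_integrable \<Omega> (%x. g x - k x)"
   using li by (auto simp: locally_integrable_def)
  fix \<phi> assume \<phi>: "\<phi> \<in> test_functions \<Omega>"
  have "(- 1) ^ size \<alpha> * (LINT x|M. g x * \<phi> x) = (- 1) ^ size \<alpha> * (LINT x|M. k x * \<phi> x)"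
  proof -
   have "(LINT x|M. u x * partials is \<phi> x) = (- 1) ^ size \<alpha> * (LINT x|M. w x * \<phi> x)"
    if "has_weak_deriv \<Omega> \<alpha> u w" for w
    using that \<phi> is_ by (auto simp: has_weak_deriv_def)
   from this[OF assms(1)] this[OF assms(2)] show ?thesis by simp
  qed
  then have "(LINT x|M. g x * \<phi> x) = (LINT x|M. k x * \<phi> x)" by simp
  then show "(LINT x|M. (g x - k x) * \<phi> x) = 0"
   using test_mult_integrable[OF li(1) \<phi>] test_mult_integrable[OF li(2) \<phi>] by (simp add: left_diff_distrib)
 qed
 then show ?thesis by simp
qed

text \<open>Makes the choice inside \<open>weak_deriv\<close> harmless: one measurable weak
  derivative identifies the chosen one and passes its measurability on to it.\<close>

lemma weak_deriv_eqI:
 assumes "has_weak_deriv \<Omega> \<alpha> u g" "g \<in> borel_measurable M"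
 shows "AE x in M. weak_deriv \<Omega> \<alpha> u x = g x" "weak_deriv \<Omega> \<alpha> u \<in> borel_measurable M"
  "has_weak_deriv \<Omega> \<alpha> u (weak_deriv \<Omega> \<alpha> u)"
proof -
 show h: "has_weak_deriv \<Omega> \<alpha> u (weak_deriv \<Omega> \<alpha> u)"
  unfolding weak_deriv_def using someI[of "has_weak_deriv \<Omega> \<alpha> u", OF assms(1)] .
 show ae: "AE x in M. weak_deriv \<Omega> \<alpha> u x = g x" by (rule has_weak_deriv_unique[OF h assms(1)])
 show "weak_deriv \<Omega> \<alpha> u \<in> borel_measurable M"
  by (rule meas_AE[OF assms(2)]) (use ae in \<open>auto elim: eventually_mono\<close>)
qed

lemma has_weak_deriv_empty:
 assumes "sqint M u" shows "has_weak_deriv \<Omega> {#} u u"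
 using sqint_locally_integrable[OF assms] by (simp add: has_weak_deriv_def)

lemma has_weak_deriv_single:
 "has_weak_deriv \<Omega> {#i#} u g \<longleftrightarrow> locally_integrable \<Omega> u \<and> locally_integrable \<Omega> g \<and>
   (\<forall>\<phi>\<in>test_functions \<Omega>. (LINT x|M. u x * pd i \<phi> x) = - (LINT x|M. g x * \<phi> x))"
proof -
 have "mset is = {#i#} \<longleftrightarrow> is = [i]" for "is" by auto
 then show ?thesis by (simp add: has_weak_deriv_def pd_def[abs_def])
qed

end

section \<open>Criteria for convergence in the L^2 norm\<close>

lemma L2limI:
 assumes "!!n. sqint M (f n)" "sqint M g" "(%n. nrm M (%x. f n x - g x)) ----> 0"
 shows "L2lim M f g"
 using assms by (simp add: L2lim_def)

lemma L2limI_bound: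
 assumes "!!n. sqint M (f n)" "sqint M g" "!!n. nrm M (%x. f n x - g x) <= b n" "b ----> 0"
 shows "L2lim M f g"
proof (rule L2limI)
 show "(%n. nrm M (%x. f n x - g x)) ----> 0"
  by (rule tendsto_sandwich[OF _ _ tendsto_const assms(4)]) (use assms(3) in auto)
qed (use assms in auto)

lemma nrm_mono:
 assumes "sqint M g" "f \<in> borel_measurable M" "!!x. x \<in> space M ==> \<bar>f x\<bar> <= \<bar>g x\<bar>"
 shows "nrm M f <= nrm M g"
proof -
 have f: "sqint M f" by (rule sqint_le[OF assms])
 have "(LINT x|M. (f x)^2) <= (LINT x|M. (g x)^2)"
  using assms(3) by (intro integral_mono sqint_sq f assms(1)) (simp add: abs_le_square_iff[symmetric])
 then show ?thesis by (simp add: nrm_def)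
qed

lemma L2lim_perturb:
 assumes "L2lim M f g" "!!n. sqint M (f' n)" "(%n. nrm M (%x. f' n x - f n x)) ----> 0"
 shows "L2lim M f' g"
proof (rule L2limI_bound)
 note D = L2limD[OF assms(1)]
 show "nrm M (%x. f' n x - g x) <= nrm M (%x. f' n x - f n x) + nrm M (%x. f n x - g x)" for n
  by (rule nrm_diff_triangle[OF assms(2) D(2) D(1)])
 show "(%n. nrm M (%x. f' n x - f n x) + nrm M (%x. f n x - g x)) ----> 0"
  using tendsto_add[OF assms(3) D(3)] by simp
qed (use assms L2limD in auto)

lemma L2lim_cong:
 assumes "L2lim M f g" "!!n. f' n \<in> borel_measurable M" "!!n. AE x in M. f' n x = f n x"
  "g' \<in> borel_measurable M" "AE x in M. g' x = g x"
 shows "L2lim M f' g'"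
proof (rule L2limI)
 note D = L2limD[OF assms(1)]
 show f': "sqint M (f' n)" for n by (rule sqint_AE[OF D(1)[of n] assms(2,3)])
 show g': "sqint M g'" by (rule sqint_AE[OF D(2) assms(4,5)])
 have "nrm M (%x. f' n x - g' x) = nrm M (%x. f n x - g x)" for n
  using assms(3)[of n] assms(5) by (intro nrm_cong_AE sqint_diff f' g' D) auto
 then show "(%n. nrm M (%x. f' n x - g' x)) ----> 0" using D(3) by simp
qed

lemma L2lim_bounded_mult:
 assumes "L2lim M f g" "E \<in> borel_measurable M" "!!x. x \<in> space M ==> \<bar>E x\<bar> <= B"
 shows "L2lim M (%n x. f n x * E x) (%x. g x * E x)"
proof (rule L2limI_bound)
 note D = L2limD[OF assms(1)]
 have le: "\<bar>h x * E x\<bar> <= \<bar>B * h x\<bar>" if "x \<in> space M" for h :: "'a => real" and x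
 proof -
  have "\<bar>E x\<bar> <= \<bar>B\<bar>" using assms(3)[OF that] by simp
  then have "\<bar>h x\<bar> * \<bar>E x\<bar> <= \<bar>h x\<bar> * \<bar>B\<bar>" by (intro mult_left_mono) auto
  then show ?thesis by (simp add: abs_mult mult.commute)
 qed
 have sq: "sqint M (%x. h x * E x)" if "sqint M h" for h
  by (rule sqint_le[of M "%x. B * h x"]) (use that assms(2) le in auto)
 show "sqint M (%x. f n x * E x)" for n by (rule sq[OF D(1)])
 show "sqint M (%x. g x * E x)" by (rule sq[OF D(2)])
 show "nrm M (%x. f n x * E x - g x * E x) <= \<bar>B\<bar> * nrm M (%x. f n x - g x)" for n
 proof -
  have "nrm M (%x. (f n x - g x) * E x) <= nrm M (%x. B * (f n x - g x))"
   using D assms(2) le[of _ "%x. f n x - g x"] by (intro nrm_mono sqint_cmult sqint_diff) auto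
  then show ?thesis by (simp add: nrm_cmult left_diff_distrib)
 qed
 show "(%n. \<bar>B\<bar> * nrm M (%x. f n x - g x)) ----> 0"
  using tendsto_mult[OF tendsto_const[of "\<bar>B\<bar>"] D(3)] by simp
qed

lemma L2lim_dominated:
 assumes f: "!!n. f n \<in> borel_measurable M" and g: "g \<in> borel_measurable M" and h: "sqint M h"
  and le: "!!n. AE x in M. \<bar>f n x\<bar> <= h x" and lim: "AE x in M. (%n. f n x) ----> g x"
 shows "L2lim M f g"
proof -
 have hi: "integrable M (%x. (h x)^2)" using h by (rule sqint_sq)
 have fs: "sqint M (f n)" for n
  using le[of n] by (intro sqint_dominated[OF f hi]) (auto elim!: eventually_mono simp: power2_le_iff_abs_le abs_le_square_iff[symmetric])
 have "AE x in M. \<forall>n. \<bar>f n x\<bar> <= h x" using le by (simp add: AE_all_countable)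
 with lim have gh: "AE x in M. \<bar>g x\<bar> <= h x"
 proof eventually_elim
  case (elim x)
  then show ?case by (intro LIMSEQ_le_const2[OF tendsto_rabs]) auto
 qed
 have gs: "sqint M g"
  using gh by (intro sqint_dominated[OF g hi]) (auto elim!: eventually_mono simp: abs_le_square_iff[symmetric])
 have "(%n. (LINT x|M. (f n x - g x)^2)) ----> (LINT x|M. 0)"
 proof (rule integral_dominated_convergence[where w = "%x. 4 * (h x)^2"])
  show "AE x in M. (%n. (f n x - g x)^2) ----> 0"
   using lim
  proof eventually_elim
   case (elim x)
   have "(%n. (f n x - g x)^2) ----> (g x - g x)^2" by (intro tendsto_intros elim)
   then show ?case by simp
  qed
  show "AE x in M. norm ((f n x - g x)^2) <= 4 * (h x)^2" for n
   using le[of n] gh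
  proof eventually_elim
   case (elim x)
   then have "\<bar>f n x - g x\<bar> <= \<bar>2 * h x\<bar>" by linarith
   then have "(f n x - g x)^2 <= (2 * h x)^2" by (simp only: abs_le_square_iff)
   then show ?case by (simp add: power_mult_distrib)
  qed
 qed (use f g hi in auto)
 then have "(%n. sqrt (LINT x|M. (f n x - g x)^2)) ----> sqrt 0" by (intro tendsto_intros) simp
 then show ?thesis using fs gs by (auto simp: L2lim_def nrm_def)
qed

lemma size_le_1_iff: "size \<alpha> <= 1 \<longleftrightarrow> \<alpha> = {#} \<or> (\<exists>i. \<alpha> = {#i#})"
 using size_1_singleton_mset[of \<alpha>] by (auto simp: le_Suc_eq)

lemma multi_index_le1: "{\<alpha> :: 'n::finite multiset. size \<alpha> <= 1} = insert {#} (range (%i. {#i#}))"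
 unfolding size_le_1_iff by auto

section \<open>The space of one weak derivative and its subspace with zero boundary values\<close>

context bounded_domain
begin

definition W1 :: "(real ^ 'n => real) => bool" where
 "W1 u \<longleftrightarrow> sqint M u \<and> (\<forall>i. \<exists>g. sqint M g \<and> has_weak_deriv \<Omega> {#i#} u g)"

lemma W1I: "sqint M u ==> (!!i. sqint M (g i)) ==> (!!i. has_weak_deriv \<Omega> {#i#} u (g i)) ==> W1 u"
 unfolding W1_def by blast

lemma W1D:
 assumes "W1 u" shows "sqint M u" "sqint M (D i u)" "has_weak_deriv \<Omega> {#i#} u (D i u)"
proof -
 obtain g where g: "sqint M g" "has_weak_deriv \<Omega> {#i#} u g" using assms by (auto simp: W1_def)
 note w = weak_deriv_eqI[OF g(2) sqintD[OF g(1)]]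
 show "sqint M u" using assms by (simp add: W1_def)
 show "sqint M (D i u)" by (rule sqint_AE[OF g(1) w(2,1)])
 show "has_weak_deriv \<Omega> {#i#} u (D i u)" by (rule w(3))
qed

lemma W1_eqI:
 assumes "has_weak_deriv \<Omega> {#i#} u g" "sqint M g" shows "AE x in M. D i u x = g x"
 using weak_deriv_eqI(1)[OF assms(1)] assms(2) by (simp add: sqint_def)

lemma sobolev_1_iff: "u \<in> sobolev \<Omega> 1 \<longleftrightarrow> W1 u"
proof -
 have "(\<forall>\<alpha>. size \<alpha> <= 1 --> (\<exists>g\<in>L2 \<Omega>. has_weak_deriv \<Omega> \<alpha> u g)) \<longleftrightarrow>
   (\<exists>g\<in>L2 \<Omega>. has_weak_deriv \<Omega> {#} u g) \<and> (\<forall>i. \<exists>g\<in>L2 \<Omega>. has_weak_deriv \<Omega> {#i#} u g)"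
  unfolding size_le_1_iff by blast
 then show ?thesis
  using has_weak_deriv_empty[of u] unfolding sobolev_def W1_def mem_Collect_eq L2_iff Bex_def by blast
qed

lemma sobolev_norm_1:
 assumes "W1 u" shows "sobolev_norm \<Omega> 1 u = sqrt ((nrm M u)^2 + (\<Sum>i\<in>UNIV. (nrm M (D i u))^2))"
proof -
 have e: "AE x in M. weak_deriv \<Omega> {#} u x = u x" "weak_deriv \<Omega> {#} u \<in> borel_measurable M"
  using weak_deriv_eqI[OF has_weak_deriv_empty[OF W1D(1)[OF assms]]] W1D(1)[OF assms] by (auto simp: sqint_def)
 have s: "sqint M (weak_deriv \<Omega> {#} u)" by (rule sqint_AE[OF W1D(1)[OF assms] e(2,1)])
 have "Lp_norm \<Omega> 2 (weak_deriv \<Omega> {#} u) = nrm M u"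
  using Lp_norm_nrm[OF s] nrm_cong_AE[OF s W1D(1)[OF assms] e(1)] by simp
 moreover have "(\<Sum>\<alpha>\<in>range (%i. {#i#}). (Lp_norm \<Omega> 2 (weak_deriv \<Omega> \<alpha> u))^2) = (\<Sum>i\<in>UNIV. (nrm M (D i u))^2)"
  using Lp_norm_nrm[OF W1D(2)[OF assms]] by (subst sum.reindex) (auto simp: inj_on_def)
 ultimately show ?thesis
  unfolding sobolev_norm_def multi_index_le1 by (subst sum.insert) auto
qed

lemma sobolev_norm_1_bounds:
 assumes "W1 u"
 shows "nrm M u <= sobolev_norm \<Omega> 1 u" "nrm M (D i u) <= sobolev_norm \<Omega> 1 u"
  "sobolev_norm \<Omega> 1 u <= nrm M u + (\<Sum>i\<in>UNIV. nrm M (D i u))"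
proof -
 let ?S = "\<Sum>i\<in>UNIV. (nrm M (D i u))^2"
 have S0: "0 <= ?S" by (intro sum_nonneg) auto
 show "nrm M u <= sobolev_norm \<Omega> 1 u"
  unfolding sobolev_norm_1[OF assms] using S0 by (intro real_le_rsqrt) simp
 have "(nrm M (D i u))^2 <= ?S" by (rule member_le_sum) auto
 then show "nrm M (D i u) <= sobolev_norm \<Omega> 1 u"
  unfolding sobolev_norm_1[OF assms] by (intro real_le_rsqrt) (smt (verit) zero_le_power2)
 have "sqrt ((nrm M u)^2 + ?S) <= sqrt ((nrm M u)^2) + sqrt ?S" by (rule sqrt_add_le_add_sqrt) (use S0 in auto)
 also have "sqrt ?S <= (\<Sum>i\<in>UNIV. nrm M (D i u))"
  using L2_set_le_sum[of UNIV "%i. nrm M (D i u)"] by (simp add: L2_set_def)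
 finally show "sobolev_norm \<Omega> 1 u <= nrm M u + (\<Sum>i\<in>UNIV. nrm M (D i u))"
  unfolding sobolev_norm_1[OF assms] by simp
qed

lemma locally_integrable_lin:
 "locally_integrable \<Omega> u ==> locally_integrable \<Omega> v ==> locally_integrable \<Omega> (%x. a * u x + b * v x)"
 by (auto simp: locally_integrable_def)

lemma has_weak_deriv_lin:
 assumes "has_weak_deriv \<Omega> {#i#} u g" "has_weak_deriv \<Omega> {#i#} v k"
 shows "has_weak_deriv \<Omega> {#i#} (%x. a * u x + b * v x) (%x. a * g x + b * k x)"
proof -
 have li: "locally_integrable \<Omega> u" "locally_integrable \<Omega> v" "locally_integrable \<Omega> g" "locally_integrable \<Omega> k"
  using assms by (auto simp: has_weak_deriv_def)
 have split: "(LINT x|M. (a * p x + b * q x) * \<psi> x) = a * (LINT x|M. p x * \<psi> x) + b * (LINT x|M. q x * \<psi> x)"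
  if "locally_integrable \<Omega> p" "locally_integrable \<Omega> q" "\<psi> \<in> test_functions \<Omega>" for p q \<psi>
  using test_mult_integrable[OF that(1,3)] test_mult_integrable[OF that(2,3)]
  by (simp add: distrib_right mult.assoc)
 show ?thesis
  unfolding has_weak_deriv_single
 proof (intro conjI ballI locally_integrable_lin li)
  fix \<phi> assume \<phi>: "\<phi> \<in> test_functions \<Omega>"
  show "(LINT x|M. (a * u x + b * v x) * pd i \<phi> x) = - (LINT x|M. (a * g x + b * k x) * \<phi> x)"
   using assms \<phi> unfolding split[OF li(1,2) test_pd[OF \<phi>]] split[OF li(3,4) \<phi>] has_weak_deriv_single
   by simp
 qed
qed

lemma W1_lin:
 assumes "W1 u" "W1 v"
 shows "W1 (%x. a * u x + b * v x)" "AE x in M. D i (%x. a * u x + b * v x) x = a * D i u x + b * D i v x"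
proof -
 have h: "has_weak_deriv \<Omega> {#i#} (%x. a * u x + b * v x) (%x. a * D i u x + b * D i v x)" for i
  by (intro has_weak_deriv_lin W1D assms)
 have s: "sqint M (%x. a * D i u x + b * D i v x)" for i
  by (intro sqint_add sqint_cmult W1D assms)
 show "W1 (%x. a * u x + b * v x)"
  by (rule W1I[OF _ s h]) (intro sqint_add sqint_cmult W1D assms)
 show "AE x in M. D i (%x. a * u x + b * v x) x = a * D i u x + b * D i v x"
  by (rule W1_eqI[OF h s])
qed

lemma test_W1:
 assumes "\<phi> \<in> test_functions \<Omega>" shows "W1 \<phi>" "AE x in M. D i \<phi> x = pd i \<phi> x"
proof -
 have s: "smooth \<phi>" by (rule test_smooth[OF assms])
 have h: "has_weak_deriv \<Omega> {#i#} \<phi> (pd i \<phi>)" for i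
  unfolding has_weak_deriv_single
  using test_parts[OF assms test_smooth] s
  by (auto intro!: sqint_locally_integrable smooth_sqint smooth_pd)
 show "W1 \<phi>" by (rule W1I[OF _ _ h]) (auto intro!: smooth_sqint smooth_pd s)
 show "AE x in M. D i \<phi> x = pd i \<phi> x" by (rule W1_eqI[OF h]) (auto intro!: smooth_sqint smooth_pd s)
qed

lemma W1_diff:
 assumes "W1 u" "W1 v"
 shows "W1 (%x. u x - v x)" "AE x in M. D i (%x. u x - v x) x = D i u x - D i v x"
 using W1_lin[OF assms, where a = 1 and b = "-1"] by auto

lemma H01_W1: "u \<in> H0 ==> W1 u"
 unfolding H01_def sobolev_1_iff by blast

lemma test_sqint:
 assumes "\<phi> \<in> test_functions \<Omega>" shows "sqint M \<phi>" "sqint M (pd i \<phi>)"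
 using assms by (auto intro: smooth_sqint smooth_pd test_smooth)

lemma H01E:
 assumes "u \<in> H0"
 obtains \<phi> where "!!m. \<phi> m \<in> test_functions \<Omega>" "L2lim M \<phi> u" "!!i. L2lim M (%m. pd i (\<phi> m)) (D i u)"
proof -
 obtain \<phi> where \<phi>: "!!m. \<phi> m \<in> test_functions \<Omega>"
  and lim: "(%m. sobolev_norm \<Omega> 1 (%x. u x - \<phi> m x)) ----> 0"
  using assms unfolding H01_def by blast
 have u: "W1 u" by (rule H01_W1[OF assms])
 have d: "W1 (%x. u x - \<phi> m x)" for m by (intro W1_diff u test_W1 \<phi>)
 have sm: "sqint M (\<phi> m)" "sqint M (pd i (\<phi> m))" for m i
  by (rule test_sqint[OF \<phi>])+
 have "L2lim M \<phi> u"
  by (rule L2limI_bound[OF sm(1) W1D(1)[OF u] _ lim], subst nrm_minus_commute)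
    (rule sobolev_norm_1_bounds(1)[OF d])
 moreover have "L2lim M (%m. pd i (\<phi> m)) (D i u)" for i
 proof (rule L2limI_bound[OF sm(2) W1D(2)[OF u] _ lim])
  fix m
  have "nrm M (%x. D i u x - pd i (\<phi> m) x) = nrm M (D i (%x. u x - \<phi> m x))"
   using W1_diff(2)[OF u test_W1(1)[OF \<phi>[of m]], of i] test_W1(2)[OF \<phi>[of m], of i]
   by (intro nrm_cong_AE W1D d sqint_diff u sm) auto
  then show "nrm M (%x. pd i (\<phi> m) x - D i u x) <= sobolev_norm \<Omega> 1 (%x. u x - \<phi> m x)"
   using sobolev_norm_1_bounds(2)[OF d, of i m] by (simp add: nrm_minus_commute)
 qed
 ultimately show ?thesis by (rule that[of \<phi>, OF \<phi>])
qed

text \<open>The identity that defines a weak derivative tests against fixed functions and is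
  therefore stable under L^2 limits; so the limits of the partial derivatives are the weak
  derivatives of the limit. All later membership proofs in \<open>H0\<close> go through this rule or
  through \<open>H01_closed\<close>.\<close>

lemma H01I:
 assumes \<phi>: "!!m. \<phi> m \<in> test_functions \<Omega>" and u: "L2lim M \<phi> u" and g: "!!i. L2lim M (%m. pd i (\<phi> m)) (g i)"
 shows "u \<in> H0" "AE x in M. D i u x = g i x"
proof -
 have hw: "has_weak_deriv \<Omega> {#i#} u (g i)" for i
  unfolding has_weak_deriv_single
 proof (intro conjI ballI sqint_locally_integrable L2limD(2)[OF u] L2limD(2)[OF g])
  fix \<psi> assume \<psi>: "\<psi> \<in> test_functions \<Omega>"
  have s: "smooth \<psi>" by (rule test_smooth[OF \<psi>])
  have 1: "(%m. (LINT x|M. \<phi> m x * pd i \<psi> x)) ----> (LINT x|M. u x * pd i \<psi> x)"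
   by (intro L2lim_inner u L2lim_const smooth_sqint smooth_pd s)
  have "(%m. - (LINT x|M. pd i (\<phi> m) x * \<psi> x)) ----> - (LINT x|M. g i x * \<psi> x)"
   by (intro tendsto_minus L2lim_inner g L2lim_const smooth_sqint s)
  moreover have "(LINT x|M. \<phi> m x * pd i \<psi> x) = - (LINT x|M. pd i (\<phi> m) x * \<psi> x)" for m
   by (rule test_parts[OF \<phi> s])
  ultimately show "(LINT x|M. u x * pd i \<psi> x) = - (LINT x|M. g i x * \<psi> x)"
   using LIMSEQ_unique[OF 1] by simp
 qed
 have W: "W1 u" by (rule W1I[OF L2limD(2)[OF u] L2limD(2)[OF g] hw])
 show ae: "AE x in M. D i u x = g i x" for i by (rule W1_eqI[OF hw L2limD(2)[OF g]])
 have d: "W1 (%x. u x - \<phi> m x)" for m by (intro W1_diff W test_W1 \<phi>)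
 have eq: "nrm M (D i (%x. u x - \<phi> m x)) = nrm M (%x. pd i (\<phi> m) x - g i x)" for i m
 proof -
  have "nrm M (D i (%x. u x - \<phi> m x)) = nrm M (%x. g i x - pd i (\<phi> m) x)"
   using W1_diff(2)[OF W test_W1(1)[OF \<phi>[of m]], of i] test_W1(2)[OF \<phi>[of m], of i] ae[of i]
   by (intro nrm_cong_AE W1D d sqint_diff L2limD(2)[OF g] L2limD(1)[OF g]) auto
  then show ?thesis by (simp add: nrm_minus_commute)
 qed
 have "(%m. sobolev_norm \<Omega> 1 (%x. u x - \<phi> m x)) ----> 0"
 proof (rule tendsto_sandwich[OF _ _ tendsto_const])
  have "(%m. nrm M (%x. \<phi> m x - u x) + (\<Sum>i\<in>UNIV. nrm M (%x. pd i (\<phi> m) x - g i x))) ----> 0 + (\<Sum>i\<in>(UNIV::'n set). 0)"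
   by (intro tendsto_add tendsto_sum L2limD(3)[OF u] L2limD(3)[OF g])
  then show "(%m. nrm M (%x. \<phi> m x - u x) + (\<Sum>i\<in>UNIV. nrm M (%x. pd i (\<phi> m) x - g i x))) ----> 0" by simp
  show "\<forall>\<^sub>F m in sequentially. sobolev_norm \<Omega> 1 (%x. u x - \<phi> m x) <=
    nrm M (%x. \<phi> m x - u x) + (\<Sum>i\<in>UNIV. nrm M (%x. pd i (\<phi> m) x - g i x))"
   using sobolev_norm_1_bounds(3)[OF d] by (simp add: eq nrm_minus_commute[of M u])
  show "\<forall>\<^sub>F m in sequentially. 0 <= sobolev_norm \<Omega> 1 (%x. u x - \<phi> m x)"
   unfolding sobolev_norm_1[OF d] by (simp add: sum_nonneg)
 qed
 then show "u \<in> H0" using W \<phi> unfolding H01_def sobolev_1_iff by blast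
qed

lemma H01_sqint:
 assumes "u \<in> H0" shows "sqint M u" "sqint M (D i u)"
 using W1D[OF H01_W1[OF assms]] by auto

lemma H01_test: "\<phi> \<in> test_functions \<Omega> ==> \<phi> \<in> H0"
 by (rule H01I(1)[of "%m. \<phi>" _ "%i. pd i \<phi>"])
   (auto intro!: L2lim_const test_sqint)

lemma H01_lin:
 assumes "u \<in> H0" "v \<in> H0"
 shows "(%x. a * u x + b * v x) \<in> H0"
  "AE x in M. D i (%x. a * u x + b * v x) x = a * D i u x + b * D i v x"
proof -
 obtain \<phi> where \<phi>: "!!m. \<phi> m \<in> test_functions \<Omega>" "L2lim M \<phi> u" "!!i. L2lim M (%m. pd i (\<phi> m)) (D i u)"
  using H01E[OF assms(1)] by blast
 obtain \<psi> where \<psi>: "!!m. \<psi> m \<in> test_functions \<Omega>" "L2lim M \<psi> v" "!!i. L2lim M (%m. pd i (\<psi> m)) (D i v)"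
  using H01E[OF assms(2)] by blast
 have c: "(%x. a * f x) \<in> test_functions \<Omega>" if "f \<in> test_functions \<Omega>" for a f
  using test_mult[OF that smooth_const[of a]] by (simp add: mult.commute)
 have t: "(%x. a * \<phi> m x + b * \<psi> m x) \<in> test_functions \<Omega>" for m
  by (intro test_add c \<phi> \<psi>)
 have p: "pd i (%x. a * \<phi> m x + b * \<psi> m x) = (%x. a * pd i (\<phi> m) x + b * pd i (\<psi> m) x)" for i m
 proof (rule ext)
  fix x
  have "smooth (\<phi> m)" "smooth (\<psi> m)" using test_smooth[OF \<phi>(1)] test_smooth[OF \<psi>(1)] by auto
  then show "pd i (%x. a * \<phi> m x + b * \<psi> m x) x = a * pd i (\<phi> m) x + b * pd i (\<psi> m) x"
   by (subst pd_add) (auto simp: pd_cmult intro!: smooth_mult smooth_const)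
 qed
 have l: "L2lim M (%m. pd i (%x. a * \<phi> m x + b * \<psi> m x)) (%x. a * D i u x + b * D i v x)" for i
  unfolding p by (intro L2lim_add L2lim_cmult \<phi> \<psi>)
 show "(%x. a * u x + b * v x) \<in> H0"
  by (rule H01I(1)[OF t _ l]) (intro L2lim_add L2lim_cmult \<phi> \<psi>)
 show "AE x in M. D i (%x. a * u x + b * v x) x = a * D i u x + b * D i v x"
  by (rule W1_lin(2)[OF assms[THEN H01_W1]])
qed

lemma H01_diff:
 assumes "u \<in> H0" "v \<in> H0"
 shows "(%x. u x - v x) \<in> H0" "AE x in M. D i (%x. u x - v x) x = D i u x - D i v x"
 using H01_lin[OF assms, where a = 1 and b = "-1"] by auto

lemma H01_add:
 assumes "u \<in> H0" "v \<in> H0"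
 shows "(%x. u x + v x) \<in> H0" "AE x in M. D i (%x. u x + v x) x = D i u x + D i v x"
 using H01_lin[OF assms, where a = 1 and b = 1] by auto

lemma H01_cmult:
 assumes "u \<in> H0"
 shows "(%x. a * u x) \<in> H0" "AE x in M. D i (%x. a * u x) x = a * D i u x"
 using H01_lin[OF assms assms, where a = a and b = 0] by auto

lemma H01_zero: "(%x. 0) \<in> H0"
 by (rule H01_test) (auto simp: test_functions_iff intro!: exI[of _ "{}"])

lemma H01_AE:
 assumes "u \<in> H0" "AE x in M. u x = v x"
 shows "v \<in> H0" "AE x in M. D i v x = D i u x"
proof -
 obtain \<phi> where \<phi>: "!!m. \<phi> m \<in> test_functions \<Omega>" "L2lim M \<phi> u" "!!i. L2lim M (%m. pd i (\<phi> m)) (D i u)"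
  using H01E[OF assms(1)] by blast
 have v: "v \<in> borel_measurable M" using H01_sqint[OF assms(1)] by (intro meas_AE[OF _ assms(2)]) (simp add: sqint_def)
 have "L2lim M \<phi> v"
  using assms(2) L2limD(1)[OF \<phi>(2)] by (intro L2lim_cong[OF \<phi>(2) _ _ v]) (auto simp: sqint_def elim: eventually_mono)
 from H01I[OF \<phi>(1) this \<phi>(3)] show "v \<in> H0" "AE x in M. D i v x = D i u x" by auto
qed

text \<open>A diagonal choice: each \<open>v m\<close> is replaced by one test function within
  \<open>1 / Suc m\<close>, simultaneously for the function and all of its derivatives.\<close>

lemma H01_closed:
 assumes v: "!!m. v m \<in> H0" and u: "L2lim M v u" and g: "!!i. L2lim M (%m. D i (v m)) (g i)"
 shows "u \<in> H0" "AE x in M. D i u x = g i x"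
proof -
 have "\<exists>\<phi>. \<phi> \<in> test_functions \<Omega> \<and> nrm M (%x. \<phi> x - v m x) < 1 / Suc m \<and>
   (\<forall>i. nrm M (%x. pd i \<phi> x - D i (v m) x) < 1 / Suc m)" for m
 proof -
  obtain \<phi> where \<phi>: "!!k. \<phi> k \<in> test_functions \<Omega>" "L2lim M \<phi> (v m)" "!!i. L2lim M (%k. pd i (\<phi> k)) (D i (v m))"
   using H01E[OF v] by blast
  have "\<forall>\<^sub>F k in sequentially. nrm M (%x. \<phi> k x - v m x) < 1 / Suc m"
   by (rule order_tendstoD(2)[OF L2limD(3)[OF \<phi>(2)]]) simp
  moreover have "\<forall>\<^sub>F k in sequentially. \<forall>i\<in>UNIV. nrm M (%x. pd i (\<phi> k) x - D i (v m) x) < 1 / Suc m"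
   by (intro eventually_ball_finite ballI order_tendstoD(2)[OF L2limD(3)[OF \<phi>(3)]]) auto
  ultimately have "\<forall>\<^sub>F k in sequentially. nrm M (%x. \<phi> k x - v m x) < 1 / Suc m \<and>
    (\<forall>i\<in>UNIV. nrm M (%x. pd i (\<phi> k) x - D i (v m) x) < 1 / Suc m)" by eventually_elim auto
  then obtain k where "nrm M (%x. \<phi> k x - v m x) < 1 / Suc m \<and>
    (\<forall>i\<in>UNIV. nrm M (%x. pd i (\<phi> k) x - D i (v m) x) < 1 / Suc m)"
   by (auto dest: eventually_happens)
  then show ?thesis using \<phi>(1) by blast
 qed
 then have "\<exists>\<phi>. \<forall>m. \<phi> m \<in> test_functions \<Omega> \<and> nrm M (%x. \<phi> m x - v m x) < 1 / Suc m \<and>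
   (\<forall>i. nrm M (%x. pd i (\<phi> m) x - D i (v m) x) < 1 / Suc m)"
  by (intro choice allI)
 then obtain \<phi> where "\<forall>m. \<phi> m \<in> test_functions \<Omega> \<and> nrm M (%x. \<phi> m x - v m x) < 1 / Suc m \<and>
   (\<forall>i. nrm M (%x. pd i (\<phi> m) x - D i (v m) x) < 1 / Suc m)" ..
 then have \<phi>: "\<phi> m \<in> test_functions \<Omega>" "nrm M (%x. \<phi> m x - v m x) <= 1 / Suc m"
   "nrm M (%x. pd i (\<phi> m) x - D i (v m) x) <= 1 / Suc m" for m i
  by (auto intro: less_imp_le)
 have z: "(%m. 1 / real (Suc m)) ----> 0" using LIMSEQ_inverse_real_of_nat by (simp add: inverse_eq_divide)
 have l1: "L2lim M \<phi> u"
 proof (rule L2lim_perturb[OF u test_sqint(1)[OF \<phi>(1)]])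
  show "(%m. nrm M (%x. \<phi> m x - v m x)) ----> 0"
   by (rule tendsto_sandwich[OF _ _ tendsto_const z]) (use \<phi>(2) in auto)
 qed
 have l2: "L2lim M (%m. pd i (\<phi> m)) (g i)" for i
 proof (rule L2lim_perturb[OF g test_sqint(2)[OF \<phi>(1)]])
  show "(%m. nrm M (%x. pd i (\<phi> m) x - D i (v m) x)) ----> 0"
   by (rule tendsto_sandwich[OF _ _ tendsto_const z]) (use \<phi>(3) in auto)
 qed
 show "u \<in> H0" "AE x in M. D i u x = g i x" using H01I[OF \<phi>(1) l1 l2] by auto
qed

lemma weak_deriv_parts:
 assumes "sqint M u" "sqint M g" "has_weak_deriv \<Omega> {#i#} u g" "v \<in> H0"
 shows "(LINT x|M. u x * D i v x) = - (LINT x|M. g x * v x)"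
proof -
 obtain \<phi> where \<phi>: "!!m. \<phi> m \<in> test_functions \<Omega>" "L2lim M \<phi> v" "!!i. L2lim M (%m. pd i (\<phi> m)) (D i v)"
  using H01E[OF assms(4)] by blast
 have 1: "(%m. (LINT x|M. u x * pd i (\<phi> m) x)) ----> (LINT x|M. u x * D i v x)"
  by (intro L2lim_inner L2lim_const assms \<phi>)
 have 2: "(%m. - (LINT x|M. g x * \<phi> m x)) ----> - (LINT x|M. g x * v x)"
  by (intro tendsto_minus L2lim_inner L2lim_const assms \<phi>)
 have "(LINT x|M. u x * pd i (\<phi> m) x) = - (LINT x|M. g x * \<phi> m x)" for m
  using assms(3) \<phi>(1) by (simp add: has_weak_deriv_single)
 then show ?thesis using LIMSEQ_unique[OF 1] 2 by simp
qed

lemma H01_parts: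
 assumes "u \<in> H0" "v \<in> H0"
 shows "(LINT x|M. u x * D i v x) = - (LINT x|M. D i u x * v x)"
 using weak_deriv_parts[OF H01_sqint[OF assms(1)] _ assms(2)] W1D(3)[OF H01_W1[OF assms(1)]] by blast

text \<open>The bounded factors converge only almost everywhere. The product with the fixed limit g
  is treated by domination, and replacing g by \<open>f n\<close> costs at most \<open>L\<close>
  times the norm of the difference.\<close>

lemma L2lim_continuous_mult:
 assumes f: "L2lim M f g" and h: "!!n. h n \<in> borel_measurable M" "!!n x. \<bar>h n x\<bar> <= L"
  and k: "k \<in> borel_measurable M" and lim: "AE x in M. (%n. h n x) ----> k x"
 shows "L2lim M (%n x. h n x * f n x) (%x. k x * g x)"
proof -
 note D = L2limD[OF f]
 have bd: "\<bar>h n x * y x\<bar> <= \<bar>L * y x\<bar>" for n x and y :: "real ^ 'n => real"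
 proof -
  have "\<bar>h n x\<bar> <= \<bar>L\<bar>" using h(2)[of n x] by simp
  then show ?thesis unfolding abs_mult by (rule mult_right_mono) simp
 qed
 have hs: "sqint M (%x. h n x * y x)" if "sqint M y" for n y
  by (rule sqint_le[of M "%x. L * y x"]) (use that h bd in auto)
 have "L2lim M (%n x. h n x * g x) (%x. k x * g x)"
 proof (rule L2lim_dominated[where h = "%x. \<bar>L * g x\<bar>"])
  show "AE x in M. (%n. h n x * g x) ----> k x * g x"
   using lim by eventually_elim (intro tendsto_intros)
  show "sqint M (%x. \<bar>L * g x\<bar>)" by (intro sqint_abs sqint_cmult D)
 qed (use h k D(2) bd in auto)
 then show ?thesis
 proof (rule L2lim_perturb)
  show "sqint M (%x. h n x * f n x)" for n by (rule hs[OF D(1)])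
  show "(%n. nrm M (%x. h n x * f n x - h n x * g x)) ----> 0"
  proof (rule tendsto_sandwich[OF _ _ tendsto_const])
   show "(%n. \<bar>L\<bar> * nrm M (%x. f n x - g x)) ----> 0"
    using tendsto_mult[OF tendsto_const[of "\<bar>L\<bar>"] D(3)] by simp
   have "nrm M (%x. h n x * f n x - h n x * g x) <= \<bar>L\<bar> * nrm M (%x. f n x - g x)" for n
   proof -
    have "nrm M (%x. h n x * (f n x - g x)) <= nrm M (%x. L * (f n x - g x))"
     using D h bd[of n _ "%x. f n x - g x"] by (intro nrm_mono sqint_cmult sqint_diff) auto
    then show ?thesis unfolding nrm_cmult by (simp add: right_diff_distrib)
   qed
   then show "\<forall>\<^sub>F n in sequentially. nrm M (%x. h n x * f n x - h n x * g x) <= \<bar>L\<bar> * nrm M (%x. f n x - g x)"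
    by simp
  qed auto
 qed
qed

text \<open>\<open>G\<close> has to preserve smoothness and vanish at 0 so that the approximating
  functions remain test functions, and the bound on \<open>G'\<close> makes the composition
  continuous in L^2. These demands dictate the regularised powers used later; the factor
  \<open>E\<close> leaves room for the exponential weight.\<close>

lemma H01_chain:
 assumes u: "u \<in> H0" and E: "smooth E"
  and G: "!!\<phi>. smooth \<phi> ==> smooth (%x::real ^ 'n. G (\<phi> x))" "G 0 = 0"
  and G': "!!s. (G has_real_derivative G' s) (at s)" "continuous_on UNIV G'" "!!s. \<bar>G' s\<bar> <= L"
 shows "(%x. G (u x) * E x) \<in> H0"
  "AE x in M. D i (%x. G (u x) * E x) x = G' (u x) * D i u x * E x + G (u x) * pd i E x"
proof -
 obtain \<phi>0 where \<phi>0: "!!m. \<phi>0 m \<in> test_functions \<Omega>" "L2lim M \<phi>0 u" "!!i. L2lim M (%m. pd i (\<phi>0 m)) (D i u)"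
  using H01E[OF u] by blast
 obtain r :: "nat => nat" where r: "strict_mono r" "AE x in M. (%n. \<phi>0 (r n) x) ----> u x"
  using L2lim_AE_subseq[OF \<phi>0(2)] by blast
 define \<phi> where "\<phi> n = \<phi>0 (r n)" for n
 have \<phi>: "\<phi> m \<in> test_functions \<Omega>" "L2lim M \<phi> u" "L2lim M (%m. pd i (\<phi> m)) (D i u)"
   "AE x in M. (%n. \<phi> n x) ----> u x" for i m
  unfolding \<phi>_def[abs_def] using \<phi>0(1) r(2) L2lim_subseq[OF \<phi>0(2) r(1)] L2lim_subseq[OF \<phi>0(3) r(1), of i] by auto
 have sm: "smooth (\<phi> m)" for m by (rule test_smooth[OF \<phi>(1)])
 have um: "u \<in> borel_measurable M" using H01_sqint[OF u] by (simp add: sqint_def)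
 have fm: "\<phi> m \<in> borel_measurable M" for m using sm by (rule meas_smooth)
 have L0: "0 <= L" using G'(3)[of 0] by linarith
 have Gc: "continuous_on UNIV G" using G'(1) by (intro DERIV_continuous_on) auto
 have Gm: "(%x. G (w x)) \<in> borel_measurable M" "(%x. G' (w x)) \<in> borel_measurable M"
  if "w \<in> borel_measurable M" for w :: "real ^ 'n => real"
  using measurable_compose[OF that borel_measurable_continuous_onI[OF Gc]]
   measurable_compose[OF that borel_measurable_continuous_onI[OF G'(2)]] by auto
 have lip: "\<bar>G a - G b\<bar> <= \<bar>L * (a - b)\<bar>" for a b
  using field_differentiable_bound[of UNIV G G' L a b] G' L0
  by (auto simp: abs_mult intro: has_field_derivative_at_within)
 have Gs: "sqint M (%x. G (w x))" if "sqint M w" for w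
 proof (rule sqint_le[of M "%x. L * w x"])
  show "\<bar>G (w x)\<bar> <= \<bar>L * w x\<bar>" for x using lip[of "w x" 0] G(2) by simp
  show "(%x. G (w x)) \<in> borel_measurable M" using Gm(1) that by (simp add: sqint_def)
 qed (intro sqint_cmult that)
 have GL: "L2lim M (%m x. G (\<phi> m x)) (%x. G (u x))"
 proof (rule L2limI_bound)
  fix m
  have "nrm M (%x. G (\<phi> m x) - G (u x)) <= nrm M (%x. L * (\<phi> m x - u x))"
   using lip Gm um fm by (intro nrm_mono sqint_cmult sqint_diff L2limD[OF \<phi>(2)]) auto
  then show "nrm M (%x. G (\<phi> m x) - G (u x)) <= \<bar>L\<bar> * nrm M (%x. \<phi> m x - u x)" by (simp add: nrm_cmult)
 next
  show "(%m. \<bar>L\<bar> * nrm M (%x. \<phi> m x - u x)) ----> 0"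
   using tendsto_mult[OF tendsto_const[of "\<bar>L\<bar>"] L2limD(3)[OF \<phi>(2)]] by simp
 qed (auto intro!: Gs L2limD[OF \<phi>(2)])
 obtain B where B: "!!x. x \<in> \<Omega> ==> \<bar>E x\<bar> <= B" using smooth_bounded[OF E] by blast
 have Em: "E \<in> borel_measurable M" "pd i E \<in> borel_measurable M" for i
  by (auto intro!: meas_smooth smooth_pd E)
 have t: "(%x. G (\<phi> m x) * E x) \<in> test_functions \<Omega>" for m
  by (intro test_mult[OF _ E] test_compose[OF \<phi>(1)] G sm)
 have p: "pd i (%x. G (\<phi> m x) * E x) = (%x. G' (\<phi> m x) * pd i (\<phi> m) x * E x + G (\<phi> m x) * pd i E x)" for i m
  using pd_compose[OF sm G'(1)] by (auto simp: pd_mult[OF G(1)[OF sm] E])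
 have l1: "L2lim M (%m x. G (\<phi> m x) * E x) (%x. G (u x) * E x)"
  by (rule L2lim_bounded_mult[OF GL Em(1)]) (use B in auto)
 have l2: "L2lim M (%m. pd i (%x. G (\<phi> m x) * E x)) (%x. G' (u x) * D i u x * E x + G (u x) * pd i E x)" for i
 proof -
  obtain B' where B': "!!x. x \<in> \<Omega> ==> \<bar>pd i E x\<bar> <= B'" using smooth_bounded[OF smooth_pd[OF E]] by blast
  have "L2lim M (%m x. G' (\<phi> m x) * pd i (\<phi> m) x) (%x. G' (u x) * D i u x)"
  proof (rule L2lim_continuous_mult[OF \<phi>(3) Gm(2)[OF fm] G'(3) Gm(2)[OF um]])
   show "AE x in M. (%n. G' (\<phi> n x)) ----> G' (u x)"
    using \<phi>(4)
   proof eventually_elim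
    case (elim x)
    show ?case by (rule continuous_on_tendsto_compose[OF G'(2) elim]) auto
   qed
  qed
  then have "L2lim M (%m x. G' (\<phi> m x) * pd i (\<phi> m) x * E x) (%x. G' (u x) * D i u x * E x)"
   by (rule L2lim_bounded_mult[OF _ Em(1)]) (use B in auto)
  moreover have "L2lim M (%m x. G (\<phi> m x) * pd i E x) (%x. G (u x) * pd i E x)"
   by (rule L2lim_bounded_mult[OF GL Em(2)]) (use B' in auto)
  ultimately show ?thesis unfolding p by (rule L2lim_add)
 qed
 show "(%x. G (u x) * E x) \<in> H0"
  "AE x in M. D i (%x. G (u x) * E x) x = G' (u x) * D i u x * E x + G (u x) * pd i E x"
  using H01I[OF t l1 l2] by auto
qed

section \<open>The gradient form and the Poincare inequality\<close>

lemma grad_inner_sum: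
 assumes "W1 u" "W1 v"
 shows "gi u v = (\<Sum>i\<in>UNIV. (LINT x|M. D i u x * D i v x))"
 unfolding grad_inner_def grad_def inner_vec_def
 using W1D(2)[OF assms(1)] W1D(2)[OF assms(2)]
 by (simp add: sqint_mult_integrable)

lemma grad_norm_sq:
 assumes "W1 u" shows "(gn u)^2 = (\<Sum>i\<in>UNIV. (nrm M (D i u))^2)"
proof -
 have "gi u u = (\<Sum>i\<in>UNIV. (nrm M (D i u))^2)"
  unfolding grad_inner_sum[OF assms assms] nrm_sq by (simp add: power2_eq_square)
 moreover have "0 <= (\<Sum>i\<in>UNIV. (nrm M (D i u))^2)" by (simp add: sum_nonneg)
 ultimately show ?thesis by (simp add: grad_norm_def)
qed

lemma grad_inner_self: "W1 u ==> gi u u = (gn u)^2"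
 unfolding grad_norm_sq nrm_sq by (simp add: grad_inner_sum power2_eq_square)

lemma grad_norm_nonneg: "W1 u ==> 0 <= gn u"
 using grad_inner_self[of u] zero_le_power2[of "gn u"] by (simp add: grad_norm_def)

lemma nrm_D_le: assumes "W1 u" shows "nrm M (D i u) <= gn u"
proof (rule power2_le_imp_le[OF _ grad_norm_nonneg[OF assms]])
 show "(nrm M (D i u))^2 <= (gn u)^2"
  unfolding grad_norm_sq[OF assms] by (rule member_le_sum) auto
qed

lemma grad_norm_le_sum: assumes "W1 u" shows "gn u <= (\<Sum>i\<in>UNIV. nrm M (D i u))"
proof -
 have "gn u = L2_set (%i. nrm M (D i u)) UNIV"
  using grad_norm_sq[OF assms] grad_norm_nonneg[OF assms] by (simp add: L2_set_def real_sqrt_unique)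
 then show ?thesis using L2_set_le_sum[of UNIV "%i. nrm M (D i u)"] by simp
qed

lemma grad_inner_commute: "gi u v = gi v u"
 by (simp add: grad_inner_def inner_commute)

lemma D_cong_nrm:
 assumes "W1 u" "sqint M g" "AE x in M. D i u x = g x"
 shows "nrm M (D i u) = nrm M g" "sqint M k ==> (LINT x|M. D i u x * k x) = (LINT x|M. g x * k x)"
proof -
 show "nrm M (D i u) = nrm M g" by (rule nrm_cong_AE[OF W1D(2)[OF assms(1)] assms(2,3)])
 assume "sqint M k"
 then show "(LINT x|M. D i u x * k x) = (LINT x|M. g x * k x)"
  using assms W1D(2)[OF assms(1), of i] by (intro integral_cong_AE) (auto simp: sqint_def elim: eventually_mono)
qed

lemma grad_inner_lin:
 assumes "W1 u" "W1 v" "W1 w"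
 shows "gi (%x. a * u x + b * v x) w = a * gi u w + b * gi v w"
proof -
 note W = W1_lin[OF assms(1,2)]
 have s: "sqint M (%x. a * D i u x + b * D i v x)" for i by (intro sqint_add sqint_cmult W1D assms)
 have "(LINT x|M. D i (%x. a * u x + b * v x) x * D i w x)
   = a * (LINT x|M. D i u x * D i w x) + b * (LINT x|M. D i v x * D i w x)" for i
  using W1D(2)[OF assms(1)] W1D(2)[OF assms(2)] W1D(2)[OF assms(3)]
  by (subst D_cong_nrm(2)[OF W(1) s W(2) W1D(2)[OF assms(3)]])
    (simp add: distrib_right mult.assoc sqint_mult_integrable)
 then show ?thesis
  by (simp add: grad_inner_sum assms W(1) sum.distrib sum_distrib_left)
qed

lemma grad_inner_lin_right:
 assumes "W1 u" "W1 v" "W1 w"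
 shows "gi w (%x. a * u x + b * v x) = a * gi w u + b * gi w v"
 using grad_inner_lin[OF assms, of a b] by (simp add: grad_inner_commute)

lemma grad_inner_diff:
 assumes "W1 u" "W1 v" "W1 w"
 shows "gi (%x. u x - v x) w = gi u w - gi v w"
 using grad_inner_lin[OF assms, of 1 "-1"] by simp

lemma grad_inner_diff_right:
 assumes "W1 u" "W1 v" "W1 w"
 shows "gi w (%x. u x - v x) = gi w u - gi w v"
 using grad_inner_lin_right[OF assms, of 1 "-1"] by simp

lemma grad_cauchy_schwarz:
 assumes "W1 u" "W1 v"
 shows "\<bar>gi u v\<bar> <= gn u * gn v"
proof -
 have "\<bar>gi u v\<bar> <= (\<Sum>i\<in>UNIV. \<bar>(LINT x|M. D i u x * D i v x)\<bar>)"
  unfolding grad_inner_sum[OF assms] by (rule sum_abs)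
 also have "... <= (\<Sum>i\<in>UNIV. \<bar>nrm M (D i u)\<bar> * \<bar>nrm M (D i v)\<bar>)"
  using cauchy_schwarz[OF W1D(2)[OF assms(1)] W1D(2)[OF assms(2)]] by (intro sum_mono) simp
 also have "... <= L2_set (%i. nrm M (D i u)) UNIV * L2_set (%i. nrm M (D i v)) UNIV"
  by (rule L2_set_mult_ineq)
 also have "... = gn u * gn v"
  using grad_norm_sq[OF assms(1)] grad_norm_nonneg[OF assms(1)] grad_norm_sq[OF assms(2)] grad_norm_nonneg[OF assms(2)]
  by (simp add: L2_set_def real_sqrt_unique)
 finally show ?thesis .
qed

lemma grad_norm_cmult:
 assumes "W1 u" shows "gn (%x. a * u x) = \<bar>a\<bar> * gn u"
proof -
 have W: "W1 (%x. a * u x)" using W1_lin(1)[OF assms assms, of a 0] by simp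
 have "gi (%x. a * u x) (%x. a * u x) = a * gi u (%x. a * u x)"
  using grad_inner_lin[OF assms assms W, of a 0] by simp
 also have "gi u (%x. a * u x) = a * gi u u"
  using grad_inner_lin_right[OF assms assms assms, of a 0] by simp
 finally have "(gn (%x. a * u x))^2 = (\<bar>a\<bar> * gn u)^2"
  using grad_inner_self[OF assms] grad_inner_self[OF W] by (simp add: power2_eq_square mult_ac)
 then show ?thesis using grad_norm_nonneg[OF assms] grad_norm_nonneg[OF W] by (simp add: power2_eq_iff_nonneg)
qed

lemma grad_norm_add_sq:
 assumes "W1 u" "W1 v"
 shows "(gn (%x. u x + v x))^2 = (gn u)^2 + 2 * gi u v + (gn v)^2"
proof -
 have W: "W1 (%x. u x + v x)" using W1_lin(1)[OF assms, of 1 1] by simp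
 have "gi (%x. u x + v x) (%x. u x + v x) =
   gi u (%x. u x + v x) + gi v (%x. u x + v x)"
  using grad_inner_lin[OF assms W, of 1 1] by simp
 also have "... = (gi u u + gi u v) + (gi v u + gi v v)"
  using grad_inner_lin_right[OF assms assms(1), of 1 1] grad_inner_lin_right[OF assms assms(2), of 1 1] by simp
 finally show ?thesis by (simp add: grad_inner_self assms W grad_inner_commute[of v u])
qed

lemma grad_norm_triangle:
 assumes "W1 u" "W1 v"
 shows "gn (%x. u x + v x) <= gn u + gn v"
proof (rule power2_le_imp_le)
 show "(gn (%x. u x + v x))^2 <= (gn u + gn v)^2"
  using grad_norm_add_sq[OF assms] grad_cauchy_schwarz[OF assms] by (simp add: power2_sum)
qed (simp add: grad_norm_nonneg assms)

lemma grad_norm_minus: "W1 u ==> W1 v ==> gn (%x. u x - v x) = gn (%x. v x - u x)"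
 using grad_norm_cmult[OF W1_diff(1), of u v "-1"] by simp

lemma grad_norm_triangle_diff:
 assumes "W1 u" "W1 v"
 shows "gn (%x. u x - v x) <= gn u + gn v"
proof -
 have W: "W1 (%x. -1 * v x)" using W1_lin(1)[OF assms(2,2), of "-1" 0] by simp
 show ?thesis using grad_norm_triangle[OF assms(1) W] grad_norm_cmult[OF assms(2), of "-1"] by simp
qed

lemma grad_norm_cong_AE:
 assumes "u \<in> H0" "AE x in M. u x = v x"
 shows "gn v = gn u" "w \<in> H0 ==> gi v w = gi u w"
proof -
 note v = H01_AE[OF assms]
 have nn: "nrm M (D i v) = nrm M (D i u)" for i
  by (rule nrm_cong_AE[OF H01_sqint(2)[OF v(1)] H01_sqint(2)[OF assms(1)] v(2)])
 have "(gn v)^2 = (gn u)^2"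
  using grad_norm_sq[OF H01_W1[OF v(1)]] grad_norm_sq[OF H01_W1[OF assms(1)]] by (simp add: nn)
 then show "gn v = gn u"
  using grad_norm_nonneg[OF H01_W1[OF v(1)]] grad_norm_nonneg[OF H01_W1[OF assms(1)]] by (simp add: power2_eq_iff_nonneg)
 show "gi v w = gi u w" if w: "w \<in> H0"
  unfolding grad_inner_sum[OF H01_W1[OF v(1)] H01_W1[OF w]] grad_inner_sum[OF H01_W1[OF assms(1)] H01_W1[OF w]]
  by (intro sum.cong refl D_cong_nrm(2)[OF H01_W1[OF v(1)] H01_sqint(2)[OF assms(1)] v(2) H01_sqint(2)[OF w]])
qed

text \<open>Integrate the partial derivative of \<open>x\<^sub>i \<phi>^2\<close>.\<close>

lemma poincare: obtains P where "P > 0" "!!u. u \<in> H0 ==> nrm M u <= P * gn u"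
proof -
 fix i :: 'n
 obtain R where R: "R > 0" "!!x. x \<in> \<Omega> ==> \<bar>x $ i\<bar> <= R"
  using smooth_bounded[OF smooth_coord[of i]] by blast
 have T: "nrm M \<phi> <= 2 * R * nrm M (pd i \<phi>)" if \<phi>: "\<phi> \<in> test_functions \<Omega>" for \<phi>
 proof -
  have s: "smooth \<phi>" by (rule test_smooth[OF \<phi>])
  have t: "(%x. \<phi> x * (x $ i * \<phi> x)) \<in> test_functions \<Omega>"
   by (intro test_mult[OF \<phi>] smooth_mult smooth_coord s)
  have xs: "sqint M (%x. \<phi> x * x $ i)"
   by (rule sqint_mult_bounded[OF test_sqint(1)[OF \<phi>] meas_smooth[OF smooth_coord] R(2)])
  have p: "pd i (%x. \<phi> x * (x $ i * \<phi> x)) x = (\<phi> x)^2 + 2 * ((\<phi> x * x $ i) * pd i \<phi> x)" for x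
   by (subst pd_mult[OF s smooth_mult[OF smooth_coord s]], subst pd_mult[OF smooth_coord s])
     (simp add: pd_coord power2_eq_square algebra_simps)
  have "0 = (LINT x|M. (\<phi> x)^2 + 2 * ((\<phi> x * x $ i) * pd i \<phi> x))"
   using test_integral_pd_zero[OF t, of i] by (simp only: p)
  also have "... = (nrm M \<phi>)^2 + 2 * (LINT x|M. (\<phi> x * x $ i) * pd i \<phi> x)"
   unfolding nrm_sq using sqint_sq[OF test_sqint(1)[OF \<phi>]] sqint_mult_integrable[OF xs test_sqint(2)[OF \<phi>, of i]]
   by (subst Bochner_Integration.integral_add) auto
  finally have "(nrm M \<phi>)^2 <= 2 * (nrm M (%x. \<phi> x * x $ i) * nrm M (pd i \<phi>))"
   using cauchy_schwarz[OF xs test_sqint(2)[OF \<phi>, of i]] by linarith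
  also have "nrm M (%x. \<phi> x * x $ i) <= nrm M (%x. R * \<phi> x)"
  proof (rule nrm_mono)
   show "\<bar>\<phi> x * x $ i\<bar> <= \<bar>R * \<phi> x\<bar>" if "x \<in> space M" for x
    using mult_left_mono[OF R(2)[of x], of "\<bar>\<phi> x\<bar>"] R(1) that by (simp add: abs_mult mult.commute)
  qed (use xs test_sqint(1)[OF \<phi>] in \<open>auto simp: sqint_def[of _ "%x. \<phi> x * x $ i"]\<close>)
  then have "2 * (nrm M (%x. \<phi> x * x $ i) * nrm M (pd i \<phi>)) <= 2 * ((R * nrm M \<phi>) * nrm M (pd i \<phi>))"
   using R(1) by (intro mult_left_mono mult_right_mono) (auto simp: nrm_cmult)
  finally have "nrm M \<phi> * nrm M \<phi> <= nrm M \<phi> * (2 * R * nrm M (pd i \<phi>))"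
   by (simp add: power2_eq_square mult_ac)
  then show ?thesis
   using R(1) by (cases "nrm M \<phi> = 0") (auto simp: mult_le_cancel_left_pos less_le)
 qed
 show thesis
 proof (rule that[of "2 * R"])
  fix u assume u: "u \<in> H0"
  obtain \<phi> where \<phi>: "!!m. \<phi> m \<in> test_functions \<Omega>" "L2lim M \<phi> u" "!!i. L2lim M (%m. pd i (\<phi> m)) (D i u)"
   using H01E[OF u] by blast
  have "nrm M u <= 2 * R * nrm M (D i u)"
   by (rule LIMSEQ_le[OF L2lim_nrm[OF \<phi>(2)] tendsto_mult[OF tendsto_const L2lim_nrm[OF \<phi>(3)]]])
     (use T[OF \<phi>(1)] in auto)
  also have "... <= 2 * R * gn u"
   using nrm_D_le[OF H01_W1[OF u]] R(1) by (intro mult_left_mono) auto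
  finally show "nrm M u <= 2 * R * gn u" .
 qed (use R in auto)
qed

end

text \<open>The first-order condition at a minimum; it yields the Euler-Lagrange equation of the
  Rayleigh quotient.\<close>

lemma quadratic_nonneg_imp_linear_zero:
 fixes a b :: real
 assumes "!!t. 0 <= 2 * t * a + t^2 * b" shows "a = 0"
proof (rule ccontr)
 assume a: "a ~= 0"
 define c where "c = \<bar>b\<bar> + 1"
 have c: "c > 0" "b < c" by (auto simp: c_def)
 have "0 <= 2 * (- (a / c)) * a + (- (a / c))^2 * b" by (rule assms)
 also have "... = (a^2 / c) * (b / c - 2)" using c by (simp add: field_simps power2_eq_square)
 also have "... < 0" using a c by (intro mult_pos_neg) (auto simp: field_simps)
 finally show False by simp
qed

section \<open>Completeness of the energy space and weak limits\<close>

context bounded_domain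
begin

lemma L2_inner_le: "sqint M f ==> sqint M g ==> \<bar>L2_inner \<Omega> f g\<bar> <= nrm M f * nrm M g"
 unfolding L2_inner_def by (rule cauchy_schwarz)

lemma H01_test_dense:
 assumes "z \<in> H0" "eps > 0"
 obtains \<phi> where "\<phi> \<in> test_functions \<Omega>" "gn (%x. z x - \<phi> x) < eps"
proof -
 obtain \<phi> where \<phi>: "!!m. \<phi> m \<in> test_functions \<Omega>" "L2lim M \<phi> z" "!!i. L2lim M (%m. pd i (\<phi> m)) (D i z)"
  using H01E[OF assms(1)] by blast
 have z: "W1 z" by (rule H01_W1[OF assms(1)])
 have d: "W1 (%x. z x - \<phi> m x)" for m by (intro W1_diff z test_W1 \<phi>)
 have "nrm M (D i (%x. z x - \<phi> m x)) = nrm M (%x. pd i (\<phi> m) x - D i z x)" for i m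
 proof -
  have "nrm M (D i (%x. z x - \<phi> m x)) = nrm M (%x. D i z x - pd i (\<phi> m) x)"
   using W1_diff(2)[OF z test_W1(1)[OF \<phi>(1)[of m]], of i] test_W1(2)[OF \<phi>(1)[of m], of i]
   by (intro nrm_cong_AE W1D d sqint_diff z test_sqint \<phi>) auto
  then show ?thesis by (simp add: nrm_minus_commute)
 qed
 then have le: "gn (%x. z x - \<phi> m x) <= (\<Sum>i\<in>UNIV. nrm M (%x. pd i (\<phi> m) x - D i z x))" for m
  using grad_norm_le_sum[OF d[of m]] by simp
 have "(%m. \<Sum>i\<in>UNIV. nrm M (%x. pd i (\<phi> m) x - D i z x)) ----> (\<Sum>i\<in>(UNIV::'n set). 0)"
  by (intro tendsto_sum L2limD(3)[OF \<phi>(3)])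
 then have "\<forall>\<^sub>F m in sequentially. (\<Sum>i\<in>UNIV. nrm M (%x. pd i (\<phi> m) x - D i z x)) < eps"
  using assms(2) by (intro order_tendstoD(2)) auto
 then obtain m where "(\<Sum>i\<in>UNIV. nrm M (%x. pd i (\<phi> m) x - D i z x)) < eps"
  by (auto dest: eventually_happens)
 then show ?thesis using that[OF \<phi>(1)[of m]] le[of m] by simp
qed

text \<open>The gradient components converge by completeness of L^2, and closedness of
  \<open>H0\<close> identifies their limits with the derivatives of the given limit w.\<close>

lemma H01_complete:
 assumes x: "!!m. x m \<in> H0" and w: "L2lim M x w"
  and c: "!!e. e > 0 ==> \<exists>N. \<forall>m\<ge>N. \<forall>k\<ge>N. gn (%t. x m t - x k t) < e"
 shows "w \<in> H0" "(%m. gn (%t. x m t - w t)) ----> 0"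
proof -
 have nd: "nrm M (%t. D i (x m) t - D i (x k) t) <= gn (%t. x m t - x k t)" for i m k
 proof -
  have W: "W1 (%t. x m t - x k t)" by (intro H01_W1 H01_diff x)
  have "nrm M (D i (%t. x m t - x k t)) = nrm M (%t. D i (x m) t - D i (x k) t)"
   by (intro nrm_cong_AE W1D W sqint_diff H01_sqint x H01_diff)
  then show ?thesis using nrm_D_le[OF W, of i] by simp
 qed
 have "\<exists>g. L2lim M (%m. D i (x m)) g" for i
 proof (rule riesz_fischer)
  fix e :: real assume "0 < e"
  then obtain N where "\<forall>m\<ge>N. \<forall>k\<ge>N. gn (%t. x m t - x k t) < e" using c by blast
  then show "\<exists>N. \<forall>m\<ge>N. \<forall>n\<ge>N. nrm M (%t. D i (x m) t - D i (x n) t) < e"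
   using nd le_less_trans by blast
 qed (intro H01_sqint x)
 then have "\<exists>g. \<forall>i. L2lim M (%m. D i (x m)) (g i)" by (intro choice allI)
 then obtain g where g: "!!i. L2lim M (%m. D i (x m)) (g i)" by blast
 note cl = H01_closed[OF x w g]
 show wH: "w \<in> H0" by (rule cl(1))
 have le: "gn (%t. x m t - w t) <= (\<Sum>i\<in>UNIV. nrm M (%t. D i (x m) t - g i t))" for m
 proof -
  have W: "W1 (%t. x m t - w t)" by (intro H01_W1 H01_diff x wH)
  have "nrm M (D i (%t. x m t - w t)) = nrm M (%t. D i (x m) t - g i t)" for i
   using H01_diff(2)[OF x[of m] wH, of i] cl(2)[of i]
   by (intro nrm_cong_AE W1D W sqint_diff H01_sqint x L2limD(2)[OF g]) auto
  then show ?thesis using grad_norm_le_sum[OF W] by simp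
 qed
 have "(%m. \<Sum>i\<in>UNIV. nrm M (%t. D i (x m) t - g i t)) ----> (\<Sum>i\<in>(UNIV::'n set). 0)"
  by (intro tendsto_sum L2limD(3)[OF g])
 then have l: "(%m. \<Sum>i\<in>UNIV. nrm M (%t. D i (x m) t - g i t)) ----> 0" by simp
 show "(%m. gn (%t. x m t - w t)) ----> 0"
  by (rule tendsto_sandwich[OF _ _ tendsto_const l])
    (use le grad_norm_nonneg[OF H01_W1[OF H01_diff(1)[OF x wH]]] in auto)
qed

text \<open>Closing the tails under midpoints alone suffices in place of convex hulls, since the
  parallelogram law uses nothing else.\<close>

inductive_set mid_hull :: "(nat => real ^ 'n => real) => nat => (real ^ 'n => real) set" for v m where
 hull_base: "k \<ge> m ==> v k \<in> mid_hull v m"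
| hull_mid: "x \<in> mid_hull v m ==> y \<in> mid_hull v m ==> (%t. (1/2) * x t + (1/2) * y t) \<in> mid_hull v m"

lemma hull_mono:
 assumes "x \<in> mid_hull v k" "m <= k" shows "x \<in> mid_hull v m"
 using assms
proof induction
 case (hull_mid x y)
 then show ?case by (intro mid_hull.hull_mid)
qed (auto intro: hull_base)

lemma hull_H01:
 assumes "x \<in> mid_hull v m" "!!k. v k \<in> H0" "!!k. gn (v k) <= B"
 shows "x \<in> H0 \<and> gn x <= B"
 using assms(1)
proof induction
 case (hull_mid x y)
 have W: "W1 x" "W1 y" using hull_mid H01_W1 by auto
 have "gn (%t. (1/2) * x t + (1/2) * y t) <= gn (%t. (1/2) * x t) + gn (%t. (1/2) * y t)"
  by (intro grad_norm_triangle H01_W1 H01_cmult) (use hull_mid in auto)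
 also have "... <= B" unfolding grad_norm_cmult[OF W(1)] grad_norm_cmult[OF W(2)] using hull_mid by linarith
 finally show ?case using hull_mid H01_lin(1)[of x y "1/2" "1/2"] by blast
qed (use assms in auto)

lemma hull_close:
 assumes "x \<in> mid_hull v m" "!!k. sqint M (v k)" "sqint M w" "!!k. k \<ge> m ==> nrm M (%t. v k t - w t) <= eps"
 shows "sqint M x \<and> nrm M (%t. x t - w t) <= eps"
 using assms(1)
proof induction
 case (hull_mid x y)
 have s: "sqint M (%t. x t - w t)" "sqint M (%t. y t - w t)" using hull_mid assms by auto
 have "(%t. (1/2) * x t + (1/2) * y t - w t) = (%t. (1/2) * (x t - w t) + (1/2) * (y t - w t))"
  by (auto simp: field_simps)
 then have "nrm M (%t. (1/2) * x t + (1/2) * y t - w t) <=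
   nrm M (%t. (1/2) * (x t - w t)) + nrm M (%t. (1/2) * (y t - w t))"
  using nrm_triangle[OF sqint_cmult[OF s(1)] sqint_cmult[OF s(2)], of "1/2" "1/2"] by simp
 also have "... <= eps" unfolding nrm_cmult using hull_mid by linarith
 finally show ?case using hull_mid sqint_add[OF sqint_cmult sqint_cmult, of M x y "1/2" "1/2"] by blast
qed (use assms in auto)

text \<open>Mazur's argument: almost norm-minimal elements of the midpoint-convex hulls of the tails
 form a Cauchy sequence by the parallelogram law.\<close>

lemma weak_closed:
 assumes v: "!!k. v k \<in> H0" and B: "!!k. gn (v k) <= B" and w: "L2lim M v w"
 shows "w \<in> H0"
proof -
 define q where "q m = Inf ((%x. (gn x)^2) ` mid_hull v m)" for m
 have bb: "bdd_below ((%x. (gn x)^2) ` mid_hull v m)" for m by (rule bdd_belowI[of _ 0]) auto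
 have ne: "mid_hull v m ~= {}" for m using hull_base[of m m v] by auto
 have q_le: "q m <= (gn x)^2" if "x \<in> mid_hull v m" for m x
  unfolding q_def using that bb by (intro cInf_lower) auto
 have "\<exists>x\<in>mid_hull v m. (gn x)^2 < q m + 1 / Suc m" for m
 proof -
  have "Inf ((%x. (gn x)^2) ` mid_hull v m) < q m + 1 / Suc m" by (simp add: q_def)
  then show ?thesis using cInf_lessD[of "(%x. (gn x)^2) ` mid_hull v m"] ne by auto
 qed
 then have "\<exists>x. \<forall>m. x m \<in> mid_hull v m \<and> (gn (x m))^2 < q m + 1 / Suc m" by (intro choice) auto
 then obtain x where x: "!!m. x m \<in> mid_hull v m" "!!m. (gn (x m))^2 < q m + 1 / Suc m" by blast
 have xH: "x m \<in> H0" for m using hull_H01[OF x(1) v B] by simp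
 have inc: "incseq q"
 proof (rule incseq_SucI)
  fix m show "q m <= q (Suc m)"
   unfolding q_def by (rule cInf_superset_mono) (use ne bb hull_mono in \<open>auto intro!: image_mono\<close>)
 qed
 have "q m <= B^2" for m
  using q_le[OF x(1)[of m]] hull_H01[OF x(1)[of m] v B] grad_norm_nonneg[OF H01_W1[OF xH[of m]]]
  by (meson order_trans power_mono)
 then have "convergent q"
  using incseq_convergent[OF inc, of "B^2"] unfolding convergent_def by blast
 then have qC: "Cauchy q" by (rule convergent_Cauchy)
 have key: "(gn (%t. x m t - x k t))^2 <= 2 * (q k - q m) + 2 / Suc m + 2 / Suc k" if mk: "m <= k" for m k
 proof -
  have W: "W1 (x m)" "W1 (x k)" using xH H01_W1 by auto
  have Wm: "W1 (%t. -1 * x k t)" using W1_lin(1)[OF W(2,2), of "-1" 0] by simp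
  have Ws: "W1 (%t. x m t + x k t)" using W1_lin(1)[OF W, of 1 1] by simp
  \<comment> \<open>Both elements lie in the earlier hull, so their midpoint lies there too and its
    squared norm cannot fall below \<open>q m\<close>.\<close>
  have "x k \<in> mid_hull v m" by (rule hull_mono[OF x(1) mk])
  then have mid: "(%t. (1/2) * x m t + (1/2) * x k t) \<in> mid_hull v m" by (intro hull_mid x)
  have eq: "(%t. (1/2) * x m t + (1/2) * x k t) = (%t. (1/2) * (x m t + x k t))" by (auto simp: field_simps)
  have "q m <= (gn (%t. (1/2) * (x m t + x k t)))^2" using q_le[OF mid] unfolding eq .
  also have "... = (1/4) * (gn (%t. x m t + x k t))^2"
   unfolding grad_norm_cmult[OF Ws] by (simp add: power_mult_distrib power2_eq_square)
  finally have 1: "4 * q m <= (gn (%t. x m t + x k t))^2" by simp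
  have "gi (x m) (%t. -1 * x k t) = - gi (x m) (x k)"
   using grad_inner_lin_right[OF W(2,2,1), of "-1" 0] by simp
  moreover have "gn (%t. -1 * x k t) = gn (x k)"
   using grad_norm_cmult[OF W(2), of "-1"] by simp
  ultimately have "(gn (%t. x m t - x k t))^2 =
    (gn (x m))^2 - 2 * gi (x m) (x k) + (gn (x k))^2"
   using grad_norm_add_sq[OF W(1) Wm] by simp
  then have E: "(gn (%t. x m t - x k t))^2 =
    2 * (gn (x m))^2 + 2 * (gn (x k))^2 - (gn (%t. x m t + x k t))^2"
   using grad_norm_add_sq[OF W] by linarith
  have arith: "d <= 2 * (y - x) + p2 + r2"
   if "d = 2 * a + 2 * b - s" "4 * x <= s" "a < x + p" "b < y + r" "p2 = 2 * p" "r2 = 2 * r"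
   for a b d s x y p r p2 r2 :: real using that by (simp add: algebra_simps)
  show ?thesis by (rule arith[OF E 1 x(2)[of m] x(2)[of k]]) simp_all
 qed
 show ?thesis
 proof (rule H01_complete(1)[OF xH])
  show "L2lim M x w"
  proof (rule L2limI)
   show "sqint M (x n)" for n by (rule H01_sqint[OF xH])
   show "sqint M w" by (rule L2limD(2)[OF w])
   show "(%n. nrm M (%t. x n t - w t)) ----> 0"
   proof (rule LIMSEQ_I)
    fix e :: real assume "0 < e"
    then obtain N where N: "!!n. n \<ge> N ==> nrm M (%t. v n t - w t) < e / 2"
     using LIMSEQ_D[OF L2limD(3)[OF w], of "e / 2"] by auto
    have "nrm M (%t. x n t - w t) < e" if "n \<ge> N" for n
    proof -
     have "nrm M (%t. v k t - w t) <= e / 2" if "k \<ge> n" for k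
      using N[of k] \<open>n \<ge> N\<close> that by simp
     then have "nrm M (%t. x n t - w t) <= e / 2"
      using hull_close[OF x(1)[of n] H01_sqint(1)[OF v] L2limD(2)[OF w], of "e / 2"] by blast
     then show ?thesis using \<open>0 < e\<close> by linarith
    qed
    then show "\<exists>no. \<forall>n\<ge>no. norm (nrm M (%t. x n t - w t) - 0) < e"
     by (intro exI[of _ N]) simp
   qed
  qed
  fix e :: real assume e: "0 < e"
  then obtain N1 where N1: "!!m k. m \<ge> N1 ==> k \<ge> N1 ==> \<bar>q k - q m\<bar> < e^2 / 8"
   using CauchyD[OF qC, of "e^2 / 8"] by auto
  obtain N2 where N2: "1 / real (Suc N2) < e^2 / 8"
   using nat_approx_posE[of "e^2 / 8"] e by auto
  have half: "gn (%t. x m t - x k t) < e" if "m \<ge> max N1 N2" "m <= k" for m k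
  proof -
   have a: "1 / real (Suc m) <= 1 / real (Suc N2)" "1 / real (Suc k) <= 1 / real (Suc N2)"
    using that by (auto simp: field_simps)
   have b: "\<bar>q k - q m\<bar> < e^2 / 8" using N1 that by auto
   have c: "0 < e^2" using e by simp
   have arith: "d < E" if "p <= r" "s <= r" "\<bar>y\<bar> < E / 8" "0 < E" "d <= 2 * y + p2 + s2" "r < E / 8"
     "p2 = 2 * p" "s2 = 2 * s" for d E p r s y p2 s2 :: real using that by (simp add: abs_less_iff algebra_simps)
   have "(gn (%t. x m t - x k t))^2 < e^2"
    by (rule arith[OF a b c key[OF that(2)] N2]) simp_all
   then show ?thesis using e by (intro power2_less_imp_less[of _ e]) auto
  qed
  show "\<exists>N. \<forall>m\<ge>N. \<forall>k\<ge>N. gn (%t. x m t - x k t) < e"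
  proof (intro exI allI impI)
   fix m k assume "m \<ge> max N1 N2" "k \<ge> max N1 N2"
   then show "gn (%t. x m t - x k t) < e"
    using half[of m k] half[of k m] grad_norm_minus[OF H01_W1[OF xH] H01_W1[OF xH], of m k]
    by (cases "m <= k") auto
  qed
 qed
qed

text \<open>Both derivatives are moved to the test function, which makes the gradient form
  continuous in the L^2 norm of u for fixed \<phi>.\<close>

lemma grad_inner_test:
 assumes "u \<in> H0" "\<phi> \<in> test_functions \<Omega>"
 shows "gi u \<phi> = - (\<Sum>i\<in>UNIV. (LINT x|M. u x * pd i (pd i \<phi>) x))"
proof -
 have "(LINT x|M. D i u x * D i \<phi> x) = - (LINT x|M. u x * pd i (pd i \<phi>) x)" for i
 proof -
  have "(LINT x|M. D i u x * D i \<phi> x) = (LINT x|M. D i \<phi> x * D i u x)" by (simp add: mult.commute)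
  also have "... = (LINT x|M. pd i \<phi> x * D i u x)"
   by (rule D_cong_nrm(2)[OF test_W1(1)[OF assms(2)] test_sqint(2)[OF assms(2)] test_W1(2)[OF assms(2)] H01_sqint(2)[OF assms(1)]])
  also have "... = (LINT x|M. D i u x * pd i \<phi> x)" by (simp add: mult.commute)
  also have "... = - (LINT x|M. u x * pd i (pd i \<phi>) x)"
   using W1D(3)[OF H01_W1[OF assms(1)], of i] test_pd[OF assms(2), of i] by (simp add: has_weak_deriv_single)
  finally show ?thesis .
 qed
 then show ?thesis
  unfolding grad_inner_sum[OF H01_W1[OF assms(1)] test_W1(1)[OF assms(2)]] by (simp add: sum_negf)
qed

text \<open>Under an energy bound, L^2 convergence already implies weak convergence of gradients: it
  is clear against test functions by \<open>grad_inner_test\<close>, and \<open>B\<close> controls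
  the error made in approximating z by one.\<close>

lemma weak_grad_conv:
 assumes v: "!!k. v k \<in> H0" and B: "!!k. gn (v k) <= B" and w: "L2lim M v w" and z: "z \<in> H0"
 shows "(%k. gi (v k) z) ----> gi w z"
proof (rule LIMSEQ_I)
 have wH: "w \<in> H0" by (rule weak_closed[OF v B w])
 fix e :: real assume e: "0 < e"
 define c where "c = \<bar>B\<bar> + gn w + 1"
 have c: "c > 0" using grad_norm_nonneg[OF H01_W1[OF wH]] by (simp add: c_def)
 obtain \<phi> where \<phi>: "\<phi> \<in> test_functions \<Omega>" "gn (%x. z x - \<phi> x) < e / (2 * c)"
  using H01_test_dense[OF z, of "e / (2 * c)"] e c by auto
 have zW: "W1 z" "W1 \<phi>" "W1 w" "W1 (%x. z x - \<phi> x)" using H01_W1 z wH test_W1(1)[OF \<phi>(1)] by (auto intro: W1_diff)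
 have "(%k. gi (v k) \<phi>) ----> gi w \<phi>"
  unfolding grad_inner_test[OF v \<phi>(1)] grad_inner_test[OF wH \<phi>(1)]
  by (intro tendsto_intros L2lim_inner w L2lim_const test_sqint test_pd \<phi>)
 then obtain N where N: "!!k. k \<ge> N ==> \<bar>gi (v k) \<phi> - gi w \<phi>\<bar> < e / 2"
  using LIMSEQ_D[of _ _ "e / 2"] e by fastforce
 show "\<exists>no. \<forall>k\<ge>no. norm (gi (v k) z - gi w z) < e"
 proof (intro exI[of _ N] allI impI)
  fix k assume k: "N <= k"
  have vW: "W1 (v k)" by (rule H01_W1[OF v])
  have "\<bar>gi (v k) (%x. z x - \<phi> x)\<bar> <= \<bar>B\<bar> * gn (%x. z x - \<phi> x)"
   using grad_cauchy_schwarz[OF vW zW(4)] B[of k] grad_norm_nonneg[OF zW(4)]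
   by (meson abs_ge_self mult_right_mono order_trans)
  moreover have "\<bar>gi w (%x. z x - \<phi> x)\<bar> <= gn w * gn (%x. z x - \<phi> x)"
   by (rule grad_cauchy_schwarz[OF zW(3,4)])
  moreover have "(\<bar>B\<bar> + gn w) * gn (%x. z x - \<phi> x) <= c * (e / (2 * c))"
   using \<phi>(2) c grad_norm_nonneg[OF zW(4)] grad_norm_nonneg[OF zW(3)] by (intro mult_mono) (auto simp: c_def)
  moreover have "c * (e / (2 * c)) = e / 2" using c by simp
  ultimately have "\<bar>gi (v k) (%x. z x - \<phi> x)\<bar> + \<bar>gi w (%x. z x - \<phi> x)\<bar> <= e / 2"
   by (simp add: distrib_right)
  then show "norm (gi (v k) z - gi w z) < e"
   using N[OF k] unfolding grad_inner_diff_right[OF zW(1,2) vW] grad_inner_diff_right[OF zW(1,2,3)] real_norm_def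
   by linarith
 qed
qed

section \<open>Finite-dimensional subspaces and Ritz projections\<close>

lemma H01_sum:
 "(!!j. j < (m::nat) ==> b j \<in> H0) ==> (%x. \<Sum>j<m. a j * b j x) \<in> H0"
proof (induction m)
 case (Suc m)
 have "(%x. 1 * (\<Sum>j<m. a j * b j x) + a m * b m x) \<in> H0"
  by (rule H01_lin(1)) (use Suc in auto)
 then show ?case by simp
qed (simp add: H01_zero)

lemma grad_inner_zero: "gi (%x. 0) v = 0" if "W1 v"
proof -
 have z: "W1 (%x. 0)" by (rule H01_W1[OF H01_zero])
 show ?thesis using grad_inner_lin[OF z z that, of 0 0] by simp
qed

lemma grad_inner_H01_sum:
 assumes "!!j. j < (m::nat) ==> b j \<in> H0" "v \<in> H0"
 shows "gi (%x. \<Sum>j<m. a j * b j x) v = (\<Sum>j<m. a j * gi (b j) v)"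
 using assms(1)
proof (induction m)
 case 0
 show ?case using grad_inner_zero[OF H01_W1[OF assms(2)]] by simp
next
 case (Suc m)
 have "gi (%x. 1 * (\<Sum>j<m. a j * b j x) + a m * b m x) v =
   1 * gi (%x. \<Sum>j<m. a j * b j x) v + a m * gi (b m) v"
  by (intro grad_inner_lin H01_W1 H01_sum assms(2)) (use Suc in auto)
 then show ?case using Suc by simp
qed

lemma fin_dim_H01:
 assumes "fin_dim_subspace_H01 \<Omega> V" "v \<in> V" shows "v \<in> H0"
proof -
 obtain m b a where b: "!!j. j < m ==> b j \<in> H0" and "AE x in M. v x = (\<Sum>j<(m::nat). a j * b j x)"
  using assms unfolding fin_dim_subspace_H01_def by auto
 then have "AE x in M. (\<Sum>j<m. a j * b j x) = v x" by (auto elim: eventually_mono)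
 then show ?thesis by (rule H01_AE(1)[rotated]) (rule H01_sum, rule b)
qed

lemma fin_dim_lin:
 assumes "fin_dim_subspace_H01 \<Omega> V" "v \<in> V" "w \<in> V" shows "(%x. s * v x + t * w x) \<in> V"
proof -
 obtain m b where V: "V = {v. \<exists>a. AE x in M. v x = (\<Sum>j<(m::nat). a j * b j x)}"
  using assms unfolding fin_dim_subspace_H01_def by auto
 obtain a a' where "AE x in M. v x = (\<Sum>j<m. a j * b j x)" "AE x in M. w x = (\<Sum>j<m. a' j * b j x)"
  using assms V by auto
 then have "AE x in M. s * v x + t * w x = (\<Sum>j<m. (s * a j + t * a' j) * b j x)"
  by eventually_elim (simp add: sum_distrib_left sum.distrib algebra_simps)
 then show ?thesis unfolding V by auto
qed

lemma fin_dim_zero: "fin_dim_subspace_H01 \<Omega> V ==> (%x. 0) \<in> V"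
 unfolding fin_dim_subspace_H01_def by (auto intro!: exI[of _ "%j. 0"])

lemma fin_dim_diff: "fin_dim_subspace_H01 \<Omega> V ==> v \<in> V ==> w \<in> V ==> (%x. v x - w x) \<in> V"
 using fin_dim_lin[of V v w 1 "-1"] by simp

text \<open>Spans are expressed by coefficient families because elements of the subspaces are
  determined only up to null sets. The generators may be dependent, so n can be smaller than
  m.\<close>

lemma gram_schmidt:
 assumes "!!j. j < (m::nat) ==> b j \<in> H0"
 shows "\<exists>(n::nat) e. (\<forall>k<n. e k \<in> H0 \<and> (\<exists>a. AE x in M. e k x = (\<Sum>j<m. a j * b j x))) \<and>
  (\<forall>j<n. \<forall>k<n. gi (e j) (e k) = (if j = k then 1 else 0)) \<and>
  (\<forall>j<m. \<exists>c. AE x in M. b j x = (\<Sum>k<n. c k * e k x))"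
 using assms
proof (induction m)
 case 0
 show ?case by (intro exI[of _ 0]) auto
next
 case (Suc m)
 have b': "!!j. j < m ==> b j \<in> H0" using Suc.prems by simp
 obtain n :: nat and e where E: "\<forall>k<n. e k \<in> H0 \<and> (\<exists>a. AE x in M. e k x = (\<Sum>j<m. a j * b j x))"
   "\<forall>j<n. \<forall>k<n. gi (e j) (e k) = (if j = k then 1 else 0)"
   "\<forall>j<m. \<exists>c. AE x in M. b j x = (\<Sum>k<n. c k * e k x)"
  using Suc.IH[OF b'] by blast
 have e: "!!k. k < n ==> e k \<in> H0"
   "!!k. k < n ==> \<exists>a. AE x in M. e k x = (\<Sum>j<m. a j * b j x)"
   "!!j k. j < n ==> k < n ==> gi (e j) (e k) = (if j = k then 1 else 0)"
   "!!j. j < m ==> \<exists>c. AE x in M. b j x = (\<Sum>k<n. c k * e k x)" using E by simp_all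
 have bm: "b m \<in> H0" using Suc by simp
 define c where "c k = gi (b m) (e k)" for k
 define r where "r x = b m x - (\<Sum>k<n. c k * e k x)" for x
 have sH: "(%x. \<Sum>k<n. c k * e k x) \<in> H0" by (rule H01_sum) (rule e(1))
 have gs: "gi (%x. \<Sum>k<n. c k * e k x) z = (\<Sum>k<n. c k * gi (e k) z)"
  if "z \<in> H0" for c z by (rule grad_inner_H01_sum[OF _ that]) (rule e(1))
 have rH: "r \<in> H0" unfolding r_def by (rule H01_diff(1)[OF bm sH])
 have "gi r (e k) = 0" if "k < n" for k
 proof -
  have "gi r (e k) = c k - (\<Sum>j<n. c j * gi (e j) (e k))"
   unfolding r_def using grad_inner_diff[OF H01_W1[OF bm] H01_W1[OF sH] H01_W1[OF e(1)[OF that]]]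
    gs[OF e(1)[OF that], of c] by (simp add: c_def)
  also have "(\<Sum>j<n. c j * gi (e j) (e k)) = (\<Sum>j<n. if j = k then c j else 0)"
   using e(3) that by (intro sum.cong) auto
  also have "... = c k" using that by simp
  finally show ?thesis by simp
 qed note orth = this
 have ext: "\<exists>a. AE x in M. e k x = (\<Sum>j<Suc m. a j * b j x)" if k: "k < n" for k
 proof -
  obtain a where "AE x in M. e k x = (\<Sum>j<m. a j * b j x)" using e(2)[OF k] by blast
  then have "AE x in M. e k x = (\<Sum>j<Suc m. (a(m := 0)) j * b j x)"
   by eventually_elim simp
  then show ?thesis by blast
 qed
 show ?case
 proof (cases "gn r = 0")
  case True
  \<comment> \<open>By Poincare a remainder without gradient vanishes almost everywhere, so the new
    generator depends on the earlier ones and the basis stays as it is.\<close>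
  obtain P where "nrm M r <= P * gn r" using poincare rH by metis
  then have "nrm M r = 0" using True by (simp add: antisym)
  then have "AE x in M. r x = 0" by (rule nrm_zero_AE[OF H01_sqint(1)[OF rH]])
  then have "AE x in M. b m x = (\<Sum>k<n. c k * e k x)" by eventually_elim (simp add: r_def)
  then have "\<forall>j<Suc m. \<exists>c. AE x in M. b j x = (\<Sum>k<n. c k * e k x)"
   using e(4) by (auto simp: less_Suc_eq)
  then show ?thesis using e(1,3) ext by (intro exI[of _ n] exI[of _ e]) auto
 next
  case False
  define g where "g = gn r"
  have g: "g > 0" using False grad_norm_nonneg[OF H01_W1[OF rH]] by (simp add: g_def)
  define e' where "e' k = (if k = n then (%x. (1 / g) * r x) else e k)" for k
  have en: "e' n = (%x. (1 / g) * r x)" "!!k. k < n ==> e' k = e k" by (auto simp: e'_def)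
  have H: "e' k \<in> H0" if "k < Suc n" for k
   using that e(1) H01_cmult(1)[OF rH, of "1 / g"] by (auto simp: less_Suc_eq en)
  have rb: "\<exists>a. AE x in M. (1 / g) * r x = (\<Sum>j<Suc m. a j * b j x)"
  proof -
   have "\<forall>k. \<exists>a. k < n --> (AE x in M. e k x = (\<Sum>j<m. a j * b j x))" using e(2) by blast
   then obtain A where A: "!!k. k < n ==> AE x in M. e k x = (\<Sum>j<m. A k j * b j x)" by metis
   have *: "AE x in M. \<forall>k\<in>{..<n}. e k x = (\<Sum>j<m. A k j * b j x)"
    by (subst AE_finite_all) (use A in auto)
   have lin: "t * bm - t * (\<Sum>j<m. S j * y j) = (\<Sum>j<m. (- t * S j) * y j) + t * bm" for t bm :: real and S y
    by (simp add: sum_distrib_left sum_negf mult.assoc)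
   from * have "AE x in M. (1 / g) * r x = (\<Sum>j<Suc m. (%j. if j = m then 1 / g else - (1 / g) * (\<Sum>k<n. c k * A k j)) j * b j x)"
   proof eventually_elim
    case (elim x)
    have "(\<Sum>k<n. c k * e k x) = (\<Sum>k<n. \<Sum>j<m. c k * A k j * b j x)"
     using elim by (intro sum.cong) (auto simp: sum_distrib_left mult.assoc)
    also have "... = (\<Sum>j<m. (\<Sum>k<n. c k * A k j) * b j x)"
     by (subst sum.swap) (simp add: sum_distrib_right)
    finally have "(1 / g) * r x = (1 / g) * b m x - (1 / g) * (\<Sum>j<m. (\<Sum>k<n. c k * A k j) * b j x)"
     by (simp add: r_def right_diff_distrib)
    also have "... = (\<Sum>j<m. (- (1 / g) * (\<Sum>k<n. c k * A k j)) * b j x) + (1 / g) * b m x"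
     by (rule lin)
    also have "... = (\<Sum>j<Suc m. (%j. if j = m then 1 / g else - (1 / g) * (\<Sum>k<n. c k * A k j)) j * b j x)"
    proof -
     have "(\<Sum>j<m. (%j. if j = m then 1 / g else - (1 / g) * (\<Sum>k<n. c k * A k j)) j * b j x) =
       (\<Sum>j<m. (- (1 / g) * (\<Sum>k<n. c k * A k j)) * b j x)" by (intro sum.cong) auto
     then show ?thesis by simp
    qed
    finally show ?case .
   qed
   then show ?thesis
    by (rule exI[where x = "%j. if j = m then 1 / g else - (1 / g) * (\<Sum>k<n. c k * A k j)"])
  qed
  have gr: "gi (%x. (1 / g) * r x) v = (1 / g) * gi r v" if "v \<in> H0" for v
   using grad_inner_lin[OF H01_W1[OF rH] H01_W1[OF rH] H01_W1[OF that], of "1 / g" 0] by simp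
  have n1: "gi (e' n) (e' n) = 1"
  proof -
   have "gi (e' n) (e' n) = (1 / g) * gi r (%x. (1 / g) * r x)"
    unfolding en(1) by (rule gr[OF H01_cmult(1)[OF rH]])
   also have "gi r (%x. (1 / g) * r x) = (1 / g) * gi r r"
    unfolding grad_inner_commute[of r "%x. (1 / g) * r x"] by (rule gr[OF rH])
   also have "gi r r = g^2" unfolding g_def by (rule grad_inner_self[OF H01_W1[OF rH]])
   finally show ?thesis using g by (simp add: power2_eq_square)
  qed
  have n0: "gi (e' n) (e k) = 0" if "k < n" for k
   unfolding en(1) using gr[OF e(1)[OF that]] orth[OF that] by simp
  have O: "gi (e' j) (e' k) = (if j = k then 1 else 0)" if jk: "j < Suc n" "k < Suc n" for j k
  proof -
   consider "j = n" "k = n" | "j = n" "k < n" | "j < n" "k = n" | "j < n" "k < n"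
    using jk unfolding less_Suc_eq by blast
   then show ?thesis
   proof cases
    case 3
    then show ?thesis using n0[of j] grad_inner_commute[of "e j" "e' n"] by (simp add: en(2))
   qed (use n1 n0 e(3) en(2) in simp_all)
  qed
  have "\<exists>c'. AE x in M. b j x = (\<Sum>k<Suc n. c' k * e' k x)" if "j < Suc m" for j
  proof (cases "j = m")
   case True
   have "b m x = (\<Sum>k<Suc n. (c(n := g)) k * e' k x)" for x
   proof -
    have "(\<Sum>k<n. (c(n := g)) k * e' k x) = (\<Sum>k<n. c k * e k x)"
     by (intro sum.cong) (auto simp: en)
    then show ?thesis using g by (simp add: en(1) r_def)
   qed
   then have "AE x in M. b j x = (\<Sum>k<Suc n. (c(n := g)) k * e' k x)" using True by simp
   then show ?thesis by (rule exI[where x = "c(n := g)"])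
  next
   case False
   then obtain c' where "AE x in M. b j x = (\<Sum>k<n. c' k * e k x)" using e(4)[of j] \<open>j < Suc m\<close> by auto
   then have "AE x in M. b j x = (\<Sum>k<Suc n. (c'(n := 0)) k * e' k x)"
   proof eventually_elim
    case (elim x)
    have "(\<Sum>k<n. (c'(n := 0)) k * e' k x) = (\<Sum>k<n. c' k * e k x)"
     by (intro sum.cong) (auto simp: en)
    then show ?case using elim by simp
   qed
   then show ?thesis by (rule exI[where x = "c'(n := 0)"])
  qed
  moreover have "\<exists>a. AE x in M. e' k x = (\<Sum>j<Suc m. a j * b j x)" if "k < Suc n" for k
  proof (cases "k = n")
   case True
   show ?thesis unfolding True en(1) by (rule rb)
  next
   case False
   then have "k < n" using that by simp
   then show ?thesis unfolding en(2)[OF \<open>k < n\<close>] by (rule ext)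
  qed
  ultimately show ?thesis using H O by (intro exI[of _ "Suc n"] exI[of _ e'] conjI allI impI) simp_all
 qed
qed

text \<open>The explicit formula matters as much as existence: the projection depends on v only
  through finitely many scalars \<open>gi v (e k)\<close>, and compactness rests on this.\<close>

lemma ritz_exists:
 assumes "fin_dim_subspace_H01 \<Omega> V"
 obtains n :: nat and e where "!!k. k < n ==> e k \<in> H0"
  "!!j k. j < n ==> k < n ==> gi (e j) (e k) = (if j = k then 1 else 0)"
  "!!v. v \<in> H0 ==> ritz_projection \<Omega> V v (%x. \<Sum>k<n. gi v (e k) * e k x)"
proof -
 obtain m b where b: "!!j. j < m ==> b j \<in> H0"
  and V: "V = {v. \<exists>a. AE x in M. v x = (\<Sum>j<(m::nat). a j * b j x)}"
  using assms unfolding fin_dim_subspace_H01_def by auto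
 obtain n e where e: "!!k. k < n ==> e k \<in> H0" "!!k. k < n ==> e k \<in> V"
   "!!j k. j < n ==> k < n ==> gi (e j) (e k) = (if j = k then 1 else 0)"
   "!!j. j < m ==> \<exists>c. AE x in M. b j x = (\<Sum>k<(n::nat). c k * e k x)"
 proof -
  from gram_schmidt[of m b] b obtain n :: nat and e where
   E: "\<forall>k<n. e k \<in> H0 \<and> (\<exists>a. AE x in M. e k x = (\<Sum>j<m. a j * b j x))"
   "\<forall>j<n. \<forall>k<n. gi (e j) (e k) = (if j = k then 1 else 0)"
   "\<forall>j<m. \<exists>c. AE x in M. b j x = (\<Sum>k<n. c k * e k x)" by blast
  then show thesis using that[of n e] unfolding V mem_Collect_eq by blast
 qed
 have rp: "ritz_projection \<Omega> V v (%x. \<Sum>k<n. gi v (e k) * e k x)" if v: "v \<in> H0" for v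
 proof -
  let ?w = "%x. \<Sum>k<n. gi v (e k) * e k x"
  have sumV: "(%x. \<Sum>k<n'. c k * e k x) \<in> V" if "n' <= n" for n' c
   using that
  proof (induction n')
   case (Suc n')
   have "(%x. 1 * (\<Sum>k<n'. c k * e k x) + c n' * e n' x) \<in> V"
    by (rule fin_dim_lin[OF assms]) (use Suc e(2) in auto)
   then show ?case by simp
  qed (simp add: fin_dim_zero[OF assms])
  have wH: "?w \<in> H0" by (rule H01_sum) (rule e(1))
  have gs: "gi (%x. \<Sum>k<n. c k * e k x) z = (\<Sum>k<n. c k * gi (e k) z)"
   if "z \<in> H0" for c z by (rule grad_inner_H01_sum[OF _ that]) (rule e(1))
  have gb: "gi (%x. \<Sum>k<m. c k * b k x) z = (\<Sum>k<m. c k * gi (b k) z)"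
   if "z \<in> H0" for c z by (rule grad_inner_H01_sum[OF _ that]) (rule b)
  have we: "gi ?w (e k) = gi v (e k)" if "k < n" for k
  proof -
   have "gi ?w (e k) = (\<Sum>j<n. if j = k then gi v (e j) else 0)"
    unfolding gs[OF e(1)[OF that]] using e(3) that by (intro sum.cong) auto
   then show ?thesis using that by simp
  qed
  have wb: "gi (b j) ?w = gi (b j) v" if j: "j < m" for j
  proof -
   obtain c where c: "AE x in M. b j x = (\<Sum>k<n. c k * e k x)" using e(4)[OF j] by blast
   have p: "gi (%x. \<Sum>k<n. c k * e k x) z = gi (b j) z" if "z \<in> H0" for z
    by (rule grad_norm_cong_AE(2)[OF b[OF j] c that])
   have q: "gi (%x. \<Sum>k<n. c k * e k x) ?w = gi (%x. \<Sum>k<n. c k * e k x) v"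
    unfolding gs[OF wH] gs[OF v]
    using we by (intro sum.cong) (auto simp: grad_inner_commute)
   show ?thesis using q unfolding p[OF wH] p[OF v] .
  qed
  have "gi ?w \<xi> = gi v \<xi>" if "\<xi> \<in> V" for \<xi>
  proof -
   obtain a where a: "AE x in M. \<xi> x = (\<Sum>j<m. a j * b j x)" using \<open>\<xi> \<in> V\<close> V by auto
   have \<xi>: "\<xi> \<in> H0" by (rule fin_dim_H01[OF assms \<open>\<xi> \<in> V\<close>])
   have p: "gi (%x. \<Sum>j<m. a j * b j x) z = gi \<xi> z" if "z \<in> H0" for z
    by (rule grad_norm_cong_AE(2)[OF \<xi> a that])
   have q: "gi (%x. \<Sum>j<m. a j * b j x) ?w = gi (%x. \<Sum>j<m. a j * b j x) v"
    unfolding gb[OF wH] gb[OF v] using wb by (intro sum.cong) auto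
   show ?thesis
    using q unfolding p[OF wH] p[OF v] grad_inner_commute[of ?w \<xi>] grad_inner_commute[of v \<xi>] .
  qed
  then show ?thesis using sumV[of n] by (auto simp: ritz_projection_def)
 qed
 show ?thesis by (rule that[of n e]) (simp_all add: e rp)
qed

text \<open>The Pythagorean identity makes the projection and its complement contractions in energy.
  That the error projects to 0 allows estimates for Ritz projections to be applied to the
  error.\<close>

lemma ritz_props:
 assumes "fin_dim_subspace_H01 \<Omega> V" "v \<in> H0" "ritz_projection \<Omega> V v w"
 shows "w \<in> V" "w \<in> H0" "!!\<xi>. \<xi> \<in> V ==> gi (%x. v x - w x) \<xi> = 0"
  "(gn v)^2 = (gn w)^2 + (gn (%x. v x - w x))^2"
  "ritz_projection \<Omega> V (%x. v x - w x) (%x. 0)"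
proof -
 show wV: "w \<in> V" using assms(3) by (simp add: ritz_projection_def)
 show wH: "w \<in> H0" by (rule fin_dim_H01[OF assms(1) wV])
 have W: "W1 v" "W1 w" using assms(2) wH H01_W1 by auto
 show z: "gi (%x. v x - w x) \<xi> = 0" if "\<xi> \<in> V" for \<xi>
  using assms(3) that grad_inner_diff[OF W H01_W1[OF fin_dim_H01[OF assms(1) that]]]
  by (simp add: ritz_projection_def)
 have Wd: "W1 (%x. v x - w x)" by (rule W1_diff(1)[OF W])
 show "(gn v)^2 = (gn w)^2 + (gn (%x. v x - w x))^2"
  using grad_norm_add_sq[OF W(2) Wd] z[OF wV] by (simp add: grad_inner_commute)
 show "ritz_projection \<Omega> V (%x. v x - w x) (%x. 0)"
  unfolding ritz_projection_def
  using z fin_dim_zero[OF assms(1)] grad_inner_zero H01_W1 fin_dim_H01[OF assms(1)] by auto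
qed

end

section \<open>Ritz estimates, compactness and the first eigenvalue\<close>

locale galerkin_family = bounded_domain \<Omega> for \<Omega> :: "(real ^ 'n::finite) set" +
 fixes H :: "real set" and V :: "real => (real ^ 'n => real) set"
 assumes H_pos: "h \<in> H ==> 0 < h"
  and fd: "h \<in> H ==> fin_dim_subspace_H01 \<Omega> (V h)"
  and approx: "approximation_property \<Omega> H V"
begin

text \<open>The Ritz projection of the error vanishes, so the case \<open>s = 1\<close> of the approximation property,
 applied to the error itself, bounds its \<open>L^2\<close> norm by \<open>h\<close> times its energy norm.\<close>

lemma ritz_L2:
 obtains c where "c > 0"
  "!!h v w. h \<in> H ==> v \<in> H0 ==> ritz_projection \<Omega> (V h) v w ==>
    nrm M (%x. v x - w x) <= c * h * gn (%x. v x - w x)"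
proof -
 obtain r :: nat and c where r: "r \<ge> 2" and c: "\<forall>h\<in>H. (\<forall>s\<in>{1..r}. \<forall>v\<in>sobolev \<Omega> s \<inter> H0. \<forall>w.
   ritz_projection \<Omega> (V h) v w --> scaled_error \<Omega> h w v <= c * h ^ s * sobolev_norm \<Omega> s v)"
  using approx unfolding approximation_property_def by blast
 obtain P where P: "P > 0" "!!u. u \<in> H0 ==> nrm M u <= P * gn u" using poincare by blast
 define c' where "c' = (\<bar>c\<bar> + 1) * (P + real CARD('n))"
 show thesis
 proof (rule that[of c'])
  show "c' > 0" using P by (simp add: c'_def add_pos_pos)
  fix h v w assume h: "h \<in> H" and v: "v \<in> H0" and w: "ritz_projection \<Omega> (V h) v w"
  define e where "e x = v x - w x" for x
  note R = ritz_props[OF fd[OF h] v w]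
  have e: "e \<in> H0" unfolding e_def by (rule H01_diff(1)[OF v R(2)])
  have W: "W1 e" by (rule H01_W1[OF e])
  have rz: "ritz_projection \<Omega> (V h) e (%x. 0)" using R(5) by (simp add: e_def[abs_def])
  have "e \<in> sobolev \<Omega> 1" using W by (simp only: sobolev_1_iff)
  then have "scaled_error \<Omega> h (%x. 0) e <= c * h ^ 1 * sobolev_norm \<Omega> 1 e"
   using c h rz e r by (meson IntI atLeastAtMost_iff one_le_numeral order_trans order_refl)
  moreover have "nrm M e <= scaled_error \<Omega> h (%x. 0) e"
  proof -
   have s: "sqint M (%x. 0 - e x)" by (intro sqint_diff sqint_zero H01_sqint(1)[OF e])
   have "Lp_norm \<Omega> 2 (%x. 0 - e x) = nrm M e"
    unfolding Lp_norm_nrm[OF s] by (simp add: nrm_def)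
   moreover have "0 <= h * gn (%x. 0 - e x)"
    by (intro mult_nonneg_nonneg grad_norm_nonneg H01_W1 H01_diff(1) H01_zero e) (use H_pos[OF h] in simp)
   ultimately show ?thesis unfolding scaled_error_def by linarith
  qed
  moreover have "c * h ^ 1 * sobolev_norm \<Omega> 1 e <= c' * h * gn e"
  proof -
   have "sobolev_norm \<Omega> 1 e <= nrm M e + (\<Sum>i\<in>UNIV. nrm M (D i e))" by (rule sobolev_norm_1_bounds(3)[OF W])
   also have "... <= P * gn e + (\<Sum>i\<in>(UNIV::'n set). gn e)"
    by (intro add_mono P(2)[OF e] sum_mono nrm_D_le[OF W])
   also have "... = (P + real CARD('n)) * gn e" by (simp add: distrib_right)
   finally have le: "sobolev_norm \<Omega> 1 e <= (P + real CARD('n)) * gn e" .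
   have s0: "0 <= sobolev_norm \<Omega> 1 e" using sobolev_norm_1_bounds(1)[OF W] nrm_nonneg[of M e] by linarith
   have "c * h ^ 1 * sobolev_norm \<Omega> 1 e <= ((\<bar>c\<bar> + 1) * h) * sobolev_norm \<Omega> 1 e"
    using H_pos[OF h] s0 by (intro mult_right_mono) auto
   also have "... <= ((\<bar>c\<bar> + 1) * h) * ((P + real CARD('n)) * gn e)"
    using H_pos[OF h] by (intro mult_left_mono le) auto
   finally show ?thesis by (simp add: c'_def mult_ac)
  qed
  ultimately show "nrm M (%x. v x - w x) <= c' * h * gn (%x. v x - w x)"
   by (simp add: e_def[abs_def])
 qed
qed

text \<open>Duality against the right-hand side \<open>g\<close> replaces elliptic regularity.\<close>

lemma ritz_grad:
 obtains c where "c > 0"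
  "!!h v w g. h \<in> H ==> v \<in> H0 ==> ritz_projection \<Omega> (V h) v w ==> sqint M g ==>
    (!!\<xi>. \<xi> \<in> H0 ==> gi v \<xi> = L2_inner \<Omega> g \<xi>) ==>
    gn (%x. v x - w x) <= c * h * nrm M g"
proof -
 obtain c where c: "c > 0" "!!h v w. h \<in> H ==> v \<in> H0 ==> ritz_projection \<Omega> (V h) v w ==>
    nrm M (%x. v x - w x) <= c * h * gn (%x. v x - w x)"
  using ritz_L2 by blast
 show thesis
 proof (rule that[OF c(1)])
  fix h v w g
  assume h: "h \<in> H" and v: "v \<in> H0" and w: "ritz_projection \<Omega> (V h) v w" and g: "sqint M g"
   and vg: "!!\<xi>. \<xi> \<in> H0 ==> gi v \<xi> = L2_inner \<Omega> g \<xi>"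
  note R = ritz_props[OF fd[OF h] v w]
  let ?e = "%x. v x - w x"
  have e: "?e \<in> H0" by (rule H01_diff(1)[OF v R(2)])
  have W: "W1 v" "W1 w" "W1 ?e" using v R(2) e H01_W1 by auto
  have "(gn ?e)^2 = gi v ?e - gi w ?e"
   using grad_inner_self[OF W(3)] grad_inner_diff[OF W(1,2,3)] by simp
  also have "gi w ?e = 0" using R(3)[OF R(1)] grad_inner_commute[of w ?e] by simp
  also have "gi v ?e = L2_inner \<Omega> g ?e" by (rule vg[OF e])
  also have "L2_inner \<Omega> g ?e <= nrm M g * nrm M ?e" using L2_inner_le[OF g H01_sqint(1)[OF e]] by linarith
  also have "... <= nrm M g * (c * h * gn ?e)" by (intro mult_left_mono c(2)[OF h v w]) auto
  finally have "gn ?e * gn ?e <= (c * h * nrm M g) * gn ?e"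
   by (simp add: power2_eq_square mult_ac)
  moreover have "0 <= c * h * nrm M g" using c(1) H_pos[OF h] by simp
  ultimately show "gn ?e <= c * h * nrm M g"
   using grad_norm_nonneg[OF W(3)] by (cases "gn ?e = 0") (auto simp: mult_le_cancel_right)
 qed
qed

text \<open>Rellich's theorem from approximation. Along a diagonal subsequence all Ritz coefficients
  in all spaces \<open>V (hs j)\<close> converge. For a fixed fine j the projections then form a
  Cauchy sequence, and what they miss has L^2 norm at most \<open>c * hs j * (2 * B)\<close> for
  every difference of two members.\<close>

lemma compactness:
 assumes hs: "!!j. hs j \<in> H" "hs ----> 0"
  and v: "!!m. v m \<in> H0" "!!m. gn (v m) <= B"
 shows "\<exists>r::nat=>nat. \<exists>w. strict_mono r \<and> L2lim M (%m. v (r m)) w"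
proof -
 obtain P where P: "P > 0" "!!u. u \<in> H0 ==> nrm M u <= P * gn u" using poincare by blast
 obtain c where c: "c > 0" "!!h v w. h \<in> H ==> v \<in> H0 ==> ritz_projection \<Omega> (V h) v w ==>
    nrm M (%x. v x - w x) <= c * h * gn (%x. v x - w x)"
  using ritz_L2 by blast
 have "\<exists>ne. (\<forall>k<fst ne. snd ne k \<in> H0) \<and>
   (\<forall>i<fst ne. \<forall>k<fst ne. gi (snd ne i) (snd ne k) = (if i = k then 1 else 0)) \<and>
   (\<forall>v\<in>H0. ritz_projection \<Omega> (V (hs j)) v (%x. \<Sum>k<(fst ne :: nat). gi v (snd ne k) * snd ne k x))" for j
 proof -
  obtain n :: nat and e where "!!k. k < n ==> e k \<in> H0"
   "!!j k. j < n ==> k < n ==> gi (e j) (e k) = (if j = k then 1 else 0)"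
   "!!v. v \<in> H0 ==> ritz_projection \<Omega> (V (hs j)) v (%x. \<Sum>k<n. gi v (e k) * e k x)"
   by (rule ritz_exists[OF fd[OF hs(1)[of j]]]) blast
  then show ?thesis by (intro exI[of _ "(n, e)"]) simp
 qed
 then have "\<exists>ne. \<forall>j. (\<forall>k<fst (ne j). snd (ne j) k \<in> H0) \<and>
   (\<forall>i<fst (ne j). \<forall>k<fst (ne j). gi (snd (ne j) i) (snd (ne j) k) = (if i = k then 1 else 0)) \<and>
   (\<forall>v\<in>H0. ritz_projection \<Omega> (V (hs j)) v (%x. \<Sum>k<(fst (ne j) :: nat). gi v (snd (ne j) k) * snd (ne j) k x))"
  by (intro choice allI)
 then obtain ne where ne: "\<forall>j. (\<forall>k<fst (ne j). snd (ne j) k \<in> H0) \<and>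
   (\<forall>i<fst (ne j). \<forall>k<fst (ne j). gi (snd (ne j) i) (snd (ne j) k) = (if i = k then 1 else 0)) \<and>
   (\<forall>v\<in>H0. ritz_projection \<Omega> (V (hs j)) v (%x. \<Sum>k<(fst (ne j) :: nat). gi v (snd (ne j) k) * snd (ne j) k x))" ..
 define n where "n j = fst (ne j)" for j
 define e where "e j = snd (ne j)" for j
 have e: "k < n j ==> e j k \<in> H0"
   "i < n j ==> k < n j ==> gi (e j i) (e j k) = (if i = k then 1 else 0)"
   "z \<in> H0 ==> ritz_projection \<Omega> (V (hs j)) z (%x. \<Sum>k<n j. gi z (e j k) * e j k x)" for i j k z
  using ne by (simp_all add: n_def e_def)
 define S where "S = {(j, k). k < n j}"
 have e1: "gn (e j k) = 1" if "k < n j" for j k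
 proof -
  have "(gn (e j k))^2 = 1" using e(2)[OF that that] grad_inner_self[OF H01_W1[OF e(1)[OF that]]] by simp
  then show ?thesis using grad_norm_nonneg[OF H01_W1[OF e(1)[OF that]]] by (simp add: power2_eq_1_iff)
 qed
 have bnd: "norm (gi (v m) (e (fst p) (snd p))) <= B" if "p \<in> S" for m p
 proof -
  have p: "snd p < n (fst p)" using that by (auto simp: S_def)
  show ?thesis using grad_cauchy_schwarz[OF H01_W1[OF v(1)[of m]] H01_W1[OF e(1)[OF p]]] e1[OF p] v(2)[of m] by simp
 qed
 \<comment> \<open>Cantor's diagonal argument over the countable set of pairs (space, basis
   vector).\<close>
 obtain r :: "nat => nat" where r: "strict_mono r"
  and conv: "!!p. p \<in> S ==> \<exists>l. (%m. gi (v (r m)) (e (fst p) (snd p))) ----> l"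
  by (rule function_convergent_subsequence[of S "%m p. gi (v m) (e (fst p) (snd p))" B])
    (use bnd in \<open>auto intro: countableI_type\<close>)
 define a where "a m = v (r m)" for m
 have a: "a m \<in> H0" "gn (a m) <= B" for m using v by (auto simp: a_def)
 have B0: "0 <= B" using v(2)[of 0] grad_norm_nonneg[OF H01_W1[OF v(1)[of 0]]] by linarith
 have "\<exists>w. L2lim M a w"
 proof (rule riesz_fischer)
  show "sqint M (a m)" for m by (rule H01_sqint(1)[OF a(1)])
  fix eps :: real assume eps: "eps > 0"
  have "(%j. c * hs j * (2 * B)) ----> c * 0 * (2 * B)" by (intro tendsto_intros hs(2))
  then have "\<forall>\<^sub>F j in sequentially. c * hs j * (2 * B) < eps / 2"
   using eps by (intro order_tendstoD(2)) auto
  then obtain j where j: "c * hs j * (2 * B) < eps / 2" by (auto dest: eventually_happens)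
  define q where "q k m = gi (a m) (e j k)" for k m
  have "Cauchy (q k)" if "k < n j" for k
  proof -
   have "(j, k) \<in> S" using that by (simp add: S_def)
   from conv[OF this] show ?thesis
    unfolding q_def a_def by (auto simp: convergent_def intro!: convergent_Cauchy)
  qed
  then have "\<forall>\<^sub>F N in sequentially. \<forall>k\<in>{..<n j}. \<forall>m\<ge>N. \<forall>l\<ge>N. \<bar>q k m - q k l\<bar> < eps / (2 * P * (real (n j) + 1))"
  proof (intro eventually_ball_finite ballI)
   fix k assume "!!k. k < n j ==> Cauchy (q k)" "k \<in> {..<n j}"
   then have "Cauchy (q k)" by simp
   then obtain N where N: "\<forall>m\<ge>N. \<forall>l\<ge>N. norm (q k m - q k l) < eps / (2 * P * (real (n j) + 1))"
    using CauchyD[of "q k" "eps / (2 * P * (real (n j) + 1))"] eps P(1) by auto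
   show "\<forall>\<^sub>F N in sequentially. \<forall>m\<ge>N. \<forall>l\<ge>N. \<bar>q k m - q k l\<bar> < eps / (2 * P * (real (n j) + 1))"
    unfolding eventually_sequentially by (rule exI[of _ N]) (use N in auto)
  qed simp
  then obtain N where "\<forall>k\<in>{..<n j}. \<forall>m\<ge>N. \<forall>l\<ge>N. \<bar>q k m - q k l\<bar> < eps / (2 * P * (real (n j) + 1))"
   unfolding eventually_sequentially by blast
  then have N: "!!k m l. k < n j ==> m \<ge> N ==> l \<ge> N ==> \<bar>q k m - q k l\<bar> < eps / (2 * P * (real (n j) + 1))"
   by simp
  show "\<exists>N. \<forall>m\<ge>N. \<forall>l\<ge>N. nrm M (%x. a m x - a l x) < eps"
  proof (intro exI[of _ N] allI impI)
   fix m l assume ml: "N <= m" "N <= l"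
   define z where "z x = a m x - a l x" for x
   define y where "y x = (\<Sum>k<n j. gi z (e j k) * e j k x)" for x
   have z: "z \<in> H0" unfolding z_def by (rule H01_diff(1)[OF a(1) a(1)])
   have yr: "ritz_projection \<Omega> (V (hs j)) z y" unfolding y_def by (rule e(3)[OF z])
   note R = ritz_props[OF fd[OF hs(1)] z yr]
   have zW: "W1 z" by (rule H01_W1[OF z])
   have zB: "gn z <= 2 * B"
    using grad_norm_triangle_diff[OF H01_W1[OF a(1)[of m]] H01_W1[OF a(1)[of l]]] a(2)[of m] a(2)[of l]
    unfolding z_def by linarith
   have ez: "gi z (e j k) = q k m - q k l" if "k < n j" for k
    unfolding z_def q_def by (rule grad_inner_diff[OF H01_W1[OF a(1)] H01_W1[OF a(1)] H01_W1[OF e(1)[OF that]]])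
   have W: "W1 (%x. z x - y x)" by (rule H01_W1[OF H01_diff(1)[OF z R(2)]])
   have zy: "gn (%x. z x - y x) <= 2 * B"
   proof (rule power2_le_imp_le)
    have "(gn (%x. z x - y x))^2 <= (gn z)^2" using R(4) by simp
    also have "... <= (2 * B)^2" by (intro power_mono zB grad_norm_nonneg zW)
    finally show "(gn (%x. z x - y x))^2 <= (2 * B)^2" .
   qed (use B0 in simp)
   have "nrm M (%x. z x - y x) <= c * hs j * gn (%x. z x - y x)" by (rule c(2)[OF hs(1) z yr])
   also have "... <= c * hs j * (2 * B)" using c(1) H_pos[OF hs(1)[of j]] by (intro mult_left_mono zy) auto
   finally have n1: "nrm M (%x. z x - y x) < eps / 2" using j by linarith
   have "nrm M y <= (\<Sum>k<n j. nrm M (%x. gi z (e j k) * e j k x))"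
    unfolding y_def by (rule nrm_sum_le) (auto intro!: sqint_cmult H01_sqint(1)[OF e(1)])
   also have "... <= (\<Sum>k<n j. eps / (2 * P * (real (n j) + 1)) * P)"
   proof (rule sum_mono)
    fix k assume "k \<in> {..<n j}"
    then have k: "k < n j" by simp
    have "nrm M (e j k) <= P" using P(2)[OF e(1)[OF k]] e1[OF k] by simp
    then show "nrm M (%x. gi z (e j k) * e j k x) <= eps / (2 * P * (real (n j) + 1)) * P"
     unfolding nrm_cmult ez[OF k] using N[OF k ml] by (intro mult_mono) auto
   qed
   also have "... = real (n j) * (eps / (2 * (real (n j) + 1)))" using P(1) by simp
   also have "... < eps / 2"
    using eps by (simp add: field_simps add_nonneg_pos)
   finally have n2: "nrm M y < eps / 2" .
   have "nrm M z <= nrm M y + nrm M (%x. z x - y x)"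
    by (rule nrm_le_diff[OF H01_sqint(1)[OF z] H01_sqint(1)[OF R(2)]])
   then show "nrm M (%x. a m x - a l x) < eps" using n1 n2 unfolding z_def by linarith
  qed
 qed
 then show ?thesis using r by (auto simp: a_def[abs_def])
qed

text \<open>A general v in \<open>H0\<close> admits no rate. Test functions have one, since their
  Laplacian is square integrable, and it transfers by density because the Ritz error does not exceed
  the function in energy.\<close>

lemma ritz_converges:
 assumes hs: "!!j. hs j \<in> H" "hs ----> 0" and v: "v \<in> H0"
  and w: "!!j. ritz_projection \<Omega> (V (hs j)) v (w j)"
 shows "(%j. gn (%x. v x - w j x)) ----> 0"
proof (rule LIMSEQ_I)
 fix eps :: real assume eps: "0 < eps"
 obtain c where c: "c > 0" "!!h v w g. h \<in> H ==> v \<in> H0 ==> ritz_projection \<Omega> (V h) v w ==> sqint M g ==>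
    (!!\<xi>. \<xi> \<in> H0 ==> gi v \<xi> = L2_inner \<Omega> g \<xi>) ==>
    gn (%x. v x - w x) <= c * h * nrm M g"
  using ritz_grad by blast
 obtain \<phi> where \<phi>: "\<phi> \<in> test_functions \<Omega>" "gn (%x. v x - \<phi> x) < eps / 2"
  using H01_test_dense[OF v, of "eps / 2"] eps by auto
 have \<phi>H: "\<phi> \<in> H0" by (rule H01_test[OF \<phi>(1)])
 \<comment> \<open>Minus the Laplacian of \<phi>, the right-hand side for which
   \<open>ritz_grad\<close> is applied.\<close>
 define g where "g x = (\<Sum>i\<in>UNIV. - 1 * pd i (pd i \<phi>) x)" for x
 have g: "sqint M g" unfolding g_def by (intro sqint_sum sqint_cmult test_sqint test_pd \<phi>)
 have gi: "gi \<phi> \<xi> = L2_inner \<Omega> g \<xi>" if \<xi>: "\<xi> \<in> H0" for \<xi>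
 proof -
  have i: "integrable M (%x. \<xi> x * pd i (pd i \<phi>) x)" for i
   by (intro sqint_mult_integrable H01_sqint(1)[OF \<xi>] test_sqint test_pd \<phi>)
  have "L2_inner \<Omega> g \<xi> = (LINT x|M. (\<Sum>i\<in>UNIV. - (\<xi> x * pd i (pd i \<phi>) x)))"
   unfolding L2_inner_def g_def
   by (intro Bochner_Integration.integral_cong refl) (simp add: sum_distrib_left sum_negf mult.commute)
  also have "... = (\<Sum>i\<in>UNIV. (LINT x|M. - (\<xi> x * pd i (pd i \<phi>) x)))"
   by (intro Bochner_Integration.integral_sum integrable_minus i)
  also have "... = gi \<xi> \<phi>" unfolding grad_inner_test[OF \<xi> \<phi>(1)] by (simp add: sum_negf)
  finally show ?thesis by (simp add: grad_inner_commute)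
 qed
 have "(%j. c * hs j * nrm M g) ----> c * 0 * nrm M g" by (intro tendsto_intros hs(2))
 then have "\<forall>\<^sub>F j in sequentially. c * hs j * nrm M g < eps / 2" using eps by (intro order_tendstoD(2)) auto
 then obtain N where N: "!!j. j \<ge> N ==> c * hs j * nrm M g < eps / 2" by (auto simp: eventually_sequentially)
 show "\<exists>no. \<forall>j\<ge>no. norm (gn (%x. v x - w j x) - 0) < eps"
 proof (intro exI[of _ N] allI impI)
  fix j assume j: "N <= j"
  obtain n :: nat and e where "!!z. z \<in> H0 ==> ritz_projection \<Omega> (V (hs j)) z (%x. \<Sum>k<n. gi z (e k) * e k x)"
   by (rule ritz_exists[OF fd[OF hs(1)[of j]]]) blast
  then obtain y where y: "ritz_projection \<Omega> (V (hs j)) \<phi> y" using \<phi>H by blast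
  note R = ritz_props[OF fd[OF hs(1)] v w[of j]] and Y = ritz_props[OF fd[OF hs(1)] \<phi>H y]
  define d where "d x = v x - \<phi> x" for x
  have d: "d \<in> H0" unfolding d_def by (rule H01_diff(1)[OF v \<phi>H])
  have dr: "ritz_projection \<Omega> (V (hs j)) d (%x. w j x - y x)"
   unfolding ritz_projection_def
  proof (intro conjI ballI)
   show "(%x. w j x - y x) \<in> V (hs j)" by (rule fin_dim_diff[OF fd[OF hs(1)] R(1) Y(1)])
   fix \<xi> assume \<xi>: "\<xi> \<in> V (hs j)"
   have W: "W1 \<xi>" "W1 (w j)" "W1 y" "W1 v" "W1 \<phi>"
    using H01_W1 fin_dim_H01[OF fd[OF hs(1)] \<xi>] R(2) Y(2) v \<phi>H by auto
   show "gi (%x. w j x - y x) \<xi> = gi d \<xi>"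
    unfolding d_def grad_inner_diff[OF W(2,3,1)] grad_inner_diff[OF W(4,5,1)]
    using w[of j] y \<xi> by (simp add: ritz_projection_def)
  qed
  note DR = ritz_props[OF fd[OF hs(1)] d dr]
  have W: "W1 (%x. d x - (w j x - y x))" "W1 (%x. \<phi> x - y x)" "W1 (%x. v x - w j x)"
   by (auto intro!: H01_W1 H01_diff(1) d R(2) Y(2) \<phi>H v)
  have "gn (%x. d x - (w j x - y x)) <= gn d"
   using DR(4) grad_norm_nonneg[OF H01_W1[OF d]] by - (rule power2_le_imp_le, simp_all)
  moreover have "gn (%x. \<phi> x - y x) < eps / 2"
   using c(2)[OF hs(1) \<phi>H y g gi] N[OF j] by linarith
  moreover have "gn (%x. (d x - (w j x - y x)) + (\<phi> x - y x)) <=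
    gn (%x. d x - (w j x - y x)) + gn (%x. \<phi> x - y x)"
   by (rule grad_norm_triangle[OF W(1,2)])
  moreover have "(%x. (d x - (w j x - y x)) + (\<phi> x - y x)) = (%x. v x - w j x)" by (auto simp: d_def)
  ultimately show "norm (gn (%x. v x - w j x) - 0) < eps"
   using \<phi>(2) grad_norm_nonneg[OF W(3)] by (simp add: d_def[abs_def])
 qed
qed

text \<open>By definition lam lies below all eigenvalues, so the infimum \<mu> of the Rayleigh
  quotient has to be shown to be one. A minimising sequence converges in L^2 by
  \<open>compactness\<close>, its limit attains \<mu>, and stationarity in every direction is the
  eigenvalue equation.\<close>

lemma sharp_poincare:
 assumes hs: "!!j. hs j \<in> H" "hs ----> 0" and lam: "first_dirichlet_eigenvalue \<Omega> lam" and v: "v \<in> H0"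
 shows "lam * (nrm M v)^2 <= (gn v)^2"
proof (cases "nrm M v = 0")
 case False
 define A where "A = (%u. (gn u)^2) ` {u \<in> H0. nrm M u = 1}"
 define \<mu> where "\<mu> = Inf A"
 have scale: "(%x. (1 / nrm M u) * u x) \<in> {u \<in> H0. nrm M u = 1}"
   "(gn (%x. (1 / nrm M u) * u x))^2 = (gn u)^2 / (nrm M u)^2"
  if "u \<in> H0" "nrm M u ~= 0" for u
 proof -
  have "nrm M (%x. (1 / nrm M u) * u x) = 1" unfolding nrm_cmult using that(2) by simp
  then show "(%x. (1 / nrm M u) * u x) \<in> {u \<in> H0. nrm M u = 1}" using H01_cmult(1)[OF that(1)] by blast
  show "(gn (%x. (1 / nrm M u) * u x))^2 = (gn u)^2 / (nrm M u)^2"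
   unfolding grad_norm_cmult[OF H01_W1[OF that(1)]] by (simp add: power_divide power_mult_distrib)
 qed
 have bb: "bdd_below A" unfolding A_def by (rule bdd_belowI[of _ 0]) auto
 have ne: "A ~= {}" unfolding A_def using scale(1)[OF v False] by blast
 have \<mu>: "\<mu> * (nrm M u)^2 <= (gn u)^2" if "u \<in> H0" for u
 proof (cases "nrm M u = 0")
  case False
  have "\<mu> <= (gn u)^2 / (nrm M u)^2"
   unfolding \<mu>_def scale(2)[OF that False, symmetric]
   by (rule cInf_lower[OF _ bb]) (use scale(1)[OF that False] in \<open>auto simp: A_def\<close>)
  then show ?thesis using False by (simp add: pos_le_divide_eq)
 qed simp
 have "\<exists>u. u \<in> H0 \<and> nrm M u = 1 \<and> (gn u)^2 < \<mu> + 1 / Suc m" for m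
 proof -
  have "Inf A < \<mu> + 1 / Suc m" by (simp add: \<mu>_def)
  then show ?thesis using cInf_lessD[OF ne] by (auto simp: A_def)
 qed
 then have "\<exists>u. \<forall>m. u m \<in> H0 \<and> nrm M (u m) = 1 \<and> (gn (u m))^2 < \<mu> + 1 / Suc m"
  by (intro choice allI)
 then obtain u where u: "!!m. u m \<in> H0" "!!m. nrm M (u m) = 1" "!!m. (gn (u m))^2 < \<mu> + 1 / Suc m"
  by blast
 have \<mu>0: "0 <= \<mu>" unfolding \<mu>_def by (rule cInf_greatest[OF ne]) (auto simp: A_def)
 have B: "gn (u m) <= sqrt (\<mu> + 1 / Suc m)" for m
  using u(3)[of m] by (intro real_le_rsqrt) simp
 have B': "gn (u m) <= sqrt (\<mu> + 1)" for m
  using B[of m] by (rule order_trans) (simp add: field_simps)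
 obtain r :: "nat => nat" and w where r: "strict_mono r" and w: "L2lim M (%m. u (r m)) w"
  using compactness[of hs u "sqrt (\<mu> + 1)", OF hs u(1) B'] by blast
 have wH: "w \<in> H0" by (rule weak_closed[of "%m. u (r m)", OF u(1) B' w])
 have w1: "nrm M w = 1"
  using L2lim_nrm[OF w] u(2) by (simp add: LIMSEQ_const_iff)
 \<comment> \<open>Weak lower semicontinuity of the norm, obtained by pairing the sequence with its
   own limit.\<close>
 have "(gn w)^2 <= sqrt \<mu> * gn w"
 proof (rule LIMSEQ_le)
  show "(%m. gi (u (r m)) w) ----> (gn w)^2"
   using weak_grad_conv[of "%m. u (r m)", OF u(1) B' w wH] grad_inner_self[OF H01_W1[OF wH]] by simp
  have "(%m. sqrt (\<mu> + 1 / real (Suc m)) * gn w) ----> sqrt (\<mu> + 0) * gn w"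
   using LIMSEQ_inverse_real_of_nat by (intro tendsto_intros) (simp add: inverse_eq_divide)
  then have l: "(%m. sqrt (\<mu> + 1 / real (Suc m)) * gn w) ----> sqrt \<mu> * gn w" by simp
  show "(%m. sqrt (\<mu> + 1 / real (Suc (r m))) * gn w) ----> sqrt \<mu> * gn w"
   using LIMSEQ_subseq_LIMSEQ[OF l r] by (simp add: o_def)
  show "\<exists>N. \<forall>m\<ge>N. gi (u (r m)) w <= sqrt (\<mu> + 1 / real (Suc (r m))) * gn w"
  proof (intro exI allI impI)
   fix m
   have "gi (u (r m)) w <= gn (u (r m)) * gn w"
    using grad_cauchy_schwarz[OF H01_W1[OF u(1)] H01_W1[OF wH], of "r m"] by linarith
   also have "... <= sqrt (\<mu> + 1 / real (Suc (r m))) * gn w"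
    by (intro mult_right_mono B grad_norm_nonneg H01_W1 wH)
   finally show "gi (u (r m)) w <= sqrt (\<mu> + 1 / real (Suc (r m))) * gn w" .
  qed
 qed
 then have "gn w <= sqrt \<mu>"
  using grad_norm_nonneg[OF H01_W1[OF wH]] \<mu>0
  by (cases "gn w = 0") (auto simp: power2_eq_square mult_le_cancel_right)
 then have "(gn w)^2 <= (sqrt \<mu>)^2" by (intro power_mono grad_norm_nonneg H01_W1 wH)
 then have gw: "(gn w)^2 = \<mu>" using \<mu>[OF wH] w1 \<mu>0 by simp
 have "gi w z = \<mu> * L2_inner \<Omega> w z" if z: "z \<in> H0" for z
 proof -
  have "gi w z - \<mu> * L2_inner \<Omega> w z = 0"
  proof (rule quadratic_nonneg_imp_linear_zero)
   fix t :: real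
   have tz: "(%x. t * z x) \<in> H0" by (rule H01_cmult(1)[OF z])
   have g1: "gi w (%x. t * z x) = t * gi w z"
    using grad_inner_lin_right[OF H01_W1[OF z] H01_W1[OF z] H01_W1[OF wH], of t 0] by simp
   have g2: "(LINT x|M. w x * (t * z x)) = t * L2_inner \<Omega> w z"
    by (simp add: L2_inner_def mult.left_commute)
   have "\<mu> * (nrm M (%x. w x + t * z x))^2 <= (gn (%x. w x + t * z x))^2"
    by (rule \<mu>[OF H01_add(1)[OF wH tz]])
   then have "\<mu> * (1 + 2 * (t * L2_inner \<Omega> w z) + t^2 * (nrm M z)^2) <=
     \<mu> + 2 * (t * gi w z) + t^2 * (gn z)^2"
    unfolding nrm_add_sq[OF H01_sqint(1)[OF wH] H01_sqint(1)[OF tz]]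
     grad_norm_add_sq[OF H01_W1[OF wH] H01_W1[OF tz]] g1 g2 nrm_cmult grad_norm_cmult[OF H01_W1[OF z]] gw w1
    by (simp add: power_mult_distrib)
   then show "0 <= 2 * t * (gi w z - \<mu> * L2_inner \<Omega> w z) + t^2 * ((gn z)^2 - \<mu> * (nrm M z)^2)"
    by (simp add: algebra_simps)
  qed
  then show ?thesis by simp
 qed
 moreover have "\<not> (AE x in M. w x = 0)" using nrm_AE_zero[OF H01_sqint(1)[OF wH]] w1 by auto
 ultimately have "dirichlet_eigenvalue \<Omega> \<mu>" unfolding dirichlet_eigenvalue_def using wH by blast
 then have "lam <= \<mu>" using lam by (simp add: first_dirichlet_eigenvalue_def)
 then have "lam * (nrm M v)^2 <= \<mu> * (nrm M v)^2" by (rule mult_right_mono) simp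
 then show ?thesis using \<mu>[OF v] by linarith
qed simp

end

section \<open>Pointwise inequalities for the nonlinearities\<close>

lemma DERIV_mult_abs_powr:
 fixes q :: real
 assumes q: "q > 0"
 shows "((%s. s * \<bar>s\<bar> powr q) has_real_derivative (q + 1) * \<bar>s\<bar> powr q) (at s)"
proof -
 consider "s > 0" | "s < 0" | "s = 0" by linarith
 then show ?thesis
 proof cases
  case 1
  have "((%s. s * s powr q) has_real_derivative (q + 1) * s powr q) (at s)"
   using 1 by (auto intro!: derivative_eq_intros simp: powr_diff field_simps)
  then show ?thesis
   by (rule DERIV_cong_ev[THEN iffD1, OF refl _ _, rotated 2])
     (use 1 eventually_nhds_in_open[of "{0<..}" s] in \<open>auto elim: eventually_mono\<close>)
 next
  case 2
  have "((%s. s * (- s) powr q) has_real_derivative (q + 1) * (- s) powr q) (at s)"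
   using 2 by (auto intro!: derivative_eq_intros simp: powr_diff field_simps)
  then show ?thesis
   by (rule DERIV_cong_ev[THEN iffD1, OF refl _ _, rotated 2])
     (use 2 eventually_nhds_in_open[of "{..<0}" s] in \<open>auto elim: eventually_mono\<close>)
 next
  case 3
  have "((%h. \<bar>h\<bar> powr q) \<longlongrightarrow> \<bar>0\<bar> powr q) (at (0::real))"
   using q by (intro tendsto_powr' tendsto_intros) auto
  then have "((%h. ((0 + h) * \<bar>0 + h\<bar> powr q - 0 * \<bar>0\<bar> powr q) / h) \<longlongrightarrow> 0) (at (0::real))"
   by (rule Lim_transform_eventually[THEN tendsto_eq_rhs])
     (auto simp: eventually_at_filter)
  then show ?thesis using 3 q by (simp add: DERIV_def)
 qed
qed

lemma continuous_abs_powr: "q > 0 ==> continuous_on UNIV (%s::real. \<bar>s\<bar> powr q)"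
 by (intro continuous_on_powr' continuous_intros) auto

lemma abs_powr_mono: "\<bar>a\<bar> <= \<bar>b\<bar> ==> 0 <= q ==> \<bar>a\<bar> powr q <= \<bar>b::real\<bar> powr q"
 by (rule powr_mono2) auto

lemma abs_powr_max: "0 <= q ==> (max \<bar>a\<bar> \<bar>b\<bar>) powr q <= \<bar>a\<bar> powr q + \<bar>b::real\<bar> powr q"
 by (cases "\<bar>a\<bar> <= \<bar>b\<bar>") (auto simp: max_def)

lemma powr_Suc_mult: "0 <= x ==> x powr q * x = x powr (q + 1)" for x :: real
 by (cases "x = 0") (auto simp: powr_add)

lemma powr_two_mult: "x powr q * x^2 = x powr (q + 2)" if "0 <= x" for x :: real
 using that by (cases "x = 0") (auto simp: powr_add powr_numeral)

lemma DERIV_bound_diff: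
 fixes f f' :: "real => real"
 assumes "!!s. (f has_real_derivative f' s) (at s)" "!!s. \<bar>f' s\<bar> <= C * \<bar>s\<bar> powr q" "0 <= q" "0 <= C"
 shows "\<bar>f a - f b\<bar> <= C * (\<bar>a\<bar> powr q + \<bar>b\<bar> powr q) * \<bar>a - b\<bar>"
proof -
 define m where "m = max \<bar>a\<bar> \<bar>b\<bar>"
 have "norm (f a - f b) <= (C * m powr q) * norm (a - b)"
 proof (rule field_differentiable_bound[of "{- m..m}" f f'])
  show "(f has_field_derivative f' z) (at z within {- m..m})" for z
   using assms(1) by (rule has_field_derivative_at_within)
  show "norm (f' z) <= C * m powr q" if "z \<in> {- m..m}" for z
  proof -
   have "\<bar>z\<bar> powr q <= m powr q" using that assms(3) by (intro powr_mono2) auto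
   then show ?thesis using assms(2)[of z] mult_left_mono[OF _ assms(4)] by (smt (verit) real_norm_def)
  qed
 qed (auto simp: m_def)
 also have "... <= (C * (\<bar>a\<bar> powr q + \<bar>b\<bar> powr q)) * norm (a - b)"
  unfolding m_def by (intro mult_right_mono mult_left_mono abs_powr_max assms) auto
 finally show ?thesis by simp
qed

lemma sum_sq_le: "(x + y)^2 <= 2 * (x^2 + y^2)" for x y :: real
proof -
 have "0 <= (x - y)^2" by simp
 then show ?thesis by (simp add: power2_sum power2_diff)
qed

locale exponent =
 fixes \<delta> :: real
 assumes delta: "\<delta> \<ge> 1"
begin

abbreviation sg :: "real => real" where "sg s \<equiv> spow s \<delta>"
text \<open>Up to the factor \<open>\<delta> + 1\<close> a primitive of \<open>sg\<close>, so that
  the advection is the divergence of a flux; it is also the intermediate power in the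
  reaction.\<close>

definition Phi :: "real => real" where "Phi s = s * spow s \<delta>"
text \<open>The monotone top-order part of the reaction, with reversed sign. Both cases of the power
  convention lead to it because the square of \<open>sg s\<close> is \<open>wt s\<close>.\<close>

definition Psi :: "real => real" where "Psi s = s * \<bar>s\<bar> powr (2 * \<delta>)"
text \<open>The exponent for which \<open>Psi s * s = pw s\<close>, and at the same time the
  Lebesgue exponent \<open>2 * (\<delta> + 1)\<close> of the Gagliardo-Nirenberg inequality.\<close>

abbreviation "p \<equiv> 2 * \<delta> + 2"
abbreviation "wt s \<equiv> \<bar>s\<bar> powr (2 * \<delta>)"
abbreviation "pw s \<equiv> \<bar>s\<bar> powr p"

lemma spow_int: assumes "\<delta> \<in> \<int>" obtains n where "n \<ge> 1" "\<delta> = real n" "!!s. spow s \<delta> = s ^ n"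
proof -
 obtain z where z: "\<delta> = of_int z" using assms by (auto elim: Ints_cases)
 have "z \<ge> 1" using delta z by simp
 then have "\<delta> = real (nat z)" "nat z \<ge> 1" using z by auto
 then show ?thesis using that[of "nat z"] assms z by (simp add: spow_def)
qed

lemma abs_spow: "\<bar>sg s\<bar> = \<bar>s\<bar> powr \<delta>"
proof (cases "\<delta> \<in> \<int>")
 case True
 obtain n where n: "n \<ge> 1" "\<delta> = real n" "!!s. spow s \<delta> = s ^ n" by (rule spow_int[OF True]) (rule that)
 show ?thesis using n by (cases "s = 0") (auto simp: power_abs powr_realpow)
qed (simp add: spow_def)

lemma spow_sq: "(sg s)^2 = (wt s)"
proof -
 have "(sg s)^2 = (\<bar>s\<bar> powr \<delta>)^2" using abs_spow[of s] by (metis power2_abs)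
 then show ?thesis by (simp add: power2_eq_square powr_add[symmetric])
qed

lemma abs_powr_delta_sq: "(\<bar>s\<bar> powr \<delta>)^2 = (wt s)" for s :: real
 by (simp add: power2_eq_square powr_add[symmetric])

lemma DERIV_Phi: "(Phi has_real_derivative (\<delta> + 1) * sg s) (at s)"
proof (cases "\<delta> \<in> \<int>")
 case True
 obtain n where n: "n \<ge> 1" "\<delta> = real n" "!!s. spow s \<delta> = s ^ n" by (rule spow_int[OF True]) (rule that)
 have "((%s. s ^ Suc n) has_real_derivative real (Suc n) * s ^ n) (at s)"
  using DERIV_pow[of "Suc n" s UNIV] by simp
 moreover have "Phi = (%s. s ^ Suc n)" by (simp add: Phi_def fun_eq_iff n(3))
 moreover have "\<delta> + 1 = real (Suc n)" using n(2) by simp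
 ultimately show ?thesis by (simp only: n(3))
next
 case False
 then show ?thesis
  using DERIV_mult_abs_powr[of \<delta> s] delta by (simp add: Phi_def[abs_def] spow_def)
qed

lemma DERIV_Psi: "(Psi has_real_derivative (2 * \<delta> + 1) * (wt s)) (at s)"
 using DERIV_mult_abs_powr[of "2 * \<delta>" s] delta by (simp add: Psi_def[abs_def])

lemma continuous_spow: "continuous_on UNIV sg"
proof (cases "\<delta> \<in> \<int>")
 case True
 obtain n where n: "n \<ge> 1" "\<delta> = real n" "!!s. spow s \<delta> = s ^ n" by (rule spow_int[OF True]) (rule that)
 show ?thesis by (simp add: n(3)) (intro continuous_intros)
next
 case False
 then show ?thesis using continuous_abs_powr[of \<delta>] delta by (simp add: spow_def)
qed

lemma continuous_Phi: "continuous_on UNIV Phi"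
 using DERIV_Phi by (intro DERIV_continuous_on) auto

lemma continuous_Psi: "continuous_on UNIV Psi"
 using DERIV_Psi by (intro DERIV_continuous_on) auto

lemma Phi_0 [simp]: "Phi 0 = 0" and Psi_0 [simp]: "Psi 0 = 0"
 by (simp_all add: Phi_def Psi_def)

lemma Phi_sq: "(Phi s)^2 = (pw s)"
 using powr_two_mult[of "\<bar>s\<bar>" "2 * \<delta>"] by (simp add: Phi_def power_mult_distrib spow_sq mult.commute)

lemma abs_Psi: "\<bar>Psi s\<bar> = \<bar>s\<bar> powr (2 * \<delta> + 1)"
 using powr_Suc_mult[of "\<bar>s\<bar>" "2 * \<delta>"] by (simp add: Psi_def abs_mult mult.commute)

lemma Psi_mult_self: "Psi s * s = (pw s)"
 using powr_two_mult[of "\<bar>s\<bar>" "2 * \<delta>"] by (simp add: Psi_def power2_eq_square mult.commute mult.left_commute)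

lemma powr_odd_mult: "0 <= x ==> x powr (2 * \<delta> + 1) * x = x powr p"
proof -
 have "2 * \<delta> + 1 + 1 = p" by simp
 then show "0 <= x ==> x powr (2 * \<delta> + 1) * x = x powr p" using powr_Suc_mult[of x "2 * \<delta> + 1"] by (simp only:)
qed

lemma reaction_eq: "reaction \<gamma> \<delta> u x = (1 + \<gamma>) * Phi (u x) - \<gamma> * u x - Psi (u x)"
proof -
 have "Psi (u x) = u x * (sg (u x) * sg (u x))" using spow_sq[of "u x"] by (simp add: Psi_def power2_eq_square)
 then show ?thesis unfolding reaction_def Phi_def by (simp add: algebra_simps)
qed

lemma Phi_diff: "\<bar>Phi a - Phi b\<bar> <= (\<delta> + 1) * (\<bar>a\<bar> powr \<delta> + \<bar>b\<bar> powr \<delta>) * \<bar>a - b\<bar>"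
 using delta by (intro DERIV_bound_diff[OF DERIV_Phi]) (auto simp: abs_mult abs_spow)

lemma Psi_diff: "\<bar>Psi a - Psi b\<bar> <= (2 * \<delta> + 1) * ((wt a) + (wt b)) * \<bar>a - b\<bar>"
 using delta by (intro DERIV_bound_diff[OF DERIV_Psi]) (auto simp: abs_mult)

lemma Phi_diff_sq: "(Phi a - Phi b)^2 <= 2 * (\<delta> + 1)^2 * ((wt a) * (a - b)^2 + (wt b) * (a - b)^2)"
proof -
 have "(Phi a - Phi b)^2 <= ((\<delta> + 1) * (\<bar>a\<bar> powr \<delta> + \<bar>b\<bar> powr \<delta>) * \<bar>a - b\<bar>)^2"
  using Phi_diff[of a b] by (metis abs_ge_zero power2_abs power_mono)
 also have "... = (\<delta> + 1)^2 * (\<bar>a\<bar> powr \<delta> + \<bar>b\<bar> powr \<delta>)^2 * (a - b)^2"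
  by (simp add: power_mult_distrib)
 also have "... <= (\<delta> + 1)^2 * (2 * ((\<bar>a\<bar> powr \<delta>)^2 + (\<bar>b\<bar> powr \<delta>)^2)) * (a - b)^2"
 proof (intro mult_right_mono mult_left_mono)
  have "0 <= (\<bar>a\<bar> powr \<delta> - \<bar>b\<bar> powr \<delta>)^2" by simp
  then show "(\<bar>a\<bar> powr \<delta> + \<bar>b\<bar> powr \<delta>)^2 <= 2 * ((\<bar>a\<bar> powr \<delta>)^2 + (\<bar>b\<bar> powr \<delta>)^2)"
   by (simp add: power2_sum power2_diff)
 qed auto
 finally show ?thesis unfolding abs_powr_delta_sq by (simp add: algebra_simps)
qed

text \<open>Cauchy-Schwarz for the averages of \<open>sg\<close> and \<open>sg^2\<close> between \<open>b\<close> and \<open>a\<close>: the function in the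
 proof has derivative \<open>(sg - \<mu>)^2\<close>.\<close>

lemma Phi_Psi_cauchy_schwarz:
 "(2 * \<delta> + 1) * (Phi a - Phi b)^2 <= (\<delta> + 1)^2 * ((Psi a - Psi b) * (a - b))"
proof (cases "a = b")
 case False
 \<comment> \<open>The average of \<open>sg\<close> between b and a.\<close>
 define \<mu> where "\<mu> = (Phi a - Phi b) / ((\<delta> + 1) * (a - b))"
 define F where "F s = Psi s / (2 * \<delta> + 1) - 2 * \<mu> * (Phi s / (\<delta> + 1)) + \<mu>^2 * s" for s
 have F': "(F has_real_derivative (sg s - \<mu>)^2) (at s)" for s
 proof -
  have "(F has_real_derivative (2 * \<delta> + 1) * (wt s) / (2 * \<delta> + 1)
    - 2 * \<mu> * ((\<delta> + 1) * sg s / (\<delta> + 1)) + \<mu>^2 * 1) (at s)"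
   unfolding F_def[abs_def] by (intro DERIV_add DERIV_diff DERIV_cmult DERIV_cdivide DERIV_Psi DERIV_Phi DERIV_ident)
  moreover have "(2 * \<delta> + 1) * (wt s) / (2 * \<delta> + 1) = (sg s)^2" "(\<delta> + 1) * sg s / (\<delta> + 1) = sg s"
   using delta by (simp_all add: spow_sq)
  ultimately have "(F has_real_derivative (sg s)^2 - 2 * \<mu> * sg s + \<mu>^2 * 1) (at s)" by (simp only:)
  moreover have "(sg s)^2 - 2 * \<mu> * sg s + \<mu>^2 * 1 = (sg s - \<mu>)^2" by (simp add: power2_diff)
  ultimately show ?thesis by (simp only:)
 qed
 have mono: "F x <= F y" if "x <= y" for x y
  by (rule DERIV_nonneg_imp_nondecreasing[OF that]) (use F' in \<open>auto intro!: exI\<close>)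
 have "0 <= (F a - F b) * (a - b)"
  using mono[of a b] mono[of b a] by (cases "a <= b") (auto intro: mult_nonneg_nonneg mult_nonpos_nonpos)
 also have "(F a - F b) * (a - b) = (Psi a - Psi b) * (a - b) / (2 * \<delta> + 1)
   - 2 * \<mu> * ((Phi a - Phi b) / (\<delta> + 1)) * (a - b) + \<mu>^2 * (a - b)^2"
 proof -
  have "F a - F b = (Psi a - Psi b) / (2 * \<delta> + 1) - 2 * \<mu> * ((Phi a - Phi b) / (\<delta> + 1)) + \<mu>^2 * (a - b)"
   by (simp add: F_def diff_divide_distrib right_diff_distrib)
  then show ?thesis by (simp add: left_diff_distrib distrib_right power2_eq_square mult.assoc)
 qed
 also have "(Phi a - Phi b) / (\<delta> + 1) = \<mu> * (a - b)" using False delta by (simp add: \<mu>_def)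
 also have "(Psi a - Psi b) * (a - b) / (2 * \<delta> + 1) - 2 * \<mu> * (\<mu> * (a - b)) * (a - b) + \<mu>^2 * (a - b)^2
   = (Psi a - Psi b) * (a - b) / (2 * \<delta> + 1) - (\<mu> * (a - b))^2"
  by (simp add: power2_eq_square algebra_simps)
 also have "(\<mu> * (a - b))^2 = (Phi a - Phi b)^2 / (\<delta> + 1)^2"
  using False delta by (simp add: \<mu>_def power_divide)
 finally have "(Phi a - Phi b)^2 / (\<delta> + 1)^2 <= (Psi a - Psi b) * (a - b) / (2 * \<delta> + 1)" by simp
 then show ?thesis using delta by (simp add: divide_le_eq le_divide_eq pos_divide_le_eq pos_le_divide_eq mult_ac)
qed simp

lemma Psi_mono: "a <= b ==> Psi a <= Psi b"
 by (rule DERIV_nonneg_imp_nondecreasing) (use DERIV_Psi delta in \<open>auto intro!: exI\<close>)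

lemma Psi_minus: "Psi (- s) = - Psi s" by (simp add: Psi_def)

text \<open>If u and u + w have the same sign, superadditivity of \<open>Psi\<close> on the positive
  axis gives even \<open>Psi w\<close>. If 0 lies between them, one of u + w and - u is at least w /
  2, and this is the origin of the factor \<open>(1/2) powr (2 * \<delta> + 1)\<close>.\<close>

lemma Psi_coercive_pos:
 assumes "0 < w" shows "(1/2) powr (2 * \<delta> + 1) * w powr (2 * \<delta> + 1) <= Psi (u + w) - Psi u"
proof -
 have pos: "Psi (w / 2) = (1/2) powr (2 * \<delta> + 1) * w powr (2 * \<delta> + 1)"
  using abs_Psi[of "w / 2"] Psi_mono[of 0 "w / 2"] assms by (simp add: powr_mult[symmetric])
 have super: "Psi x + Psi y <= Psi (x + y)" if "0 <= x" "0 <= y" for x y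
 proof -
  have "x powr (2 * \<delta>) <= (x + y) powr (2 * \<delta>)" "y powr (2 * \<delta>) <= (x + y) powr (2 * \<delta>)"
   using that delta by (auto intro!: powr_mono2)
  then have "x * x powr (2 * \<delta>) + y * y powr (2 * \<delta>) <= x * (x + y) powr (2 * \<delta>) + y * (x + y) powr (2 * \<delta>)"
   using that by (intro add_mono mult_left_mono) auto
  then show ?thesis using that by (simp add: Psi_def algebra_simps)
 qed
 have w2: "Psi (w / 2) <= Psi w" "0 <= Psi (w / 2)" using Psi_mono[of "w / 2" w] Psi_mono[of 0 "w / 2"] assms by auto
 consider "0 <= u" | "u + w <= 0" | "u < 0" "0 < u + w" by linarith
 then have "Psi (w / 2) <= Psi (u + w) - Psi u"
 proof cases
  case 1
  then show ?thesis using super[of u w] assms w2 by linarith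
 next
  case 2
  then show ?thesis using super[of "- u - w" w] assms w2 Psi_minus[of u] Psi_minus[of "u + w"] by simp
 next
  case 3
  have "w / 2 <= u + w \<or> w / 2 <= - u" by linarith
  then show ?thesis
  proof
   assume "w / 2 <= u + w"
   then show ?thesis using Psi_mono[of "w / 2" "u + w"] Psi_mono[of u 0] 3 by simp
  next
   assume "w / 2 <= - u"
   then show ?thesis using Psi_mono[of "w / 2" "- u"] Psi_mono[of 0 "u + w"] 3 Psi_minus[of u] by simp
  qed
 qed
 then show ?thesis by (simp add: pos)
qed

lemma Psi_coercive: "(1/2) powr (2 * \<delta> + 1) * (pw w) <= (Psi (u + w) - Psi u) * w"
proof -
 have e: "(pw w) = \<bar>w\<bar> powr (2 * \<delta> + 1) * \<bar>w\<bar>" using powr_odd_mult[of "\<bar>w\<bar>"] by simp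
 consider "w > 0" | "w = 0" | "w < 0" by linarith
 then show ?thesis
 proof cases
  case 1
  then show ?thesis
   using mult_right_mono[OF Psi_coercive_pos[OF 1, of u], of w] unfolding e by simp
 next
  case 3
  have "(1/2) powr (2 * \<delta> + 1) * (- w) powr (2 * \<delta> + 1) <= Psi u - Psi (u + w)"
   using Psi_coercive_pos[of "- w" "u + w"] 3 by simp
  from mult_right_mono[OF this, of "- w"] show ?thesis unfolding e using 3 by (simp add: algebra_simps)
 qed simp
qed

text \<open>For the Garding inequality \<open>Phi w\<close> is taken out of the increment because
  its drift against w integrates to 0. The rest consists of mixed terms, where the larger of u and w
  carries the power \<delta> and the smaller enters linearly.\<close>

lemma Phi_split:
 "(Phi (u + w) - Phi u - Phi w)^2 <= 2 * ((\<delta> + 1) * (2 powr \<delta> + 1) + 1)^2 *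
   ((wt u) * w^2 + u^2 * (wt w))"
proof -
 define C where "C = (\<delta> + 1) * (2 powr \<delta> + 1) + 1"
 have C: "C \<ge> 0" using delta by (simp add: C_def)
 have half: "\<bar>Phi (x + y) - Phi x - Phi y\<bar> <= C * (\<bar>x\<bar> powr \<delta> * \<bar>y\<bar>)" if "\<bar>y\<bar> <= \<bar>x\<bar>" for x y
 proof -
  have "\<bar>x + y\<bar> powr \<delta> <= (2 * \<bar>x\<bar>) powr \<delta>" using that delta by (intro powr_mono2) auto
  then have a: "\<bar>x + y\<bar> powr \<delta> <= 2 powr \<delta> * \<bar>x\<bar> powr \<delta>" by (simp add: powr_mult)
  have "\<bar>Phi (x + y) - Phi x\<bar> <= (\<delta> + 1) * (\<bar>x + y\<bar> powr \<delta> + \<bar>x\<bar> powr \<delta>) * \<bar>y\<bar>" using Phi_diff[of "x + y" x] by simp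
  also have "... <= (\<delta> + 1) * (2 powr \<delta> * \<bar>x\<bar> powr \<delta> + \<bar>x\<bar> powr \<delta>) * \<bar>y\<bar>"
   using a delta by (intro mult_right_mono mult_left_mono add_mono) auto
  finally have 1: "\<bar>Phi (x + y) - Phi x\<bar> <= (\<delta> + 1) * (2 powr \<delta> + 1) * (\<bar>x\<bar> powr \<delta> * \<bar>y\<bar>)" by (simp add: algebra_simps)
  have "\<bar>Phi y\<bar> = \<bar>y\<bar> powr \<delta> * \<bar>y\<bar>" by (simp add: Phi_def abs_mult abs_spow mult.commute)
  also have "... <= \<bar>x\<bar> powr \<delta> * \<bar>y\<bar>" using that delta by (intro mult_right_mono abs_powr_mono) auto
  finally have 2: "\<bar>Phi y\<bar> <= \<bar>x\<bar> powr \<delta> * \<bar>y\<bar>" .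
  have "\<bar>Phi (x + y) - Phi x - Phi y\<bar> <= \<bar>Phi (x + y) - Phi x\<bar> + \<bar>Phi y\<bar>" by simp
  also have "... <= (\<delta> + 1) * (2 powr \<delta> + 1) * (\<bar>x\<bar> powr \<delta> * \<bar>y\<bar>) + 1 * (\<bar>x\<bar> powr \<delta> * \<bar>y\<bar>)"
   using 1 2 by (intro add_mono) simp_all
  also have "... = C * (\<bar>x\<bar> powr \<delta> * \<bar>y\<bar>)" unfolding C_def by (rule distrib_right[symmetric])
  finally show ?thesis .
 qed
 have "\<bar>Phi (u + w) - Phi u - Phi w\<bar> <= C * (\<bar>u\<bar> powr \<delta> * \<bar>w\<bar> + \<bar>u\<bar> * \<bar>w\<bar> powr \<delta>)"
 proof (cases "\<bar>w\<bar> <= \<bar>u\<bar>")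
  case True
  have "C * (\<bar>u\<bar> powr \<delta> * \<bar>w\<bar>) <= C * (\<bar>u\<bar> powr \<delta> * \<bar>w\<bar> + \<bar>u\<bar> * \<bar>w\<bar> powr \<delta>)" using C by (intro mult_left_mono) auto
  then show ?thesis using half[OF True] by linarith
 next
  case False
  have "C * (\<bar>w\<bar> powr \<delta> * \<bar>u\<bar>) <= C * (\<bar>u\<bar> powr \<delta> * \<bar>w\<bar> + \<bar>u\<bar> * \<bar>w\<bar> powr \<delta>)"
   using C by (intro mult_left_mono) (auto simp: mult.commute)
  moreover have "\<bar>Phi (u + w) - Phi u - Phi w\<bar> = \<bar>Phi (w + u) - Phi w - Phi u\<bar>" by (simp add: add.commute)
  ultimately show ?thesis using half[of u w] False by linarith
 qed
 then have "(Phi (u + w) - Phi u - Phi w)^2 <= (C * (\<bar>u\<bar> powr \<delta> * \<bar>w\<bar> + \<bar>u\<bar> * \<bar>w\<bar> powr \<delta>))^2"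
  by (metis abs_ge_zero power2_abs power_mono)
 also have "... = C^2 * (\<bar>u\<bar> powr \<delta> * \<bar>w\<bar> + \<bar>u\<bar> * \<bar>w\<bar> powr \<delta>)^2" by (simp add: power_mult_distrib)
 also have "... <= C^2 * (2 * ((\<bar>u\<bar> powr \<delta> * \<bar>w\<bar>)^2 + (\<bar>u\<bar> * \<bar>w\<bar> powr \<delta>)^2))"
  by (intro mult_left_mono sum_sq_le) simp
 finally show ?thesis by (simp add: power_mult_distrib abs_powr_delta_sq C_def distrib_left mult_ac)
qed

text \<open>Where u is not small against w, \<open>2 * \<delta> - 2 >= 0\<close> allows
  \<open>|w|\<close> to be replaced by \<open>|u| / \<eta>\<close> in the surplus power of
  w.\<close>

lemma young_split:
 assumes "\<eta> > 0"
 shows "u^2 * (wt w) <= \<eta>^2 * (pw w) + \<eta> powr (2 - 2 * \<delta>) * ((wt u) * w^2)"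
proof (cases "\<bar>u\<bar> <= \<eta> * \<bar>w\<bar>")
 case True
 then have "\<bar>u\<bar>^2 <= (\<eta> * \<bar>w\<bar>)^2" by (intro power_mono) auto
 then have "u^2 * (wt w) <= (\<eta>^2 * w^2) * (wt w)"
  by (intro mult_right_mono) (auto simp: power_mult_distrib)
 also have "... = \<eta>^2 * (pw w)" using powr_two_mult[of "\<bar>w\<bar>" "2 * \<delta>"] by (simp add: mult_ac)
 finally show ?thesis by (simp add: add_increasing2)
next
 case False
 show ?thesis
 proof (cases "w = 0")
  case False': False
  have u: "u ~= 0" using False assms by auto
  have "\<bar>w\<bar> <= \<bar>u\<bar> / \<eta>" using False assms by (simp add: field_simps)
  then have "\<bar>w\<bar> powr (2 * \<delta> - 2) <= (\<bar>u\<bar> / \<eta>) powr (2 * \<delta> - 2)" using delta by (intro powr_mono2) auto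
  also have "... = \<eta> powr (2 - 2 * \<delta>) * \<bar>u\<bar> powr (2 * \<delta> - 2)"
   using assms u by (simp add: powr_divide powr_minus_divide[symmetric] field_simps powr_diff)
  finally have "u^2 * (\<bar>w\<bar> powr (2 * \<delta> - 2) * w^2) <= u^2 * ((\<eta> powr (2 - 2 * \<delta>) * \<bar>u\<bar> powr (2 * \<delta> - 2)) * w^2)"
   by (intro mult_left_mono mult_right_mono) auto
  moreover have "\<bar>w\<bar> powr (2 * \<delta> - 2) * w^2 = (wt w)" "\<bar>u\<bar> powr (2 * \<delta> - 2) * u^2 = (wt u)"
   using powr_two_mult[of "\<bar>w\<bar>" "2 * \<delta> - 2"] powr_two_mult[of "\<bar>u\<bar>" "2 * \<delta> - 2"] by simp_all
  ultimately have "u^2 * (wt w) <= \<eta> powr (2 - 2 * \<delta>) * ((wt u) * w^2)"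
   by (metis mult.assoc mult.commute)
  then show ?thesis by (simp add: add_increasing)
 qed simp
qed

lemma powr_2d_mult: "(wt u) * \<bar>w * v\<bar> <= (pw u) + (pw w) + (pw v)"
proof -
 define m where "m = max \<bar>u\<bar> (max \<bar>w\<bar> \<bar>v\<bar>)"
 have m: "\<bar>u\<bar> <= m" "\<bar>w\<bar> <= m" "\<bar>v\<bar> <= m" "0 <= m" by (auto simp: m_def)
 have "(wt u) * \<bar>w * v\<bar> <= m powr (2 * \<delta>) * (m * m)"
  unfolding abs_mult using m delta by (intro mult_mono powr_mono2) auto
 also have "... = m powr p" using powr_two_mult[OF m(4), of "2 * \<delta>"] by (simp add: power2_eq_square)
 also have "... <= (pw u) + (pw w) + (pw v)"
  unfolding m_def by (auto simp: max_def)
 finally show ?thesis .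
qed

lemma powr_2d_sq: "(wt u) * w^2 <= (pw u) + (pw w)"
proof -
 define m where "m = max \<bar>u\<bar> \<bar>w\<bar>"
 have m: "\<bar>u\<bar> <= m" "\<bar>w\<bar> <= m" "0 <= m" by (auto simp: m_def)
 have "w^2 <= m^2" using m(2) by (metis abs_ge_zero power2_abs power_mono)
 then have "(wt u) * w^2 <= m powr (2 * \<delta>) * m^2"
  using m delta by (intro mult_mono powr_mono2) auto
 also have "... = m powr p" using powr_two_mult[OF m(3), of "2 * \<delta>"] by simp
 also have "... <= (pw u) + (pw w)" unfolding m_def using delta by (intro abs_powr_max) auto
 finally show ?thesis .
qed

text \<open>Shaped for \<open>vitali_limit\<close>: u and w vary with the index and receive the
  small factor, v is fixed and takes the large one.\<close>

lemma young_eta: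
 assumes "\<eta> > 0"
 shows "(wt u) * \<bar>w * v\<bar> <= \<eta> * ((pw u) + (pw w)) + \<eta> powr (- (2 * \<delta> + 1)) * (pw v)"
proof -
 define m where "m = max \<bar>u\<bar> \<bar>w\<bar>"
 have m: "\<bar>u\<bar> <= m" "\<bar>w\<bar> <= m" "0 <= m" by (auto simp: m_def)
 have "(wt u) * \<bar>w * v\<bar> <= m powr (2 * \<delta>) * (m * \<bar>v\<bar>)"
  unfolding abs_mult using m delta by (intro mult_mono powr_mono2) auto
 then have 1: "(wt u) * \<bar>w * v\<bar> <= m powr (2 * \<delta> + 1) * \<bar>v\<bar>"
  using powr_Suc_mult[OF m(3), of "2 * \<delta>"] by (simp add: mult.assoc[symmetric])
 show ?thesis
 proof (cases "\<bar>v\<bar> <= \<eta> * m")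
  case True
  have "m powr (2 * \<delta> + 1) * \<bar>v\<bar> <= m powr (2 * \<delta> + 1) * (\<eta> * m)" by (intro mult_left_mono True) auto
  also have "... = \<eta> * m powr p" using powr_odd_mult[OF m(3)] by (metis mult.assoc mult.commute)
  also have "... <= \<eta> * ((pw u) + (pw w))"
   unfolding m_def using delta assms by (intro mult_left_mono abs_powr_max) auto
  finally show ?thesis using 1 by (smt (verit) mult_nonneg_nonneg powr_ge_zero)
 next
  case False
  have "m <= \<bar>v\<bar> / \<eta>" using False assms by (simp add: field_simps)
  then have "m powr (2 * \<delta> + 1) <= (\<bar>v\<bar> / \<eta>) powr (2 * \<delta> + 1)" using m delta by (intro powr_mono2) auto
  also have "... = \<eta> powr (- (2 * \<delta> + 1)) * \<bar>v\<bar> powr (2 * \<delta> + 1)"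
   using powr_divide[of "\<bar>v\<bar>" \<eta> "2 * \<delta> + 1"] powr_minus_divide[of \<eta> "2 * \<delta> + 1"] assms by simp
  finally have "m powr (2 * \<delta> + 1) * \<bar>v\<bar> <= (\<eta> powr (- (2 * \<delta> + 1)) * \<bar>v\<bar> powr (2 * \<delta> + 1)) * \<bar>v\<bar>"
   by (rule mult_right_mono) simp
  also have "... = \<eta> powr (- (2 * \<delta> + 1)) * (pw v)"
   using powr_odd_mult[of "\<bar>v\<bar>"] by (simp add: mult.assoc)
  finally show ?thesis using 1 assms by (smt (verit) mult_nonneg_nonneg powr_ge_zero)
 qed
qed

text \<open>The power \<open>4 * \<delta> + 2\<close> is that of \<open>Psi u\<close> squared, which
  is known to be integrable for the strong solution. Where w dominates K u, the term is absorbed by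
  \<open>pw w\<close>; where u is large, by that square; where u is at most L, it is a multiple of
  \<open>w^2\<close>. K and L are fixed by \<open>K powr (- 2 * \<delta>) = \<eta>\<close> and
  \<open>K^2 * L powr (- 2 * \<delta>) = \<eta>\<close>.\<close>

lemma interpolation:
 assumes "\<eta> > 0"
 obtains C where "C \<ge> 0" "!!u w. (wt u) * w^2 <= \<eta> * ((pw w) + \<bar>u\<bar> powr (4 * \<delta> + 2)) + C * w^2"
proof -
 define K where "K = \<eta> powr (- 1 / (2 * \<delta>))"
 have K: "K > 0" "K powr (- 2 * \<delta>) = \<eta>" using assms delta by (auto simp: K_def powr_powr)
 define L where "L = (\<eta> / K^2) powr (- 1 / (2 * \<delta>))"
 have L: "L > 0" "L powr (- 2 * \<delta>) = \<eta> / K^2" using assms delta K by (auto simp: L_def powr_powr)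
 have main: "(wt u) * w^2 <= \<eta> * ((pw w) + \<bar>u\<bar> powr (4 * \<delta> + 2)) + L powr (2 * \<delta>) * w^2" for u w
 proof -
  consider "\<bar>u\<bar> <= L" | "\<bar>w\<bar> \<ge> K * \<bar>u\<bar>" | "\<bar>u\<bar> > L" "\<bar>w\<bar> < K * \<bar>u\<bar>" by linarith
  then show ?thesis
  proof cases
   case 1
   then have "(wt u) * w^2 <= L powr (2 * \<delta>) * w^2" using delta by (intro mult_right_mono powr_mono2) auto
   moreover have "0 <= \<eta> * ((pw w) + \<bar>u\<bar> powr (4 * \<delta> + 2))" using assms by simp
   ultimately show ?thesis by linarith
  next
   case 2
   then have "\<bar>u\<bar> <= \<bar>w\<bar> / K" using K by (simp add: field_simps)
   then have "(wt u) <= (\<bar>w\<bar> / K) powr (2 * \<delta>)" using delta by (intro powr_mono2) auto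
   also have "... = K powr (- 2 * \<delta>) * (wt w)"
    using K(1) powr_minus_divide[of K "2 * \<delta>"] powr_divide[of "\<bar>w\<bar>" K "2 * \<delta>"] by simp
   also have "... = \<eta> * (wt w)" using K(2) by simp
   finally have "(wt u) * w^2 <= (\<eta> * (wt w)) * w^2" by (rule mult_right_mono) simp
   also have "... = \<eta> * (pw w)" using powr_two_mult[of "\<bar>w\<bar>" "2 * \<delta>"] by (simp add: mult.assoc)
   finally have "(wt u) * w^2 <= \<eta> * (pw w)" .
   moreover have "0 <= \<eta> * \<bar>u\<bar> powr (4 * \<delta> + 2)" "0 <= L powr (2 * \<delta>) * w^2" using assms by auto
   ultimately show ?thesis unfolding distrib_left by linarith
  next
   case 3
   have u0: "\<bar>u\<bar> > 0" using 3 L(1) by linarith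
   have "w^2 <= (K * \<bar>u\<bar>)^2" using 3 K(1) by (metis abs_ge_zero less_imp_le power2_abs power_mono)
   then have "(wt u) * w^2 <= (wt u) * (K^2 * \<bar>u\<bar>^2)"
    by (intro mult_left_mono) (auto simp: power_mult_distrib)
   also have "... = K^2 * (pw u)" using powr_two_mult[of "\<bar>u\<bar>" "2 * \<delta>"] by (simp add: mult_ac)
   also have "... = K^2 * (\<bar>u\<bar> powr (- 2 * \<delta>) * \<bar>u\<bar> powr (4 * \<delta> + 2))"
    unfolding powr_add[symmetric] by (simp add: algebra_simps)
   also have "... <= K^2 * (L powr (- 2 * \<delta>) * \<bar>u\<bar> powr (4 * \<delta> + 2))"
    using 3 L(1) delta by (intro mult_left_mono mult_right_mono powr_mono2') auto
   also have "... = \<eta> * \<bar>u\<bar> powr (4 * \<delta> + 2)" using L(2) K(1) by simp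
   finally have "(wt u) * w^2 <= \<eta> * \<bar>u\<bar> powr (4 * \<delta> + 2)" .
   moreover have "0 <= \<eta> * (pw w)" "0 <= L powr (2 * \<delta>) * w^2" using assms by auto
   ultimately show ?thesis unfolding distrib_left by linarith
  qed
 qed
 show thesis by (rule that[of "L powr (2 * \<delta>)"]) (use main in auto)
qed

end

text \<open>Dominated convergence with dominating functions that themselves vary. The error
  truncated at \<open>2 * C * |g|\<close> has a fixed majorant, and the excess over the truncation
  is at most \<open>C * |f n - g|\<close>.\<close>

lemma L2lim_dominated_by:
 assumes f: "L2lim M f g" and h: "!!n. h n \<in> borel_measurable M" and k: "k \<in> borel_measurable M"
  and le: "!!n x. \<bar>h n x\<bar> <= C * \<bar>f n x\<bar>" and le': "!!x. \<bar>k x\<bar> <= C * \<bar>g x\<bar>" and C: "C \<ge> 0"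
  and lim: "AE x in M. (%n. h n x) ----> k x"
 shows "L2lim M h k"
proof -
 note D = L2limD[OF f]
 have hs: "sqint M (h n)" for n
  by (rule sqint_le[of M "%x. C * f n x"]) (use D h le C in \<open>auto simp: abs_mult\<close>)
 have ks: "sqint M k"
  by (rule sqint_le[of M "%x. C * g x"]) (use D k le' C in \<open>auto simp: abs_mult\<close>)
 define m where "m n x = min \<bar>h n x - k x\<bar> (2 * C * \<bar>g x\<bar>)" for n x
 have gm: "g \<in> borel_measurable M" and fm: "f n \<in> borel_measurable M" for n using D by (auto simp: sqint_def)
 have ml: "L2lim M m (%x. 0)"
 proof (rule L2lim_dominated[where h = "%x. 2 * C * \<bar>g x\<bar>"])
  show "m n \<in> borel_measurable M" for n unfolding m_def[abs_def] using h[of n] k gm by measurable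
  show "sqint M (%x. 2 * C * \<bar>g x\<bar>)" by (intro sqint_cmult sqint_abs D)
  show "AE x in M. \<bar>m n x\<bar> <= 2 * C * \<bar>g x\<bar>" for n using C by (auto simp: m_def)
  show "AE x in M. (%n. m n x) ----> 0"
   using lim
  proof eventually_elim
   case (elim x)
   have "(%n. \<bar>h n x - k x\<bar>) ----> 0" using elim by (simp add: LIM_zero tendsto_rabs_zero)
   then show ?case
    by (rule tendsto_sandwich[OF _ _ tendsto_const, rotated 2]) (use C in \<open>auto simp: m_def\<close>)
  qed
 qed simp
 show ?thesis
 proof (rule L2limI_bound[OF hs ks])
  fix n
  have pt: "\<bar>h n x - k x\<bar> <= \<bar>C * \<bar>f n x - g x\<bar> + m n x\<bar>" for x
  proof -
   have "C * \<bar>f n x\<bar> <= C * (\<bar>f n x - g x\<bar> + \<bar>g x\<bar>)" using C by (intro mult_left_mono) auto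
   then have "\<bar>h n x\<bar> + \<bar>k x\<bar> <= C * \<bar>f n x - g x\<bar> + 2 * C * \<bar>g x\<bar>"
    using le[of n x] le'[of x] by (simp add: algebra_simps)
   then have "\<bar>h n x - k x\<bar> <= C * \<bar>f n x - g x\<bar> + 2 * C * \<bar>g x\<bar>"
    using abs_triangle_ineq4[of "h n x" "k x"] by linarith
   moreover have "0 <= C * \<bar>f n x - g x\<bar>" "0 <= m n x" using C by (auto simp: m_def)
   ultimately show ?thesis by (auto simp: m_def min_def)
  qed
  have "nrm M (%x. h n x - k x) <= nrm M (%x. C * \<bar>f n x - g x\<bar> + m n x)"
   by (rule nrm_mono) (use D h k pt L2limD(1)[OF ml] in \<open>auto intro!: sqint_add sqint_cmult sqint_abs sqint_diff\<close>)
  also have "... <= nrm M (%x. C * \<bar>f n x - g x\<bar>) + nrm M (m n)"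
   by (rule nrm_triangle) (use D L2limD(1)[OF ml] in \<open>auto intro!: sqint_cmult sqint_abs sqint_diff\<close>)
  also have "nrm M (%x. C * \<bar>f n x - g x\<bar>) = C * nrm M (%x. f n x - g x)"
   unfolding nrm_cmult using C by (simp add: nrm_def)
  finally show "nrm M (%x. h n x - k x) <= C * nrm M (%x. f n x - g x) + nrm M (%x. m n x - 0)" by simp
 next
  have "(%n. C * nrm M (%x. f n x - g x) + nrm M (%x. m n x - 0)) ----> C * 0 + 0"
   by (intro tendsto_intros D L2limD(3)[OF ml])
  then show "(%n. C * nrm M (%x. f n x - g x) + nrm M (%x. m n x - 0)) ----> 0" by simp
 qed
qed

context bounded_domain
begin

lemma grad_norm_test_le:
 assumes "\<phi> \<in> test_functions \<Omega>" "u \<in> H0"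
 shows "gn (%x. \<phi> x - u x) <= (\<Sum>i\<in>UNIV. nrm M (%x. pd i \<phi> x - D i u x))"
proof -
 have H: "\<phi> \<in> H0" by (rule H01_test[OF assms(1)])
 have W: "W1 (%x. \<phi> x - u x)" by (rule H01_W1[OF H01_diff(1)[OF H assms(2)]])
 have "nrm M (D i (%x. \<phi> x - u x)) = nrm M (%x. pd i \<phi> x - D i u x)" for i
  using H01_diff(2)[OF H assms(2), of i] test_W1(2)[OF assms(1), of i]
  by (intro nrm_cong_AE W1D(2)[OF W] sqint_diff test_sqint(2)[OF assms(1)] H01_sqint(2)[OF assms(2)]) auto
 then show ?thesis using grad_norm_le_sum[OF W] by simp
qed

lemma H01E_AE:
 assumes "u \<in> H0"
 obtains \<phi> where "!!m. \<phi> m \<in> test_functions \<Omega>" "L2lim M \<phi> u" "L2lim M (%m. pd i (\<phi> m)) (D i u)"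
  "(%m. gn (%x. \<phi> m x - u x)) ----> 0"
  "AE x in M. (%m. \<phi> m x) ----> u x" "AE x in M. (%m. pd i (\<phi> m) x) ----> D i u x"
proof -
 obtain \<phi> where \<phi>: "!!m. \<phi> m \<in> test_functions \<Omega>" "L2lim M \<phi> u" "!!i. L2lim M (%m. pd i (\<phi> m)) (D i u)"
  using H01E[OF assms] by blast
 obtain r :: "nat => nat" where r: "strict_mono r" "AE x in M. (%n. \<phi> (r n) x) ----> u x"
  using L2lim_AE_subseq[OF \<phi>(2)] by blast
 obtain s :: "nat => nat" where s: "strict_mono s" "AE x in M. (%n. pd i (\<phi> (r (s n))) x) ----> D i u x"
  using L2lim_AE_subseq[OF L2lim_subseq[OF \<phi>(3)[of i] r(1)]] by blast
 define \<psi> where "\<psi> n = \<phi> (r (s n))" for n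
 have rs: "strict_mono (%n. r (s n))" using strict_mono_o[OF r(1) s(1)] by (simp add: o_def)
 have l: "L2lim M (%m. pd j (\<psi> m)) (D j u)" for j unfolding \<psi>_def by (rule L2lim_subseq[OF \<phi>(3) rs])
 have t: "\<psi> m \<in> test_functions \<Omega>" for m unfolding \<psi>_def by (rule \<phi>(1))
 show thesis
 proof (rule that[of \<psi>])
  show "L2lim M \<psi> u" using L2lim_subseq[OF \<phi>(2) rs] by (simp add: \<psi>_def[abs_def])
  show "AE x in M. (%m. \<psi> m x) ----> u x"
   using r(2) unfolding \<psi>_def
  proof eventually_elim
   case (elim x)
   show ?case using LIMSEQ_subseq_LIMSEQ[OF elim s(1)] by (simp add: o_def)
  qed
  show "(%m. gn (%x. \<psi> m x - u x)) ----> 0"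
  proof (rule tendsto_sandwich[OF _ _ tendsto_const])
   have "(%m. \<Sum>j\<in>UNIV. nrm M (%x. pd j (\<psi> m) x - D j u x)) ----> (\<Sum>j\<in>(UNIV::'n set). 0)"
    by (intro tendsto_sum L2limD(3)[OF l])
   then show "(%m. \<Sum>j\<in>UNIV. nrm M (%x. pd j (\<psi> m) x - D j u x)) ----> 0" by simp
   show "\<forall>\<^sub>F m in sequentially. gn (%x. \<psi> m x - u x) <= (\<Sum>j\<in>UNIV. nrm M (%x. pd j (\<psi> m) x - D j u x))"
    using grad_norm_test_le[OF t assms] by simp
   show "\<forall>\<^sub>F m in sequentially. 0 <= gn (%x. \<psi> m x - u x)"
    by (intro always_eventually allI grad_norm_nonneg H01_W1 H01_diff(1) H01_test t assms)
  qed
 qed (use t l s in \<open>simp_all add: \<psi>_def\<close>)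
qed

lemma meas_compose:
 fixes f :: "real => real"
 assumes "continuous_on UNIV f" "u \<in> borel_measurable M"
 shows "(%x. f (u x)) \<in> borel_measurable M"
 using measurable_compose[OF assms(2) borel_measurable_continuous_onI[OF assms(1)]] .

lemma H01_meas: "u \<in> H0 ==> u \<in> borel_measurable M" "u \<in> H0 ==> D i u \<in> borel_measurable M"
 using H01_sqint by (auto simp: sqint_def)

lemma grad_norm_zero:
 assumes "w \<in> H0" "gn w = 0" shows "AE x in M. w x = 0"
proof -
 obtain P where P: "P > 0" "!!u. u \<in> H0 ==> nrm M u <= P * gn u" using poincare by blast
 have "nrm M w = 0" using P(2)[OF assms(1)] assms(2) nrm_nonneg[of M w] by simp
 then show ?thesis by (rule nrm_zero_AE[OF H01_sqint(1)[OF assms(1)]])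
qed

end

section \<open>Gagliardo-Nirenberg and the nonlinear integrals\<close>

locale gn_domain = bounded_domain \<Omega> + exponent \<delta> for \<Omega> :: "(real ^ 'n::finite) set" and \<delta> :: real +
 fixes C\<^sub>G\<^sub>N :: real
 assumes dims: "CARD('n) = 2 \<or> \<delta> <= 2"
  and gn: "gagliardo_nirenberg_const \<Omega> \<delta> C\<^sub>G\<^sub>N"
begin

definition pint :: "(real ^ 'n => real) => bool" where
 "pint u \<longleftrightarrow> u \<in> borel_measurable M \<and> integrable M (%x. (pw (u x)))"

definition PI :: "(real ^ 'n => real) => real" where
 "PI u = (LINT x|M. (pw (u x)))"

lemma pintD: "pint u ==> u \<in> borel_measurable M" "pint u ==> integrable M (%x. (pw (u x)))"
 by (auto simp: pint_def)

lemma PI_nonneg: "0 <= PI u"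
 unfolding PI_def by (intro Bochner_Integration.integral_nonneg) auto

lemma test_pint: "\<phi> \<in> test_functions \<Omega> ==> pint \<phi>"
 unfolding pint_def using delta
 by (intro conjI meas_smooth test_smooth continuous_integrable
   continuous_on_compose2[OF continuous_abs_powr] smooth_continuous) auto

text \<open>Test functions come first because \<open>Lp_norm\<close> has the default value 0 where
  the power is not integrable: the assumed inequality says nothing about integrability. For all of
  \<open>H0\<close> that is gained by Fatou in \<open>gn_H01\<close>.\<close>

lemma gn_test:
 obtains G where "G > 0" "!!\<phi>. \<phi> \<in> test_functions \<Omega> ==> PI \<phi> <= G * gn \<phi> powr p"
proof -
 obtain P where P: "P > 0" "!!u. u \<in> H0 ==> nrm M u <= P * gn u" using poincare by blast
 define a where "a = (if CARD('n) = 2 then \<delta> / (\<delta> + 1) else 3 * \<delta> / (2 * (\<delta> + 1)))"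
 define b where "b = (if CARD('n) = 2 then 1 / (\<delta> + 1) else (2 - \<delta>) / (2 * (\<delta> + 1)))"
 have "3 * \<delta> / (2 * (\<delta> + 1)) + (2 - \<delta>) / (2 * (\<delta> + 1)) = 1" "\<delta> / (\<delta> + 1) + 1 / (\<delta> + 1) = 1"
  unfolding add_divide_distrib[symmetric] using delta by simp_all
 \<comment> \<open>The exponents add up to 1, so Poincare turns the product into a multiple of
   \<open>gn \<phi>\<close>; \<open>dims\<close> guarantees that the exponent of the L^2 norm is
   nonnegative.\<close>
 then have ab: "a + b = 1" "0 <= b" using delta dims by (auto simp: a_def b_def)
 define K where "K = \<bar>C\<^sub>G\<^sub>N\<bar> * P powr b"
 have K0: "0 <= K" by (simp add: K_def)
 show thesis
 proof (rule that[of "K powr p + 1"])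
  show "0 < K powr p + 1" by (simp add: add_nonneg_pos)
  fix \<phi> assume \<phi>: "\<phi> \<in> test_functions \<Omega>"
  have H: "\<phi> \<in> H0" by (rule H01_test[OF \<phi>])
  have g0: "0 <= gn \<phi>" by (rule grad_norm_nonneg[OF H01_W1[OF H]])
  have pe: "2 * (\<delta> + 1) = p" by simp
  have L0: "0 <= Lp_norm \<Omega> p \<phi>" by (simp add: Lp_norm_def)
  have "Lp_norm \<Omega> p \<phi> <= C\<^sub>G\<^sub>N * (gn \<phi> powr a * nrm M \<phi> powr b)"
   using gn H Lp_norm_nrm[OF H01_sqint(1)[OF H]]
   unfolding gagliardo_nirenberg_const_def pe a_def b_def by (auto simp: mult.assoc)
  also have "... <= \<bar>C\<^sub>G\<^sub>N\<bar> * (gn \<phi> powr a * (P * gn \<phi>) powr b)"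
   using P(2)[OF H] ab by (intro mult_mono powr_mono2 order_refl) auto
  also have "(P * gn \<phi>) powr b = P powr b * gn \<phi> powr b"
   using P(1) g0 by (simp add: powr_mult)
  also have "\<bar>C\<^sub>G\<^sub>N\<bar> * (gn \<phi> powr a * (P powr b * gn \<phi> powr b)) = K * gn \<phi> powr (a + b)"
   by (simp add: K_def powr_add mult_ac)
  also have "... = K * gn \<phi>" unfolding ab(1) using g0 by simp
  finally have "Lp_norm \<Omega> p \<phi> powr p <= (K * gn \<phi>) powr p"
   using L0 delta by (intro powr_mono2) auto
  also have "... = K powr p * gn \<phi> powr p" using K0 g0 by (simp add: powr_mult)
  also have "... <= (K powr p + 1) * gn \<phi> powr p" by (intro mult_right_mono) auto
  also have "Lp_norm \<Omega> p \<phi> powr p = PI \<phi>"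
   using PI_nonneg[of \<phi>] delta by (simp add: Lp_norm_def PI_def[symmetric] powr_powr)
  finally show "PI \<phi> <= (K powr p + 1) * gn \<phi> powr p" .
 qed
qed

lemma gn_H01:
 "\<exists>G>0. \<forall>u\<in>H0. pint u \<and> PI u <= G * gn u powr p"
proof -
 obtain G where G: "G > 0" "!!\<phi>. \<phi> \<in> test_functions \<Omega> ==> PI \<phi> <= G * gn \<phi> powr p"
  using gn_test by blast
 have "pint u \<and> PI u <= G * gn u powr p" if u: "u \<in> H0" for u
 proof -
  fix i :: 'n
  obtain \<phi> where \<phi>: "!!m. \<phi> m \<in> test_functions \<Omega>" "(%m. gn (%x. \<phi> m x - u x)) ----> 0"
   "AE x in M. (%m. \<phi> m x) ----> u x"
   by (rule H01E_AE[OF u, of i]) (rule that)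
  have W: "W1 u" "W1 (\<phi> m)" for m using H01_W1[OF u] test_W1(1)[OF \<phi>(1)] by auto
  have "(%m. gn (\<phi> m)) ----> gn u"
  proof (rule LIM_zero_cancel, rule tendsto_rabs_zero_cancel, rule tendsto_sandwich[OF _ _ tendsto_const \<phi>(2)])
   show "\<forall>\<^sub>F m in sequentially. \<bar>gn (\<phi> m) - gn u\<bar> <= gn (%x. \<phi> m x - u x)"
   proof (intro always_eventually allI)
    fix m
    have "gn (\<phi> m) <= gn u + gn (%x. \<phi> m x - u x)"
     using grad_norm_triangle[OF W(1) W1_diff(1)[OF W(2) W(1)], of m] by simp
    moreover have "gn u <= gn (\<phi> m) + gn (%x. \<phi> m x - u x)"
     using grad_norm_triangle[OF W(2) W1_diff(1)[OF W(1) W(2)], of m m] grad_norm_minus[OF W(1) W(2)[of m]] by simp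
    ultimately show "\<bar>gn (\<phi> m) - gn u\<bar> <= gn (%x. \<phi> m x - u x)" by linarith
   qed
  qed simp
  then have lim: "(%m. G * gn (\<phi> m) powr p) ----> G * gn u powr p"
   using delta grad_norm_nonneg[OF W(2)] by (intro tendsto_intros tendsto_powr') auto
  have res: "integrable M (%x. (pw (u x))) \<and> PI u <= G * gn u powr p + e" if e: "e > 0" for e
  proof -
   have "\<forall>\<^sub>F m in sequentially. G * gn (\<phi> m) powr p < G * gn u powr p + e"
    using lim e by (intro order_tendstoD(2)) auto
   then obtain N where N: "!!m. m \<ge> N ==> G * gn (\<phi> m) powr p < G * gn u powr p + e"
    by (auto simp: eventually_sequentially)
   have i: "integrable M (%x. (pw (\<phi> (m + N) x)))" for m by (rule pintD(2)[OF test_pint[OF \<phi>(1)]])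
   have l: "AE x in M. (%m. (pw (\<phi> (m + N) x))) ----> (pw (u x))"
    using \<phi>(3)
   proof eventually_elim
    case (elim x)
    show ?case using delta by (intro tendsto_powr' tendsto_intros LIMSEQ_ignore_initial_segment elim) auto
   qed
   have b: "(LINT x|M. (pw (\<phi> (m + N) x))) <= G * gn u powr p + e" for m
    using G(2)[OF \<phi>(1)[of "m + N"]] N[of "m + N"] by (simp add: PI_def)
   have mm: "(%x. (pw (u x))) \<in> borel_measurable M"
    using delta by (intro meas_compose[OF continuous_abs_powr] H01_meas u) auto
   show ?thesis using fatou_bounded[OF i _ l b mm] by (simp add: PI_def)
  qed
  have "PI u <= G * gn u powr p" by (rule field_le_epsilon) (use res in blast)
  then show ?thesis using res[of 1] H01_meas(1)[OF u] by (simp add: pint_def)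
 qed
 then show ?thesis using G(1) by blast
qed

definition Gc :: real where
 "Gc = (SOME G. G > 0 \<and> (\<forall>u\<in>H0. pint u \<and> PI u <= G * gn u powr p))"

lemma Gc: "Gc > 0" "u \<in> H0 ==> pint u" "u \<in> H0 ==> PI u <= Gc * gn u powr p"
proof -
 have *: "Gc > 0 \<and> (\<forall>u\<in>H0. pint u \<and> PI u <= Gc * gn u powr p)"
  unfolding Gc_def by (rule someI_ex[OF gn_H01])
 show "Gc > 0" "u \<in> H0 ==> pint u" "u \<in> H0 ==> PI u <= Gc * gn u powr p"
  using * by blast+
qed

lemma weighted_sqint:
 assumes "pint u" "pint w" shows "integrable M (%x. (wt (u x)) * (w x)^2)"
proof (rule Bochner_Integration.integrable_bound[OF Bochner_Integration.integrable_add[OF pintD(2)[OF assms(1)] pintD(2)[OF assms(2)]]])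
 have "(%x. (wt (u x))) \<in> borel_measurable M"
  using delta by (intro meas_compose[OF continuous_abs_powr] pintD(1)[OF assms(1)]) auto
 then show "(%x. (wt (u x)) * (w x)^2) \<in> borel_measurable M" using pintD(1)[OF assms(2)] by simp
 show "AE x in M. norm ((wt (u x)) * (w x)^2) <= norm ((pw (u x)) + (pw (w x)))"
  using powr_2d_sq by (intro AE_I2) simp
qed

lemma weighted_mult_integrable:
 assumes "pint u" "pint w" "pint v" shows "integrable M (%x. (wt (u x)) * \<bar>w x * v x\<bar>)"
proof (rule Bochner_Integration.integrable_bound)
 show "integrable M (%x. (pw (u x)) + (pw (w x)) + (pw (v x)))"
  using assms by (intro Bochner_Integration.integrable_add pintD(2))
 have "(%x. (wt (u x))) \<in> borel_measurable M"
  using delta by (intro meas_compose[OF continuous_abs_powr] pintD(1)[OF assms(1)]) auto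
 then show "(%x. (wt (u x)) * \<bar>w x * v x\<bar>) \<in> borel_measurable M"
  using pintD(1)[OF assms(2)] pintD(1)[OF assms(3)] by simp
 show "AE x in M. norm ((wt (u x)) * \<bar>w x * v x\<bar>) <= norm ((pw (u x)) + (pw (w x)) + (pw (v x)))"
  using powr_2d_mult by (intro AE_I2) (simp add: abs_mult[symmetric] del: abs_mult)
qed

text \<open>Hoelder's inequality and the Sobolev embedding in one step, by homogeneity in \<open>d\<close>.\<close>

lemma weighted_bound:
 assumes u: "pint u" and d: "d \<in> H0"
 shows "(LINT x|M. (wt (u x)) * (d x)^2) <= (PI u + Gc) * (gn d)^2"
proof (cases "gn d = 0")
 case True
 have "AE x in M. (wt (u x)) * (d x)^2 = 0"
  using grad_norm_zero[OF d True] by (auto elim: eventually_mono)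
 then have "(LINT x|M. (wt (u x)) * (d x)^2) = (LINT x|M. 0)"
  using weighted_sqint[OF u Gc(2)[OF d]] by (intro integral_cong_AE) auto
 then show ?thesis using True by simp
next
 case False
 define g where "g = gn d"
 have g: "g > 0" using False grad_norm_nonneg[OF H01_W1[OF d]] by (simp add: g_def)
 define e where "e x = (1 / g) * d x" for x
 have e: "e \<in> H0" unfolding e_def by (rule H01_cmult(1)[OF d])
 have e1: "gn e = 1"
  unfolding e_def grad_norm_cmult[OF H01_W1[OF d]] using g by (simp add: g_def)
 have "(LINT x|M. (wt (u x)) * (e x)^2) <= (LINT x|M. (pw (u x)) + (pw (e x)))"
  by (intro integral_mono weighted_sqint u Gc(2)[OF e] Bochner_Integration.integrable_add pintD(2) powr_2d_sq)
 also have "... = PI u + PI e"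
  unfolding PI_def using pintD(2)[OF u] pintD(2)[OF Gc(2)[OF e]] by simp
 also have "... <= PI u + Gc" using Gc(3)[OF e] e1 by simp
 finally have "(LINT x|M. (wt (u x)) * (e x)^2) * g^2 <= (PI u + Gc) * g^2"
  by (rule mult_right_mono) simp
 moreover have "(LINT x|M. (wt (u x)) * (e x)^2) * g^2 = (LINT x|M. (wt (u x)) * (d x)^2)"
  unfolding Bochner_Integration.integral_mult_left_zero[symmetric]
  by (intro Bochner_Integration.integral_cong refl) (use g in \<open>simp add: e_def power_mult_distrib power_divide\<close>)
 ultimately show ?thesis by (simp add: g_def)
qed

lemma Phi_meas: "u \<in> borel_measurable M ==> (%x. Phi (u x)) \<in> borel_measurable M"
 and Psi_meas: "u \<in> borel_measurable M ==> (%x. Psi (u x)) \<in> borel_measurable M"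
 and sg_meas: "u \<in> borel_measurable M ==> (%x. sg (u x)) \<in> borel_measurable M"
 using meas_compose[OF continuous_Phi] meas_compose[OF continuous_Psi] meas_compose[OF continuous_spow] by blast+

lemma Phi_sqint: "pint u ==> sqint M (%x. Phi (u x))"
 unfolding sqint_def Phi_sq by (auto simp: pint_def intro: Phi_meas)

lemma sg_mult_sqint: assumes "pint u" "pint w" shows "sqint M (%x. sg (u x) * w x)"
 unfolding sqint_def power_mult_distrib spow_sq using weighted_sqint[OF assms] assms
 by (auto simp: pint_def intro!: borel_measurable_times sg_meas)

lemma Phi_diff_nrm:
 assumes u: "u \<in> H0" and v: "v \<in> H0"
 shows "(nrm M (%x. Phi (u x) - Phi (v x)))^2 <=
  2 * (\<delta> + 1)^2 * (PI u + PI v + 2 * Gc) * (gn (%x. u x - v x))^2"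
proof -
 have d: "(%x. u x - v x) \<in> H0" by (rule H01_diff(1)[OF u v])
 note P = Gc(2)[OF u] Gc(2)[OF v] Gc(2)[OF d]
 have "(nrm M (%x. Phi (u x) - Phi (v x)))^2 <= (LINT x|M. 2 * (\<delta> + 1)^2 *
   ((wt (u x)) * (u x - v x)^2 + (wt (v x)) * (u x - v x)^2))"
  by (rule nrm_le_of_sq) (auto intro!: Phi_diff_sq sqint_diff Phi_sqint weighted_sqint P)
 also have "... = 2 * (\<delta> + 1)^2 * ((LINT x|M. (wt (u x)) * (u x - v x)^2) + (LINT x|M. (wt (v x)) * (u x - v x)^2))"
  using weighted_sqint[OF P(1,3)] weighted_sqint[OF P(2,3)] by simp
 also have "... <= 2 * (\<delta> + 1)^2 * ((PI u + Gc) * (gn (%x. u x - v x))^2 + (PI v + Gc) * (gn (%x. u x - v x))^2)"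
  by (intro mult_left_mono add_mono weighted_bound P d) auto
 finally show ?thesis by (simp add: algebra_simps)
qed

lemma Phi_L2lim:
 assumes \<phi>: "!!m. \<phi> m \<in> H0" and u: "u \<in> H0"
  and lim: "(%m. gn (%x. \<phi> m x - u x)) ----> 0"
 shows "L2lim M (%m x. Phi (\<phi> m x)) (%x. Phi (u x))"
proof (rule L2limI)
 show "sqint M (%x. Phi (\<phi> m x))" for m by (rule Phi_sqint[OF Gc(2)[OF \<phi>]])
 show "sqint M (%x. Phi (u x))" by (rule Phi_sqint[OF Gc(2)[OF u]])
 define g where "g m = gn (%x. \<phi> m x - u x)" for m
 have g0: "0 <= g m" for m unfolding g_def by (intro grad_norm_nonneg H01_W1 H01_diff(1) \<phi> u)
 have gl: "gn (\<phi> m) <= gn u + g m" for m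
  using grad_norm_triangle[OF H01_W1[OF u] H01_W1[OF H01_diff(1)[OF \<phi> u]], of m] by (simp add: g_def)
 define b where "b m = 2 * (\<delta> + 1)^2 * (Gc * (gn u + g m) powr p + PI u + 2 * Gc) * (g m)^2" for m
 have gz: "g ----> 0" using lim by (simp add: g_def[abs_def])
 have "b ----> 2 * (\<delta> + 1)^2 * (Gc * (gn u + 0) powr p + PI u + 2 * Gc) * 0^2"
  unfolding b_def using delta grad_norm_nonneg[OF H01_W1[OF u]] g0
  by (intro tendsto_intros tendsto_powr' gz) (auto intro!: always_eventually add_nonneg_nonneg)
 then have bz: "b ----> 0" by simp
 have "(%m. (nrm M (%x. Phi (\<phi> m x) - Phi (u x)))^2) ----> 0"
 proof (rule tendsto_sandwich[OF _ _ tendsto_const bz])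
  show "\<forall>\<^sub>F m in sequentially. (nrm M (%x. Phi (\<phi> m x) - Phi (u x)))^2 <= b m"
  proof (intro always_eventually allI)
   fix m
   have "PI (\<phi> m) <= Gc * gn (\<phi> m) powr p" by (rule Gc(3)[OF \<phi>])
   also have "... <= Gc * (gn u + g m) powr p"
    using gl delta Gc(1) grad_norm_nonneg[OF H01_W1[OF \<phi>]] by (intro mult_left_mono powr_mono2) auto
   finally have "PI (\<phi> m) + PI u + 2 * Gc <= Gc * (gn u + g m) powr p + PI u + 2 * Gc" by simp
   then have "2 * (\<delta> + 1)^2 * (PI (\<phi> m) + PI u + 2 * Gc) * (g m)^2 <= b m"
    unfolding b_def by (intro mult_right_mono mult_left_mono) auto
   then show "(nrm M (%x. Phi (\<phi> m x) - Phi (u x)))^2 <= b m"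
    using Phi_diff_nrm[OF \<phi>[of m] u] by (simp add: g_def)
  qed
 qed simp
 then have "(%m. sqrt ((nrm M (%x. Phi (\<phi> m x) - Phi (u x)))^2)) ----> sqrt 0" by (intro tendsto_intros)
 then show "(%m. nrm M (%x. Phi (\<phi> m x) - Phi (u x))) ----> 0" by simp
qed

lemma advection_test:
 assumes \<phi>: "\<phi> \<in> test_functions \<Omega>" and \<psi>: "\<psi> \<in> test_functions \<Omega>"
 shows "(\<delta> + 1) * (LINT x|M. sg (\<phi> x) * pd i \<phi> x * \<psi> x) = - (LINT x|M. Phi (\<phi> x) * pd i \<psi> x)"
proof -
 have s: "smooth \<phi>" "smooth \<psi>" using assms test_smooth by auto
 obtain K where K: "compact K" "K \<subseteq> \<Omega>" "!!x. x \<notin> K ==> \<psi> x = 0" using \<psi> by (auto simp: test_functions_iff)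
 define F' where "F' x h = Phi (\<phi> x) * frechet_derivative \<psi> (at x) h + (\<delta> + 1) * sg (\<phi> x) * frechet_derivative \<phi> (at x) h * \<psi> x" for x h
 have der: "((%x. Phi (\<phi> x) * \<psi> x) has_derivative F' x) (at x)" for x
 proof -
  have d: "(\<phi> has_derivative frechet_derivative \<phi> (at x)) (at x)" "(\<psi> has_derivative frechet_derivative \<psi> (at x)) (at x)"
   using s by (auto intro!: pd_has_derivative smooth_differentiable)
  have "(Phi has_derivative (%h. (\<delta> + 1) * sg (\<phi> x) * h)) (at (\<phi> x))"
   using DERIV_Phi[of "\<phi> x"] by (simp add: has_field_derivative_def)
  from has_derivative_mult[OF has_derivative_compose[OF d(1) this] d(2)]
  show ?thesis by (simp add: F'_def[abs_def])
 qed
 have eq: "F' x (axis i 1) = Phi (\<phi> x) * pd i \<psi> x + (\<delta> + 1) * (sg (\<phi> x) * pd i \<phi> x * \<psi> x)" for x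
  by (simp add: F'_def pd_def)
 have c: "continuous_on UNIV (%x. Phi (\<phi> x))" "continuous_on UNIV (%x. sg (\<phi> x))"
  by (rule continuous_on_compose2[OF continuous_Phi smooth_continuous[OF s(1)]]
    continuous_on_compose2[OF continuous_spow smooth_continuous[OF s(1)]]; simp)+
 have cc: "continuous_on UNIV (%x. Phi (\<phi> x) * pd i \<psi> x)" "continuous_on UNIV (%x. sg (\<phi> x) * pd i \<phi> x * \<psi> x)"
  by (intro continuous_on_mult c smooth_continuous smooth_pd s)+
 have "(LINT x|M. F' x (axis i 1)) = 0"
  by (rule integral_partial_zero[OF der K(1,2)]) (use K(3) cc in \<open>auto simp: eq intro!: continuous_intros\<close>)
 then have "(LINT x|M. Phi (\<phi> x) * pd i \<psi> x) + (\<delta> + 1) * (LINT x|M. sg (\<phi> x) * pd i \<phi> x * \<psi> x) = 0"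
  using continuous_integrable[OF cc(1)] continuous_integrable[OF cc(2)] unfolding eq by simp
 then show ?thesis by linarith
qed

lemma advection_integrable:
 assumes "u \<in> H0" "v \<in> H0" shows "integrable M (%x. sg (u x) * D i u x * v x)"
 using sqint_mult_integrable[OF sg_mult_sqint[OF Gc(2)[OF assms(1)] Gc(2)[OF assms(2)]] H01_sqint(2)[OF assms(1), of i]]
 by (simp add: mult_ac)

text \<open>Two density arguments in succession. With a fixed test function \<psi> the left side
  converges only in the sense of Vitali, as \<open>sg u\<close> times the gradient is a product of
  two limits. Afterwards \<psi> may tend to v, since multiplication by \<open>sg u\<close> maps the
  energy space continuously into L^2.\<close>

lemma advection_parts:
 assumes u: "u \<in> H0" and v: "v \<in> H0"
 shows "(\<delta> + 1) * (LINT x|M. sg (u x) * D i u x * v x) = - (LINT x|M. Phi (u x) * D i v x)"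
proof -
 obtain \<phi> where \<phi>: "!!m. \<phi> m \<in> test_functions \<Omega>" "L2lim M \<phi> u" "L2lim M (%m. pd i (\<phi> m)) (D i u)"
  "(%m. gn (%x. \<phi> m x - u x)) ----> 0"
  "AE x in M. (%m. \<phi> m x) ----> u x" "AE x in M. (%m. pd i (\<phi> m) x) ----> D i u x"
  by (rule H01E_AE[OF u, of i]) (rule that)
 obtain \<theta> where \<theta>: "!!m. \<theta> m \<in> test_functions \<Omega>" "L2lim M \<theta> v" "L2lim M (%m. pd i (\<theta> m)) (D i v)"
  "(%m. gn (%x. \<theta> m x - v x)) ----> 0"
  by (rule H01E_AE[OF v, of i]) (rule that)
 have \<phi>H: "\<phi> m \<in> H0" and \<theta>H: "\<theta> m \<in> H0" for m by (rule H01_test[OF \<phi>(1)], rule H01_test[OF \<theta>(1)])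
 obtain Bd where Bd: "!!m. nrm M (pd i (\<phi> m)) <= Bd" using L2lim_bounded[OF \<phi>(3)] by blast
 obtain Bg where Bg: "!!m. nrm M (%x. Phi (\<phi> m x)) <= Bg" using L2lim_bounded[OF Phi_L2lim[OF \<phi>H u \<phi>(4)]] by blast
 have step: "(\<delta> + 1) * (LINT x|M. sg (u x) * D i u x * \<psi> x) = - (LINT x|M. Phi (u x) * pd i \<psi> x)"
  if \<psi>: "\<psi> \<in> test_functions \<Omega>" for \<psi>
 proof -
  have "(%m. (LINT x|M. sg (\<phi> m x) * pd i (\<phi> m) x * \<psi> x)) ----> (LINT x|M. sg (u x) * D i u x * \<psi> x)"
  proof (rule vitali_limit(2)[where A = "%m x. (pd i (\<phi> m) x)^2 + (Phi (\<phi> m x))^2" and K = "Bd^2 + Bg^2"])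
   show "(%x. sg (\<phi> m x) * pd i (\<phi> m) x * \<psi> x) \<in> borel_measurable M" for m
    by (intro borel_measurable_times sg_meas meas_smooth smooth_pd test_smooth[OF \<phi>(1)] test_smooth[OF \<psi>])
   show "(%x. sg (u x) * D i u x * \<psi> x) \<in> borel_measurable M"
    by (intro borel_measurable_times sg_meas H01_meas u meas_smooth test_smooth[OF \<psi>])
   show "AE x in M. (%m. sg (\<phi> m x) * pd i (\<phi> m) x * \<psi> x) ----> sg (u x) * D i u x * \<psi> x"
    using \<phi>(5,6)
   proof eventually_elim
    case (elim x)
    have "(%m. sg (\<phi> m x)) ----> sg (u x)" by (rule continuous_on_tendsto_compose[OF continuous_spow elim(1)]) auto
    then show ?case by (intro tendsto_intros elim)
   qed
   show "integrable M (%x. (pd i (\<phi> m) x)^2 + (Phi (\<phi> m x))^2)" for m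
    by (intro Bochner_Integration.integrable_add sqint_sq test_sqint(2)[OF \<phi>(1)] Phi_sqint test_pint \<phi>(1))
   show "(LINT x|M. (pd i (\<phi> m) x)^2 + (Phi (\<phi> m x))^2) <= Bd^2 + Bg^2" for m
   proof -
    have "(LINT x|M. (pd i (\<phi> m) x)^2 + (Phi (\<phi> m x))^2) = (nrm M (pd i (\<phi> m)))^2 + (nrm M (%x. Phi (\<phi> m x)))^2"
     unfolding nrm_sq by (intro Bochner_Integration.integral_add sqint_sq test_sqint(2)[OF \<phi>(1)] Phi_sqint test_pint \<phi>(1))
    also have "... <= Bd^2 + Bg^2" by (intro add_mono power_mono Bd Bg) auto
    finally show ?thesis .
   qed
   fix \<eta> :: real assume \<eta>: "\<eta> > 0"
   \<comment> \<open>Young's inequality between \<open>pd i (\<phi> m)\<close> and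
     \<open>sg (\<phi> m) * \<psi>\<close> leaves a factor \<open>1 / \<eta>\<close>, which
     \<open>\<zeta> <= \<eta>^2\<close> turns back into \<eta>.\<close>
   define \<zeta> where "\<zeta> = min (\<eta>^2) 1"
   have \<zeta>: "\<zeta> > 0" "\<zeta> <= \<eta>^2" using \<eta> by (auto simp: \<zeta>_def)
   define B where "B x = (1 / \<eta>) * ((\<zeta> + \<zeta> powr (- (2 * \<delta> + 1))) * (pw (\<psi> x)))" for x
   have "integrable M B" unfolding B_def by (intro integrable_mult_right pintD(2)[OF test_pint[OF \<psi>]])
   moreover have "\<bar>sg (\<phi> m x) * pd i (\<phi> m) x * \<psi> x\<bar> <= \<eta> * ((pd i (\<phi> m) x)^2 + (Phi (\<phi> m x))^2) + B x" for m x
   proof -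
    have "\<bar>s * t * q\<bar> <= \<eta> * t^2 + (1 / \<eta>) * (s^2 * q^2)" for s t q :: real
    proof -
     have "0 <= (\<eta> * \<bar>t\<bar> - \<bar>s * q\<bar>)^2" by simp
     then have "\<eta> * \<bar>s * t * q\<bar> * 2 <= \<eta>^2 * t^2 + s^2 * q^2"
      by (simp add: power2_diff power_mult_distrib abs_mult mult_ac)
     then have "\<eta> * \<bar>s * t * q\<bar> <= \<eta>^2 * t^2 + s^2 * q^2"
      using \<eta> by (smt (verit) abs_ge_zero mult_nonneg_nonneg)
     then have "(1 / \<eta>) * (\<eta> * \<bar>s * t * q\<bar>) <= (1 / \<eta>) * (\<eta>^2 * t^2 + s^2 * q^2)"
      using \<eta> by (intro mult_left_mono) auto
     then show ?thesis using \<eta> by (simp add: distrib_left power2_eq_square)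
    qed
    then have A: "\<bar>sg (\<phi> m x) * pd i (\<phi> m) x * \<psi> x\<bar> <= \<eta> * (pd i (\<phi> m) x)^2 + (1 / \<eta>) * ((sg (\<phi> m x))^2 * (\<psi> x)^2)" .
    have "(sg (\<phi> m x))^2 * (\<psi> x)^2 <= \<zeta> * ((pw (\<phi> m x)) + (pw (\<psi> x))) + \<zeta> powr (- (2 * \<delta> + 1)) * (pw (\<psi> x))"
     using young_eta[OF \<zeta>(1), of "\<phi> m x" "\<psi> x" "\<psi> x"] unfolding spow_sq by (simp add: power2_eq_square[of "\<psi> x"])
    also have "... <= \<eta>^2 * (pw (\<phi> m x)) + (\<zeta> + \<zeta> powr (- (2 * \<delta> + 1))) * (pw (\<psi> x))"
     using mult_right_mono[OF \<zeta>(2), of "(pw (\<phi> m x))"] by (simp add: algebra_simps)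
    finally have "(1 / \<eta>) * ((sg (\<phi> m x))^2 * (\<psi> x)^2) <=
      (1 / \<eta>) * (\<eta>^2 * (pw (\<phi> m x)) + (\<zeta> + \<zeta> powr (- (2 * \<delta> + 1))) * (pw (\<psi> x)))"
     using \<eta> by (intro mult_left_mono) auto
    note order_trans[OF A add_left_mono[OF this]]
    also have "\<eta> * (pd i (\<phi> m) x)^2 + (1 / \<eta>) * (\<eta>^2 * (pw (\<phi> m x)) + (\<zeta> + \<zeta> powr (- (2 * \<delta> + 1))) * (pw (\<psi> x))) =
      \<eta> * ((pd i (\<phi> m) x)^2 + (Phi (\<phi> m x))^2) + B x"
     unfolding B_def Phi_sq using \<eta> by (simp add: distrib_left power2_eq_square)
    finally show ?thesis .
   qed
   ultimately show "\<exists>B. integrable M B \<and> (\<forall>m. AE x in M. \<bar>sg (\<phi> m x) * pd i (\<phi> m) x * \<psi> x\<bar> <=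
     \<eta> * ((pd i (\<phi> m) x)^2 + (Phi (\<phi> m x))^2) + B x)" by (intro exI[of _ B]) simp
  qed simp
  then have "(%m. (\<delta> + 1) * (LINT x|M. sg (\<phi> m x) * pd i (\<phi> m) x * \<psi> x)) ----> (\<delta> + 1) * (LINT x|M. sg (u x) * D i u x * \<psi> x)"
   by (intro tendsto_intros)
  moreover have "(%m. - (LINT x|M. Phi (\<phi> m x) * pd i \<psi> x)) ----> - (LINT x|M. Phi (u x) * pd i \<psi> x)"
   by (intro tendsto_minus L2lim_inner Phi_L2lim[OF \<phi>H u \<phi>(4)] L2lim_const test_sqint \<psi>)
  ultimately show ?thesis unfolding advection_test[OF \<phi>(1) \<psi>] by (rule LIMSEQ_unique)
 qed
 have l1: "(%m. - (LINT x|M. Phi (u x) * pd i (\<theta> m) x)) ----> - (LINT x|M. Phi (u x) * D i v x)"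
  by (intro tendsto_minus L2lim_inner L2lim_const Phi_sqint Gc(2) u \<theta>(3))
 have "L2lim M (%m x. sg (u x) * \<theta> m x) (%x. sg (u x) * v x)"
 proof (rule L2limI_bound)
  show "sqint M (%x. sg (u x) * \<theta> m x)" for m by (intro sg_mult_sqint Gc(2) u \<theta>H)
  show "sqint M (%x. sg (u x) * v x)" by (intro sg_mult_sqint Gc(2) u v)
  fix m
  have d: "(%x. \<theta> m x - v x) \<in> H0" by (rule H01_diff(1)[OF \<theta>H v])
  have "(nrm M (%x. sg (u x) * \<theta> m x - sg (u x) * v x))^2 = (LINT x|M. (wt (u x)) * (\<theta> m x - v x)^2)"
   unfolding nrm_sq right_diff_distrib[symmetric] power_mult_distrib spow_sq ..
  also have "... <= (PI u + Gc) * (gn (%x. \<theta> m x - v x))^2" by (rule weighted_bound[OF Gc(2)[OF u] d])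
  finally have "sqrt ((nrm M (%x. sg (u x) * \<theta> m x - sg (u x) * v x))^2) <= sqrt ((PI u + Gc) * (gn (%x. \<theta> m x - v x))^2)"
   by (rule real_sqrt_le_mono)
  then show "nrm M (%x. sg (u x) * \<theta> m x - sg (u x) * v x) <= sqrt (PI u + Gc) * gn (%x. \<theta> m x - v x)"
   using grad_norm_nonneg[OF H01_W1[OF d]] by (simp add: real_sqrt_mult)
 next
  show "(%m. sqrt (PI u + Gc) * gn (%x. \<theta> m x - v x)) ----> 0"
   using tendsto_mult[OF tendsto_const[of "sqrt (PI u + Gc)"] \<theta>(4)] by simp
 qed
 from L2lim_inner[OF this L2lim_const[OF H01_sqint(2)[OF u, of i]]]
 have "(%m. (\<delta> + 1) * (LINT x|M. sg (u x) * D i u x * \<theta> m x)) ----> (\<delta> + 1) * (LINT x|M. sg (u x) * D i u x * v x)"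
  by (intro tendsto_intros) (simp add: mult_ac)
 then show ?thesis using l1 LIMSEQ_unique unfolding step[OF \<theta>(1)] by blast
qed

text \<open>The integrand is a partial derivative of a primitive of h composed with \<phi>. The
  primitive is needed only on a bounded interval that contains the range of \<phi>.\<close>

lemma test_antiderivative_zero:
 assumes \<phi>: "\<phi> \<in> test_functions \<Omega>" and h: "continuous_on UNIV h"
 shows "(LINT x|M. h (\<phi> x) * pd i \<phi> x) = 0"
proof -
 have s: "smooth \<phi>" by (rule test_smooth[OF \<phi>])
 obtain K where K: "compact K" "K \<subseteq> \<Omega>" "!!x. x \<notin> K ==> \<phi> x = 0" using \<phi> by (auto simp: test_functions_iff)
 have "compact (\<phi> ` K)" using K(1) smooth_continuous[OF s] by (intro compact_continuous_image)
 then obtain B where B: "B > 0" "\<forall>y\<in>\<phi> ` K. norm y <= B" using compact_imp_bounded bounded_pos by metis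
 have bd: "\<bar>\<phi> x\<bar> <= B" for x using B K(3) by (cases "x \<in> K") auto
 obtain W0 where W0: "!!t. t \<in> {- B - 1..B + 1} ==> (W0 has_vector_derivative h t) (at t within {- B - 1..B + 1})"
  using antiderivative_continuous[of "- B - 1" "B + 1" h] h by (metis continuous_on_subset top_greatest)
 have W: "(W0 has_real_derivative h t) (at t)" if "\<bar>t\<bar> <= B" for t
 proof -
  have "t \<in> {- B - 1..B + 1}" "t \<in> interior {- B - 1..B + 1}" using that by auto
  then show ?thesis using W0[of t] at_within_interior[of t "{- B - 1..B + 1}"]
   by (simp add: has_real_derivative_iff_has_vector_derivative)
 qed
 have der: "((%x. W0 (\<phi> x) - W0 0) has_derivative (%v. h (\<phi> x) * frechet_derivative \<phi> (at x) v)) (at x)" for x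
 proof -
  have d: "(\<phi> has_derivative frechet_derivative \<phi> (at x)) (at x)"
   using s by (auto intro!: pd_has_derivative smooth_differentiable)
  have "(W0 has_derivative (%v. h (\<phi> x) * v)) (at (\<phi> x))"
   using W[OF bd] by (simp add: has_field_derivative_def)
  from has_derivative_diff[OF has_derivative_compose[OF d this] has_derivative_const[of "W0 0"]]
  show ?thesis by simp
 qed
 have "continuous_on UNIV (%x. h (\<phi> x))" by (rule continuous_on_compose2[OF h smooth_continuous[OF s]]) auto
 then have c: "continuous_on UNIV (%x. h (\<phi> x) * frechet_derivative \<phi> (at x) (axis i 1))"
  using smooth_continuous[OF smooth_pd[OF s, of i], of UNIV] unfolding pd_def[symmetric] by (intro continuous_intros)
 from integral_partial_zero[OF der K(1,2) _ c] K(3) show ?thesis by (simp add: pd_def)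
qed

text \<open>The growth condition lets \<open>h\<close> of the approximations converge in L^2
  together with \<open>Phi\<close>. It serves every step where the drift is tested with a function
  of the solution itself and disappears.\<close>

lemma antiderivative_zero:
 assumes u: "u \<in> H0" and h: "continuous_on UNIV h" and le: "!!s. \<bar>h s\<bar> <= C * \<bar>Phi s\<bar>" and C: "C \<ge> 0"
 shows "(LINT x|M. h (u x) * D i u x) = 0" "sqint M (%x. h (u x))"
proof -
 obtain \<phi> where \<phi>: "!!m. \<phi> m \<in> test_functions \<Omega>" "L2lim M \<phi> u" "L2lim M (%m. pd i (\<phi> m)) (D i u)"
  "(%m. gn (%x. \<phi> m x - u x)) ----> 0" "AE x in M. (%m. \<phi> m x) ----> u x"
  by (rule H01E_AE[OF u, of i]) (rule that)
 have L: "L2lim M (%m x. h (\<phi> m x)) (%x. h (u x))"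
 proof (rule L2lim_dominated_by[OF Phi_L2lim[of \<phi>, OF H01_test[OF \<phi>(1)] u \<phi>(4)] _ _ le le C])
  show "(%x. h (\<phi> m x)) \<in> borel_measurable M" for m by (intro meas_compose[OF h] meas_smooth test_smooth[OF \<phi>(1)])
  show "(%x. h (u x)) \<in> borel_measurable M" by (intro meas_compose[OF h] H01_meas u)
  show "AE x in M. (%n. h (\<phi> n x)) ----> h (u x)"
   using \<phi>(5) by eventually_elim (rule continuous_on_tendsto_compose[OF h], auto)
 qed
 show "sqint M (%x. h (u x))" by (rule L2limD(2)[OF L])
 have "(%m. (LINT x|M. h (\<phi> m x) * pd i (\<phi> m) x)) ----> (LINT x|M. h (u x) * D i u x)"
  by (rule L2lim_inner[OF L \<phi>(3)])
 then show "(LINT x|M. h (u x) * D i u x) = 0"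
  unfolding test_antiderivative_zero[OF \<phi>(1) h] by (simp add: LIMSEQ_const_iff)
qed

end

section \<open>Regularised powers for the uniqueness proof\<close>

definition reg :: "real => real => real" where
 "reg eps w = w^2 + eps^2"

text \<open>Tends to \<open>|w| powr (2 * q)\<close> as eps tends to 0. The subtracted constant
  makes it vanish at 0, as zero boundary values require.\<close>

definition ypow :: "real => real => real => real" where
 "ypow q eps w = reg eps w powr q - (eps^2) powr q"

definition ypow' :: "real => real => real => real" where
 "ypow' q eps w = 2 * q * w * reg eps w powr (q - 1)"

text \<open>Tends to sign w times \<open>|w| powr (4 * q - 1)\<close>, the intended test function,
  whose derivative is singular at 0 without regularisation.\<close>

definition gpow :: "real => real => real => real" where
 "gpow q eps w = w * reg eps w powr (2 * q - 1)"

definition gpow' :: "real => real => real => real" where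
 "gpow' q eps w = reg eps w powr (2 * q - 2) * ((4 * q - 1) * w^2 + eps^2)"

lemma reg_pos: "eps > 0 ==> 0 < reg eps w"
 by (simp add: reg_def add_nonneg_pos)

lemma DERIV_reg_powr:
 assumes "eps > 0"
 shows "((%w. reg eps w powr r) has_real_derivative 2 * r * w * reg eps w powr (r - 1)) (at w)"
proof -
 have "(reg eps has_real_derivative 2 * w) (at w)"
  unfolding reg_def[abs_def] by (auto intro!: derivative_eq_intros)
 from DERIV_chain2[OF has_real_derivative_powr[OF reg_pos[OF assms]] this, of r]
 show ?thesis by (simp add: mult_ac)
qed

lemma DERIV_ypow: "eps > 0 ==> (ypow q eps has_real_derivative ypow' q eps w) (at w)"
 using DERIV_diff[OF DERIV_reg_powr[of eps q w] DERIV_const[of "(eps^2) powr q"]]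
 by (simp add: ypow_def[abs_def] ypow'_def)

lemma reg_powr_Suc: "eps > 0 ==> reg eps w powr r * reg eps w = reg eps w powr (r + 1)"
 using reg_pos[of eps w] by (simp add: powr_add)

lemma DERIV_gpow:
 assumes "eps > 0"
 shows "(gpow q eps has_real_derivative gpow' q eps w) (at w)"
proof -
 have eq: "reg eps w powr (2 * q - 1) = reg eps w powr (2 * q - 2) * (w^2 + eps^2)"
  using reg_powr_Suc[OF assms, of w "2 * q - 2"] by (simp add: reg_def)
 have "(gpow q eps has_real_derivative 1 * reg eps w powr (2 * q - 1) + 2 * (2 * q - 1) * w * reg eps w powr (2 * q - 1 - 1) * w) (at w)"
  unfolding gpow_def[abs_def] by (rule DERIV_mult[OF DERIV_ident DERIV_reg_powr[OF assms]])
 also have "1 * reg eps w powr (2 * q - 1) + 2 * (2 * q - 1) * w * reg eps w powr (2 * q - 1 - 1) * w = gpow' q eps w"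
  unfolding gpow'_def eq by (simp add: algebra_simps power2_eq_square)
 finally show ?thesis .
qed

context
 fixes q eps :: real
 assumes q: "1/4 < q" "q <= 5/16" and e: "0 < eps"
begin

lemma reg_smooth:
 assumes "smooth \<phi>"
 shows "smooth (%x. gpow q eps (\<phi> x))" "smooth (%x. ypow q eps (\<phi> x))"
proof -
 have p: "smooth (%x. reg eps (\<phi> x) powr r)" for r
  by (rule smooth_powr) (use e assms in \<open>auto simp: reg_def power2_eq_square intro!: smooth_add smooth_mult smooth_const add_nonneg_pos\<close>)
 show "smooth (%x. gpow q eps (\<phi> x))" unfolding gpow_def by (intro smooth_mult p assms)
 show "smooth (%x. ypow q eps (\<phi> x))" unfolding ypow_def by (intro smooth_diff p smooth_const)
qed

lemma reg_continuous: "continuous_on UNIV (gpow q eps)" "continuous_on UNIV (ypow q eps)"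
 "continuous_on UNIV (gpow' q eps)" "continuous_on UNIV (ypow' q eps)"
proof -
 have "continuous_on UNIV (%w. reg eps w powr r)" for r
  using DERIV_reg_powr[OF e] by (intro DERIV_continuous_on) (auto simp: has_field_derivative_at_within)
 then show "continuous_on UNIV (gpow q eps)" "continuous_on UNIV (ypow q eps)"
   "continuous_on UNIV (gpow' q eps)" "continuous_on UNIV (ypow' q eps)"
  unfolding gpow_def[abs_def] ypow_def[abs_def] gpow'_def[abs_def] ypow'_def[abs_def]
  by (auto intro!: continuous_on_mult continuous_on_add continuous_on_diff continuous_on_power continuous_on_const continuous_on_id)
qed

lemma reg_powr_le: "r <= 0 ==> reg eps w powr r <= (eps^2) powr r"
 using e by (intro powr_mono2') (auto simp: reg_def)

lemma gpow'_nonneg: "0 <= gpow' q eps w"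
 using q by (simp add: gpow'_def)

lemma gpow'_le: "w^2 * gpow' q eps w <= w * gpow q eps w"
 and gpow'_bound: "gpow' q eps w <= (eps^2) powr (2 * q - 1)"
proof -
 have "(4 * q - 1) * w^2 <= 1 * w^2" using q by (intro mult_right_mono) auto
 then have "gpow' q eps w <= reg eps w powr (2 * q - 2) * reg eps w"
  unfolding gpow'_def by (intro mult_left_mono) (auto simp: reg_def)
 then have le: "gpow' q eps w <= reg eps w powr (2 * q - 1)"
  using reg_powr_Suc[OF e, of w "2 * q - 2"] by simp
 from mult_left_mono[OF this, of "w^2"] show "w^2 * gpow' q eps w <= w * gpow q eps w"
  by (simp add: gpow_def power2_eq_square mult.assoc)
 show "gpow' q eps w <= (eps^2) powr (2 * q - 1)"
  using le reg_powr_le[of "2 * q - 1" w] q by linarith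
qed

lemma gpow_mult_nonneg: "0 <= w * gpow q eps w"
 by (simp add: gpow_def mult.assoc[symmetric])

text \<open>Compares the energy of \<open>ypow\<close>, to which Poincare applies, with the
  diffusion that \<open>gpow\<close> produces. Without regularisation this is an equality: both
  sides are \<open>4 * q^2 * (4 * q - 1) * |w| powr (4 * q - 2)\<close>. Hence only a multiple of
  \<open>4 * q - 1\<close> of the Poincare constant is recovered.\<close>

lemma ypow'_sq: "(ypow' q eps w)^2 * (4 * q - 1) <= 4 * q^2 * gpow' q eps w"
proof -
 have "(reg eps w powr (q - 1))^2 = reg eps w powr (2 * q - 2)"
  using powr_add[of "reg eps w" "q - 1" "q - 1"] by (simp add: power2_eq_square)
 then have "4 * q^2 * gpow' q eps w - (ypow' q eps w)^2 * (4 * q - 1) = 4 * q^2 * reg eps w powr (2 * q - 2) * eps^2"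
  unfolding gpow'_def ypow'_def by (simp add: algebra_simps power2_eq_square)
 moreover have "0 <= 4 * q^2 * reg eps w powr (2 * q - 2) * eps^2" by simp
 ultimately show ?thesis by linarith
qed

lemma ypow'_bound: "\<bar>ypow' q eps w\<bar> <= 4 * q^2 * (eps^2) powr (2 * q - 1) / (4 * q - 1) + 1"
proof -
 have "(ypow' q eps w)^2 <= 4 * q^2 * gpow' q eps w / (4 * q - 1)"
  using ypow'_sq[of w] q by (simp add: pos_le_divide_eq)
 also have "... <= 4 * q^2 * (eps^2) powr (2 * q - 1) / (4 * q - 1)"
  using q gpow'_bound[of w] by (intro divide_right_mono mult_left_mono) auto
 finally have "(ypow' q eps w)^2 <= 4 * q^2 * (eps^2) powr (2 * q - 1) / (4 * q - 1)" .
 moreover have "2 * \<bar>ypow' q eps w\<bar> <= (ypow' q eps w)^2 + 1"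
  using zero_le_power2[of "\<bar>ypow' q eps w\<bar> - 1"] by (simp add: power2_diff)
 ultimately show ?thesis by (smt (verit) abs_ge_zero)
qed

text \<open>Up to \<open>2 * q\<close>, \<open>gpow\<close> is the derivative of
  \<open>ypow^2 / 2 + (eps^2) powr q * ypow\<close>, the expression found in the drift
  integrals.\<close>

lemma gpow_ypow: "gpow q eps w = (ypow q eps w * ypow' q eps w + (eps^2) powr q * ypow' q eps w) / (2 * q)"
proof -
 have "reg eps w powr q * reg eps w powr (q - 1) = reg eps w powr (2 * q - 1)"
  by (simp add: powr_add[symmetric])
 then have "ypow q eps w * ypow' q eps w + (eps^2) powr q * ypow' q eps w = 2 * q * gpow q eps w"
  unfolding ypow_def ypow'_def gpow_def by (simp add: algebra_simps)
 then show ?thesis using q by simp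
qed

lemma ypow_nonneg: "0 <= ypow q eps w"
 unfolding ypow_def using q by (simp add: reg_def powr_mono2)

text \<open>Majorants that do not depend on eps; they exist because \<open>2 * q <= 1\<close>, so
  that \<open>1 + w^2\<close> dominates its own power.\<close>

lemma reg_growth:
 assumes "eps <= 1"
 shows "(ypow q eps w)^2 <= 1 + w^2" "w * gpow q eps w <= 1 + w^2" "w^2 * gpow' q eps w <= 1 + w^2"
  "((ypow q eps w)^2 / 2 + (eps^2) powr q * ypow q eps w) / (2 * q) <= 4 * (1 + w^2)"
  "0 <= ((ypow q eps w)^2 / 2 + (eps^2) powr q * ypow q eps w) / (2 * q)"
proof -
 have e1: "eps^2 <= 1" using assms e by (simp add: power_le_one)
 have "reg eps w powr (2 * q) <= (1 + w^2) powr (2 * q)" using q e1 by (intro powr_mono2) (auto simp: reg_def)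
 also have "... <= (1 + w^2) powr 1" using q by (intro powr_mono) auto
 also have "... = 1 + w^2" using add_nonneg_nonneg[of 1 "w^2"] by simp
 finally have r: "reg eps w powr (2 * q) <= 1 + w^2" .
 have "(ypow q eps w)^2 <= (reg eps w powr q)^2" using ypow_nonneg[of w] by (intro power_mono) (auto simp: ypow_def)
 also have "... = reg eps w powr (2 * q)" using powr_add[of "reg eps w" q q] by (simp add: power2_eq_square)
 finally show y: "(ypow q eps w)^2 <= 1 + w^2" using r by simp
 have "w * gpow q eps w = w^2 * reg eps w powr (2 * q - 1)" by (simp add: gpow_def power2_eq_square mult.assoc)
 also have "... <= reg eps w * reg eps w powr (2 * q - 1)" by (intro mult_right_mono) (auto simp: reg_def)
 also have "... = reg eps w powr (2 * q)" using reg_powr_Suc[OF e, of w "2 * q - 1"] by (simp add: mult.commute)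
 finally show g: "w * gpow q eps w <= 1 + w^2" using r by simp
 show "w^2 * gpow' q eps w <= 1 + w^2" using g gpow'_le[of w] by simp
 have "(eps^2) powr q <= 1" using e1 e q powr_mono2[of q "eps^2" 1] by simp
 then have "(eps^2) powr q * ypow q eps w <= 1 * ypow q eps w" using ypow_nonneg by (rule mult_right_mono)
 moreover have "2 * ypow q eps w <= 1 + (ypow q eps w)^2"
  using zero_le_power2[of "ypow q eps w - 1"] by (simp add: power2_diff)
 moreover have "0 <= w^2" by simp
 ultimately have "(ypow q eps w)^2 / 2 + (eps^2) powr q * ypow q eps w <= 2 * (1 + w^2)"
  using y unfolding mult_1 distrib_left by linarith
 also have "... <= 4 * (1 + w^2) * (2 * q)"
  using mult_left_mono[of 1 "4 * q" "2 * (1 + w^2)"] q by (simp add: mult_ac)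
 finally show "((ypow q eps w)^2 / 2 + (eps^2) powr q * ypow q eps w) / (2 * q) <= 4 * (1 + w^2)"
  using q by (simp add: pos_divide_le_eq)
 show "0 <= ((ypow q eps w)^2 / 2 + (eps^2) powr q * ypow q eps w) / (2 * q)"
  using q ypow_nonneg[of w] by simp
qed

end

lemma reg_limits:
 fixes e :: "nat => real"
 assumes q: "1/4 < q" "q <= 5/16" and e: "!!n. 0 < e n" "e ----> 0"
 shows "(%n. (ypow q (e n) w)^2) ----> \<bar>w\<bar> powr (4 * q)"
  "(%n. w * gpow q (e n) w) ----> \<bar>w\<bar> powr (4 * q)"
  "(%n. w^2 * gpow' q (e n) w) ----> (4 * q - 1) * \<bar>w\<bar> powr (4 * q)"
  "(%n. ((ypow q (e n) w)^2 / 2 + ((e n)^2) powr q * ypow q (e n) w) / (2 * q)) ----> \<bar>w\<bar> powr (4 * q) / (4 * q)"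
proof -
 have e2: "(%n. (e n)^2) ----> 0" using tendsto_power[OF e(2), of 2] by simp
 have ep: "(%n. ((e n)^2) powr q) ----> 0"
  using tendsto_powr'[OF e2 tendsto_const[of q]] q by simp
 have r: "(%n. reg (e n) w) ----> w^2" unfolding reg_def using tendsto_add[OF tendsto_const e2, of "w^2"] by simp
 have w2: "(w^2) powr s = \<bar>w\<bar> powr (2 * s)" for s
  using powr_powr[of "\<bar>w\<bar>" 2 s] by (cases "w = 0") (auto simp: powr_numeral[of "\<bar>w\<bar>"])
 have r0: "0 <= reg (e n) w" for n by (simp add: reg_def)
 have rp: "(%n. reg (e n) w powr q) ----> \<bar>w\<bar> powr (2 * q)"
  using tendsto_powr'[OF r tendsto_const[of q]] q r0 by (simp add: w2)
 have y: "(%n. ypow q (e n) w) ----> \<bar>w\<bar> powr (2 * q)"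
  unfolding ypow_def using tendsto_diff[OF rp ep] by simp
 have "(%n. (ypow q (e n) w)^2) ----> (\<bar>w\<bar> powr (2 * q))^2" by (intro tendsto_intros y)
 also have "(\<bar>w\<bar> powr (2 * q))^2 = \<bar>w\<bar> powr (4 * q)" by (simp add: power2_eq_square powr_add[symmetric])
 finally show y2: "(%n. (ypow q (e n) w)^2) ----> \<bar>w\<bar> powr (4 * q)" .
 have "(%n. ((ypow q (e n) w)^2 / 2 + ((e n)^2) powr q * ypow q (e n) w) / (2 * q)) ---->
   (\<bar>w\<bar> powr (4 * q) / 2 + 0 * \<bar>w\<bar> powr (2 * q)) / (2 * q)"
  by (intro tendsto_intros y2 ep y) (use q in auto)
 then show "(%n. ((ypow q (e n) w)^2 / 2 + ((e n)^2) powr q * ypow q (e n) w) / (2 * q)) ----> \<bar>w\<bar> powr (4 * q) / (4 * q)"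
  by simp
 show "(%n. w * gpow q (e n) w) ----> \<bar>w\<bar> powr (4 * q)"
  "(%n. w^2 * gpow' q (e n) w) ----> (4 * q - 1) * \<bar>w\<bar> powr (4 * q)"
 proof (atomize (full), cases "w = 0")
  case True then show "(%n. w * gpow q (e n) w) ----> \<bar>w\<bar> powr (4 * q) \<and>
   (%n. w^2 * gpow' q (e n) w) ----> (4 * q - 1) * \<bar>w\<bar> powr (4 * q)" by simp
 next
  case False
  have p: "\<bar>w\<bar> powr s * w^2 = \<bar>w\<bar> powr (s + 2)" for s
   using False by (simp add: powr_add powr_numeral)
  have rr: "(%n. reg (e n) w powr s) ----> \<bar>w\<bar> powr (2 * s)" for s
   using tendsto_powr[OF r tendsto_const[of s]] False by (simp add: w2)
  have 1: "w * (w * \<bar>w\<bar> powr (2 * (2 * q - 1))) = \<bar>w\<bar> powr (4 * q)"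
   using p[of "2 * (2 * q - 1)"] by (simp add: power2_eq_square mult_ac)
  have "w^2 * (\<bar>w\<bar> powr (2 * (2 * q - 2)) * ((4 * q - 1) * w^2 + 0)) = (4 * q - 1) * ((\<bar>w\<bar> powr (2 * (2 * q - 2)) * w^2) * w^2)"
   by simp
  also have "... = (4 * q - 1) * \<bar>w\<bar> powr (4 * q)" unfolding p by simp
  finally have 2: "w^2 * (\<bar>w\<bar> powr (2 * (2 * q - 2)) * ((4 * q - 1) * w^2 + 0)) = (4 * q - 1) * \<bar>w\<bar> powr (4 * q)" .
  have "(%n. w * (w * reg (e n) w powr (2 * q - 1))) ----> w * (w * \<bar>w\<bar> powr (2 * (2 * q - 1)))"
   by (intro tendsto_intros rr)
  moreover have "(%n. w^2 * (reg (e n) w powr (2 * q - 2) * ((4 * q - 1) * w^2 + (e n)^2))) ---->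
    w^2 * (\<bar>w\<bar> powr (2 * (2 * q - 2)) * ((4 * q - 1) * w^2 + 0))"
   by (intro tendsto_intros rr e2)
  ultimately show "(%n. w * gpow q (e n) w) ----> \<bar>w\<bar> powr (4 * q) \<and>
   (%n. w^2 * gpow' q (e n) w) ----> (4 * q - 1) * \<bar>w\<bar> powr (4 * q)"
   unfolding 1 2 gpow_def gpow'_def ..
 qed
qed

text \<open>All terms are of order u. As \<open>q <= 5/16\<close>, Poincare contributes at least
  8/25 of \<open>lam * \<nu> * u\<close>. The weight costs at most
  \<open>\<nu> * B * (u - u^2)\<close>, and completing the square against half of the reaction
  leaves \<open>2 * \<nu> * B * u^2\<close>. Smallness means \<open>B <= lam / 12\<close>, so the
  total loss is at most \<open>lam * \<nu> * u / 6\<close>, and 8/25 - 1/6 exceeds 1/10.\<close>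

lemma limit_coefficient_pos:
 fixes u B \<nu> lam q \<beta> s b c :: real
 assumes u: "0 < u" "u <= 1" and q: "q = (1 + u / 4) / 4" and pos: "\<nu> > 0" "\<beta> > 0" "s > 0" "lam > 0"
  and small: "3 * b^2 <= \<beta> * s * \<nu> * lam"
 shows "\<nu> * lam * u / 10 <= lam * \<nu> * (u / 4) / (8 * q^2) - \<nu> * ((1 - u) * u * (b^2 / (4 * \<beta> * s * \<nu>))) / (4 * q)
   - u * b * c + (\<beta> * s - \<beta> * s * (1 - u) / 2) * c^2"
proof -
 define B where "B = b^2 / (4 * \<beta> * s * \<nu>)"
 have bs: "\<beta> * s > 0" "\<beta> * s * \<nu> > 0" using pos by auto
 have B0: "0 <= B" using pos by (simp add: B_def)
 have "b^2 <= (lam / 12) * (4 * \<beta> * s * \<nu>)" using small by (simp add: mult_ac)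
 then have B1: "B <= lam / 12" unfolding B_def using bs by (subst pos_divide_le_eq) (auto simp: mult_ac)
 have bB: "b^2 = 4 * (\<beta> * s) * \<nu> * B" using pos by (simp add: B_def)
 have qb: "1/4 <= q" "q <= 5/16" using u q by auto
 have "8 * q^2 <= 8 * (5/16)^2" using qb by (intro mult_left_mono power_mono) auto
 then have "8 * q^2 <= 25 / 32" by (simp add: power2_eq_square)
 then have "lam * \<nu> * (u / 4) / (25 / 32) <= lam * \<nu> * (u / 4) / (8 * q^2)"
  using qb u pos by (intro divide_left_mono) auto
 then have 1: "8 / 25 * (lam * \<nu> * u) <= lam * \<nu> * (u / 4) / (8 * q^2)" by (simp add: mult_ac)
 have "\<nu> * ((1 - u) * u * B) / (4 * q) <= \<nu> * ((1 - u) * u * B) / 1"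
  using qb u pos B0 by (intro divide_left_mono) auto
 then have 2: "\<nu> * ((1 - u) * u * B) / (4 * q) <= \<nu> * B * u - \<nu> * B * u^2" by (simp add: algebra_simps power2_eq_square)
 have "0 <= (\<beta> * s * c - u * b)^2" by simp
 also have "(\<beta> * s * c - u * b)^2 = (\<beta> * s) * (\<beta> * s * c^2 - 2 * u * b * c) + u^2 * b^2"
  by (simp add: power2_diff power_mult_distrib algebra_simps power2_eq_square)
 also have "... = (\<beta> * s) * (\<beta> * s * c^2 - 2 * u * b * c + 4 * u^2 * \<nu> * B)"
  unfolding bB by (simp add: algebra_simps)
 finally have "0 <= (\<beta> * s) * (\<beta> * s * c^2 - 2 * u * b * c + 4 * u^2 * \<nu> * B)" .
 then have 3: "0 <= \<beta> * s * c^2 - 2 * u * b * c + 4 * u^2 * \<nu> * B" using bs(1) by (simp add: zero_le_mult_iff)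
 have "\<beta> * s * c^2 / 2 <= \<beta> * s * c^2 / 2 * (1 + u)"
  using mult_left_mono[of 1 "1 + u" "\<beta> * s * c^2 / 2"] bs(1) u by simp
 also have "\<beta> * s * c^2 / 2 * (1 + u) = (\<beta> * s - \<beta> * s * (1 - u) / 2) * c^2" by (simp add: field_simps)
 finally have 4: "\<beta> * s * c^2 / 2 <= (\<beta> * s - \<beta> * s * (1 - u) / 2) * c^2" .
 have 5: "\<nu> * B * u^2 <= \<nu> * B * u"
  using u pos B0 by (intro mult_left_mono) (auto simp: power2_eq_square mult_le_cancel_left1)
 have 6: "\<nu> * B * u <= lam * \<nu> * u / 12"
  using mult_right_mono[OF B1, of "\<nu> * u"] u pos by (simp add: mult_ac)
 have "0 <= lam * \<nu> * u" using pos u by simp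
 then show ?thesis unfolding B_def[symmetric] using 1 2 3 4 5 6 by (simp add: algebra_simps)
qed

section \<open>Uniqueness for the linear limit equation\<close>

context bounded_domain
begin

lemma H01_integral_zero:
 assumes "v \<in> H0" shows "(LINT x|M. D i v x) = 0"
proof -
 have s: "sqint M (%x. 1)" by (intro smooth_sqint smooth_const)
 have "has_weak_deriv \<Omega> {#i#} (%x. 1) (%x. 0)"
  unfolding has_weak_deriv_single using sqint_locally_integrable[OF s] sqint_locally_integrable[OF sqint_zero]
  by (simp add: test_integral_pd_zero)
 from weak_deriv_parts[OF s sqint_zero this assms] show ?thesis by simp
qed

text \<open>The advection acts along the direction (1, ..., 1), so the weight decays in that
  direction and every partial derivative multiplies it by the same constant - k.\<close>

definition wgt :: "real => real ^ 'n => real" where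
 "wgt k x = exp (- k * (\<Sum>j\<in>UNIV. x $ j))"

lemma smooth_wgt: "smooth (wgt k)"
 unfolding wgt_def[abs_def] by (intro smooth_exp smooth_mult smooth_const smooth_sum smooth_coord)

lemma pd_wgt: "pd i (wgt k) x = - k * wgt k x"
proof -
 have "(wgt k has_derivative (%h. exp (- k * (\<Sum>j\<in>UNIV. x $ j)) * (- k * (\<Sum>j\<in>UNIV. h $ j)))) (at x)"
  unfolding wgt_def[abs_def]
  by (auto intro!: derivative_eq_intros bounded_linear.has_derivative[OF bounded_linear_vec_nth])
 from pd_eq[OF this, of i] show ?thesis by (simp add: wgt_def axis_def if_distrib cong: if_cong)
qed

lemma wgt_pos: "0 < wgt k x" by (simp add: wgt_def)

lemma wgt_sq: "(wgt (k / 2) x)^2 = wgt k x"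
 by (simp add: wgt_def power2_eq_square exp_add[symmetric] mult_exp_exp)

context
 fixes w :: "real ^ 'n => real" and q eps k :: real
 assumes w: "w \<in> H0" and q: "1/4 < q" "q <= 5/16" and e: "0 < eps"
begin

lemma reg_H01:
 shows "(%x. gpow q eps (w x) * wgt k x) \<in> H0"
  "AE x in M. D i (%x. gpow q eps (w x) * wgt k x) x = gpow' q eps (w x) * D i w x * wgt k x - k * (gpow q eps (w x) * wgt k x)"
  "(%x. ypow q eps (w x) * wgt k' x) \<in> H0"
  "AE x in M. D i (%x. ypow q eps (w x) * wgt k' x) x = ypow' q eps (w x) * D i w x * wgt k' x - k' * (ypow q eps (w x) * wgt k' x)"
proof -
 have z: "gpow q eps 0 = 0" "ypow q eps 0 = 0" by (auto simp: gpow_def ypow_def reg_def)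
 have b: "\<bar>gpow' q eps s\<bar> <= (eps^2) powr (2 * q - 1)" for s
  using gpow'_nonneg[OF q e, of s] gpow'_bound[OF q e, of s] by simp
 note g = H01_chain[OF w smooth_wgt reg_smooth(1)[OF q e] z(1) DERIV_gpow[OF e] reg_continuous(3)[OF q e] b]
 note y = H01_chain[OF w smooth_wgt reg_smooth(2)[OF q e] z(2) DERIV_ypow[OF e] reg_continuous(4)[OF q e] ypow'_bound[OF q e]]
 show "(%x. gpow q eps (w x) * wgt k x) \<in> H0" "(%x. ypow q eps (w x) * wgt k' x) \<in> H0"
  using g(1) y(1) by simp_all
 show "AE x in M. D i (%x. gpow q eps (w x) * wgt k x) x = gpow' q eps (w x) * D i w x * wgt k x - k * (gpow q eps (w x) * wgt k x)"
 proof -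
  have "AE x in M. D i (%x. gpow q eps (w x) * wgt k x) x = gpow' q eps (w x) * D i w x * wgt k x + gpow q eps (w x) * pd i (wgt k) x"
   by (rule g(2))
  then show ?thesis by eventually_elim (simp add: pd_wgt algebra_simps)
 qed
 show "AE x in M. D i (%x. ypow q eps (w x) * wgt k' x) x = ypow' q eps (w x) * D i w x * wgt k' x - k' * (ypow q eps (w x) * wgt k' x)"
 proof -
  have "AE x in M. D i (%x. ypow q eps (w x) * wgt k' x) x = ypow' q eps (w x) * D i w x * wgt k' x + ypow q eps (w x) * pd i (wgt k') x"
   by (rule y(2))
  then show ?thesis by eventually_elim (simp add: pd_wgt algebra_simps)
 qed
qed

lemma reg_meas:
 "(%x. gpow q eps (w x)) \<in> borel_measurable M" "(%x. ypow q eps (w x)) \<in> borel_measurable M"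
 "(%x. gpow' q eps (w x)) \<in> borel_measurable M" "(%x. ypow' q eps (w x)) \<in> borel_measurable M"
 by (rule meas_compose[OF reg_continuous(1)[OF q e] H01_meas(1)[OF w]] meas_compose[OF reg_continuous(2)[OF q e] H01_meas(1)[OF w]]
   meas_compose[OF reg_continuous(3)[OF q e] H01_meas(1)[OF w]] meas_compose[OF reg_continuous(4)[OF q e] H01_meas(1)[OF w]])+

lemma reg_sqint:
 shows "sqint M f ==> sqint M (%x. f x * (gpow' q eps (w x) * wgt k' x))"
  "sqint M f ==> sqint M (%x. f x * (ypow' q eps (w x) * wgt k' x))"
proof -
 obtain BE where BE: "BE > 0" "!!x. x \<in> \<Omega> ==> \<bar>wgt k' x\<bar> <= BE" by (rule smooth_bounded[OF smooth_wgt]) (rule that)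
 have b1: "\<bar>gpow' q eps (w x) * wgt k' x\<bar> <= (eps^2) powr (2 * q - 1) * BE" if "x \<in> \<Omega>" for x
  unfolding abs_mult using gpow'_nonneg[OF q e, of "w x"] gpow'_bound[OF q e, of "w x"] BE(2)[OF that] by (intro mult_mono) auto
 have b2: "\<bar>ypow' q eps (w x) * wgt k' x\<bar> <= (4 * q^2 * (eps^2) powr (2 * q - 1) / (4 * q - 1) + 1) * BE" if "x \<in> \<Omega>" for x
  unfolding abs_mult using ypow'_bound[OF q e, of "w x"] BE(2)[OF that] BE(1)
  by (intro mult_mono) (auto intro: order_trans[OF abs_ge_zero])
 show "sqint M (%x. f x * (gpow' q eps (w x) * wgt k' x))" if "sqint M f"
  by (rule sqint_mult_bounded[OF that borel_measurable_times[OF reg_meas(3) meas_smooth[OF smooth_wgt]] b1])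
 show "sqint M (%x. f x * (ypow' q eps (w x) * wgt k' x))" if "sqint M f"
  by (rule sqint_mult_bounded[OF that borel_measurable_times[OF reg_meas(4) meas_smooth[OF smooth_wgt]] b2])
qed

text \<open>The drift term is integrated by parts through the square \<open>ypow^2\<close>, since a primitive of
 \<open>gpow\<close> has unbounded derivative.\<close>

lemma drift_term:
 "(LINT x|M. gpow q eps (w x) * D i w x * wgt k x) =
   k * (LINT x|M. ((ypow q eps (w x))^2 / 2 + (eps^2) powr q * ypow q eps (w x)) / (2 * q) * wgt k x)" (is ?drift)
 and weighted_poincare:
 "(!!v. v \<in> H0 ==> lam * (nrm M v)^2 <= (gn v)^2) ==>
  lam * (LINT x|M. (ypow q eps (w x))^2 * wgt k x) <= (\<Sum>i\<in>UNIV. (LINT x|M. (ypow' q eps (w x))^2 * (D i w x)^2 * wgt k x))"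
proof -
 define y where "y x = ypow q eps (w x)" for x
 define y' where "y' x = ypow' q eps (w x)" for x
 \<comment> \<open>The square root of the weight: Poincare is applied to \<open>y * F\<close>, so
   that its square carries the full weight.\<close>
 define F where "F = wgt (k / 2)"
 note Y = reg_H01(3,4)[where k' = "k / 2", folded y_def y'_def F_def]
 have FF: "F x * F x = wgt k x" for x using wgt_sq[of k x] by (simp add: F_def power2_eq_square)
 have sy: "sqint M (%x. y x * F x)" by (rule H01_sqint(1)[OF Y(1)])
 have sy': "sqint M (%x. y' x * D i w x * F x)" for i
  using reg_sqint(2)[OF H01_sqint(2)[OF w, of i], of "k / 2"] by (simp add: y'_def F_def mult_ac)
 have i1: "integrable M (%x. (y x)^2 * wgt k x)"
  using sqint_sq[OF sy] by (simp add: power_mult_distrib F_def wgt_sq)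
 have i2: "integrable M (%x. y x * y' x * D i w x * wgt k x)" for i
  using sqint_mult_integrable[OF sy sy'[of i]] unfolding FF[symmetric] by (simp add: mult_ac)
 have i3: "integrable M (%x. (y' x)^2 * (D i w x)^2 * wgt k x)" for i
  using sqint_sq[OF sy'[of i]] by (simp add: power_mult_distrib F_def wgt_sq)
 \<comment> \<open>The derivative of \<open>(y * F)^2\<close> integrates to 0.\<close>
 have cross: "(LINT x|M. y x * y' x * D i w x * wgt k x) = k / 2 * (LINT x|M. (y x)^2 * wgt k x)" for i
 proof -
  have "(LINT x|M. y x * F x * D i (%x. y x * F x) x) = - (LINT x|M. D i (%x. y x * F x) x * (y x * F x))"
   by (rule H01_parts[OF Y(1) Y(1)])
  then have "(LINT x|M. D i (%x. y x * F x) x * (y x * F x)) = 0" by (simp add: mult.commute)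
  also have "(LINT x|M. D i (%x. y x * F x) x * (y x * F x)) =
    (LINT x|M. (y' x * D i w x * F x - k / 2 * (y x * F x)) * (y x * F x))"
   by (rule D_cong_nrm(2)[OF H01_W1[OF Y(1)] _ Y(2) sy]) (intro sqint_diff sy' sqint_cmult sy)
  also have "... = (LINT x|M. y x * y' x * D i w x * wgt k x - k / 2 * ((y x)^2 * wgt k x))"
   unfolding FF[symmetric] by (intro Bochner_Integration.integral_cong refl) (simp add: algebra_simps power2_eq_square)
  also have "... = (LINT x|M. y x * y' x * D i w x * wgt k x) - k / 2 * (LINT x|M. (y x)^2 * wgt k x)"
   using i1 i2[of i] by simp
  finally show ?thesis by simp
 qed
 note Y1 = reg_H01(3,4)[where k' = k, folded y_def y'_def]
 have iy: "integrable M (%x. y x * wgt k x)" by (rule sqint_integrable[OF H01_sqint(1)[OF Y1(1)]])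
 have iy': "integrable M (%x. y' x * D i w x * wgt k x)" for i
  using sqint_integrable[OF reg_sqint(2)[OF H01_sqint(2)[OF w, of i], of k]] by (simp add: y'_def mult_ac)
 have lin: "(LINT x|M. y' x * D i w x * wgt k x) = k * (LINT x|M. y x * wgt k x)" for i
 proof -
  have "0 = (LINT x|M. y' x * D i w x * wgt k x - k * (y x * wgt k x))"
   unfolding H01_integral_zero[OF Y1(1), of i, symmetric]
   by (rule integral_cong_AE) (use Y1(2) iy iy'[of i] H01_meas(2)[OF Y1(1)] in \<open>auto intro!: borel_measurable_integrable\<close>)
  then show ?thesis using iy iy'[of i] by simp
 qed
 show ?drift
 proof -
  have "(LINT x|M. gpow q eps (w x) * D i w x * wgt k x) =
    (LINT x|M. (1 / (2 * q)) * (y x * y' x * D i w x * wgt k x) + ((eps^2) powr q / (2 * q)) * (y' x * D i w x * wgt k x))"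
   unfolding gpow_ypow[OF q e] y_def y'_def
   by (intro Bochner_Integration.integral_cong refl) (simp add: algebra_simps add_divide_distrib)
  also have "... = (1 / (2 * q)) * (k / 2 * (LINT x|M. (y x)^2 * wgt k x)) + ((eps^2) powr q / (2 * q)) * (k * (LINT x|M. y x * wgt k x))"
   unfolding cross[of i, symmetric] lin[of i, symmetric] using i2[of i] iy'[of i] by simp
  also have "... = k * (LINT x|M. (1 / (4 * q)) * ((y x)^2 * wgt k x) + ((eps^2) powr q / (2 * q)) * (y x * wgt k x))"
   unfolding Bochner_Integration.integral_add[OF integrable_mult_right[OF i1] integrable_mult_right[OF iy]] integral_mult_right_zero
   by (simp add: algebra_simps)
  also have "... = k * (LINT x|M. ((y x)^2 / 2 + (eps^2) powr q * y x) / (2 * q) * wgt k x)"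
   by (intro arg_cong[where f = "%t. k * t"] Bochner_Integration.integral_cong refl)
    (simp add: algebra_simps add_divide_distrib)
  finally show ?thesis by (simp add: y_def)
 qed
 assume poin: "!!v. v \<in> H0 ==> lam * (nrm M v)^2 <= (gn v)^2"
 have "(nrm M (D i (%x. y x * F x)))^2 <= (LINT x|M. (y' x)^2 * (D i w x)^2 * wgt k x)" for i
 proof -
  have s: "sqint M (%x. y' x * D i w x * F x - k / 2 * (y x * F x))" by (intro sqint_diff sy' sqint_cmult sy)
  have "(nrm M (D i (%x. y x * F x)))^2 = (nrm M (%x. y' x * D i w x * F x - k / 2 * (y x * F x)))^2"
   unfolding D_cong_nrm(1)[OF H01_W1[OF Y(1)] s Y(2)] ..
  also have "... = (LINT x|M. (y' x)^2 * (D i w x)^2 * wgt k x - k * (y x * y' x * D i w x * wgt k x) + k^2 / 4 * ((y x)^2 * wgt k x))"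
   unfolding nrm_sq FF[symmetric]
   by (intro Bochner_Integration.integral_cong refl) (simp add: power2_diff algebra_simps power2_eq_square)
  also have "... = (LINT x|M. (y' x)^2 * (D i w x)^2 * wgt k x) - k * (k / 2 * (LINT x|M. (y x)^2 * wgt k x)) + k^2 / 4 * (LINT x|M. (y x)^2 * wgt k x)"
   unfolding cross[of i, symmetric] using i1 i2[of i] i3[of i] by simp
  \<comment> \<open>The cross term contributes - k^2 / 2 and the square of the derivative of
    \<open>F\<close> only k^2 / 4, so the effect of the weight is negative and may be
    dropped.\<close>
  also have "... = (LINT x|M. (y' x)^2 * (D i w x)^2 * wgt k x) - k^2 / 4 * (LINT x|M. (y x)^2 * wgt k x)"
   by (simp add: power2_eq_square)
  also have "... <= (LINT x|M. (y' x)^2 * (D i w x)^2 * wgt k x)"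
   using wgt_pos by (simp add: Bochner_Integration.integral_nonneg less_imp_le)
  finally show ?thesis .
 qed
 then have "(gn (%x. y x * F x))^2 <= (\<Sum>i\<in>UNIV. (LINT x|M. (y' x)^2 * (D i w x)^2 * wgt k x))"
  unfolding grad_norm_sq[OF H01_W1[OF Y(1)]] by (intro sum_mono)
 moreover have "(nrm M (%x. y x * F x))^2 = (LINT x|M. (y x)^2 * wgt k x)"
  by (simp add: nrm_sq power_mult_distrib F_def wgt_sq)
 ultimately show "lam * (LINT x|M. (ypow q eps (w x))^2 * wgt k x) <=
   (\<Sum>i\<in>UNIV. (LINT x|M. (ypow' q eps (w x))^2 * (D i w x)^2 * wgt k x))"
  using poin[OF Y(1)] by (simp add: y_def y'_def)
qed

end

text \<open>The equation is tested with \<open>gpow q eps w * wgt k\<close>. The derivative of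
  \<open>gpow\<close> brings the factor \<open>4 * q - 1\<close> to the charge that the drift leaves
  on the reaction, so a small exponent serves every size of a. What remains is collected in
  \<open>Q eps\<close>, whose weighted integral is at most 0; its limit \<open>Q0\<close> is at
  least a positive multiple of \<open>|w| powr (4 * q)\<close>, and this forces w = 0.\<close>

lemma limit_equation_unique:
 assumes w: "w \<in> H0"
  and poin: "!!v. v \<in> H0 ==> lam * (nrm M v)^2 <= (gn v)^2"
  and c: "sqint M c" "sqint M (%x. c x * w x)" and m: "m \<in> borel_measurable M" "!!x. s * (c x)^2 <= m x"
  and pos: "\<nu> > 0" "a > 0" "\<beta> > 0" "s > 0" "lam > 0" "g \<ge> 0"
  and small: "3 * b^2 <= \<beta> * s * \<nu> * lam"
  and int: "!!\<xi>. \<xi> \<in> H0 ==> integrable M (%x. m x * w x * \<xi> x)"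
  and eq: "!!\<xi>. \<xi> \<in> H0 ==> \<nu> * gi w \<xi> - a * (\<Sum>i\<in>UNIV. (LINT x|M. c x * w x * D i \<xi> x))
    - b * (LINT x|M. c x * w x * \<xi> x) + g * (LINT x|M. w x * \<xi> x) + \<beta> * (LINT x|M. m x * w x * \<xi> x) = 0"
 shows "AE x in M. w x = 0"
proof -
 define d where "d = real CARD('n)"
 have d: "d > 0" by (simp add: d_def)
 \<comment> \<open>The strength of the drift against diffusion and reaction.\<close>
 define T where "T = d * a^2 / (4 * \<beta> * s * \<nu>)"
 have T: "T > 0" using d pos by (simp add: T_def)
 \<comment> \<open>The solution of \<open>T * u = 1 - u\<close>: then the drift consumes the share
   (1 - u) / 2 of the reaction and the rest exceeds one half of it.\<close>
 define u where "u = 1 / (1 + T)"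
 have u: "0 < u" "u <= 1" and Tu: "T * u = 1 - u" using T by (auto simp: u_def field_simps)
 \<comment> \<open>Makes \<open>4 * q - 1 = u / 4\<close>, the power of |w| in the test
   function.\<close>
 define q where "q = (1 + u / 4) / 4"
 have q: "1/4 < q" "q <= 5/16" using u by (auto simp: q_def)
 have pp: "4 * q - 1 = u / 4" unfolding q_def by (simp add: add_divide_distrib)
 \<comment> \<open>Differentiating the weight adds \<open>d * a * k\<close> times the integral of
   \<open>c * w * \<xi>\<close>. This k cancels the share 1 - u of the term with b, so what is left
   of it is of order u like the Poincare gain.\<close>
 define k where "k = (1 - u) * b / (d * a)"
 have dak: "d * a * k = (1 - u) * b" using d pos by (simp add: k_def)
 have dT: "d * a^2 = 4 * \<beta> * s * \<nu> * T" using pos by (simp add: T_def)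
 have dk: "d * k^2 = (1 - u) * u * (b^2 / (4 * \<beta> * s * \<nu>))"
 proof -
  have "(d * a^2) * (d * k^2) = ((1 - u) * b)^2" unfolding dak[symmetric] by (simp add: power2_eq_square)
  also have "... = (1 - u) * (T * u) * b^2" unfolding Tu by (simp add: power2_eq_square)
  finally have "T * (4 * \<beta> * s * \<nu> * (d * k^2)) = T * ((1 - u) * u * b^2)" unfolding dT by (simp add: mult_ac)
  then have "4 * \<beta> * s * \<nu> * (d * k^2) = (1 - u) * u * b^2" using T by simp
  then show ?thesis using pos by (simp add: eq_divide_eq mult_ac)
 qed
 \<comment> \<open>The Poincare gain from half of the diffusion, by \<open>ypow'_sq\<close> with
   \<open>4 * q - 1 = u / 4\<close>.\<close>
 define k1 where "k1 = lam * \<nu> * (u / 4) / (8 * q^2)"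
 have k1: "0 <= k1" using pos u by (simp add: k1_def)
 define \<Gamma> where "\<Gamma> eps t = ((ypow q eps t)^2 / 2 + (eps^2) powr q * ypow q eps t) / (2 * q)" for eps t
 \<comment> \<open>The terms are, in order: Poincare gain, cost of the weight, remaining linear
   term, reaction bounded below by \<open>s * c^2\<close>, and the charge of the drift.\<close>
 define Q where "Q eps x = k1 * (ypow q eps (w x))^2 - \<nu> * (d * k^2) * \<Gamma> eps (w x) - u * b * c x * (w x * gpow q eps (w x))
  + \<beta> * s * (c x)^2 * (w x * gpow q eps (w x)) - d * a^2 / (2 * \<nu>) * (c x)^2 * ((w x)^2 * gpow' q eps (w x))" for eps x
 define Q0 where "Q0 x = \<bar>w x\<bar> powr (4 * q) * (k1 - \<nu> * (d * k^2) / (4 * q) - u * b * c x + (\<beta> * s - \<beta> * s * (1 - u) / 2) * (c x)^2)" for x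
 obtain BE where BE: "BE > 0" "!!x. x \<in> \<Omega> ==> \<bar>wgt k x\<bar> <= BE" by (rule smooth_bounded[OF smooth_wgt]) (rule that)
 have E0: "0 <= wgt k x" for x using wgt_pos[of k x] by simp
 \<comment> \<open>A majorant for all eps at once. Expanded, it requires exactly the squares of 1,
   c, w and \<open>c * w\<close> to be integrable.\<close>
 define R where "R x = (1 + (c x)^2) * (1 + (w x)^2) * BE" for x
 have ws: "sqint M w" by (rule H01_sqint(1)[OF w])
 have cm: "c \<in> borel_measurable M" and wm: "w \<in> borel_measurable M" using c(1) ws by (auto simp: sqint_def)
 have R: "integrable M R"
 proof -
  have "integrable M (%x. BE * (1 + (c x)^2 + (w x)^2 + (c x * w x)^2))"
   by (intro integrable_mult_right Bochner_Integration.integrable_add sqint_sq c ws) (simp add: finite_measure.emeasure_finite)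
  then show ?thesis unfolding R_def by (simp add: algebra_simps power_mult_distrib)
 qed
 have c1: "\<bar>c x\<bar> <= 1 + (c x)^2" for x using zero_le_power2[of "\<bar>c x\<bar> - 1"] by (simp add: power2_diff)
 have bnd: "\<bar>h * t * wgt k x\<bar> <= 4 * C * R x"
  if h: "\<bar>h\<bar> <= C * (1 + (c x)^2)" and t: "0 <= t" "t <= 4 * (1 + (w x)^2)" and x: "x \<in> \<Omega>" for h t C x
 proof -
  have "\<bar>h * t * wgt k x\<bar> = \<bar>h\<bar> * t * \<bar>wgt k x\<bar>" using t by (simp add: abs_mult)
  also have "... <= (C * (1 + (c x)^2)) * (4 * (1 + (w x)^2)) * BE"
   by (intro mult_mono h t BE(2)[OF x] mult_nonneg_nonneg order_trans[OF abs_ge_zero h]) auto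
  also have "... = 4 * C * R x" unfolding R_def by (simp only: mult_ac)
  finally show ?thesis .
 qed
 have coef: "\<bar>K\<bar> <= \<bar>K\<bar> * (1 + (c x)^2)" "\<bar>K * c x\<bar> <= \<bar>K\<bar> * (1 + (c x)^2)" "\<bar>K * (c x)^2\<bar> <= \<bar>K\<bar> * (1 + (c x)^2)" for K x
  using mult_left_mono[of 1 "1 + (c x)^2" "\<bar>K\<bar>"] mult_left_mono[OF c1[of x], of "\<bar>K\<bar>"] by (auto simp: abs_mult algebra_simps)
 have main: "(LINT x|M. Q eps x * wgt k x) <= 0" "integrable M (%x. Q eps x * wgt k x)"
   "!!x. x \<in> \<Omega> ==> \<bar>Q eps x * wgt k x\<bar> <= 4 * (\<bar>k1\<bar> + \<bar>\<nu> * (d * k^2)\<bar> + \<bar>u * b\<bar> + \<bar>\<beta> * s\<bar> + \<bar>d * a^2 / (2 * \<nu>)\<bar>) * R x"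
  if e: "0 < eps" "eps <= 1" for eps
 proof -
  note gr = reg_growth[OF q e]
  define y where "y x = ypow q eps (w x)" for x
  define y' where "y' x = ypow' q eps (w x)" for x
  define G where "G x = gpow q eps (w x)" for x
  define G' where "G' x = gpow' q eps (w x)" for x
  define E where "E = wgt k"
  note meas = reg_meas[OF w q e(1), folded y_def G_def y'_def G'_def]
  have Em: "E \<in> borel_measurable M" unfolding E_def by (intro meas_smooth smooth_wgt)
  have \<Gamma>m: "(%x. \<Gamma> eps (w x)) \<in> borel_measurable M"
   unfolding \<Gamma>_def y_def[symmetric] using meas(2) by measurable
  have le4: "t <= 1 + (w x)^2 ==> t <= 4 * (1 + (w x)^2)" for t x
   using zero_le_power2[of "w x"] unfolding distrib_left by linarith
  have wG: "0 <= w x * G x" "w x * G x <= 4 * (1 + (w x)^2)" for x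
   unfolding G_def by (rule gpow_mult_nonneg[OF q e(1)], rule le4[OF gr(2)])
  have wG': "0 <= (w x)^2 * G' x" "(w x)^2 * G' x <= 4 * (1 + (w x)^2)" for x
   unfolding G'_def by (rule mult_nonneg_nonneg[OF zero_le_power2 gpow'_nonneg[OF q e(1)]], rule le4[OF gr(3)])
  have yy: "0 <= (y x)^2" "(y x)^2 <= 4 * (1 + (w x)^2)" for x
   unfolding y_def by (rule zero_le_power2, rule le4[OF gr(1)])
  have \<Gamma>b: "0 <= \<Gamma> eps (w x)" "\<Gamma> eps (w x) <= 4 * (1 + (w x)^2)" for x
   using gr(4,5)[of "w x"] unfolding \<Gamma>_def by auto
  have ib: "integrable M (%x. h x * t x * E x)"
   if h: "h \<in> borel_measurable M" "!!x. \<bar>h x\<bar> <= C * (1 + (c x)^2)" and t: "t \<in> borel_measurable M"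
    "!!x. 0 <= t x" "!!x. t x <= 4 * (1 + (w x)^2)" for h t C
  proof (rule Bochner_Integration.integrable_bound[OF integrable_mult_right[OF R, of "4 * C"]])
   show "(%x. h x * t x * E x) \<in> borel_measurable M" by (intro borel_measurable_times h t Em)
   show "AE x in M. norm (h x * t x * E x) <= norm (4 * C * R x)"
    using bnd[OF h(2) t(2,3)] by (intro AE_I2) (force simp: E_def)
  qed
  have mt: "(%x. w x * G x) \<in> borel_measurable M" "(%x. (w x)^2 * G' x) \<in> borel_measurable M" "(%x. (y x)^2) \<in> borel_measurable M"
   by (intro borel_measurable_times borel_measurable_power wm meas)+
  have ct: "(%x. K) \<in> borel_measurable M" "(%x. K * c x) \<in> borel_measurable M" "(%x. K * (c x)^2) \<in> borel_measurable M" for K :: real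
   by (intro borel_measurable_times borel_measurable_power cm borel_measurable_const)+
  note i1 = ib[OF ct(1) coef(1) mt(3) yy] and i2 = ib[OF ct(1) coef(1) \<Gamma>m \<Gamma>b] and i3 = ib[OF ct(2) coef(2) mt(1) wG]
   and i4 = ib[OF ct(3) coef(3) mt(1) wG] and i5 = ib[OF ct(3) coef(3) mt(2) wG']
  have Qeq: "Q eps x * wgt k x = k1 * (y x)^2 * E x - \<nu> * (d * k^2) * \<Gamma> eps (w x) * E x - u * b * c x * (w x * G x) * E x
    + \<beta> * s * (c x)^2 * (w x * G x) * E x - d * a^2 / (2 * \<nu>) * (c x)^2 * ((w x)^2 * G' x) * E x" for x
   by (simp only: Q_def y_def G_def G'_def E_def left_diff_distrib distrib_right)
  show "integrable M (%x. Q eps x * wgt k x)"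
   unfolding Qeq by (intro Bochner_Integration.integrable_add Bochner_Integration.integrable_diff i1 i2 i3 i4 i5)
  show "\<bar>Q eps x * wgt k x\<bar> <= 4 * (\<bar>k1\<bar> + \<bar>\<nu> * (d * k^2)\<bar> + \<bar>u * b\<bar> + \<bar>\<beta> * s\<bar> + \<bar>d * a^2 / (2 * \<nu>)\<bar>) * R x" if x: "x \<in> \<Omega>" for x
  proof -
   have tri: "\<bar>t1 - t2 - t3 + t4 - t5\<bar> <= B1 + B2 + B3 + B4 + B5"
    if "\<bar>t1\<bar> <= B1" "\<bar>t2\<bar> <= B2" "\<bar>t3\<bar> <= B3" "\<bar>t4\<bar> <= B4" "\<bar>t5\<bar> <= B5" for t1 t2 t3 t4 t5 B1 B2 B3 B4 B5 :: real
    using that by (simp add: abs_le_iff)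
   note tri[OF bnd[OF coef(1) yy x, of k1] bnd[OF coef(1) \<Gamma>b x, of "\<nu> * (d * k^2)"] bnd[OF coef(2) wG x, of "u * b"]
    bnd[OF coef(3) wG x, of "\<beta> * s"] bnd[OF coef(3) wG' x, of "d * a^2 / (2 * \<nu>)"]]
   then show ?thesis unfolding Qeq E_def distrib_left distrib_right .
  qed
  define U where "U = (LINT x|M. \<Gamma> eps (w x) * E x)"
  define P where "P = (LINT x|M. c x * (w x * G x) * E x)"
  define S where "S = (LINT x|M. (c x)^2 * (w x * G x) * E x)"
  define Rr where "Rr = (LINT x|M. (c x)^2 * ((w x)^2 * G' x) * E x)"
  define Yy where "Yy = (LINT x|M. (y x)^2 * E x)"
  have pull: "(LINT x|M. K * h x * t x * E x) = K * (LINT x|M. h x * t x * E x)" for K :: real and h t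
   unfolding mult.assoc by (rule integral_mult_right_zero)
  have pull1: "(LINT x|M. K * t x * E x) = K * (LINT x|M. t x * E x)" for K :: real and t
   unfolding mult.assoc by (rule integral_mult_right_zero)
  have QI: "(LINT x|M. Q eps x * wgt k x) = k1 * Yy - \<nu> * (d * k^2) * U - u * b * P + \<beta> * s * S - d * a^2 / (2 * \<nu>) * Rr"
   unfolding Qeq Yy_def U_def P_def S_def Rr_def pull[symmetric] pull1[symmetric]
   by (simp only: Bochner_Integration.integral_add Bochner_Integration.integral_diff Bochner_Integration.integrable_add
     Bochner_Integration.integrable_diff i1 i2 i3 i4 i5)
  define X where "X i = (LINT x|M. (D i w x)^2 * (G' x * E x))" for i
  define Cc where "Cc i = (LINT x|M. c x * w x * (D i w x * (G' x * E x)))" for i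
  define \<xi> where "\<xi> x = G x * E x" for x
  note xi = reg_H01(1,2)[OF w q e(1), where k = k, folded G_def G'_def E_def \<xi>_def[abs_def], unfolded \<xi>_def[symmetric]]
  have \<xi>H: "\<xi> \<in> H0" using reg_H01(1)[OF w q e(1), of k] by (simp add: \<xi>_def[abs_def] G_def E_def)
  have \<xi>D: "AE x in M. D i \<xi> x = D i w x * (G' x * E x) - k * \<xi> x" for i
   using reg_H01(2)[OF w q e(1), of i k] by (simp add: \<xi>_def[abs_def] G_def E_def G'_def mult_ac)
  have \<xi>s: "sqint M \<xi>" by (rule H01_sqint(1)[OF \<xi>H])
  have Ds: "sqint M (D i w)" for i by (rule H01_sqint(2)[OF w])
  have DG: "sqint M (%x. D i w x * (G' x * E x))" for i
   using reg_sqint(1)[OF w q e(1) Ds, of i k] by (simp add: G'_def E_def)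
  have Dxi: "sqint M (%x. D i w x * (G' x * E x) - k * \<xi> x)" for i by (intro sqint_diff DG sqint_cmult \<xi>s)
  have DI: "(LINT x|M. f x * D i \<xi> x) = (LINT x|M. f x * (D i w x * (G' x * E x))) - k * (LINT x|M. f x * \<xi> x)"
   if f: "sqint M f" for f i
  proof -
   have "(LINT x|M. f x * D i \<xi> x) = (LINT x|M. D i \<xi> x * f x)" by (simp add: mult.commute)
   also have "... = (LINT x|M. (D i w x * (G' x * E x) - k * \<xi> x) * f x)"
    by (rule D_cong_nrm(2)[OF H01_W1[OF \<xi>H] Dxi \<xi>D f])
   also have "... = (LINT x|M. f x * (D i w x * (G' x * E x)) - k * (f x * \<xi> x))"
    by (intro Bochner_Integration.integral_cong refl) (simp add: algebra_simps)
   finally show ?thesis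
    using sqint_mult_integrable[OF f DG[of i]] sqint_mult_integrable[OF f \<xi>s] by simp
  qed
  have drift: "(LINT x|M. D i w x * \<xi> x) = k * U" for i
   using drift_term[OF w q e(1), of i k] by (simp add: \<xi>_def G_def E_def U_def \<Gamma>_def mult_ac)
  have XI: "(LINT x|M. D i w x * D i \<xi> x) = X i - k^2 * U" for i
   using DI[OF Ds, of i i] drift[of i] by (simp add: X_def power2_eq_square mult.assoc)
  have PI': "(LINT x|M. c x * w x * \<xi> x) = P" by (simp add: P_def \<xi>_def mult_ac)
  have CI: "(LINT x|M. c x * w x * D i \<xi> x) = Cc i - k * P" for i
   using DI[OF c(2), of i] by (simp add: Cc_def PI')
  have Wg: "0 <= (LINT x|M. w x * \<xi> x)"
   unfolding \<xi>_def mult.assoc[symmetric] E_def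
   by (intro Bochner_Integration.integral_nonneg mult_nonneg_nonneg[OF wG(1) E0])
  have Ms: "s * S <= (LINT x|M. m x * w x * \<xi> x)"
   unfolding S_def integral_mult_right_zero[symmetric]
  proof (rule integral_mono)
   show "integrable M (%x. s * ((c x)^2 * (w x * G x) * E x))" using i4[of s] by (simp add: mult.assoc)
   show "integrable M (%x. m x * w x * \<xi> x)" by (rule int[OF \<xi>H])
   fix x
   have "s * (c x)^2 * (w x * G x * E x) <= m x * (w x * G x * E x)"
    unfolding E_def by (intro mult_right_mono[OF m(2)] mult_nonneg_nonneg[OF wG(1) E0])
   then show "s * ((c x)^2 * (w x * G x) * E x) <= m x * w x * \<xi> x" by (simp add: \<xi>_def mult_ac)
  qed
  have G'E: "0 <= G' x * E x" for x using gpow'_nonneg[OF q e(1)] E0 by (simp add: G'_def E_def)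
  have X: "integrable M (%x. (D i w x)^2 * (G' x * E x))" for i
   using sqint_mult_integrable[OF Ds[of i] DG[of i]] by (simp add: power2_eq_square mult.assoc)
  \<comment> \<open>One half of the diffusion pays for the drift; the other half is reserved for
    Poincare in \<open>Yl\<close>.\<close>
  have Ca: "a * Cc i <= \<nu> / 2 * X i + a^2 / (2 * \<nu>) * Rr" for i
  proof -
   have ic: "integrable M (%x. c x * w x * (D i w x * (G' x * E x)))" by (rule sqint_mult_integrable[OF c(2) DG])
   have ir: "integrable M (%x. (c x)^2 * ((w x)^2 * G' x) * E x)" using i5[of 1] by simp
   have "a * Cc i = (LINT x|M. a * (c x * w x * (D i w x * (G' x * E x))))" by (simp add: Cc_def)
   also have "... <= (LINT x|M. \<nu> / 2 * ((D i w x)^2 * (G' x * E x)) + a^2 / (2 * \<nu>) * ((c x)^2 * ((w x)^2 * G' x) * E x))"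
   proof (rule integral_mono)
    fix x
    have dist: "(n * D2 + r * (c x * w x)^2) * (G' x * E x) = n * (D2 * (G' x * E x)) + r * ((c x)^2 * ((w x)^2 * G' x) * E x)" for n D2 r
     by (simp add: algebra_simps power_mult_distrib)
    have "0 <= (\<nu> * D i w x - a * (c x * w x))^2 / (2 * \<nu>)" using pos by simp
    also have "... = \<nu> / 2 * (D i w x)^2 + a^2 / (2 * \<nu>) * (c x * w x)^2 - a * (c x * w x) * D i w x"
     using pos by (simp add: power2_diff field_simps power2_eq_square)
    finally have "a * (c x * w x) * D i w x * (G' x * E x) <= (\<nu> / 2 * (D i w x)^2 + a^2 / (2 * \<nu>) * (c x * w x)^2) * (G' x * E x)"
     using G'E[of x] by (intro mult_right_mono) auto
    also note dist[of "\<nu> / 2" "(D i w x)^2" "a^2 / (2 * \<nu>)"]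
    finally show "a * (c x * w x * (D i w x * (G' x * E x))) <= \<nu> / 2 * ((D i w x)^2 * (G' x * E x)) + a^2 / (2 * \<nu>) * ((c x)^2 * ((w x)^2 * G' x) * E x)"
     by (simp only: mult.assoc)
   qed (intro Bochner_Integration.integrable_add integrable_mult_right ic ir X)+
   also have "... = \<nu> / 2 * X i + a^2 / (2 * \<nu>) * Rr" using X[of i] ir by (simp add: X_def Rr_def)
   finally show ?thesis .
  qed
  have Yl: "k1 * Yy <= \<nu> / 2 * (\<Sum>i\<in>UNIV. X i)"
  proof -
   have "(u / 4) * (LINT x|M. (y' x)^2 * (D i w x)^2 * E x) <= 4 * q^2 * X i" for i
    unfolding X_def integral_mult_right_zero[symmetric]
   proof (rule integral_mono)
    have "integrable M (%x. (D i w x * (y' x * wgt (k / 2) x))^2)"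
     using sqint_sq[OF reg_sqint(2)[OF w q e(1) Ds, of i "k / 2"]] by (simp add: y'_def)
    then show "integrable M (%x. u / 4 * ((y' x)^2 * (D i w x)^2 * E x))"
     unfolding power_mult_distrib wgt_sq E_def[symmetric] by (simp add: mult_ac)
    show "integrable M (%x. 4 * q^2 * ((D i w x)^2 * (G' x * E x)))" by (rule integrable_mult_right[OF X])
    fix x
    have "((y' x)^2 * (4 * q - 1)) * ((D i w x)^2 * E x) <= (4 * q^2 * G' x) * ((D i w x)^2 * E x)"
     using ypow'_sq[OF q e(1), of "w x"] E0[of x] unfolding y'_def G'_def E_def by (intro mult_right_mono) auto
    then show "u / 4 * ((y' x)^2 * (D i w x)^2 * E x) <= 4 * q^2 * ((D i w x)^2 * (G' x * E x))"
     unfolding pp by (simp add: mult_ac)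
   qed
   then have "(\<Sum>i\<in>UNIV. (u / 4) * (LINT x|M. (y' x)^2 * (D i w x)^2 * E x)) <= (\<Sum>i\<in>UNIV. 4 * q^2 * X i)" by (intro sum_mono)
   moreover have "lam * Yy <= (\<Sum>i\<in>UNIV. (LINT x|M. (y' x)^2 * (D i w x)^2 * E x))"
    using weighted_poincare[OF w q e(1) poin, of k] by (simp add: Yy_def y_def y'_def E_def)
   ultimately have "(u / 4) * (lam * Yy) <= 4 * q^2 * (\<Sum>i\<in>UNIV. X i)"
    unfolding sum_distrib_left[symmetric] using mult_left_mono[of _ _ "u / 4"] u by (smt (verit) divide_nonneg_nonneg)
   then have "\<nu> / (8 * q^2) * ((u / 4) * (lam * Yy)) <= \<nu> / (8 * q^2) * (4 * q^2 * (\<Sum>i\<in>UNIV. X i))"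
    using pos by (intro mult_left_mono) auto
   then show ?thesis using q by (simp add: k1_def mult_ac)
  qed
  have "\<nu> * (\<Sum>i\<in>UNIV. X i - k^2 * U) - a * (\<Sum>i\<in>UNIV. Cc i - k * P) - b * P + g * (LINT x|M. w x * \<xi> x)
    + \<beta> * (LINT x|M. m x * w x * \<xi> x) = 0"
   using eq[OF \<xi>H] unfolding grad_inner_sum[OF H01_W1[OF w] H01_W1[OF \<xi>H]] XI CI PI' .
  then have e1: "\<nu> * (\<Sum>i\<in>UNIV. X i) - \<nu> * (d * k^2) * U - a * (\<Sum>i\<in>UNIV. Cc i) + d * a * k * P - b * P + g * (LINT x|M. w x * \<xi> x)
    + \<beta> * (LINT x|M. m x * w x * \<xi> x) = 0"
   by (simp add: sum_subtractf d_def algebra_simps)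
  have "a * (\<Sum>i\<in>UNIV. Cc i) <= (\<Sum>i\<in>UNIV. \<nu> / 2 * X i + a^2 / (2 * \<nu>) * Rr)"
   unfolding sum_distrib_left by (intro sum_mono Ca)
  also have "... = \<nu> / 2 * (\<Sum>i\<in>UNIV. X i) + d * a^2 / (2 * \<nu>) * Rr"
   by (simp add: sum.distrib sum_distrib_left sum_divide_distrib d_def mult_ac)
  finally have "a * (\<Sum>i\<in>UNIV. Cc i) <= \<nu> / 2 * (\<Sum>i\<in>UNIV. X i) + d * a^2 / (2 * \<nu>) * Rr" .
  moreover have "\<beta> * s * S <= \<beta> * (LINT x|M. m x * w x * \<xi> x)" using mult_left_mono[OF Ms, of \<beta>] pos by (simp add: mult_ac)
  moreover have "0 <= g * (LINT x|M. w x * \<xi> x)" using Wg pos by simp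
  moreover have "d * a * k * P - b * P = - (u * b * P)" unfolding dak by (simp add: algebra_simps)
  moreover have "\<nu> * (\<Sum>i\<in>UNIV. X i) = \<nu> / 2 * (\<Sum>i\<in>UNIV. X i) + \<nu> / 2 * (\<Sum>i\<in>UNIV. X i)" by simp
  ultimately show "(LINT x|M. Q eps x * wgt k x) <= 0" unfolding QI using e1 Yl by linarith
 qed
 define en where "en n = 1 / real (Suc n)" for n
 have en: "0 < en n" "en n <= 1" for n by (auto simp: en_def)
 have en0: "en ----> 0" unfolding en_def[abs_def] by (rule LIMSEQ_Suc[OF lim_1_over_n])
 \<comment> \<open>The charge of the drift in the limit, expressed as a share of the reaction by the
   choice of u.\<close>
 have k5: "d * a^2 / (2 * \<nu>) * (4 * q - 1) = \<beta> * s * (1 - u) / 2"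
  unfolding dT pp Tu[symmetric] using pos by simp
 have lim: "(%n. Q (en n) x * wgt k x) ----> Q0 x * wgt k x" for x
 proof (rule tendsto_mult[OF _ tendsto_const])
  note l = reg_limits[OF q en(1) en0, of "w x"]
  have "(%n. Q (en n) x) ----> k1 * (\<bar>w x\<bar> powr (4 * q)) - \<nu> * (d * k^2) * (\<bar>w x\<bar> powr (4 * q) / (4 * q)) - u * b * c x * (\<bar>w x\<bar> powr (4 * q))
   + \<beta> * s * (c x)^2 * (\<bar>w x\<bar> powr (4 * q)) - d * a^2 / (2 * \<nu>) * (c x)^2 * ((4 * q - 1) * \<bar>w x\<bar> powr (4 * q))"
   unfolding Q_def \<Gamma>_def by (intro tendsto_intros l)
  also have "k1 * W - L * (W / (4 * q)) - u * b * c x * W + \<beta> * s * (c x)^2 * W - K * (c x)^2 * ((4 * q - 1) * W)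
   = W * (k1 - L / (4 * q) - u * b * c x + (\<beta> * s - K * (4 * q - 1)) * (c x)^2)" for W L K
   by (simp add: algebra_simps)
  finally show "(%n. Q (en n) x) ----> Q0 x" unfolding k5 Q0_def .
 qed
 have Q0m: "(%x. Q0 x * wgt k x) \<in> borel_measurable M"
 proof -
  have "(%x. \<bar>w x\<bar> powr (4 * q)) \<in> borel_measurable M" by (intro meas_compose[OF continuous_abs_powr] wm) (use q in auto)
  then show ?thesis unfolding Q0_def using cm meas_smooth[OF smooth_wgt[of k]] by measurable
 qed
 define KK where "KK = 4 * (\<bar>k1\<bar> + \<bar>\<nu> * (d * k^2)\<bar> + \<bar>u * b\<bar> + \<bar>\<beta> * s\<bar> + \<bar>d * a^2 / (2 * \<nu>)\<bar>)"
 note dc = Q0m borel_measurable_integrable[OF main(2)[OF en]] integrable_mult_right[OF R, of KK]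
 have dcb: "AE x in M. norm (Q (en n) x * wgt k x) <= KK * R x" for n
  using main(3)[OF en] by (intro AE_I2) (simp add: KK_def)
 have i0: "integrable M (%x. Q0 x * wgt k x)"
  by (rule integrable_dominated_convergence[OF dc AE_I2[OF lim] dcb])
 have "(%n. (LINT x|M. Q (en n) x * wgt k x)) ----> (LINT x|M. Q0 x * wgt k x)"
  by (rule integral_dominated_convergence[OF dc AE_I2[OF lim] dcb])
 then have le0: "(LINT x|M. Q0 x * wgt k x) <= 0"
  by (rule LIMSEQ_le_const2) (use main(1)[OF en] in blast)
 have low: "\<nu> * lam * u / 10 * \<bar>w x\<bar> powr (4 * q) <= Q0 x" for x
  using mult_left_mono[OF limit_coefficient_pos[OF u q_def pos(1,3,4,5) small, of "c x"], of "\<bar>w x\<bar> powr (4 * q)"]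
  unfolding Q0_def k1_def dk by (simp add: mult_ac)
 have cpos: "\<nu> * lam * u / 10 > 0" using pos u by simp
 have nn: "0 <= Q0 x * wgt k x" for x
  using order_trans[OF mult_nonneg_nonneg[OF less_imp_le[OF cpos] powr_ge_zero] low[of x]] E0[of x] by simp
 have "(LINT x|M. Q0 x * wgt k x) = 0"
  using le0 Bochner_Integration.integral_nonneg[of M "%x. Q0 x * wgt k x"] nn by fastforce
 then have "AE x in M. Q0 x * wgt k x = 0"
  using integral_nonneg_eq_0_iff_AE[OF i0] nn by simp
 then show ?thesis
 proof eventually_elim
  case (elim x)
  then have "\<nu> * lam * u / 10 * \<bar>w x\<bar> powr (4 * q) <= 0" using low[of x] wgt_pos[of k x] by simp
  then have "\<bar>w x\<bar> powr (4 * q) <= 0" using mult_pos_pos[OF cpos] by (meson not_le)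
  then show "w x = 0" by (metis abs_eq_0 powr_ge_zero powr_eq_0_iff order_antisym)
 qed
qed

end

section \<open>Regularity of the strong solution: its Laplacian and a regularised test
  function\<close>

context bounded_domain
begin

text \<open>\<open>laplacian\<close> refers to multi-indices of order two. Testing the first weak
  derivative with \<open>pd i \<phi>\<close> shows that the second is the weak derivative of the
  first, and integration by parts against \<open>H0\<close> becomes available.\<close>

lemma second_weak_deriv:
 assumes u: "u \<in> H0" and u2: "u \<in> sobolev \<Omega> 2"
 shows "sqint M (weak_deriv \<Omega> {#i, i#} u)" "has_weak_deriv \<Omega> {#i#} (D i u) (weak_deriv \<Omega> {#i, i#} u)"
proof -
 have sz: "size {#i, i#} <= 2" by simp
 from u2 have "\<forall>\<alpha>. size \<alpha> <= 2 --> (\<exists>g\<in>L2 \<Omega>. has_weak_deriv \<Omega> \<alpha> u g)" by (simp add: sobolev_def)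
 from this[rule_format, OF sz] obtain g where g: "sqint M g" "has_weak_deriv \<Omega> {#i, i#} u g"
  by (auto simp: L2_iff)
 note e = weak_deriv_eqI[OF g(2) sqintD[OF g(1)]]
 show s: "sqint M (weak_deriv \<Omega> {#i, i#} u)" by (rule sqint_AE[OF g(1) e(2,1)])
 show "has_weak_deriv \<Omega> {#i#} (D i u) (weak_deriv \<Omega> {#i, i#} u)"
  unfolding has_weak_deriv_single
 proof (intro conjI ballI sqint_locally_integrable s H01_sqint(2)[OF u])
  fix \<phi> assume \<phi>: "\<phi> \<in> test_functions \<Omega>"
  have "(LINT x|M. u x * pd i (pd i \<phi>) x) = - (LINT x|M. D i u x * pd i \<phi> x)"
   using W1D(3)[OF H01_W1[OF u], of i] test_pd[OF \<phi>] unfolding has_weak_deriv_single by blast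
  moreover have "(LINT x|M. u x * partials [i, i] \<phi> x) = (- 1) ^ size {#i, i#} * (LINT x|M. weak_deriv \<Omega> {#i, i#} u x * \<phi> x)"
   by (rule e(3)[unfolded has_weak_deriv_def, THEN conjunct2, THEN conjunct2, rule_format, OF \<phi>]) simp
  ultimately show "(LINT x|M. D i u x * pd i \<phi> x) = - (LINT x|M. weak_deriv \<Omega> {#i, i#} u x * \<phi> x)"
   by (simp add: partials_Cons_pd del: partials.simps(2))
 qed
qed

lemma laplacian_weak:
 assumes u: "u \<in> H0" and u2: "u \<in> sobolev \<Omega> 2"
 shows "sqint M (laplacian \<Omega> u)" "v \<in> H0 ==> gi u v = - (LINT x|M. laplacian \<Omega> u x * v x)"
proof -
 note s = second_weak_deriv[OF u u2]
 show "sqint M (laplacian \<Omega> u)" unfolding laplacian_def[abs_def] by (intro sqint_sum s)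
 assume v: "v \<in> H0"
 have "gi u v = (\<Sum>i\<in>UNIV. - (LINT x|M. weak_deriv \<Omega> {#i, i#} u x * v x))"
  unfolding grad_inner_sum[OF H01_W1[OF u] H01_W1[OF v]]
  by (intro sum.cong refl weak_deriv_parts[OF H01_sqint(2)[OF u] s v])
 also have "... = - (LINT x|M. laplacian \<Omega> u x * v x)"
  unfolding laplacian_def sum_distrib_right
  by (subst Bochner_Integration.integral_sum)
   (auto simp: sum_negf intro!: sqint_mult_integrable s H01_sqint(1)[OF v])
 finally show "gi u v = - (LINT x|M. laplacian \<Omega> u x * v x)" .
qed

end

text \<open>A positive function bounded by \<open>1 / eps\<close> that tends to \<open>s^2\<close>:
  positivity keeps its real powers smooth, the bound keeps derivatives bounded. The quotient is
  written as a power so that the closure rules for smooth functions apply.\<close>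

definition qreg :: "real => real => real" where
 "qreg eps s = (s^2 + eps) * (1 + eps * s^2) powr (- 1)"

context exponent
begin

text \<open>Approximates \<open>Psi\<close> with a bounded derivative, as the chain rule in
  \<open>H0\<close> demands; \<open>Psi\<close> of the solution is not known to be an admissible
  test function.\<close>

definition Hreg :: "real => real => real" where
 "Hreg eps s = s * qreg eps s powr \<delta>"

definition Hreg' :: "real => real => real" where
 "Hreg' eps s = qreg eps s powr \<delta> + s * (\<delta> * qreg eps s powr (\<delta> - 1) * (2 * s * (1 - eps^2) / (1 + eps * s^2)^2))"

context
 fixes eps :: real
 assumes e: "0 < eps" "eps <= 1"
begin

lemma den_pos: "0 < 1 + eps * s^2"
 using e by (simp add: add_pos_nonneg)

lemma qreg_eq: "qreg eps s = (s^2 + eps) / (1 + eps * s^2)"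
 using den_pos[of s] by (simp add: qreg_def powr_minus_divide)

lemma qreg_bounds: "0 < qreg eps s" "qreg eps s <= 1 / eps" "qreg eps s <= s^2 + 1"
proof -
 show "0 < qreg eps s" using e den_pos[of s] unfolding qreg_eq by (intro divide_pos_pos) (auto simp: add_nonneg_pos)
 have "eps * eps <= 1 * 1" using e by (intro mult_mono) auto
 then have "(s^2 + eps) * eps <= 1 + eps * s^2" by (simp add: algebra_simps)
 then show "qreg eps s <= 1 / eps" unfolding qreg_eq using e den_pos[of s] by (simp add: divide_simps)
 have "(s^2 + eps) / (1 + eps * s^2) <= (s^2 + eps) / 1" using e den_pos[of s] by (intro divide_left_mono) auto
 then show "qreg eps s <= s^2 + 1" unfolding qreg_eq using e by simp
qed

lemma Hreg_smooth: "smooth \<phi> ==> smooth (%x. Hreg eps (\<phi> x))"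
proof -
 assume s: "smooth \<phi>"
 have "smooth (%x. qreg eps (\<phi> x))" unfolding qreg_def power2_eq_square
  using den_pos[unfolded power2_eq_square] by (intro smooth_mult smooth_add smooth_const smooth_powr s)
 then show ?thesis unfolding Hreg_def using qreg_bounds(1) by (intro smooth_mult smooth_powr s)
qed

lemma DERIV_Hreg: "(Hreg eps has_real_derivative Hreg' eps s) (at s)"
proof -
 have "((%s. (s^2 + eps) / (1 + eps * s^2)) has_real_derivative
   (2 * s * (1 + eps * s^2) - (s^2 + eps) * (eps * (2 * s))) / ((1 + eps * s^2) * (1 + eps * s^2))) (at s)"
  using den_pos[of s] by (auto intro!: derivative_eq_intros)
 then have "(qreg eps has_real_derivative 2 * s * (1 - eps^2) / (1 + eps * s^2)^2) (at s)"
  unfolding qreg_eq[abs_def] by (simp add: power2_eq_square algebra_simps)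
 from DERIV_chain2[OF has_real_derivative_powr[OF qreg_bounds(1)] this, of \<delta>]
 have "((%s. qreg eps s powr \<delta>) has_real_derivative \<delta> * qreg eps s powr (\<delta> - 1) * (2 * s * (1 - eps^2) / (1 + eps * s^2)^2)) (at s)" .
 from DERIV_mult[OF DERIV_ident this] show ?thesis
  unfolding Hreg_def[abs_def] Hreg'_def by (simp add: mult_ac)
qed

lemma continuous_Hreg: "continuous_on UNIV (Hreg eps)" "continuous_on UNIV (Hreg' eps)"
proof -
 have c: "continuous_on UNIV (qreg eps)" unfolding qreg_eq[abs_def]
  using den_pos by (intro continuous_intros) (metis less_irrefl)
 have p: "continuous_on UNIV (%s. qreg eps s powr r)" for r
  using qreg_bounds(1) by (intro continuous_on_powr c continuous_on_const) (metis less_irrefl)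
 show "continuous_on UNIV (Hreg eps)" unfolding Hreg_def[abs_def] by (intro continuous_on_mult p continuous_on_id)
 have d: "(1 + eps * s^2)^2 ~= 0" for s using den_pos[of s] by simp
 show "continuous_on UNIV (Hreg' eps)" unfolding Hreg'_def[abs_def]
  by (intro continuous_on_add continuous_on_mult p continuous_on_divide continuous_on_power continuous_on_const continuous_on_id) (use d in blast)
qed

lemma Hreg'_bounds: "qreg eps s powr \<delta> <= Hreg' eps s" "Hreg' eps s <= (1 + 2 * \<delta>) * qreg eps s powr \<delta>"
proof -
 define z where "z = s * (2 * s * (1 - eps^2) / (1 + eps * s^2)^2)"
 have H: "Hreg' eps s = qreg eps s powr \<delta> + \<delta> * qreg eps s powr (\<delta> - 1) * z" by (simp add: Hreg'_def z_def)
 have e1: "0 <= 1 - eps^2" using e by (simp add: power_le_one)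
 have z: "z = 2 * s^2 * (1 - eps^2) / (1 + eps * s^2)^2" by (simp add: z_def power2_eq_square)
 have z0: "0 <= z" unfolding z using e1 by (intro divide_nonneg_nonneg mult_nonneg_nonneg) auto
 have "z <= 2 * s^2 * 1 / (1 + eps * s^2)"
  unfolding z using den_pos[of s] e1 e
  by (intro frac_le mult_mono) (auto simp: power2_eq_square mult_le_cancel_left1)
 also have "... <= 2 * qreg eps s" unfolding qreg_eq using den_pos[of s] e
  by (simp add: divide_right_mono)
 finally have z2: "z <= 2 * qreg eps s" .
 have nn: "0 <= \<delta> * qreg eps s powr (\<delta> - 1)" using delta by simp
 show "qreg eps s powr \<delta> <= Hreg' eps s" unfolding H using mult_nonneg_nonneg[OF nn z0] by simp
 have "\<delta> * qreg eps s powr (\<delta> - 1) * z <= \<delta> * qreg eps s powr (\<delta> - 1) * (2 * qreg eps s)" by (rule mult_left_mono[OF z2 nn])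
 also have "... = 2 * \<delta> * qreg eps s powr \<delta>"
  using powr_Suc_mult[of "qreg eps s" "\<delta> - 1"] qreg_bounds(1)[of s] by simp
 finally show "Hreg' eps s <= (1 + 2 * \<delta>) * qreg eps s powr \<delta>" unfolding H by (simp add: algebra_simps)
qed

lemma Hreg'_bound: "\<bar>Hreg' eps s\<bar> <= (1 + 2 * \<delta>) * (1 / eps) powr \<delta>"
proof -
 have "qreg eps s powr \<delta> <= (1 / eps) powr \<delta>" using qreg_bounds[of s] delta by (intro powr_mono2) auto
 then have "(1 + 2 * \<delta>) * qreg eps s powr \<delta> <= (1 + 2 * \<delta>) * (1 / eps) powr \<delta>" using delta by (intro mult_left_mono) auto
 moreover have "0 <= Hreg' eps s" using Hreg'_bounds(1)[of s] powr_ge_zero[of "qreg eps s" \<delta>] by linarith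
 ultimately show ?thesis using Hreg'_bounds(2)[of s] by simp
qed

lemma qreg_powr_le: "qreg eps s powr \<delta> <= 2 powr \<delta> * ((wt s) + 1)"
proof -
 have "qreg eps s powr \<delta> <= (2 * (max \<bar>s\<bar> \<bar>1\<bar>)^2) powr \<delta>"
 proof (rule powr_mono2)
  have "s^2 <= (max \<bar>s\<bar> 1)^2" using power_mono[of "\<bar>s\<bar>" "max \<bar>s\<bar> 1" 2] by simp
  moreover have "1 <= (max \<bar>s\<bar> (1::real))^2" by (rule one_le_power) simp
  ultimately show "qreg eps s <= 2 * (max \<bar>s\<bar> \<bar>1\<bar>)^2" using qreg_bounds(3)[of s] unfolding abs_one by linarith
 qed (use delta qreg_bounds(1)[of s] in auto)
 also have "... = 2 powr \<delta> * (max \<bar>s\<bar> \<bar>1\<bar>) powr (2 * \<delta>)"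
 proof -
  have "((max \<bar>s\<bar> \<bar>1::real\<bar>)^2) powr \<delta> = (max \<bar>s\<bar> \<bar>1\<bar>) powr (2 * \<delta>)"
   using powr_powr[of "max \<bar>s\<bar> 1" 2 \<delta>] by (simp add: powr_numeral)
  then show ?thesis by (simp add: powr_mult)
 qed
 also have "... <= 2 powr \<delta> * ((wt s) + (wt 1))"
  using abs_powr_max[of "2 * \<delta>" s 1] delta by (intro mult_left_mono) auto
 finally show ?thesis by simp
qed

text \<open>By the last inequality the square of the test function is controlled by the reaction it
  generates, so a square-integrable source can be absorbed uniformly in eps.\<close>

lemma Hreg_mult_bounds: "0 <= s * Hreg eps s" "0 <= Psi s * Hreg eps s"
 "s * Hreg eps s <= 2 powr \<delta> * ((pw s) + s^2)"
 "(Hreg eps s)^2 <= 2 powr \<delta> * (Psi s * Hreg eps s + s * Hreg eps s)"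
proof -
 define Z where "Z = qreg eps s powr \<delta>"
 have Z: "0 <= Z" "Z <= 2 powr \<delta> * ((wt s) + 1)" using qreg_powr_le[of s] by (auto simp: Z_def)
 have sH: "s * Hreg eps s = s^2 * Z" and PH: "Psi s * Hreg eps s = (wt s) * (s^2 * Z)"
  and HH: "(Hreg eps s)^2 = s^2 * Z * Z" by (simp_all add: Hreg_def Psi_def Z_def power2_eq_square)
 have sp: "(wt s) * s^2 = (pw s)" using powr_two_mult[of "\<bar>s\<bar>" "2 * \<delta>"] by simp
 show "0 <= s * Hreg eps s" "0 <= Psi s * Hreg eps s" unfolding sH PH using Z by simp_all
 show "s * Hreg eps s <= 2 powr \<delta> * ((pw s) + s^2)"
  unfolding sH sp[symmetric] using mult_left_mono[OF Z(2), of "s^2"] by (simp add: algebra_simps)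
 show "(Hreg eps s)^2 <= 2 powr \<delta> * (Psi s * Hreg eps s + s * Hreg eps s)"
  unfolding sH PH HH using mult_left_mono[OF Z(2), of "s^2 * Z"] Z(1) by (simp add: algebra_simps)
qed

text \<open>Of the term with \<open>Psi\<close>, half is kept. A quarter absorbs the intermediate
  power, by \<open>0 <= (|s| powr \<delta> - 4)^2\<close>, and a quarter absorbs the source t, by
  Young with the constant \<open>2 powr \<delta> / \<beta>\<close>. The leftover multiples of
  \<open>s * Hreg eps s\<close> stay below 5 and are estimated by \<open>pw s + s^2\<close>.\<close>

lemma Hreg_coercive:
 assumes b: "0 < \<beta>" "0 <= \<gamma>" "\<gamma> <= 1"
 shows "\<beta> / 2 * (Psi s * Hreg eps s) - 5 * \<beta> * 2 powr \<delta> * ((pw s) + s^2) - 2 powr \<delta> / \<beta> * t^2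
  <= \<beta> * (Psi s * Hreg eps s) - \<beta> * (1 + \<gamma>) * (Phi s * Hreg eps s) - t * Hreg eps s"
proof -
 define A where "A = Psi s * Hreg eps s"
 define B where "B = s * Hreg eps s"
 note h = Hreg_mult_bounds[of s, folded A_def B_def]
 have AB: "A = (wt s) * B" by (simp add: A_def B_def Psi_def)
 have PH: "\<bar>Phi s * Hreg eps s\<bar> = \<bar>s\<bar> powr \<delta> * B"
 proof -
  have "\<bar>Phi s * Hreg eps s\<bar> = \<bar>sg s\<bar> * \<bar>B\<bar>" by (simp add: B_def Phi_def abs_mult mult_ac)
  then show ?thesis using h(1) by (simp add: abs_spow)
 qed
 have "0 <= (\<bar>s\<bar> powr \<delta> - 4)^2" by simp
 then have "2 * \<bar>s\<bar> powr \<delta> <= (wt s) / 4 + 4"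
  using abs_powr_delta_sq[of s] by (simp add: power2_diff)
 then have 1: "2 * (\<bar>s\<bar> powr \<delta> * B) <= A / 4 + 4 * B"
  unfolding AB using mult_right_mono[OF _ h(1)] by (fastforce simp: algebra_simps)
 have "(1 + \<gamma>) * (Phi s * Hreg eps s) <= 2 * \<bar>Phi s * Hreg eps s\<bar>"
  using b by (intro order_trans[OF mult_left_mono[OF abs_ge_self] mult_right_mono]) auto
 then have 2: "(1 + \<gamma>) * (Phi s * Hreg eps s) <= A / 4 + 4 * B" using 1 unfolding PH by linarith
 have 3: "\<beta> * (1 + \<gamma>) * (Phi s * Hreg eps s) <= \<beta> * (A / 4 + 4 * B)"
  using mult_left_mono[OF 2, of \<beta>] b by (simp add: mult.assoc)
 define c where "c = 2 powr \<delta> / \<beta>"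
 have c: "c > 0" using b by (simp add: c_def)
 have "0 <= (2 * c * t - Hreg eps s)^2 / (4 * c)" using c by simp
 then have "t * Hreg eps s <= c * t^2 + (Hreg eps s)^2 / (4 * c)"
  using c by (simp add: power2_diff field_simps power2_eq_square)
 moreover have "(Hreg eps s)^2 / (4 * c) <= (2 powr \<delta> * (A + B)) / (4 * c)" using h(4) c by (intro divide_right_mono) auto
 moreover have "(2 powr \<delta> * (A + B)) / (4 * c) = \<beta> / 4 * (A + B)" using b by (simp add: c_def)
 ultimately have 4: "t * Hreg eps s <= c * t^2 + \<beta> / 4 * (A + B)" by linarith
 define Z where "Z = 2 powr \<delta> * ((pw s) + s^2)"
 have 5: "\<beta> * B <= \<beta> * Z" using mult_left_mono[OF h(3), of \<beta>] b by (simp add: Z_def)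
 have 6: "0 <= \<beta> * B" using b h(1) by simp
 have 7: "\<beta> * (A / 4 + 4 * B) = \<beta> * A / 4 + 4 * (\<beta> * B)" "\<beta> / 4 * (A + B) = \<beta> * A / 4 + \<beta> * B / 4" "\<beta> / 2 * A = \<beta> * A / 2"
  by (simp_all add: algebra_simps add_divide_distrib)
 have 8: "5 * \<beta> * 2 powr \<delta> * ((pw s) + s^2) = 5 * (\<beta> * Z)" by (simp add: Z_def)
 show ?thesis unfolding A_def[symmetric] c_def[symmetric] 8 using 3 4 5 6 unfolding 7 by linarith
qed

end

lemma qreg_limit:
 assumes "e ----> 0" "!!n::nat. 0 < e n" "!!n. e n <= 1" shows "(%n. qreg (e n) s powr \<delta>) ----> (wt s)"
proof -
 have "(%n. (s^2 + e n) / (1 + e n * s^2)) ----> (s^2 + 0) / (1 + 0 * s^2)"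
  by (intro tendsto_intros assms) simp
 then have l: "(%n. qreg (e n) s) ----> s^2" using qreg_eq[OF assms(2,3)] by simp
 have "(%n. qreg (e n) s powr \<delta>) ----> (s^2) powr \<delta>"
  using delta qreg_bounds(1)[OF assms(2,3)] by (intro tendsto_powr' l tendsto_const) (auto simp: less_imp_le)
 moreover have "(s^2) powr \<delta> = (wt s)"
  using powr_powr[of "\<bar>s\<bar>" 2 \<delta>] by (cases "s = 0") (auto simp: powr_numeral)
 ultimately show ?thesis by simp
qed

text \<open>Since \<open>\<delta> >= 1\<close>, p is at least 4 and a quarter of \<open>pw s\<close>
  plus 12 dominates \<open>3 * s^2\<close>: two of these come from the intermediate power, one from
  the source.\<close>

lemma energy_young:
 assumes b: "0 < \<beta>" "0 <= \<gamma>" "\<gamma> <= 1"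
 shows "\<beta> * (1 + \<gamma>) * (Phi s * s) + t * s <= 3 / 4 * \<beta> * (pw s) + 12 * \<beta> + t^2 / (4 * \<beta>)"
proof -
 have s4: "3 * s^2 <= (pw s) / 4 + 12"
 proof (cases "\<bar>s\<bar> <= 1")
  case True
  then have "s^2 <= 1" using abs_square_le_1 by blast
  then show ?thesis using powr_ge_zero[of "\<bar>s\<bar>" p] by linarith
 next
  case False
  then have "\<bar>s\<bar> powr 4 <= (pw s)" using delta by (intro powr_mono) auto
  moreover have "\<bar>s\<bar> powr 4 = (s^2)^2" using False by (simp add: powr_numeral)
  moreover have "0 <= (s^2 - 6)^2" by simp
  ultimately show ?thesis by (simp add: power2_diff)
 qed
 have "G * \<bar>Phi s * s\<bar> <= (Phi s)^2 / 2 + G^2 * s^2 / 2" for G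
  using zero_le_power2[of "\<bar>Phi s\<bar> - G * \<bar>s\<bar>"] by (simp add: power2_diff power_mult_distrib abs_mult algebra_simps)
 from this[of "1 + \<gamma>"] have "(1 + \<gamma>) * \<bar>Phi s * s\<bar> <= (Phi s)^2 / 2 + (1 + \<gamma>)^2 * s^2 / 2" .
 moreover have "(1 + \<gamma>)^2 * s^2 <= 4 * s^2" using b power_mono[of "1 + \<gamma>" 2 2] by (intro mult_right_mono) auto
 moreover have "(1 + \<gamma>) * (Phi s * s) <= (1 + \<gamma>) * \<bar>Phi s * s\<bar>" using b by (intro mult_left_mono) auto
 ultimately have "(1 + \<gamma>) * (Phi s * s) <= (pw s) / 2 + 2 * s^2" unfolding Phi_sq by linarith
 then have "(1 + \<gamma>) * (Phi s * s) + s^2 <= 3 / 4 * (pw s) + 12" using s4 by linarith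
 from mult_left_mono[OF this, of \<beta>] b
 have 1: "\<beta> * (1 + \<gamma>) * (Phi s * s) + \<beta> * s^2 <= 3 / 4 * \<beta> * (pw s) + 12 * \<beta>" by (simp add: algebra_simps)
 have "0 <= (t - 2 * \<beta> * s)^2 / (4 * \<beta>)" using b by simp
 then have "t * s <= \<beta> * s^2 + t^2 / (4 * \<beta>)"
  using b by (simp add: power2_diff field_simps power2_eq_square)
 then show ?thesis using 1 by linarith
qed

end

section \<open>The weak form and a priori bounds\<close>

locale burgers_huxley = gn_domain \<Omega> \<delta> C\<^sub>G\<^sub>N for \<Omega> :: "(real ^ 'n::finite) set" and \<delta> C\<^sub>G\<^sub>N +
 fixes \<nu> \<alpha> \<beta> \<gamma> :: real
 assumes pos: "\<nu> > 0" "\<alpha> > 0" "\<beta> > 0" and gam: "0 < \<gamma>" "\<gamma> < 1"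
begin

text \<open>Advection is written after integration by parts: comparing two states then involves
  differences of \<open>Phi\<close> only, and no gradient multiplied by a power.\<close>

definition form :: "(real ^ 'n => real) => (real ^ 'n => real) => real" where
 "form u v = \<nu> * gi u v - \<alpha> / (\<delta> + 1) * (\<Sum>i\<in>UNIV. (LINT x|M. Phi (u x) * D i v x))
   - \<beta> * (1 + \<gamma>) * (LINT x|M. Phi (u x) * v x) + \<beta> * \<gamma> * (LINT x|M. u x * v x) + \<beta> * (LINT x|M. Psi (u x) * v x)"

lemma Phi_H01: "u \<in> H0 ==> sqint M (%x. Phi (u x))"
 by (rule Phi_sqint[OF Gc(2)])

lemma Psi_mult_integrable:
 assumes u: "u \<in> H0" and v: "v \<in> H0" shows "integrable M (%x. Psi (u x) * v x)"
proof (rule Bochner_Integration.integrable_bound[OF weighted_mult_integrable[OF Gc(2)[OF u] Gc(2)[OF u] Gc(2)[OF v]]])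
 show "(%x. Psi (u x) * v x) \<in> borel_measurable M" by (intro borel_measurable_times Psi_meas H01_meas u v)
qed (simp add: Psi_def abs_mult mult_ac)

lemma reaction_integral:
 assumes u: "u \<in> H0" and v: "v \<in> H0"
 shows "integrable M (%x. reaction \<gamma> \<delta> u x * v x)"
  "(LINT x|M. reaction \<gamma> \<delta> u x * v x) = (1 + \<gamma>) * (LINT x|M. Phi (u x) * v x) - \<gamma> * (LINT x|M. u x * v x) - (LINT x|M. Psi (u x) * v x)"
proof -
 have eq: "reaction \<gamma> \<delta> u x * v x = (1 + \<gamma>) * (Phi (u x) * v x) - \<gamma> * (u x * v x) - Psi (u x) * v x" for x
  unfolding reaction_eq by (simp add: algebra_simps)
 note i = sqint_mult_integrable[OF Phi_H01[OF u] H01_sqint(1)[OF v]] sqint_mult_integrable[OF H01_sqint(1)[OF u] H01_sqint(1)[OF v]]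
  Psi_mult_integrable[OF u v]
 show "integrable M (%x. reaction \<gamma> \<delta> u x * v x)" unfolding eq using i by simp
 show "(LINT x|M. reaction \<gamma> \<delta> u x * v x) = (1 + \<gamma>) * (LINT x|M. Phi (u x) * v x) - \<gamma> * (LINT x|M. u x * v x) - (LINT x|M. Psi (u x) * v x)"
  unfolding eq using i by simp
qed

lemma advection_integral:
 assumes u: "u \<in> H0" and v: "v \<in> H0"
 shows "integrable M (%x. advection \<Omega> \<delta> u x * v x)"
  "(LINT x|M. advection \<Omega> \<delta> u x * v x) = - (1 / (\<delta> + 1)) * (\<Sum>i\<in>UNIV. (LINT x|M. Phi (u x) * D i v x))"
proof -
 have eq: "advection \<Omega> \<delta> u x * v x = (\<Sum>i\<in>UNIV. sg (u x) * D i u x * v x)" for x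
  by (simp add: advection_def grad_def sum_distrib_left sum_distrib_right)
 note i = advection_integrable[OF u v]
 show "integrable M (%x. advection \<Omega> \<delta> u x * v x)" unfolding eq by (intro Bochner_Integration.integrable_sum i)
 have "(LINT x|M. sg (u x) * D i u x * v x) = - (1 / (\<delta> + 1)) * (LINT x|M. Phi (u x) * D i v x)" for i
  using advection_parts[OF u v, of i] delta by (simp add: field_simps)
 then show "(LINT x|M. advection \<Omega> \<delta> u x * v x) = - (1 / (\<delta> + 1)) * (\<Sum>i\<in>UNIV. (LINT x|M. Phi (u x) * D i v x))"
  unfolding eq by (subst Bochner_Integration.integral_sum) (auto intro: i simp: sum_distrib_left)
qed

lemma galerkin_form:
 assumes "galerkin_solution \<Omega> \<nu> \<alpha> \<beta> \<gamma> \<delta> f W u" "fin_dim_subspace_H01 \<Omega> W" "\<xi> \<in> W"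
 shows "form u \<xi> = (LINT x|M. f x * \<xi> x)"
proof -
 have H: "u \<in> H0" "\<xi> \<in> H0" using assms fin_dim_H01 by (auto simp: galerkin_solution_def)
 have "\<nu> * gi u \<xi> + \<alpha> * (LINT x|M. advection \<Omega> \<delta> u x * \<xi> x) =
   \<beta> * (LINT x|M. reaction \<gamma> \<delta> u x * \<xi> x) + (LINT x|M. f x * \<xi> x)"
  using assms(1,3) by (simp add: galerkin_solution_def L2_inner_def)
 then show ?thesis unfolding form_def advection_integral(2)[OF H] reaction_integral(2)[OF H]
  by (simp add: algebra_simps)
qed

lemma strong_form:
 assumes s: "strong_solution \<Omega> \<nu> \<alpha> \<beta> \<gamma> \<delta> f u" and f: "sqint M f" and v: "v \<in> H0"
 shows "form u v = (LINT x|M. f x * v x)"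
proof -
 have u: "u \<in> H0" "u \<in> sobolev \<Omega> 2" using s by (auto simp: strong_solution_def)
 note l = laplacian_weak[OF u]
 note i = sqint_mult_integrable[OF l(1) H01_sqint(1)[OF v]] advection_integral(1)[OF u(1) v] reaction_integral(1)[OF u(1) v]
 have "AE x in M. f x * v x = - \<nu> * (laplacian \<Omega> u x * v x) + \<alpha> * (advection \<Omega> \<delta> u x * v x) - \<beta> * (reaction \<gamma> \<delta> u x * v x)"
 proof -
  have "AE x in M. - \<nu> * laplacian \<Omega> u x + \<alpha> * advection \<Omega> \<delta> u x - \<beta> * reaction \<gamma> \<delta> u x = f x"
   using s by (simp add: strong_solution_def)
  then show ?thesis
  proof eventually_elim
   case (elim x)
   show ?case unfolding elim[symmetric] by (simp add: algebra_simps)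
  qed
 qed
 then have "(LINT x|M. f x * v x) = (LINT x|M. - \<nu> * (laplacian \<Omega> u x * v x) + \<alpha> * (advection \<Omega> \<delta> u x * v x) - \<beta> * (reaction \<gamma> \<delta> u x * v x))"
  using i sqint_mult_integrable[OF f H01_sqint(1)[OF v]] by (intro integral_cong_AE) auto
 also have "... = - \<nu> * (LINT x|M. laplacian \<Omega> u x * v x) + \<alpha> * (LINT x|M. advection \<Omega> \<delta> u x * v x) - \<beta> * (LINT x|M. reaction \<gamma> \<delta> u x * v x)"
  using i by simp
 finally show ?thesis unfolding form_def advection_integral(2)[OF u(1) v] reaction_integral(2)[OF u(1) v] l(2)[OF v]
  by (simp add: algebra_simps)
qed

definition vol :: real where "vol = measure M (space M)"

text \<open>Tested with the solution itself the drift is a total derivative and vanishes, so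
  \<open>\<alpha>\<close> does not appear in the bound.\<close>

lemma energy:
 assumes u: "u \<in> H0" and f: "sqint M f" and eq: "form u u = (LINT x|M. f x * u x)"
 shows "\<nu> * (gn u)^2 + \<beta> / 4 * PI u <= 12 * \<beta> * vol + (nrm M f)^2 / (4 * \<beta>)"
proof -
 have z: "(LINT x|M. Phi (u x) * D i u x) = 0" for i
  by (rule antiderivative_zero(1)[OF u continuous_Phi, where C = 1]) auto
 note s = H01_sqint(1)[OF u]
 note i = sqint_mult_integrable[OF Phi_H01[OF u] s] sqint_mult_integrable[OF f s] pintD(2)[OF Gc(2)[OF u]] sqint_sq[OF f]
 have "\<beta> * (1 + \<gamma>) * (LINT x|M. Phi (u x) * u x) + (LINT x|M. f x * u x) = (LINT x|M. \<beta> * (1 + \<gamma>) * (Phi (u x) * u x) + f x * u x)"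
  using i by simp
 also have "... <= (LINT x|M. 3 / 4 * \<beta> * (pw (u x)) + 12 * \<beta> + (f x)^2 / (4 * \<beta>))"
  using i pos gam by (intro integral_mono energy_young) auto
 also have "... = 3 / 4 * \<beta> * PI u + 12 * \<beta> * vol + (nrm M f)^2 / (4 * \<beta>)"
  using i by (simp add: PI_def nrm_sq vol_def)
 finally have 1: "\<beta> * (1 + \<gamma>) * (LINT x|M. Phi (u x) * u x) + (LINT x|M. f x * u x) <= 3 / 4 * \<beta> * PI u + 12 * \<beta> * vol + (nrm M f)^2 / (4 * \<beta>)" .
 have "form u u = \<nu> * (gn u)^2 - \<beta> * (1 + \<gamma>) * (LINT x|M. Phi (u x) * u x) + \<beta> * \<gamma> * (LINT x|M. u x * u x) + \<beta> * PI u"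
  by (simp add: form_def z grad_inner_self[OF H01_W1[OF u]] Psi_mult_self PI_def)
 moreover have "0 <= \<beta> * \<gamma> * (LINT x|M. u x * u x)"
  unfolding power2_eq_square[symmetric] using pos gam by (intro mult_nonneg_nonneg Bochner_Integration.integral_nonneg) auto
 ultimately show ?thesis using eq 1 by linarith
qed

text \<open>The drift vanishes once more, because the test function is a function of u. The
  diffusion is nonnegative because \<open>Hreg\<close> increases, and the right side does not depend
  on eps.\<close>

lemma regularity_test:
 assumes u: "u \<in> H0" and f: "sqint M f" and eq: "!!v. v \<in> H0 ==> form u v = (LINT x|M. f x * v x)"
  and e: "0 < eps" "eps <= 1"
 shows "\<nu> * (\<Sum>i\<in>UNIV. (LINT x|M. qreg eps (u x) powr \<delta> * (D i u x)^2)) + \<beta> / 2 * (LINT x|M. Psi (u x) * Hreg eps (u x)) <=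
   5 * \<beta> * 2 powr \<delta> * (PI u + (nrm M u)^2) + 2 powr \<delta> / \<beta> * (nrm M f)^2"
  "integrable M (%x. qreg eps (u x) powr \<delta> * (D i u x)^2)" "integrable M (%x. Psi (u x) * Hreg eps (u x))"
proof -
 define h where "h x = Hreg eps (u x)" for x
 define h' where "h' x = Hreg' eps (u x)" for x
 have z0: "Hreg eps 0 = 0" by (simp add: Hreg_def)
 have hH: "h \<in> H0" and hD: "AE x in M. D i h x = h' x * D i u x" for i
 proof -
  have "(%x. Hreg eps (u x) * 1) \<in> H0"
   by (rule H01_chain(1)[OF u smooth_const Hreg_smooth[OF e] z0 DERIV_Hreg[OF e] continuous_Hreg(2)[OF e] Hreg'_bound[OF e]])
  then show "h \<in> H0" by (simp add: h_def[abs_def])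
  have "AE x in M. D i (%x. Hreg eps (u x) * 1) x = Hreg' eps (u x) * D i u x * 1 + Hreg eps (u x) * pd i (%x. 1) x"
   by (rule H01_chain(2)[OF u smooth_const Hreg_smooth[OF e] z0 DERIV_Hreg[OF e] continuous_Hreg(2)[OF e] Hreg'_bound[OF e]])
  then show "AE x in M. D i h x = h' x * D i u x" by (simp add: h_def[abs_def] h'_def pd_const)
 qed
 have hm: "h' \<in> borel_measurable M" unfolding h'_def by (rule meas_compose[OF continuous_Hreg(2)[OF e] H01_meas(1)[OF u]])
 have h's: "sqint M (%x. h' x * D i u x)" for i
  using sqint_mult_bounded[OF H01_sqint(2)[OF u, of i] hm, of "(1 + 2 * \<delta>) * (1 / eps) powr \<delta>"] Hreg'_bound[OF e]
  by (simp add: h'_def mult.commute)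
 have DI: "(LINT x|M. k x * D i h x) = (LINT x|M. k x * (h' x * D i u x))" if "sqint M k" for k i
  using D_cong_nrm(2)[OF H01_W1[OF hH] h's hD that, of i] by (simp add: mult.commute)
 have adv: "(LINT x|M. Phi (u x) * D i h x) = 0" for i
 proof -
  have "(LINT x|M. Phi (u x) * Hreg' eps (u x) * D i u x) = 0"
  proof (rule antiderivative_zero(1)[OF u, where C = "(1 + 2 * \<delta>) * (1 / eps) powr \<delta>"])
   show "continuous_on UNIV (%s. Phi s * Hreg' eps s)" by (intro continuous_on_mult continuous_Phi continuous_Hreg(2)[OF e])
   show "\<bar>Phi s * Hreg' eps s\<bar> <= (1 + 2 * \<delta>) * (1 / eps) powr \<delta> * \<bar>Phi s\<bar>" for s
    using mult_left_mono[OF Hreg'_bound[OF e, of s], of "\<bar>Phi s\<bar>"] by (simp add: abs_mult mult_ac)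
  qed (use delta in simp)
  then show ?thesis unfolding DI[OF Phi_H01[OF u]] h'_def by (simp add: mult.assoc)
 qed
 have DD: "integrable M (%x. D i u x * (h' x * D i u x))" for i
  by (rule sqint_mult_integrable[OF H01_sqint(2)[OF u] h's])
 have qm: "(%x. qreg eps (u x) powr \<delta>) \<in> borel_measurable M"
 proof -
  have "continuous_on UNIV (%s. qreg eps s)" unfolding qreg_eq[OF e]
   using den_pos[OF e] by (intro continuous_intros) (metis less_irrefl)
  moreover have "\<forall>s\<in>UNIV. qreg eps s ~= 0" using qreg_bounds(1)[OF e] by (metis less_irrefl)
  ultimately have "continuous_on UNIV (%s. qreg eps s powr \<delta>)" by (intro continuous_on_powr continuous_on_const)
  then show ?thesis by (rule meas_compose[OF _ H01_meas(1)[OF u]])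
 qed
 have le: "qreg eps (u x) powr \<delta> * (D i u x)^2 <= D i u x * (h' x * D i u x)" for i x
  using mult_right_mono[OF Hreg'_bounds(1)[OF e, of "u x"], of "(D i u x)^2"] by (simp add: h'_def power2_eq_square mult_ac)
 show qi: "integrable M (%x. qreg eps (u x) powr \<delta> * (D i u x)^2)" for i
 proof (rule Bochner_Integration.integrable_bound[OF DD[of i]])
  show "(%x. qreg eps (u x) powr \<delta> * (D i u x)^2) \<in> borel_measurable M"
   by (intro borel_measurable_times borel_measurable_power qm H01_meas u)
  show "AE x in M. norm (qreg eps (u x) powr \<delta> * (D i u x)^2) <= norm (D i u x * (h' x * D i u x))"
   using le by (intro AE_I2) (metis abs_ge_self abs_of_nonneg mult_nonneg_nonneg order_trans powr_ge_zero real_norm_def zero_le_power2)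
 qed
 show Pi: "integrable M (%x. Psi (u x) * Hreg eps (u x))"
  using Psi_mult_integrable[OF u hH] by (simp add: h_def)
 note s = H01_sqint(1)[OF hH]
 note i = sqint_mult_integrable[OF Phi_H01[OF u] s] sqint_mult_integrable[OF f s] Psi_mult_integrable[OF u hH]
  pintD(2)[OF Gc(2)[OF u]] sqint_sq[OF f] sqint_sq[OF H01_sqint(1)[OF u]]
 have "(LINT x|M. \<beta> / 2 * (Psi (u x) * h x) - 5 * \<beta> * 2 powr \<delta> * ((pw (u x)) + (u x)^2) - 2 powr \<delta> / \<beta> * (f x)^2)
   <= (LINT x|M. \<beta> * (Psi (u x) * h x) - \<beta> * (1 + \<gamma>) * (Phi (u x) * h x) - f x * h x)"
  unfolding h_def using i[unfolded h_def] pos gam by (intro integral_mono Hreg_coercive e Bochner_Integration.integrable_diff integrable_mult_right Bochner_Integration.integrable_add) auto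
 then have 1: "\<beta> / 2 * (LINT x|M. Psi (u x) * h x) - 5 * \<beta> * 2 powr \<delta> * (PI u + (nrm M u)^2) - 2 powr \<delta> / \<beta> * (nrm M f)^2
   <= \<beta> * (LINT x|M. Psi (u x) * h x) - \<beta> * (1 + \<gamma>) * (LINT x|M. Phi (u x) * h x) - (LINT x|M. f x * h x)"
  using i by (simp add: PI_def nrm_sq)
 have "0 <= (LINT x|M. u x * h x)"
  unfolding h_def using Hreg_mult_bounds(1)[OF e] by (intro Bochner_Integration.integral_nonneg)
 then have 2: "0 <= \<beta> * \<gamma> * (LINT x|M. u x * h x)" using pos gam by simp
 have "(\<Sum>i\<in>UNIV. (LINT x|M. qreg eps (u x) powr \<delta> * (D i u x)^2)) <= (\<Sum>i\<in>UNIV. (LINT x|M. D i u x * (h' x * D i u x)))"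
  by (intro sum_mono integral_mono qi DD le)
 also have "... = gi u h"
  unfolding grad_inner_sum[OF H01_W1[OF u] H01_W1[OF hH]] DI[OF H01_sqint(2)[OF u]] ..
 finally have 3: "\<nu> * (\<Sum>i\<in>UNIV. (LINT x|M. qreg eps (u x) powr \<delta> * (D i u x)^2)) <= \<nu> * gi u h"
  using pos by (intro mult_left_mono) auto
 have "form u h = \<nu> * gi u h - \<beta> * (1 + \<gamma>) * (LINT x|M. Phi (u x) * h x) + \<beta> * \<gamma> * (LINT x|M. u x * h x) + \<beta> * (LINT x|M. Psi (u x) * h x)"
  by (simp add: form_def adv)
 then show "\<nu> * (\<Sum>i\<in>UNIV. (LINT x|M. qreg eps (u x) powr \<delta> * (D i u x)^2)) + \<beta> / 2 * (LINT x|M. Psi (u x) * Hreg eps (u x)) <=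
   5 * \<beta> * 2 powr \<delta> * (PI u + (nrm M u)^2) + 2 powr \<delta> / \<beta> * (nrm M f)^2"
  using eq[OF hH] 1 2 3 unfolding h_def by linarith
qed

text \<open>Fatou for eps tending to 0. The two conclusions are what the energy estimate leaves open
  when the Laplacian is read off from the equation: the top-order reaction and the advection in
  L^2.\<close>

lemma nonlinear_bounds:
 assumes u: "u \<in> H0" and f: "sqint M f" and eq: "!!v. v \<in> H0 ==> form u v = (LINT x|M. f x * v x)"
  and K: "K = 5 * \<beta> * 2 powr \<delta> * (PI u + (nrm M u)^2) + 2 powr \<delta> / \<beta> * (nrm M f)^2"
 shows "sqint M (%x. Psi (u x))" "(nrm M (%x. Psi (u x)))^2 <= 2 * K / \<beta>"
  "sqint M (%x. sg (u x) * D i u x)" "(nrm M (%x. sg (u x) * D i u x))^2 <= K / \<nu>"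
proof -
 define e where "e n = 1 / real (Suc n)" for n
 have e: "0 < e n" "e n <= 1" for n by (auto simp: e_def)
 have e0: "e ----> 0" unfolding e_def[abs_def] by (rule LIMSEQ_Suc[OF lim_1_over_n])
 note r = regularity_test[OF u f eq e, folded K]
 have nn1: "0 <= (LINT x|M. qreg (e n) (u x) powr \<delta> * (D i u x)^2)" for n i
  by (intro Bochner_Integration.integral_nonneg) auto
 have nn2: "0 <= (LINT x|M. Psi (u x) * Hreg (e n) (u x))" for n
  using Hreg_mult_bounds(2)[OF e] by (intro Bochner_Integration.integral_nonneg)
 have b1: "(LINT x|M. qreg (e n) (u x) powr \<delta> * (D i u x)^2) <= K / \<nu>" for n i
 proof -
  have "(LINT x|M. qreg (e n) (u x) powr \<delta> * (D i u x)^2) <= (\<Sum>i\<in>UNIV. (LINT x|M. qreg (e n) (u x) powr \<delta> * (D i u x)^2))"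
   by (rule member_le_sum) (use nn1 in auto)
  then have "\<nu> * (LINT x|M. qreg (e n) (u x) powr \<delta> * (D i u x)^2) <= \<nu> * (\<Sum>i\<in>UNIV. (LINT x|M. qreg (e n) (u x) powr \<delta> * (D i u x)^2))"
   using pos by (intro mult_left_mono) auto
  moreover have "0 <= \<beta> / 2 * (LINT x|M. Psi (u x) * Hreg (e n) (u x))" using nn2[of n] pos by simp
  ultimately have "\<nu> * (LINT x|M. qreg (e n) (u x) powr \<delta> * (D i u x)^2) <= K" using r(1)[of n] by linarith
  then show ?thesis using pos by (simp add: pos_le_divide_eq mult.commute)
 qed
 have b2: "(LINT x|M. Psi (u x) * Hreg (e n) (u x)) <= 2 * K / \<beta>" for n
 proof -
  have "0 <= \<nu> * (\<Sum>i\<in>UNIV. (LINT x|M. qreg (e n) (u x) powr \<delta> * (D i u x)^2))"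
   using pos by (intro mult_nonneg_nonneg sum_nonneg nn1) auto
  then have "\<beta> * (LINT x|M. Psi (u x) * Hreg (e n) (u x)) <= 2 * K" using r(1)[of n] by simp
  then show ?thesis using pos by (simp add: pos_le_divide_eq mult.commute)
 qed
 note lim = qreg_limit[OF e0 e]
 have Pm: "(%x. Psi (u x)) \<in> borel_measurable M" by (intro Psi_meas H01_meas u)
 have l2: "AE x in M. (%n. Psi (u x) * Hreg (e n) (u x)) ----> (Psi (u x))^2"
 proof (intro AE_I2)
  fix x
  have "(%n. Psi (u x) * (u x * qreg (e n) (u x) powr \<delta>)) ----> Psi (u x) * (u x * (wt (u x)))"
   by (intro tendsto_intros lim)
  then show "(%n. Psi (u x) * Hreg (e n) (u x)) ----> (Psi (u x))^2"
   by (simp add: Hreg_def Psi_def power2_eq_square)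
 qed
 note F2 = fatou_bounded[OF r(3) Hreg_mult_bounds(2)[OF e] l2 b2 borel_measurable_power[OF Pm]]
 show "sqint M (%x. Psi (u x))" "(nrm M (%x. Psi (u x)))^2 <= 2 * K / \<beta>"
  using F2 Pm by (auto simp: sqint_def nrm_sq)
 have sm: "(%x. sg (u x) * D i u x) \<in> borel_measurable M" by (intro borel_measurable_times sg_meas H01_meas u)
 have l1: "AE x in M. (%n. qreg (e n) (u x) powr \<delta> * (D i u x)^2) ----> (sg (u x) * D i u x)^2"
  unfolding power_mult_distrib spow_sq by (intro AE_I2 tendsto_intros lim)
 have nn: "0 <= qreg (e n) (u x) powr \<delta> * (D i u x)^2" for n x by simp
 note F1 = fatou_bounded[OF r(2) nn l1 b1 borel_measurable_power[OF sm]]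
 show "sqint M (%x. sg (u x) * D i u x)" "(nrm M (%x. sg (u x) * D i u x))^2 <= K / \<nu>"
  using F1 sm by (auto simp: sqint_def nrm_sq)
qed

text \<open>B is chosen before u and f, from the norm N alone. The first estimate needs only the
  equation tested with its own solution and so covers discrete solutions too. The second rests on
  test functions outside the discrete spaces and is confined to strong solutions.\<close>

lemma apriori:
 obtains B where "B > 0"
  "!!u f. u \<in> H0 ==> sqint M f ==> nrm M f = N ==> form u u = (LINT x|M. f x * u x) ==> gn u <= B \<and> PI u <= B"
  "!!u f. sqint M f ==> nrm M f = N ==> strong_solution \<Omega> \<nu> \<alpha> \<beta> \<gamma> \<delta> f u ==>
    sqint M (%x. Psi (u x)) \<and> (nrm M (%x. Psi (u x)))^2 <= B \<and> nrm M (laplacian \<Omega> u) <= B"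
proof -
 obtain P where P: "P > 0" "!!u. u \<in> H0 ==> nrm M u <= P * gn u" using poincare by blast
 define K0 where "K0 = 12 * \<beta> * vol + N^2 / (4 * \<beta>)"
 define B1 where "B1 = K0 / \<nu> + 1"
 define B2 where "B2 = 4 * K0 / \<beta>"
 have K0: "0 <= K0" using pos by (simp add: K0_def vol_def)
 have en: "gn u <= B1 \<and> PI u <= B2"
  if H: "u \<in> H0" "sqint M f" "nrm M f = N" "form u u = (LINT x|M. f x * u x)" for u f
 proof -
  have E: "\<nu> * (gn u)^2 + \<beta> / 4 * PI u <= K0" using energy[OF H(1,2,4)] H(3) by (simp add: K0_def)
  have "0 <= \<beta> / 4 * PI u" "0 <= \<nu> * (gn u)^2" using pos PI_nonneg[of u] by auto
  then have 1: "\<nu> * (gn u)^2 <= K0" "\<beta> * PI u <= 4 * K0" using E by auto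
  then have g: "(gn u)^2 <= K0 / \<nu>" "PI u <= B2" using pos by (auto simp: B2_def pos_le_divide_eq mult.commute)
  have "0 <= (gn u - 1)^2" "0 <= (gn u)^2" by auto
  then have "gn u <= B1" using g(1) unfolding power2_diff B1_def one_power2 mult_1_right by linarith
  then show ?thesis using g(2) by simp
 qed
 define K where "K = 5 * \<beta> * 2 powr \<delta> * (B2 + (P * B1)^2) + 2 powr \<delta> / \<beta> * N^2"
 define BL where "BL = (1 / \<nu>) * (\<alpha> * (real CARD('n) * sqrt (K / \<nu>)) + \<beta> * (2 * sqrt B2 + P * B1 + sqrt (2 * K / \<beta>)) + N)"
 have strong: "sqint M (%x. Psi (u x)) \<and> (nrm M (%x. Psi (u x)))^2 <= 2 * K / \<beta> \<and> nrm M (laplacian \<Omega> u) <= BL"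
  if f: "sqint M f" and N: "nrm M f = N" and s: "strong_solution \<Omega> \<nu> \<alpha> \<beta> \<gamma> \<delta> f u" for u f
 proof -
  have u: "u \<in> H0" "u \<in> sobolev \<Omega> 2" using s by (auto simp: strong_solution_def)
  have B: "gn u <= B1" "PI u <= B2" using en[OF u(1) f N strong_form[OF s f u(1)]] by auto
  have nu: "nrm M u <= P * B1" using P(1) by (intro order_trans[OF P(2)[OF u(1)] mult_left_mono[OF B(1)]]) auto
  define Ku where "Ku = 5 * \<beta> * 2 powr \<delta> * (PI u + (nrm M u)^2) + 2 powr \<delta> / \<beta> * (nrm M f)^2"
  have Ku: "Ku <= K" unfolding Ku_def K_def N
   using pos by (intro add_right_mono mult_left_mono add_mono B(2) power_mono nu) auto
  note nb = nonlinear_bounds[OF u(1) f strong_form[OF s f] Ku_def]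
  have n1: "(nrm M (%x. Psi (u x)))^2 <= 2 * K / \<beta>"
   using nb(2) divide_right_mono[OF Ku, of \<beta>] pos by simp
  have n2: "(nrm M (%x. sg (u x) * D i u x))^2 <= K / \<nu>" for i
   using nb(4)[of i] divide_right_mono[OF Ku, of \<nu>] pos by simp
  have n1': "nrm M (%x. Psi (u x)) <= sqrt (2 * K / \<beta>)" by (rule real_le_rsqrt[OF n1])
  have n2': "nrm M (%x. sg (u x) * D i u x) <= sqrt (K / \<nu>)" for i by (rule real_le_rsqrt[OF n2])
  have n3: "nrm M (%x. Phi (u x)) <= sqrt B2"
   using B(2) by (intro real_le_rsqrt) (simp add: nrm_sq Phi_sq PI_def)
  define A where "A x = (\<Sum>i\<in>UNIV. sg (u x) * D i u x)" for x
  define Rx where "Rx x = (1 + \<gamma>) * Phi (u x) - \<gamma> * u x - Psi (u x)" for x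
  have As: "sqint M A" unfolding A_def by (intro sqint_sum nb(3))
  have An: "nrm M A <= real CARD('n) * sqrt (K / \<nu>)"
  proof -
   have "nrm M A <= (\<Sum>i\<in>UNIV. nrm M (%x. sg (u x) * D i u x))" unfolding A_def by (intro nrm_sum_le nb(3))
   also have "... <= (\<Sum>i\<in>(UNIV::'n set). sqrt (K / \<nu>))" by (intro sum_mono n2')
   finally show ?thesis by simp
  qed
  have Rs: "sqint M Rx" unfolding Rx_def by (intro sqint_diff sqint_cmult Phi_H01 u H01_sqint(1) nb(1))
  have Rn: "nrm M Rx <= 2 * sqrt B2 + P * B1 + sqrt (2 * K / \<beta>)"
  proof -
   have "nrm M Rx <= nrm M (%x. (1 + \<gamma>) * Phi (u x) - \<gamma> * u x) + nrm M (%x. Psi (u x))"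
    unfolding Rx_def by (intro nrm_triangle_diff sqint_diff sqint_cmult Phi_H01 u H01_sqint(1) nb(1))
   also have "nrm M (%x. (1 + \<gamma>) * Phi (u x) - \<gamma> * u x) <= nrm M (%x. (1 + \<gamma>) * Phi (u x)) + nrm M (%x. \<gamma> * u x)"
    by (intro nrm_triangle_diff sqint_cmult Phi_H01 u H01_sqint(1))
   also have "... = (1 + \<gamma>) * nrm M (%x. Phi (u x)) + \<gamma> * nrm M u" using gam by (simp add: nrm_cmult)
   also have "... <= 2 * sqrt B2 + 1 * (P * B1)"
    using gam n3 nu nrm_nonneg[of M u] by (intro add_mono mult_mono) (auto intro: order_trans[OF nrm_nonneg])
   finally show ?thesis using n1' by simp
  qed
  have l: "sqint M (laplacian \<Omega> u)" by (rule laplacian_weak(1)[OF u])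
  have "AE x in M. laplacian \<Omega> u x = (1 / \<nu>) * (\<alpha> * A x - \<beta> * Rx x - f x)"
  proof -
   have "AE x in M. - \<nu> * laplacian \<Omega> u x + \<alpha> * advection \<Omega> \<delta> u x - \<beta> * reaction \<gamma> \<delta> u x = f x"
    using s by (simp add: strong_solution_def)
   then show ?thesis
   proof eventually_elim
    case (elim x)
    have "advection \<Omega> \<delta> u x = A x" by (simp add: advection_def grad_def A_def sum_distrib_left)
    then show ?case using elim pos unfolding reaction_eq Rx_def[symmetric] by (simp add: field_simps)
   qed
  qed
  then have "nrm M (laplacian \<Omega> u) = nrm M (%x. (1 / \<nu>) * (\<alpha> * A x - \<beta> * Rx x - f x))"
   by (intro nrm_cong_AE l sqint_cmult sqint_diff As Rs f)
  also have "... = (1 / \<nu>) * nrm M (%x. \<alpha> * A x - \<beta> * Rx x - f x)" unfolding nrm_cmult using pos by simp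
  also have "... <= BL" unfolding BL_def
  proof (rule mult_left_mono)
   have "nrm M (%x. \<alpha> * A x - \<beta> * Rx x - f x) <= nrm M (%x. \<alpha> * A x - \<beta> * Rx x) + nrm M f"
    by (intro nrm_triangle_diff sqint_diff sqint_cmult As Rs f)
   also have "nrm M (%x. \<alpha> * A x - \<beta> * Rx x) <= nrm M (%x. \<alpha> * A x) + nrm M (%x. \<beta> * Rx x)"
    by (intro nrm_triangle_diff sqint_cmult As Rs)
   also have "... = \<alpha> * nrm M A + \<beta> * nrm M Rx" using pos by (simp add: nrm_cmult)
   also have "... <= \<alpha> * (real CARD('n) * sqrt (K / \<nu>)) + \<beta> * (2 * sqrt B2 + P * B1 + sqrt (2 * K / \<beta>))"
    using pos by (intro add_mono mult_left_mono An Rn) auto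
   finally show "nrm M (%x. \<alpha> * A x - \<beta> * Rx x - f x) <=
    \<alpha> * (real CARD('n) * sqrt (K / \<nu>)) + \<beta> * (2 * sqrt B2 + P * B1 + sqrt (2 * K / \<beta>)) + N" using N by simp
  qed (use pos in simp)
  finally show ?thesis using nb(1) n1 by blast
 qed
 show thesis
 proof (rule that[of "1 + \<bar>B1\<bar> + \<bar>B2\<bar> + \<bar>2 * K / \<beta>\<bar> + \<bar>BL\<bar>"])
  show "0 < 1 + \<bar>B1\<bar> + \<bar>B2\<bar> + \<bar>2 * K / \<beta>\<bar> + \<bar>BL\<bar>" by linarith
 next
  fix u f assume H: "u \<in> H0" "sqint M f" "nrm M f = N" "form u u = (LINT x|M. f x * u x)"
  show "gn u <= 1 + \<bar>B1\<bar> + \<bar>B2\<bar> + \<bar>2 * K / \<beta>\<bar> + \<bar>BL\<bar> \<and> PI u <= 1 + \<bar>B1\<bar> + \<bar>B2\<bar> + \<bar>2 * K / \<beta>\<bar> + \<bar>BL\<bar>"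
   using en[OF H] by linarith
 next
  fix u f assume H: "sqint M f" "nrm M f = N" "strong_solution \<Omega> \<nu> \<alpha> \<beta> \<gamma> \<delta> f u"
  show "sqint M (%x. Psi (u x)) \<and> (nrm M (%x. Psi (u x)))^2 <= 1 + \<bar>B1\<bar> + \<bar>B2\<bar> + \<bar>2 * K / \<beta>\<bar> + \<bar>BL\<bar> \<and>
    nrm M (laplacian \<Omega> u) <= 1 + \<bar>B1\<bar> + \<bar>B2\<bar> + \<bar>2 * K / \<beta>\<bar> + \<bar>BL\<bar>"
   using strong[OF H] by linarith
 qed
qed

end

section \<open>Difference quotients of the nonlinearities\<close>

definition dq :: "(real => real) => (real => real) => real => real => real" where
 "dq f f' a b = (if a = b then f' a else (f a - f b) / (a - b))"

lemma dq_mult: "f a - f b = dq f f' a b * (a - b)"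
 by (simp add: dq_def)

text \<open>Continuity is needed jointly and across the diagonal, since discrete and exact states
  may or may not merge in the limit. On the diagonal the quotient is a value of \<open>f'\<close> at
  an intermediate point.\<close>

lemma dq_tendsto:
 assumes der: "!!s. (f has_real_derivative f' s) (at s)" and c: "continuous_on UNIV f'"
  and a: "a ----> x" and b: "b ----> y"
 shows "(%n::nat. dq f f' (a n) (b n)) ----> dq f f' x y"
proof (cases "x = y")
 case False
 have "eventually (%n. a n - b n ~= 0) sequentially"
  using tendsto_imp_eventually_ne[OF tendsto_diff[OF a b], of 0] False by simp
 then have ev: "eventually (%n. (f (a n) - f (b n)) / (a n - b n) = dq f f' (a n) (b n)) sequentially"
  by eventually_elim (simp add: dq_def)
 have "(%n. (f (a n) - f (b n)) / (a n - b n)) ----> (f x - f y) / (x - y)"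
  using False by (intro tendsto_intros isCont_tendsto_compose[OF DERIV_isCont[OF der]] a b) auto
 then show ?thesis using False Lim_transform_eventually[OF _ ev] by (simp add: dq_def)
next
 case True
 have "\<exists>z. \<bar>z - x\<bar> <= \<bar>a n - x\<bar> + \<bar>b n - x\<bar> \<and> dq f f' (a n) (b n) = f' z" for n
 proof (cases "a n = b n")
  case True then show ?thesis by (intro exI[of _ "a n"]) (simp add: dq_def)
 next
  case False
  have *: "\<exists>z>s. z < t \<and> f t - f s = (t - s) * f' z" if "s < t" for s t using MVT2[OF that, of f f'] der by auto
  have "\<exists>z. (a n < z \<and> z < b n \<or> b n < z \<and> z < a n) \<and> f (a n) - f (b n) = (a n - b n) * f' z"
  proof (cases "a n < b n")
   case True
   then obtain z where "z > a n" "z < b n" "f (b n) - f (a n) = (b n - a n) * f' z" using * by blast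
   then show ?thesis by (intro exI[of _ z]) (auto simp: algebra_simps)
  next
   case F: False
   then obtain z where "z > b n" "z < a n" "f (a n) - f (b n) = (a n - b n) * f' z" using *[of "b n" "a n"] False by auto
   then show ?thesis by blast
  qed
  then obtain z where z: "a n < z \<and> z < b n \<or> b n < z \<and> z < a n" "f (a n) - f (b n) = (a n - b n) * f' z" by blast
  have "\<bar>z - x\<bar> <= \<bar>a n - x\<bar> + \<bar>b n - x\<bar>" using z(1) by linarith
  moreover have "dq f f' (a n) (b n) = f' z" using z(2) False by (simp add: dq_def)
  ultimately show ?thesis by blast
 qed
 then have "\<exists>z. \<forall>n. \<bar>z n - x\<bar> <= \<bar>a n - x\<bar> + \<bar>b n - x\<bar> \<and> dq f f' (a n) (b n) = f' (z n)" by (intro choice allI)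
 then obtain z where z: "!!n. \<bar>z n - x\<bar> <= \<bar>a n - x\<bar> + \<bar>b n - x\<bar>" "!!n. dq f f' (a n) (b n) = f' (z n)" by blast
 have "(%n. \<bar>a n - x\<bar> + \<bar>b n - x\<bar>) ----> \<bar>x - x\<bar> + \<bar>y - x\<bar>" by (intro tendsto_intros a b)
 then have "(%n. \<bar>a n - x\<bar> + \<bar>b n - x\<bar>) ----> 0" using True by simp
 then have "(%n. z n - x) ----> 0" by (rule Lim_null_comparison[rotated]) (use z(1) in simp)
 then have "z ----> x" by (rule LIM_zero_cancel)
 then have "(%n. f' (z n)) ----> f' x" by (rule continuous_on_tendsto_compose[OF c]) auto
 then show ?thesis unfolding z(2) using True by (simp add: dq_def)
qed

lemma (in bounded_domain) dq_meas:
 assumes "continuous_on UNIV f" "continuous_on UNIV f'" "u \<in> borel_measurable M" "v \<in> borel_measurable M"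
 shows "(%x. dq f f' (u x) (v x)) \<in> borel_measurable M"
proof -
 note [measurable] = meas_compose[OF assms(1,3)] meas_compose[OF assms(1,4)] meas_compose[OF assms(2,3)] assms(3,4)
 show ?thesis unfolding dq_def by measurable
qed

context exponent
begin

abbreviation "cq \<equiv> dq Phi (%s. (\<delta> + 1) * sg s)"
abbreviation "mq \<equiv> dq Psi (%s. (2 * \<delta> + 1) * (wt s))"

lemma cq_bound: "\<bar>cq a b\<bar> <= (\<delta> + 1) * (\<bar>a\<bar> powr \<delta> + \<bar>b\<bar> powr \<delta>)"
proof (cases "a = b")
 case True
 then show ?thesis using delta by (simp add: dq_def abs_mult abs_spow)
next
 case False
 have "\<bar>cq a b\<bar> * \<bar>a - b\<bar> = \<bar>Phi a - Phi b\<bar>" unfolding dq_mult[of Phi a b "%s. (\<delta> + 1) * sg s"] abs_mult ..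
 also have "... <= (\<delta> + 1) * (\<bar>a\<bar> powr \<delta> + \<bar>b\<bar> powr \<delta>) * \<bar>a - b\<bar>" by (rule Phi_diff)
 finally show ?thesis using False by simp
qed

lemma mq_bound: "\<bar>mq a b\<bar> <= (2 * \<delta> + 1) * ((wt a) + (wt b))"
proof (cases "a = b")
 case True
 then show ?thesis using delta by (simp add: dq_def abs_mult)
next
 case False
 have "\<bar>mq a b\<bar> * \<bar>a - b\<bar> = \<bar>Psi a - Psi b\<bar>"
  unfolding dq_mult[of Psi a b "%s. (2 * \<delta> + 1) * (wt s)"] abs_mult ..
 also have "... <= (2 * \<delta> + 1) * ((wt a) + (wt b)) * \<bar>a - b\<bar>" by (rule Psi_diff)
 finally show ?thesis using False by simp
qed

text \<open>\<open>Phi_Psi_cauchy_schwarz\<close> for quotients: the reaction coefficient dominates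
  the square of the drift coefficient, whichever two states are compared. The factor is the constant
  s of \<open>limit_equation_unique\<close>.\<close>

lemma cq_le_mq: "(2 * \<delta> + 1) / (\<delta> + 1)^2 * (cq a b)^2 <= mq a b"
proof -
 have "(2 * \<delta> + 1) * (cq a b)^2 <= (\<delta> + 1)^2 * mq a b"
 proof (cases "a = b")
  case True
  then show ?thesis by (simp add: dq_def power_mult_distrib spow_sq)
 next
  case False
  have "(2 * \<delta> + 1) * (cq a b * (a - b))^2 <= (\<delta> + 1)^2 * (mq a b * (a - b) * (a - b))"
   unfolding dq_mult[of Phi a b "%s. (\<delta> + 1) * sg s", symmetric] dq_mult[of Psi a b "%s. (2 * \<delta> + 1) * (wt s)", symmetric]
   by (rule Phi_Psi_cauchy_schwarz)
  then have "((2 * \<delta> + 1) * (cq a b)^2) * (a - b)^2 <= ((\<delta> + 1)^2 * mq a b) * (a - b)^2"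
   by (simp add: power2_eq_square mult_ac)
  then show ?thesis using False by simp
 qed
 then show ?thesis using delta by (simp add: pos_divide_le_eq mult.commute)
qed

lemma abs_Psi_sq: "(Psi s)^2 = \<bar>s\<bar> powr (4 * \<delta> + 2)"
proof -
 have "(Psi s)^2 = \<bar>Psi s\<bar> * \<bar>Psi s\<bar>" by (simp add: power2_eq_square)
 then show ?thesis by (simp add: abs_Psi powr_add[symmetric])
qed

end

context gn_domain
begin

lemma weighted_cs:
 assumes u: "pint u" and d: "d \<in> H0" and e: "e \<in> H0"
 shows "(LINT x|M. (wt (u x)) * \<bar>d x * e x\<bar>) <= (PI u + Gc) * (gn d * gn e)"
proof -
 have n: "nrm M (%x. \<bar>sg (u x) * d x\<bar>) <= sqrt (PI u + Gc) * gn d" if d: "d \<in> H0" for d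
 proof -
  have "(nrm M (%x. \<bar>sg (u x) * d x\<bar>))^2 <= (PI u + Gc) * (gn d)^2"
   using weighted_bound[OF u d] by (simp add: nrm_sq power_mult_distrib spow_sq)
  from real_le_rsqrt[OF this] show ?thesis using grad_norm_nonneg[OF H01_W1[OF d]] by (simp add: real_sqrt_mult)
 qed
 have s: "sqint M (%x. \<bar>sg (u x) * d x\<bar>)" if "d \<in> H0" for d by (intro sqint_abs sg_mult_sqint u Gc(2) that)
 have "(wt (u x)) * \<bar>d x * e x\<bar> = \<bar>sg (u x) * d x\<bar> * \<bar>sg (u x) * e x\<bar>" for x
  unfolding spow_sq[symmetric] by (simp add: abs_mult power2_eq_square mult_ac flip: power2_abs)
 then have "(LINT x|M. (wt (u x)) * \<bar>d x * e x\<bar>) <= nrm M (%x. \<bar>sg (u x) * d x\<bar>) * nrm M (%x. \<bar>sg (u x) * e x\<bar>)"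
  using cauchy_schwarz[OF s[OF d] s[OF e]] by simp
 also have "... <= (sqrt (PI u + Gc) * gn d) * (sqrt (PI u + Gc) * gn e)"
  by (intro mult_mono n d e order_trans[OF nrm_nonneg n[OF d]]) auto
 also have "... = (sqrt (PI u + Gc) * sqrt (PI u + Gc)) * (gn d * gn e)" by (simp add: mult_ac)
 also have "sqrt (PI u + Gc) * sqrt (PI u + Gc) = PI u + Gc" using PI_nonneg[of u] Gc(1) by simp
 finally show ?thesis .
qed

text \<open>\<open>interpolation\<close> is not homogeneous in w. Applying it to w divided by its
  energy norm and scaling back gives an estimate quadratic in w.\<close>

lemma scaled_interpolation:
 assumes th: "\<theta> > 0"
 shows "\<exists>C\<ge>0. \<forall>u w. u \<in> H0 --> w \<in> H0 --> sqint M (%x. Psi (u x)) -->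
  (LINT x|M. (wt (u x)) * (w x)^2) <= \<theta> * (Gc + (nrm M (%x. Psi (u x)))^2) * (gn w)^2 + C * (nrm M w)^2"
proof -
 obtain C where C: "C \<ge> 0" "!!u w. (wt u) * w^2 <= \<theta> * ((pw w) + \<bar>u\<bar> powr (4 * \<delta> + 2)) + C * w^2"
  using interpolation[OF th] by blast
 show ?thesis
 proof (intro exI[of _ C] conjI allI impI C(1))
  fix u w assume u: "u \<in> H0" and w: "w \<in> H0" and Ps: "sqint M (%x. Psi (u x))"
  define g where "g = gn w"
  have g0: "0 <= g" unfolding g_def by (rule grad_norm_nonneg[OF H01_W1[OF w]])
  show "(LINT x|M. (wt (u x)) * (w x)^2) <= \<theta> * (Gc + (nrm M (%x. Psi (u x)))^2) * (gn w)^2 + C * (nrm M w)^2"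
  proof (cases "g = 0")
   case True
   have "(LINT x|M. (wt (u x)) * (w x)^2) <= 0"
    using weighted_bound[OF Gc(2)[OF u] w] True by (simp add: g_def)
   also have "0 <= \<theta> * (Gc + (nrm M (%x. Psi (u x)))^2) * (gn w)^2 + C * (nrm M w)^2"
    using C(1) th Gc(1) by (intro add_nonneg_nonneg mult_nonneg_nonneg) auto
   finally show ?thesis .
  next
   case False
   then have g: "g > 0" using g0 by simp
   define e where "e x = (1 / g) * w x" for x
   have e: "e \<in> H0" unfolding e_def by (rule H01_cmult(1)[OF w])
   have e1: "gn e = 1" unfolding e_def grad_norm_cmult[OF H01_W1[OF w]] using g by (simp add: g_def)
   have we: "w x = g * e x" for x using g by (simp add: e_def)
   have Pe: "PI e <= Gc" using Gc(3)[OF e] e1 by simp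
   note i = pintD(2)[OF Gc(2)[OF e]] sqint_sq[OF Ps] sqint_sq[OF H01_sqint(1)[OF e]]
   have "(LINT x|M. (wt (u x)) * (e x)^2) <= (LINT x|M. \<theta> * ((pw (e x)) + (Psi (u x))^2) + C * (e x)^2)"
    unfolding abs_Psi_sq by (intro integral_mono C(2) weighted_sqint Gc(2) u e) (use i in \<open>simp add: abs_Psi_sq\<close>)
   also have "... = \<theta> * (PI e + (nrm M (%x. Psi (u x)))^2) + C * (nrm M e)^2"
    unfolding PI_def nrm_sq using i by simp
   also have "... <= \<theta> * (Gc + (nrm M (%x. Psi (u x)))^2) + C * (nrm M e)^2"
    using Pe th by (intro add_right_mono mult_left_mono) auto
   finally have "g^2 * (LINT x|M. (wt (u x)) * (e x)^2) <= g^2 * (\<theta> * (Gc + (nrm M (%x. Psi (u x)))^2) + C * (nrm M e)^2)"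
    by (intro mult_left_mono) auto
   moreover have "g^2 * (LINT x|M. (wt (u x)) * (e x)^2) = (LINT x|M. (wt (u x)) * (w x)^2)"
    unfolding integral_mult_right_zero[symmetric] we
    by (intro Bochner_Integration.integral_cong refl) (simp add: power_mult_distrib mult_ac)
   moreover have "nrm M w = g * nrm M e" using nrm_cmult[of M g e] g by (simp add: we[abs_def])
   ultimately show ?thesis by (simp add: g_def[symmetric] algebra_simps power_mult_distrib)
  qed
 qed
qed

end

section \<open>Lipschitz and Garding estimates for the form\<close>

context burgers_huxley
begin

lemma form_diff_right:
 assumes u: "u \<in> H0" and v: "v \<in> H0" and w: "w \<in> H0"
 shows "form u (%x. v x - w x) = form u v - form u w"
proof -
 have d: "(%x. v x - w x) \<in> H0" by (rule H01_diff(1)[OF v w])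
 have P: "(LINT x|M. Phi (u x) * D i (%x. v x - w x) x) = (LINT x|M. Phi (u x) * D i v x) - (LINT x|M. Phi (u x) * D i w x)" for i
 proof -
  have "(LINT x|M. D i (%x. v x - w x) x * Phi (u x)) = (LINT x|M. (D i v x - D i w x) * Phi (u x))"
   by (rule D_cong_nrm(2)[OF H01_W1[OF d] _ H01_diff(2)[OF v w] Phi_H01[OF u]]) (intro sqint_diff H01_sqint v w)
  also have "... = (LINT x|M. Phi (u x) * D i v x - Phi (u x) * D i w x)"
   by (intro Bochner_Integration.integral_cong refl) (simp add: algebra_simps)
  also have "... = (LINT x|M. Phi (u x) * D i v x) - (LINT x|M. Phi (u x) * D i w x)"
   by (intro Bochner_Integration.integral_diff sqint_mult_integrable Phi_H01 u H01_sqint v w)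
  finally show ?thesis by (simp add: mult.commute)
 qed
 have I: "(LINT x|M. k x * (v x - w x)) = (LINT x|M. k x * v x) - (LINT x|M. k x * w x)"
  if "integrable M (%x. k x * v x)" "integrable M (%x. k x * w x)" for k
  unfolding right_diff_distrib using that by simp
 note i = sqint_mult_integrable[OF Phi_H01[OF u] H01_sqint(1)[OF v]] sqint_mult_integrable[OF Phi_H01[OF u] H01_sqint(1)[OF w]]
  sqint_mult_integrable[OF H01_sqint(1)[OF u] H01_sqint(1)[OF v]] sqint_mult_integrable[OF H01_sqint(1)[OF u] H01_sqint(1)[OF w]]
  Psi_mult_integrable[OF u v] Psi_mult_integrable[OF u w]
 show ?thesis
  unfolding form_def grad_inner_diff_right[OF H01_W1[OF v] H01_W1[OF w] H01_W1[OF u]] P sum_subtractf I[OF i(1,2)] I[OF i(3,4)] I[OF i(5,6)]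
  by (simp add: algebra_simps)
qed

lemma form_diff_left:
 assumes u: "u \<in> H0" and v: "v \<in> H0" and e: "e \<in> H0"
 shows "form v e - form u e = \<nu> * gi (%x. v x - u x) e - \<alpha> / (\<delta> + 1) * (\<Sum>i\<in>UNIV. (LINT x|M. (Phi (v x) - Phi (u x)) * D i e x))
  - \<beta> * (1 + \<gamma>) * (LINT x|M. (Phi (v x) - Phi (u x)) * e x) + \<beta> * \<gamma> * (LINT x|M. (v x - u x) * e x)
  + \<beta> * (LINT x|M. (Psi (v x) - Psi (u x)) * e x)"
proof -
 have I: "(LINT x|M. (h x - k x) * z x) = (LINT x|M. h x * z x) - (LINT x|M. k x * z x)"
  if "integrable M (%x. h x * z x)" "integrable M (%x. k x * z x)" for h k z :: "real ^ 'n => real"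
  unfolding left_diff_distrib using that by simp
 note s = H01_sqint(1)[OF e] H01_sqint(2)[OF e]
 note i = I[OF sqint_mult_integrable[OF Phi_H01[OF v] s(1)] sqint_mult_integrable[OF Phi_H01[OF u] s(1)]]
  I[OF sqint_mult_integrable[OF Phi_H01[OF v] s(2)] sqint_mult_integrable[OF Phi_H01[OF u] s(2)]]
  I[OF sqint_mult_integrable[OF H01_sqint(1)[OF v] s(1)] sqint_mult_integrable[OF H01_sqint(1)[OF u] s(1)]]
  I[OF Psi_mult_integrable[OF v e] Psi_mult_integrable[OF u e]]
 show ?thesis
  unfolding form_def i sum_subtractf grad_inner_diff[OF H01_W1[OF v] H01_W1[OF u] H01_W1[OF e]]
  by (simp add: algebra_simps)
qed

lemma Phi_diff_le:
 assumes u: "u \<in> H0" and v: "v \<in> H0" and B: "PI u <= B" "PI v <= B"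
 shows "(nrm M (%x. Phi (v x) - Phi (u x)))^2 <= 4 * (\<delta> + 1)^2 * (B + Gc) * (gn (%x. v x - u x))^2"
proof -
 note Phi_diff_nrm[OF v u]
 also have "2 * (\<delta> + 1)^2 * (PI v + PI u + 2 * Gc) * (gn (%x. v x - u x))^2 <=
   2 * (\<delta> + 1)^2 * (2 * (B + Gc)) * (gn (%x. v x - u x))^2"
  using B by (intro mult_right_mono mult_left_mono) auto
 also have "... = 4 * (\<delta> + 1)^2 * (B + Gc) * (gn (%x. v x - u x))^2" by (simp add: algebra_simps)
 finally show ?thesis .
qed

lemma form_lipschitz:
 "\<exists>C\<ge>0. \<forall>u v e. u \<in> H0 --> v \<in> H0 --> e \<in> H0 --> PI u <= B --> PI v <= B -->
  \<bar>form v e - form u e\<bar> <= C * gn (%x. v x - u x) * gn e"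
proof -
 obtain P where P: "P > 0" "!!u. u \<in> H0 ==> nrm M u <= P * gn u" using poincare by blast
 define L where "L = sqrt (4 * (\<delta> + 1)^2 * (\<bar>B\<bar> + Gc))"
 have L0: "0 <= L" using Gc(1) by (simp add: L_def)
 define C where "C = \<nu> + \<alpha> / (\<delta> + 1) * (real CARD('n) * L) + \<beta> * (1 + \<gamma>) * (L * P) + \<beta> * \<gamma> * (P * P) + \<beta> * ((2 * \<delta> + 1) * (2 * (\<bar>B\<bar> + Gc)))"
 have C0: "0 <= C" unfolding C_def using pos gam delta L0 P(1) Gc(1) by (intro add_nonneg_nonneg mult_nonneg_nonneg) auto
 show ?thesis
 proof (intro exI[of _ C] conjI allI impI C0)
  fix u v e assume u: "u \<in> H0" and v: "v \<in> H0" and e: "e \<in> H0" and "PI u <= B" "PI v <= B"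
  then have B: "PI u <= \<bar>B\<bar>" "PI v <= \<bar>B\<bar>" by auto
  define w where "w x = v x - u x" for x
  have w: "w \<in> H0" unfolding w_def by (rule H01_diff(1)[OF v u])
  define g where "g = gn w"
  define k where "k = gn e"
  have gk: "0 <= g" "0 <= k" unfolding g_def k_def by (intro grad_norm_nonneg H01_W1 w e)+
  have dPs: "sqint M (%x. Phi (v x) - Phi (u x))" by (intro sqint_diff Phi_H01 u v)
  have dP: "nrm M (%x. Phi (v x) - Phi (u x)) <= L * g"
  proof -
   from real_le_rsqrt[OF Phi_diff_le[OF u v B]]
   show ?thesis using gk by (simp add: real_sqrt_mult L_def g_def w_def[abs_def])
  qed
  have 1: "\<bar>\<nu> * gi w e\<bar> <= \<nu> * (g * k)"
   unfolding abs_mult using pos grad_cauchy_schwarz[OF H01_W1[OF w] H01_W1[OF e]] by (simp add: g_def k_def)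
  have "\<bar>\<Sum>i\<in>UNIV. (LINT x|M. (Phi (v x) - Phi (u x)) * D i e x)\<bar> <= (\<Sum>i\<in>(UNIV::'n set). L * g * k)"
  proof (rule order_trans[OF sum_abs sum_mono])
   fix i
   have "\<bar>(LINT x|M. (Phi (v x) - Phi (u x)) * D i e x)\<bar> <= nrm M (%x. Phi (v x) - Phi (u x)) * nrm M (D i e)"
    by (rule cauchy_schwarz[OF dPs H01_sqint(2)[OF e]])
   also have "... <= (L * g) * k" using nrm_D_le[OF H01_W1[OF e], of i] L0 gk by (intro mult_mono dP) (auto simp: k_def)
   finally show "\<bar>(LINT x|M. (Phi (v x) - Phi (u x)) * D i e x)\<bar> <= L * g * k" .
  qed
  then have "\<alpha> / (\<delta> + 1) * \<bar>\<Sum>i\<in>UNIV. (LINT x|M. (Phi (v x) - Phi (u x)) * D i e x)\<bar> <= \<alpha> / (\<delta> + 1) * (\<Sum>i\<in>(UNIV::'n set). L * g * k)"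
   using pos delta by (intro mult_left_mono) auto
  then have 2: "\<bar>\<alpha> / (\<delta> + 1) * (\<Sum>i\<in>UNIV. (LINT x|M. (Phi (v x) - Phi (u x)) * D i e x))\<bar> <= \<alpha> / (\<delta> + 1) * (real CARD('n) * L) * (g * k)"
   using pos delta by (simp add: abs_mult mult_ac)
  have ek: "nrm M e <= P * k" "nrm M w <= P * g" using P(2) e w by (auto simp: k_def g_def)
  have "\<bar>(LINT x|M. (Phi (v x) - Phi (u x)) * e x)\<bar> <= nrm M (%x. Phi (v x) - Phi (u x)) * nrm M e"
   by (rule cauchy_schwarz[OF dPs H01_sqint(1)[OF e]])
  also have "... <= (L * g) * (P * k)" using L0 gk by (intro mult_mono dP ek) auto
  finally have "\<beta> * (1 + \<gamma>) * \<bar>(LINT x|M. (Phi (v x) - Phi (u x)) * e x)\<bar> <= \<beta> * (1 + \<gamma>) * ((L * g) * (P * k))"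
   using pos gam by (intro mult_left_mono) auto
  then have 3: "\<bar>\<beta> * (1 + \<gamma>) * (LINT x|M. (Phi (v x) - Phi (u x)) * e x)\<bar> <= \<beta> * (1 + \<gamma>) * (L * P) * (g * k)"
   using pos gam by (simp add: abs_mult mult_ac)
  have "\<bar>(LINT x|M. w x * e x)\<bar> <= nrm M w * nrm M e" by (rule cauchy_schwarz[OF H01_sqint(1)[OF w] H01_sqint(1)[OF e]])
  also have "... <= (P * g) * (P * k)" using P(1) gk by (intro mult_mono ek) auto
  finally have "\<beta> * \<gamma> * \<bar>(LINT x|M. w x * e x)\<bar> <= \<beta> * \<gamma> * ((P * g) * (P * k))" using pos gam by (intro mult_left_mono) auto
  then have 4: "\<bar>\<beta> * \<gamma> * (LINT x|M. w x * e x)\<bar> <= \<beta> * \<gamma> * (P * P) * (g * k)"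
   using pos gam by (simp add: abs_mult mult_ac)
  have iw: "integrable M (%x. (wt (z x)) * \<bar>w x * e x\<bar>)" if "z \<in> H0" for z
   by (rule weighted_mult_integrable[OF Gc(2)[OF that] Gc(2)[OF w] Gc(2)[OF e]])
  have "\<bar>(LINT x|M. (Psi (v x) - Psi (u x)) * e x)\<bar> <=
    (LINT x|M. (2 * \<delta> + 1) * ((wt (v x)) * \<bar>w x * e x\<bar> + (wt (u x)) * \<bar>w x * e x\<bar>))"
  proof (rule integral_abs_bound[THEN order_trans], rule integral_mono)
   show "integrable M (%x. \<bar>(Psi (v x) - Psi (u x)) * e x\<bar>)"
    unfolding left_diff_distrib by (intro integrable_abs Bochner_Integration.integrable_diff Psi_mult_integrable u v e)
   show "integrable M (%x. (2 * \<delta> + 1) * ((wt (v x)) * \<bar>w x * e x\<bar> + (wt (u x)) * \<bar>w x * e x\<bar>))"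
    by (intro integrable_mult_right Bochner_Integration.integrable_add iw u v)
   show "\<bar>(Psi (v x) - Psi (u x)) * e x\<bar> <= (2 * \<delta> + 1) * ((wt (v x)) * \<bar>w x * e x\<bar> + (wt (u x)) * \<bar>w x * e x\<bar>)" for x
    using mult_right_mono[OF Psi_diff[of "v x" "u x"], of "\<bar>e x\<bar>"] unfolding w_def abs_mult
    by (simp only: distrib_left distrib_right mult_ac add_ac abs_ge_zero simp_thms)
  qed
  also have "... = (2 * \<delta> + 1) * ((LINT x|M. (wt (v x)) * \<bar>w x * e x\<bar>) + (LINT x|M. (wt (u x)) * \<bar>w x * e x\<bar>))"
   using iw[OF u] iw[OF v] by simp
  also have "... <= (2 * \<delta> + 1) * ((\<bar>B\<bar> + Gc) * (g * k) + (\<bar>B\<bar> + Gc) * (g * k))"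
  proof -
   have "(LINT x|M. (wt (z x)) * \<bar>w x * e x\<bar>) <= (\<bar>B\<bar> + Gc) * (g * k)" if z: "z \<in> H0" "PI z <= \<bar>B\<bar>" for z
    using weighted_cs[OF Gc(2)[OF z(1)] w e] mult_right_mono[of "PI z + Gc" "\<bar>B\<bar> + Gc" "g * k"] z(2) gk
    by (simp add: g_def k_def)
   then show ?thesis using delta u v B by (intro mult_left_mono add_mono) auto
  qed
  finally have "\<beta> * \<bar>(LINT x|M. (Psi (v x) - Psi (u x)) * e x)\<bar> <= \<beta> * ((2 * \<delta> + 1) * ((\<bar>B\<bar> + Gc) * (g * k) + (\<bar>B\<bar> + Gc) * (g * k)))"
   using pos by (intro mult_left_mono) auto
  then have 5: "\<bar>\<beta> * (LINT x|M. (Psi (v x) - Psi (u x)) * e x)\<bar> <= \<beta> * ((2 * \<delta> + 1) * (2 * (\<bar>B\<bar> + Gc))) * (g * k)"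
   using pos by (simp add: abs_mult mult_ac)
  have tri: "\<bar>t1 - t2 - t3 + t4 + t5\<bar> <= (c1 + c2 + c3 + c4 + c5) * q"
   if "\<bar>t1\<bar> <= c1 * q" "\<bar>t2\<bar> <= c2 * q" "\<bar>t3\<bar> <= c3 * q" "\<bar>t4\<bar> <= c4 * q" "\<bar>t5\<bar> <= c5 * q" for t1 t2 t3 t4 t5 c1 c2 c3 c4 c5 q :: real
   using that unfolding distrib_right by (simp add: abs_le_iff)
  have "\<bar>form v e - form u e\<bar> <= C * (g * k)"
   unfolding form_diff_left[OF u v e] w_def[symmetric] C_def by (rule tri[OF 1 2 3 4 5])
  then show "\<bar>form v e - form u e\<bar> <= C * gn (%x. v x - u x) * gn e"
   by (simp add: g_def k_def w_def[abs_def] mult.assoc)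
 qed
qed

text \<open>The budget: half of \<nu> is kept, a quarter goes to Young's inequality for the drift
  and a quarter to interpolation of \<open>wt u * w^2\<close>. One half of the monotone term
  \<open>(Psi v - Psi u) * w\<close> absorbs the lower reaction, the other half gives the p-th power
  of w that the drift remainder consumes. Only u needs the bound on \<open>Psi\<close>, so v may be
  a discrete solution.\<close>

lemma garding:
 "\<exists>C\<ge>0. \<forall>u v. u \<in> H0 --> v \<in> H0 --> sqint M (%x. Psi (u x)) --> (nrm M (%x. Psi (u x)))^2 <= B -->
  \<nu> / 2 * (gn (%x. v x - u x))^2 <=
   form v (%x. v x - u x) - form u (%x. v x - u x) + C * (nrm M (%x. v x - u x))^2"
proof -
 define a where "a = \<alpha> / (\<delta> + 1)"
 have a: "a > 0" using pos delta by (simp add: a_def)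
 define k where "k = ((\<delta> + 1) * (2 powr \<delta> + 1) + 1)"
 define c0 :: real where "c0 = (1/2) powr (2 * \<delta> + 1)"
 have c0: "c0 > 0" by (simp add: c0_def)
 define R where "R = real CARD('n) * (a^2 / \<nu>) * (2 * k^2)"
 have k0: "k > 0" using delta by (simp add: k_def add_nonneg_pos)
 have R: "R > 0" using a pos k0 by (simp add: R_def)
 \<comment> \<open>Makes the p-th power in the drift remainder equal to the coercivity
   \<open>\<beta> * c0 / 2\<close> at hand.\<close>
 define \<eta> where "\<eta> = sqrt (\<beta> * c0 / (2 * R))"
 have eta: "\<eta> > 0" "R * \<eta>^2 = \<beta> * c0 / 2" using pos c0 R by (auto simp: \<eta>_def)
 define Q where "Q = R * (1 + \<eta> powr (2 - 2 * \<delta>))"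
 have Q: "Q > 0" using R by (simp add: Q_def add_pos_nonneg)
 \<comment> \<open>Makes the interpolated weight term cost a quarter of \<nu>.\<close>
 define \<theta> where "\<theta> = \<nu> / (4 * Q * (Gc + \<bar>B\<bar>))"
 have th: "\<theta> > 0" using pos Q Gc(1) by (simp add: \<theta>_def add_pos_nonneg)
 have Qth: "Q * (\<theta> * (Gc + \<bar>B\<bar>)) = \<nu> / 4" using Q Gc(1) by (simp add: \<theta>_def)
 obtain C1 where C1: "C1 \<ge> 0" "\<forall>u w. u \<in> H0 --> w \<in> H0 --> sqint M (%x. Psi (u x)) -->
  (LINT x|M. (wt (u x)) * (w x)^2) <= \<theta> * (Gc + (nrm M (%x. Psi (u x)))^2) * (gn w)^2 + C1 * (nrm M w)^2"
  using scaled_interpolation[OF th] by blast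
 \<comment> \<open>By \<open>Phi_Psi_cauchy_schwarz\<close>, \<kappa> times the squared increment of
   \<open>Phi\<close> is at most \<beta> / 2 times the monotone term.\<close>
 define \<kappa> where "\<kappa> = \<beta> * (2 * \<delta> + 1) / (2 * (\<delta> + 1)^2)"
 have kap: "\<kappa> > 0" using pos delta by (simp add: \<kappa>_def)
 define b where "b = \<beta> * (1 + \<gamma>)"
 define C2 where "C2 = b^2 / (4 * \<kappa>)"
 have C2: "C2 \<ge> 0" using kap by (simp add: C2_def)
 show ?thesis
 proof (intro exI[of _ "Q * C1 + C2"] conjI allI impI)
  show "0 <= Q * C1 + C2" using Q C1(1) C2 by simp
  fix u v assume u: "u \<in> H0" and v: "v \<in> H0" and Ps: "sqint M (%x. Psi (u x))" and PB: "(nrm M (%x. Psi (u x)))^2 <= B"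
  define w where "w x = v x - u x" for x
  have w: "w \<in> H0" unfolding w_def by (rule H01_diff(1)[OF v u])
  have vw: "v x = u x + w x" for x by (simp add: w_def)
  define S where "S x = Phi (u x + w x) - Phi (u x) - Phi (w x)" for x
  define Wt where "Wt = (LINT x|M. (wt (u x)) * (w x)^2)"
  define g2 where "g2 = (gn w)^2"
  define n2 where "n2 = (nrm M w)^2"
  have dPs: "sqint M (%x. Phi (v x) - Phi (u x))" by (intro sqint_diff Phi_H01 u v)
  have Ss: "sqint M S" unfolding S_def vw[symmetric] by (intro sqint_diff Phi_H01 u v w)
  have iw: "integrable M (%x. (wt (u x)) * (w x)^2)" by (intro weighted_sqint Gc(2) u w)
  have ip: "integrable M (%x. (pw (w x)))" by (rule pintD(2)[OF Gc(2)[OF w]])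
  note sw = H01_sqint(1)[OF w] H01_sqint(2)[OF w]
  have S2: "a^2 / \<nu> * (real CARD('n) * (LINT x|M. (S x)^2)) <= \<beta> * c0 / 2 * PI w + Q * Wt"
  proof -
   have pt: "(S x)^2 <= 2 * k^2 * (\<eta>^2 * (pw (w x)) + (1 + \<eta> powr (2 - 2 * \<delta>)) * ((wt (u x)) * (w x)^2))" for x
   proof -
    have "(S x)^2 <= 2 * k^2 * ((wt (u x)) * (w x)^2 + (u x)^2 * (wt (w x)))"
     unfolding S_def k_def by (rule Phi_split)
    also have "... <= 2 * k^2 * ((wt (u x)) * (w x)^2 + (\<eta>^2 * (pw (w x)) + \<eta> powr (2 - 2 * \<delta>) * ((wt (u x)) * (w x)^2)))"
     by (intro mult_left_mono add_left_mono young_split[OF eta(1)]) auto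
    finally show ?thesis by (simp add: algebra_simps)
   qed
   have "(LINT x|M. (S x)^2) <= (LINT x|M. 2 * k^2 * (\<eta>^2 * (pw (w x)) + (1 + \<eta> powr (2 - 2 * \<delta>)) * ((wt (u x)) * (w x)^2)))"
    by (intro integral_mono sqint_sq[OF Ss] pt integrable_mult_right Bochner_Integration.integrable_add iw ip)
   also have "... = 2 * k^2 * (\<eta>^2 * PI w + (1 + \<eta> powr (2 - 2 * \<delta>)) * Wt)"
    using iw ip by (simp add: PI_def Wt_def)
   finally have "real CARD('n) * (a^2 / \<nu>) * (LINT x|M. (S x)^2) <= real CARD('n) * (a^2 / \<nu>) * (2 * k^2 * (\<eta>^2 * PI w + (1 + \<eta> powr (2 - 2 * \<delta>)) * Wt))"
    using pos by (intro mult_left_mono) auto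
   also have "... = (R * \<eta>^2) * PI w + Q * Wt" 
   proof -
    have "A * (K * (E * X + Y * Z)) = A * K * E * X + A * K * Y * Z" for A K E X Y Z :: real by (simp add: algebra_simps)
    then show ?thesis unfolding R_def Q_def .
   qed
   finally show ?thesis unfolding eta(2) by (simp only: mult_ac)
  qed
  have z: "(LINT x|M. Phi (w x) * D i w x) = 0" for i
   by (rule antiderivative_zero(1)[OF w continuous_Phi, where C = 1]) auto
  have adv: "a * (LINT x|M. (Phi (v x) - Phi (u x)) * D i w x) <= \<nu> / 4 * (nrm M (D i w))^2 + a^2 / \<nu> * (LINT x|M. (S x)^2)" for i
  proof -
   have "(LINT x|M. (Phi (v x) - Phi (u x)) * D i w x) = (LINT x|M. S x * D i w x + Phi (w x) * D i w x)"
    by (intro Bochner_Integration.integral_cong refl) (simp add: S_def vw algebra_simps)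
   also have "... = (LINT x|M. S x * D i w x)"
    using sqint_mult_integrable[OF Ss sw(2)[of i]] sqint_mult_integrable[OF Phi_H01[OF w] sw(2)[of i]] z[of i] by simp
   finally have "a * (LINT x|M. (Phi (v x) - Phi (u x)) * D i w x) = (LINT x|M. a * (S x * D i w x))" by simp
   also have "... <= (LINT x|M. \<nu> / 4 * (D i w x)^2 + a^2 / \<nu> * (S x)^2)"
   proof (intro integral_mono integrable_mult_right Bochner_Integration.integrable_add sqint_mult_integrable sqint_sq Ss sw)
    fix x
    have "0 <= (\<nu> * D i w x - 2 * a * S x)^2 / (4 * \<nu>)" using pos by simp
    also have "... = \<nu> / 4 * (D i w x)^2 + a^2 / \<nu> * (S x)^2 - a * (S x * D i w x)"
     using pos by (simp add: power2_diff field_simps power2_eq_square)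
    finally show "a * (S x * D i w x) <= \<nu> / 4 * (D i w x)^2 + a^2 / \<nu> * (S x)^2" by simp
   qed
   also have "... = \<nu> / 4 * (nrm M (D i w))^2 + a^2 / \<nu> * (LINT x|M. (S x)^2)"
    unfolding nrm_sq using sqint_sq[OF Ss] sqint_sq[OF sw(2)[of i]] by simp
   finally show ?thesis .
  qed
  have "a * (\<Sum>i\<in>UNIV. (LINT x|M. (Phi (v x) - Phi (u x)) * D i w x)) <= (\<Sum>i\<in>UNIV. \<nu> / 4 * (nrm M (D i w))^2 + a^2 / \<nu> * (LINT x|M. (S x)^2))"
   unfolding sum_distrib_left by (intro sum_mono adv)
  also have "... = \<nu> / 4 * g2 + a^2 / \<nu> * (real CARD('n) * (LINT x|M. (S x)^2))"
   unfolding g2_def grad_norm_sq[OF H01_W1[OF w]] sum_distrib_left sum.distrib by simp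
  finally have A: "a * (\<Sum>i\<in>UNIV. (LINT x|M. (Phi (v x) - Phi (u x)) * D i w x)) <= \<nu> / 4 * g2 + (\<beta> * c0 / 2 * PI w + Q * Wt)"
   using S2 by linarith
  have iPs: "integrable M (%x. (Psi (v x) - Psi (u x)) * w x)"
   unfolding left_diff_distrib by (intro Bochner_Integration.integrable_diff Psi_mult_integrable u v w)
  have "b * (LINT x|M. (Phi (v x) - Phi (u x)) * w x) = (LINT x|M. b * ((Phi (v x) - Phi (u x)) * w x))" by simp
  also have "... <= (LINT x|M. \<beta> / 2 * ((Psi (v x) - Psi (u x)) * w x) + C2 * (w x)^2)"
  proof (rule integral_mono)
   show "integrable M (%x. b * ((Phi (v x) - Phi (u x)) * w x))"
    by (intro integrable_mult_right sqint_mult_integrable dPs sw)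
   show "integrable M (%x. \<beta> / 2 * ((Psi (v x) - Psi (u x)) * w x) + C2 * (w x)^2)"
    by (intro Bochner_Integration.integrable_add integrable_mult_right iPs sqint_sq sw)
   fix x
   define t where "t = Phi (v x) - Phi (u x)"
   have "0 <= (2 * \<kappa> * t - b * w x)^2 / (4 * \<kappa>)" using kap by simp
   also have "... = \<kappa> * t^2 + C2 * (w x)^2 - b * (t * w x)"
    using kap by (simp add: C2_def power2_diff field_simps power2_eq_square)
   finally have 1: "b * (t * w x) <= \<kappa> * t^2 + C2 * (w x)^2" by simp
   have "\<beta> / (2 * (\<delta> + 1)^2) * ((2 * \<delta> + 1) * t^2) <= \<beta> / (2 * (\<delta> + 1)^2) * ((\<delta> + 1)^2 * ((Psi (v x) - Psi (u x)) * w x))"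
    unfolding t_def w_def using pos by (intro mult_left_mono Phi_Psi_cauchy_schwarz) auto
   then have "\<kappa> * t^2 <= \<beta> / 2 * ((Psi (v x) - Psi (u x)) * w x)" using delta by (simp add: \<kappa>_def)
   then show "b * ((Phi (v x) - Phi (u x)) * w x) <= \<beta> / 2 * ((Psi (v x) - Psi (u x)) * w x) + C2 * (w x)^2"
    using 1 unfolding t_def by linarith
  qed
  also have "... = \<beta> / 2 * (LINT x|M. (Psi (v x) - Psi (u x)) * w x) + C2 * n2"
   unfolding n2_def nrm_sq using iPs sqint_sq[OF sw(1)] by simp
  finally have Bt: "b * (LINT x|M. (Phi (v x) - Phi (u x)) * w x) <= \<beta> / 2 * (LINT x|M. (Psi (v x) - Psi (u x)) * w x) + C2 * n2" .
  have "c0 * PI w <= (LINT x|M. (Psi (v x) - Psi (u x)) * w x)"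
   unfolding PI_def integral_mult_right_zero[symmetric] vw c0_def
   by (intro integral_mono integrable_mult_right ip Psi_coercive) (use iPs in \<open>simp add: vw\<close>)
  then have Ct: "\<beta> / 2 * (c0 * PI w) <= \<beta> / 2 * (LINT x|M. (Psi (v x) - Psi (u x)) * w x)" using pos by (intro mult_left_mono) auto
  have "Wt <= \<theta> * (Gc + (nrm M (%x. Psi (u x)))^2) * g2 + C1 * n2" using C1(2) u w Ps by (simp add: Wt_def g2_def n2_def)
  also have "... <= \<theta> * (Gc + \<bar>B\<bar>) * g2 + C1 * n2"
   using th PB by (intro add_right_mono mult_right_mono mult_left_mono) (auto simp: g2_def)
  finally have "Q * Wt <= Q * (\<theta> * (Gc + \<bar>B\<bar>) * g2 + C1 * n2)" using Q by (intro mult_left_mono) auto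
  also have "... = (Q * (\<theta> * (Gc + \<bar>B\<bar>))) * g2 + Q * C1 * n2" by (simp add: algebra_simps)
  finally have Dt: "Q * Wt <= \<nu> / 4 * g2 + Q * C1 * n2" unfolding Qth .
  have ww: "0 <= \<beta> * \<gamma> * (LINT x|M. w x * w x)"
   unfolding power2_eq_square[symmetric] using pos gam by (intro mult_nonneg_nonneg Bochner_Integration.integral_nonneg) auto
  have "form v w - form u w = \<nu> * g2 - a * (\<Sum>i\<in>UNIV. (LINT x|M. (Phi (v x) - Phi (u x)) * D i w x))
   - b * (LINT x|M. (Phi (v x) - Phi (u x)) * w x) + \<beta> * \<gamma> * (LINT x|M. w x * w x) + \<beta> * (LINT x|M. (Psi (v x) - Psi (u x)) * w x)"
   unfolding form_diff_left[OF u v w] w_def[symmetric] grad_inner_self[OF H01_W1[OF w]] g2_def a_def b_def ..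
  moreover have "\<beta> * c0 / 2 * PI w = \<beta> / 2 * (c0 * PI w)" "\<nu> * g2 = \<nu> / 2 * g2 + (\<nu> / 4 * g2 + \<nu> / 4 * g2)"
   "\<beta> * y = \<beta> / 2 * y + \<beta> / 2 * y" "(Q * C1 + C2) * n2 = Q * C1 * n2 + C2 * n2" for y by (simp_all add: algebra_simps)
  ultimately have "\<nu> / 2 * g2 <= form v w - form u w + (Q * C1 + C2) * n2"
   using A Bt Ct Dt ww by (smt (verit))
  then show "\<nu> / 2 * (gn (%x. v x - u x))^2 <=
   form v (%x. v x - u x) - form u (%x. v x - u x) + (Q * C1 + C2) * (nrm M (%x. v x - u x))^2"
   by (simp add: g2_def n2_def w_def[abs_def])
 qed
qed

end

section \<open>The limit of the difference of the forms, divided by the size of the error\<close>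

context burgers_huxley
begin

lemma pint_powr_sqint: "pint u ==> sqint M (%x. \<bar>u x\<bar> powr \<delta>)"
proof -
 assume u: "pint u"
 have 1: "pint (%x. 1)" unfolding pint_def by (simp add: finite_measure.emeasure_finite)
 from weighted_sqint[OF u 1] have "integrable M (%x. (\<bar>u x\<bar> powr \<delta>)^2)" by (simp add: abs_powr_delta_sq)
 moreover have "(%x. \<bar>u x\<bar> powr \<delta>) \<in> borel_measurable M"
  using delta by (intro meas_compose[OF continuous_abs_powr] pintD(1)[OF u]) auto
 ultimately show ?thesis by (simp add: sqint_def)
qed

lemma cq_mq_meas:
 assumes "u \<in> H0" "v \<in> H0"
 shows "(%x. cq (v x) (u x)) \<in> borel_measurable M" "(%x. mq (v x) (u x)) \<in> borel_measurable M"
 using delta by (intro dq_meas continuous_Phi continuous_Psi continuous_on_mult continuous_on_const continuous_spow continuous_abs_powr H01_meas assms; simp)+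

lemma cq_sqint:
 assumes "u \<in> H0" "v \<in> H0" shows "sqint M (%x. cq (v x) (u x))"
proof (rule sqint_le[of M "%x. (\<delta> + 1) * (\<bar>v x\<bar> powr \<delta> + \<bar>u x\<bar> powr \<delta>)"])
 show "sqint M (%x. (\<delta> + 1) * (\<bar>v x\<bar> powr \<delta> + \<bar>u x\<bar> powr \<delta>))"
  by (intro sqint_cmult sqint_add pint_powr_sqint Gc(2) assms)
 show "\<bar>cq (v x) (u x)\<bar> <= \<bar>(\<delta> + 1) * (\<bar>v x\<bar> powr \<delta> + \<bar>u x\<bar> powr \<delta>)\<bar>" for x
  using cq_bound[of "v x" "u x"] by linarith
qed (rule cq_mq_meas(1)[OF assms])

text \<open>Increments of \<open>Phi\<close> and \<open>Psi\<close> are difference quotients times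
  \<open>\<rho> m * wh m\<close>, so division by \<open>\<rho> m\<close> is exact and nothing is
  linearised. The drift products \<open>C m\<close> are bounded in L^2, which makes
  \<open>c * w\<close> square integrable by Fatou although c and w are not multiplied within any
  known pair of spaces. All products converge by \<open>vitali_limit\<close>, those with
  \<open>Psi\<close> through p-th powers.\<close>

lemma quotient_limit:
 fixes us vs :: "nat => real ^ 'n => real" and \<rho> :: "nat => real"
 assumes us: "!!m. us m \<in> H0" and vs: "!!m. vs m \<in> H0" and rho: "!!m. \<rho> m > 0" "\<rho> ----> r"
  and B: "!!m. PI (us m) <= B" "!!m. PI (vs m) <= B"
  and gn1: "!!m. gn (%x. vs m x - us m x) = \<rho> m"
  and uH: "u \<in> H0" and wH: "w \<in> H0"
  and AEu: "AE x in M. (%m. us m x) ----> u x"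
  and wh: "!!m. wh m = (%x. (1 / \<rho> m) * (vs m x - us m x))"
  and AEw: "AE x in M. (%m. wh m x) ----> w x" and Lw: "L2lim M wh w"
  and c: "c = (%x. cq (u x + r * w x) (u x))" and mm: "mm = (%x. mq (u x + r * w x) (u x))"
 shows "sqint M (%x. c x * w x)"
  "\<xi> \<in> H0 ==> integrable M (%x. mm x * w x * \<xi> x)"
  "\<xi> \<in> H0 ==> (%m. (form (vs m) \<xi> - form (us m) \<xi>) / \<rho> m) ---->
    \<nu> * gi w \<xi> - \<alpha> / (\<delta> + 1) * (\<Sum>i\<in>UNIV. (LINT x|M. c x * w x * D i \<xi> x))
    - \<beta> * (1 + \<gamma>) * (LINT x|M. c x * w x * \<xi> x) + \<beta> * \<gamma> * (LINT x|M. w x * \<xi> x) + \<beta> * (LINT x|M. mm x * w x * \<xi> x)"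
proof -
 have whH: "wh m \<in> H0" for m unfolding wh by (rule H01_cmult(1)[OF H01_diff(1)[OF vs us]])
 have whg: "gn (wh m) = 1" for m
  unfolding wh grad_norm_cmult[OF H01_W1[OF H01_diff(1)[OF vs us]]] gn1 using rho(1)[of m] by simp
 have diff: "vs m x - us m x = \<rho> m * wh m x" for m x using rho(1)[of m] by (simp add: wh)
 have lH: "(%x. u x + r * w x) \<in> H0" by (rule H01_add(1)[OF uH H01_cmult(1)[OF wH]])
 have AEv: "AE x in M. (%m. vs m x) ----> u x + r * w x"
  using AEu AEw
 proof eventually_elim
  case (elim x)
  have "(%m. us m x + \<rho> m * wh m x) ----> u x + r * w x" by (intro tendsto_intros elim rho)
  then show ?case by (simp add: diff[symmetric])
 qed
 define C where "C m x = cq (vs m x) (us m x) * wh m x" for m x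
 have Ceq: "Phi (vs m x) - Phi (us m x) = \<rho> m * C m x" for m x
  unfolding C_def dq_mult[of Phi "vs m x" "us m x" "%s. (\<delta> + 1) * sg s"] diff by simp
 have Ceq': "C m x = (1 / \<rho> m) * (Phi (vs m x) - Phi (us m x))" for m x unfolding Ceq using rho(1)[of m] by simp
 have Cs: "sqint M (C m)" for m unfolding Ceq'[abs_def] by (intro sqint_cmult sqint_diff Phi_H01 us vs)
 define K where "K = 4 * (\<delta> + 1)^2 * (B + Gc)"
 have CK: "(nrm M (C m))^2 <= K" for m
 proof -
  have "(nrm M (C m))^2 = (1 / \<rho> m)^2 * (nrm M (%x. Phi (vs m x) - Phi (us m x)))^2"
   unfolding Ceq'[abs_def] nrm_cmult by (simp add: power_mult_distrib power_divide)
  also have "... <= (1 / \<rho> m)^2 * (K * (\<rho> m)^2)"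
   using Phi_diff_le[OF us vs B, of m m] unfolding gn1 K_def by (intro mult_left_mono) auto
  also have "... = K" using rho(1)[of m] by (simp add: power2_eq_square)
  finally show ?thesis .
 qed
 have Clim: "AE x in M. (%m. C m x) ----> c x * w x"
  using AEu AEv AEw
 proof eventually_elim
  case (elim x)
  have cont: "continuous_on UNIV (%s. (\<delta> + 1) * sg s)" by (intro continuous_on_mult continuous_on_const continuous_spow)
  show ?case unfolding C_def c by (intro tendsto_mult elim dq_tendsto[OF DERIV_Phi cont])
 qed
 have Cm: "C m \<in> borel_measurable M" for m using Cs[of m] by (simp add: sqint_def)
 have cm: "c \<in> borel_measurable M" and mmm: "mm \<in> borel_measurable M" unfolding c mm by (rule cq_mq_meas[OF uH lH])+
 have cwm: "(%x. c x * w x) \<in> borel_measurable M" by (intro borel_measurable_times cm H01_meas wH)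
 show "sqint M (%x. c x * w x)"
  by (rule fatou_L2(1)[OF Cs Clim real_le_rsqrt[OF CK] cwm])
 have T2: "(%m. (LINT x|M. C m x * k x)) ----> (LINT x|M. c x * w x * k x)" if k: "sqint M k" for k
 proof (rule vitali_limit(2)[where A = "%m x. (C m x)^2" and K = K])
  show "(%x. C m x * k x) \<in> borel_measurable M" for m by (intro borel_measurable_times Cm sqintD k)
  show "(%x. c x * w x * k x) \<in> borel_measurable M" by (intro borel_measurable_times cm H01_meas wH sqintD k)
  show "AE x in M. (%m. C m x * k x) ----> c x * w x * k x" using Clim by eventually_elim (intro tendsto_intros)
  show "integrable M (%x. (C m x)^2)" for m by (rule sqint_sq[OF Cs])
  show "(LINT x|M. (C m x)^2) <= K" for m using CK[of m] by (simp add: nrm_sq)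
  fix \<eta> :: real assume eta: "\<eta> > 0"
  have "\<bar>C m x * k x\<bar> <= \<eta> * (C m x)^2 + 1 / (4 * \<eta>) * (k x)^2" for m x
  proof -
   have "0 <= (2 * \<eta> * \<bar>C m x\<bar> - \<bar>k x\<bar>)^2 / (4 * \<eta>)" using eta by simp
   also have "... = \<eta> * (C m x)^2 + 1 / (4 * \<eta>) * (k x)^2 - \<bar>C m x\<bar> * \<bar>k x\<bar>"
   proof -
    have "(2 * \<eta> * s - t)^2 / (4 * \<eta>) = \<eta> * s^2 + 1 / (4 * \<eta>) * t^2 - s * t" for s t
     using eta by (simp add: power2_diff field_simps power2_eq_square)
    from this[of "\<bar>C m x\<bar>" "\<bar>k x\<bar>"] show ?thesis unfolding power2_abs .
   qed
   finally show ?thesis by (simp add: abs_mult)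
  qed
  then show "\<exists>B. integrable M B \<and> (\<forall>m. AE x in M. \<bar>C m x * k x\<bar> <= \<eta> * (C m x)^2 + B x)"
   using sqint_sq[OF k] by (intro exI[of _ "%x. 1 / (4 * \<eta>) * (k x)^2"] conjI allI AE_I2 integrable_mult_right)
 qed simp
 define Y where "Y m x = mq (vs m x) (us m x) * wh m x" for m x
 have Yeq: "Psi (vs m x) - Psi (us m x) = \<rho> m * Y m x" for m x
  unfolding Y_def dq_mult[of Psi "vs m x" "us m x" "%s. (2 * \<delta> + 1) * (wt s)"] diff by simp
 have Ym: "Y m \<in> borel_measurable M" for m
  unfolding Y_def[abs_def] by (intro borel_measurable_times cq_mq_meas(2) us vs H01_meas whH)
 have Ylim: "AE x in M. (%m. Y m x) ----> mm x * w x"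
  using AEu AEv AEw
 proof eventually_elim
  case (elim x)
  have cont: "continuous_on UNIV (%s::real. (2 * \<delta> + 1) * (wt s))"
   using delta by (intro continuous_on_mult continuous_on_const continuous_abs_powr) auto
  show ?case unfolding Y_def mm by (intro tendsto_mult elim dq_tendsto[OF DERIV_Psi cont])
 qed
 have T4: "integrable M (%x. mm x * w x * \<xi> x)" "(%m. (LINT x|M. Y m x * \<xi> x)) ----> (LINT x|M. mm x * w x * \<xi> x)" if xi: "\<xi> \<in> H0" for \<xi>
 proof -
  have X: "(%x. Y m x * \<xi> x) \<in> borel_measurable M" for m by (intro borel_measurable_times Ym H01_meas xi)
  have X0: "(%x. mm x * w x * \<xi> x) \<in> borel_measurable M" by (intro borel_measurable_times mmm H01_meas wH xi)
  have lim: "AE x in M. (%m. Y m x * \<xi> x) ----> mm x * w x * \<xi> x" using Ylim by eventually_elim (intro tendsto_intros)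
  define A where "A m x = (pw (vs m x)) + (pw (us m x)) + 2 * (pw (wh m x))" for m x
  have iA: "integrable M (A m)" for m
   unfolding A_def by (intro Bochner_Integration.integrable_add integrable_mult_right pintD(2) Gc(2) us vs whH)
  have A0: "0 <= A m x" for m x by (simp add: A_def)
  have KA: "(LINT x|M. A m x) <= 2 * B + 2 * Gc" for m
  proof -
   have "(LINT x|M. A m x) = PI (vs m) + PI (us m) + 2 * PI (wh m)"
    unfolding A_def PI_def using pintD(2)[OF Gc(2)[OF us[of m]]] pintD(2)[OF Gc(2)[OF vs[of m]]] pintD(2)[OF Gc(2)[OF whH[of m]]] by simp
   then show ?thesis using B[of m] Gc(3)[OF whH[of m]] whg[of m] by simp
  qed
  have bd: "\<exists>B. integrable M B \<and> (\<forall>m. AE x in M. \<bar>Y m x * \<xi> x\<bar> <= \<eta> * A m x + B x)" if eta: "\<eta> > 0" for \<eta>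
  proof -
   define z where "z = \<eta> / (2 * \<delta> + 1)"
   have z: "z > 0" "(2 * \<delta> + 1) * z = \<eta>" using eta delta by (auto simp: z_def)
   have "\<bar>Y m x * \<xi> x\<bar> <= \<eta> * A m x + 2 * (2 * \<delta> + 1) * z powr (- (2 * \<delta> + 1)) * (pw (\<xi> x))" for m x
   proof -
    have "\<bar>Y m x * \<xi> x\<bar> = \<bar>mq (vs m x) (us m x)\<bar> * \<bar>wh m x * \<xi> x\<bar>" by (simp add: Y_def abs_mult)
    also have "... <= (2 * \<delta> + 1) * ((wt (vs m x)) + (wt (us m x))) * \<bar>wh m x * \<xi> x\<bar>"
     by (intro mult_right_mono mq_bound) auto
    also have "... = (2 * \<delta> + 1) * ((wt (vs m x)) * \<bar>wh m x * \<xi> x\<bar> + (wt (us m x)) * \<bar>wh m x * \<xi> x\<bar>)"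
     by (simp only: distrib_right mult.assoc)
    also have "... <= (2 * \<delta> + 1) * ((z * ((pw (vs m x)) + (pw (wh m x))) + z powr (- (2 * \<delta> + 1)) * (pw (\<xi> x))) +
      (z * ((pw (us m x)) + (pw (wh m x))) + z powr (- (2 * \<delta> + 1)) * (pw (\<xi> x))))"
     using delta by (intro mult_left_mono add_mono young_eta z) auto
    also have "... = ((2 * \<delta> + 1) * z) * A m x + 2 * (2 * \<delta> + 1) * z powr (- (2 * \<delta> + 1)) * (pw (\<xi> x))"
     by (simp add: A_def algebra_simps)
    finally show ?thesis unfolding z(2) .
   qed
   then show ?thesis using pintD(2)[OF Gc(2)[OF xi]]
    by (intro exI[of _ "%x. 2 * (2 * \<delta> + 1) * z powr (- (2 * \<delta> + 1)) * (pw (\<xi> x))"] conjI allI AE_I2 integrable_mult_right)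
  qed
  show "integrable M (%x. mm x * w x * \<xi> x)" by (rule vitali_limit(1)[OF X X0 lim iA A0 KA bd])
  show "(%m. (LINT x|M. Y m x * \<xi> x)) ----> (LINT x|M. mm x * w x * \<xi> x)" by (rule vitali_limit(2)[OF X X0 lim iA A0 KA bd])
 qed
 show "\<xi> \<in> H0 ==> integrable M (%x. mm x * w x * \<xi> x)" by (rule T4(1))
 assume xi: "\<xi> \<in> H0"
 have quot: "(form (vs m) \<xi> - form (us m) \<xi>) / \<rho> m = \<nu> * gi (wh m) \<xi> - \<alpha> / (\<delta> + 1) * (\<Sum>i\<in>UNIV. (LINT x|M. C m x * D i \<xi> x))
    - \<beta> * (1 + \<gamma>) * (LINT x|M. C m x * \<xi> x) + \<beta> * \<gamma> * (LINT x|M. wh m x * \<xi> x) + \<beta> * (LINT x|M. Y m x * \<xi> x)" for m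
 proof -
  have fe: "(%x. vs m x - us m x) = (%x. \<rho> m * wh m x + 0 * wh m x)" by (simp add: diff)
  have gi: "gi (%x. vs m x - us m x) \<xi> = \<rho> m * gi (wh m) \<xi>"
   unfolding fe
   using grad_inner_lin[OF H01_W1[OF whH[of m]] H01_W1[OF whH[of m]] H01_W1[OF xi], where a = "\<rho> m" and b = 0] by simp
  have pull: "(LINT x|M. \<rho> m * h x * k x) = \<rho> m * (LINT x|M. h x * k x)" for h k
   unfolding mult.assoc by (rule integral_mult_right_zero)
  have "form (vs m) \<xi> - form (us m) \<xi> = \<rho> m * (\<nu> * gi (wh m) \<xi> - \<alpha> / (\<delta> + 1) * (\<Sum>i\<in>UNIV. (LINT x|M. C m x * D i \<xi> x))
    - \<beta> * (1 + \<gamma>) * (LINT x|M. C m x * \<xi> x) + \<beta> * \<gamma> * (LINT x|M. wh m x * \<xi> x) + \<beta> * (LINT x|M. Y m x * \<xi> x))"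
   unfolding form_diff_left[OF us vs xi] gi unfolding Ceq Yeq diff pull sum_distrib_left[symmetric]
   by (simp add: algebra_simps)
  then show ?thesis using rho(1)[of m] by simp
 qed
 show "(%m. (form (vs m) \<xi> - form (us m) \<xi>) / \<rho> m) ---->
    \<nu> * gi w \<xi> - \<alpha> / (\<delta> + 1) * (\<Sum>i\<in>UNIV. (LINT x|M. c x * w x * D i \<xi> x))
    - \<beta> * (1 + \<gamma>) * (LINT x|M. c x * w x * \<xi> x) + \<beta> * \<gamma> * (LINT x|M. w x * \<xi> x) + \<beta> * (LINT x|M. mm x * w x * \<xi> x)"
  unfolding quot
  by (intro tendsto_add tendsto_diff tendsto_mult tendsto_const tendsto_sum T2 T4(2)[OF xi] H01_sqint xi
    weak_grad_conv[OF whH _ Lw xi, of 1] L2lim_inner[OF Lw L2lim_const[OF H01_sqint(1)[OF xi]]]) (simp add: whg)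
qed

end

section \<open>The contradiction argument\<close>

locale galerkin_burgers_huxley = galerkin_family \<Omega> H V + burgers_huxley \<Omega> \<delta> C\<^sub>G\<^sub>N \<nu> \<alpha> \<beta> \<gamma>
 for \<Omega> :: "(real ^ 'n::finite) set" and H V \<delta> C\<^sub>G\<^sub>N \<nu> \<alpha> \<beta> \<gamma>
begin

text \<open>Collects all that varies along a contradicting sequence: source, solution, mesh size and
  discrete solution. Only the norm N of the source is held fixed.\<close>

definition adm :: "real => (real ^ 'n => real) => (real ^ 'n => real) => real => (real ^ 'n => real) => bool" where
 "adm N f u h v \<longleftrightarrow> sqint M f \<and> nrm M f = N \<and> strong_solution \<Omega> \<nu> \<alpha> \<beta> \<gamma> \<delta> f u \<and> h \<in> H \<and>
   galerkin_solution \<Omega> \<nu> \<alpha> \<beta> \<gamma> \<delta> f (V h) v"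

lemma admD:
 assumes "adm N f u h v"
 shows "sqint M f" "nrm M f = N" "strong_solution \<Omega> \<nu> \<alpha> \<beta> \<gamma> \<delta> f u" "h \<in> H" "u \<in> H0" "u \<in> sobolev \<Omega> 2"
  "v \<in> V h" "v \<in> H0" "!!\<xi>. \<xi> \<in> H0 ==> form u \<xi> = (LINT x|M. f x * \<xi> x)"
  "!!\<xi>. \<xi> \<in> V h ==> form v \<xi> = (LINT x|M. f x * \<xi> x)"
proof -
 show a: "sqint M f" "nrm M f = N" "strong_solution \<Omega> \<nu> \<alpha> \<beta> \<gamma> \<delta> f u" "h \<in> H" "u \<in> H0" "u \<in> sobolev \<Omega> 2" "v \<in> V h"
  using assms by (auto simp: adm_def strong_solution_def galerkin_solution_def)
 show "v \<in> H0" by (rule fin_dim_H01[OF fd[OF a(4)] a(7)])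
 show "!!\<xi>. \<xi> \<in> H0 ==> form u \<xi> = (LINT x|M. f x * \<xi> x)" by (rule strong_form[OF a(3,1)])
 show "!!\<xi>. \<xi> \<in> V h ==> form v \<xi> = (LINT x|M. f x * \<xi> x)"
  using assms galerkin_form[OF _ fd[OF a(4)]] unfolding adm_def by blast
qed

lemma ritz_ex: "h \<in> H ==> v \<in> H0 ==> \<exists>w. ritz_projection \<Omega> (V h) v w"
 using ritz_exists[OF fd] by meson

text \<open>The form is nonlinear in its first argument but linear in the second, so discrete
  functions can still be subtracted there.\<close>

lemma galerkin_orthogonality:
 assumes "adm N f u h v" "z \<in> H0" "ritz_projection \<Omega> (V h) z w"
 shows "form v (%x. z x - w x) - form u (%x. z x - w x) = form v z - form u z"
proof -
 note a = admD[OF assms(1)]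
 note r = ritz_props(1,2)[OF fd[OF a(4)] assms(2,3)]
 have "form v w = form u w" using a(9)[OF r(2)] a(10)[OF r(1)] by simp
 then show ?thesis unfolding form_diff_right[OF a(8) assms(2) r(2)] form_diff_right[OF a(5) assms(2) r(2)] by simp
qed

text \<open>The error is a discrete function minus the Ritz error e of u. Orthogonality removes the
  discrete part from the Garding inequality, and the gradient of e is of order h with the Laplacian
  of u as source of the constant.\<close>

lemma quasi_garding:
 "\<exists>C\<ge>0. \<forall>f u h v. adm N f u h v --> \<nu> / 2 * (gn (%x. v x - u x))^2 <=
   C * (h * gn (%x. v x - u x) + (nrm M (%x. v x - u x))^2)"
proof -
 obtain B where B: "B > 0"
  "!!u f. u \<in> H0 ==> sqint M f ==> nrm M f = N ==> form u u = (LINT x|M. f x * u x) ==> gn u <= B \<and> PI u <= B"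
  "!!u f. sqint M f ==> nrm M f = N ==> strong_solution \<Omega> \<nu> \<alpha> \<beta> \<gamma> \<delta> f u ==>
    sqint M (%x. Psi (u x)) \<and> (nrm M (%x. Psi (u x)))^2 <= B \<and> nrm M (laplacian \<Omega> u) <= B"
  by (rule apriori[of N]) (rule that)
 obtain L where L: "L \<ge> 0" "\<forall>u v e. u \<in> H0 --> v \<in> H0 --> e \<in> H0 --> PI u <= B --> PI v <= B -->
  \<bar>form v e - form u e\<bar> <= L * gn (%x. v x - u x) * gn e" using form_lipschitz[of B] by blast
 obtain G where G: "G \<ge> 0" "\<forall>u v. u \<in> H0 --> v \<in> H0 --> sqint M (%x. Psi (u x)) --> (nrm M (%x. Psi (u x)))^2 <= B -->
  \<nu> / 2 * (gn (%x. v x - u x))^2 <=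
   form v (%x. v x - u x) - form u (%x. v x - u x) + G * (nrm M (%x. v x - u x))^2" using garding[of B] by blast
 have "\<exists>c>0. \<forall>h v w g. h \<in> H --> v \<in> H0 --> ritz_projection \<Omega> (V h) v w --> sqint M g -->
  (\<forall>\<xi>\<in>H0. gi v \<xi> = L2_inner \<Omega> g \<xi>) --> gn (%x. v x - w x) <= c * h * nrm M g"
 proof (rule ritz_grad)
  fix c assume c1: "c > 0" and c2: "!!h v w g. h \<in> H ==> v \<in> H0 ==> ritz_projection \<Omega> (V h) v w ==> sqint M g ==>
   (!!\<xi>. \<xi> \<in> H0 ==> gi v \<xi> = L2_inner \<Omega> g \<xi>) ==> gn (%x. v x - w x) <= c * h * nrm M g"
  show "\<exists>c>0. \<forall>h v w g. h \<in> H --> v \<in> H0 --> ritz_projection \<Omega> (V h) v w --> sqint M g -->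
   (\<forall>\<xi>\<in>H0. gi v \<xi> = L2_inner \<Omega> g \<xi>) --> gn (%x. v x - w x) <= c * h * nrm M g"
   by (intro exI[of _ c] conjI allI impI c1 c2) auto
 qed
 then obtain c where c: "c > 0" "\<forall>h v w g. h \<in> H --> v \<in> H0 --> ritz_projection \<Omega> (V h) v w --> sqint M g -->
  (\<forall>\<xi>\<in>H0. gi v \<xi> = L2_inner \<Omega> g \<xi>) --> gn (%x. v x - w x) <= c * h * nrm M g" by blast
 show ?thesis
 proof (intro exI[of _ "L * c * B + G"] conjI allI impI)
  show "0 <= L * c * B + G" using L(1) c(1) B(1) G(1) by simp
  fix f u h v assume adm: "adm N f u h v"
  note a = admD[OF adm]
  have h: "h > 0" by (rule H_pos[OF a(4)])
  define w where "w x = v x - u x" for x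
  have w: "w \<in> H0" unfolding w_def by (rule H01_diff(1)[OF a(8,5)])
  have g0: "0 <= gn w" by (rule grad_norm_nonneg[OF H01_W1[OF w]])
  have Bu: "PI u <= B" using B(2)[OF a(5,1,2) a(9)[OF a(5)]] by simp
  have Bv: "PI v <= B" using B(2)[OF a(8,1,2) a(10)[OF a(7)]] by simp
  note P = B(3)[OF a(1,2,3)]
  obtain R where R: "ritz_projection \<Omega> (V h) u R" using ritz_ex[OF a(4,5)] by blast
  note r = ritz_props(1,2)[OF fd[OF a(4)] a(5) R]
  define e where "e x = u x - R x" for x
  have e: "e \<in> H0" unfolding e_def by (rule H01_diff(1)[OF a(5) r(2)])
  have ge: "gn e <= c * h * B"
  proof -
   note l = laplacian_weak[OF a(5,6)]
   have s: "sqint M (%x. - 1 * laplacian \<Omega> u x)" by (rule sqint_cmult[OF l(1)])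
   have "gn (%x. u x - R x) <= c * h * nrm M (%x. - 1 * laplacian \<Omega> u x)"
    by (rule c(2)[rule_format, OF a(4,5) R s]) (simp add: l(2) L2_inner_def)
   also have "... <= c * h * B" unfolding nrm_cmult using P c(1) h by (intro mult_left_mono) auto
   finally show ?thesis by (simp add: e_def[abs_def])
  qed
  have \<xi>V: "(%x. v x - R x) \<in> V h" by (rule fin_dim_diff[OF fd[OF a(4)] a(7) r(1)])
  have \<xi>H: "(%x. v x - R x) \<in> H0" by (rule fin_dim_H01[OF fd[OF a(4)] \<xi>V])
  have we: "w = (%x. (v x - R x) - e x)" by (simp add: w_def e_def fun_eq_iff)
  have "form v w - form u w = - (form v e - form u e)"
   unfolding we form_diff_right[OF a(8) \<xi>H e] form_diff_right[OF a(5) \<xi>H e] using a(9)[OF \<xi>H] a(10)[OF \<xi>V] by simp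
  also have "... <= \<bar>form v e - form u e\<bar>" by simp
  also have "... <= L * gn w * gn e" using L(2) a(5,8) e Bu Bv by (simp add: w_def[abs_def])
  also have "... <= L * gn w * (c * h * B)" using L(1) g0 by (intro mult_left_mono ge) auto
  finally have "form v w - form u w <= (L * c * B) * (h * gn w)" by (simp add: mult_ac)
  moreover have "\<nu> / 2 * (gn w)^2 <= form v w - form u w + G * (nrm M w)^2"
   using G(2) a(5,8) P by (simp add: w_def[abs_def])
  moreover have "0 <= G * (h * gn w)" "0 <= (L * c * B) * (nrm M w)^2" using G(1) h g0 L(1) c(1) B(1) by auto
  ultimately have "\<nu> / 2 * (gn w)^2 <= (L * c * B + G) * (h * gn w + (nrm M w)^2)"
   unfolding distrib_left distrib_right by linarith
  then show "\<nu> / 2 * (gn (%x. v x - u x))^2 <=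
   (L * c * B + G) * (h * gn (%x. v x - u x) + (nrm M (%x. v x - u x))^2)"
   by (simp add: w_def[abs_def])
 qed
qed

lemma error_bound:
 assumes lam: "first_dirichlet_eigenvalue \<Omega> lam" "lam > 0"
  and small: "3 * (\<beta> * (1 + \<gamma>))^2 <= \<beta> * ((2 * \<delta> + 1) / (\<delta> + 1)^2) * \<nu> * lam"
 shows "\<exists>C. \<forall>f u h v. adm N f u h v --> gn (%x. v x - u x) <= C * h"
proof (rule ccontr)
 assume no: "\<not> ?thesis"
 have "\<exists>z. adm N (fst z) (fst (snd z)) (fst (snd (snd z))) (snd (snd (snd z))) \<and>
   real (Suc m) * fst (snd (snd z)) < gn (%x. snd (snd (snd z)) x - fst (snd z) x)" for m
 proof -
  from no obtain f u h v where "adm N f u h v" "\<not> gn (%x. v x - u x) <= real (Suc m) * h" by blast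
  then show ?thesis by (intro exI[of _ "(f, u, h, v)"]) simp
 qed
 then have "\<exists>z. \<forall>m. adm N (fst (z m)) (fst (snd (z m))) (fst (snd (snd (z m)))) (snd (snd (snd (z m)))) \<and>
   real (Suc m) * fst (snd (snd (z m))) < gn (%x. snd (snd (snd (z m))) x - fst (snd (z m)) x)"
  by (intro choice allI)
 then obtain z where z: "!!m. adm N (fst (z m)) (fst (snd (z m))) (fst (snd (snd (z m)))) (snd (snd (snd (z m))))"
   "!!m. real (Suc m) * fst (snd (snd (z m))) < gn (%x. snd (snd (snd (z m))) x - fst (snd (z m)) x)" by blast
 define fs us hs vs where "fs m = fst (z m)" and "us m = fst (snd (z m))" and "hs m = fst (snd (snd (z m)))" and "vs m = snd (snd (snd (z m)))" for m
 have adm: "adm N (fs m) (us m) (hs m) (vs m)" for m unfolding fs_def us_def hs_def vs_def by (rule z(1))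
 define \<rho> where "\<rho> m = gn (%x. vs m x - us m x)" for m
 have big: "real (Suc m) * hs m < \<rho> m" for m unfolding \<rho>_def hs_def vs_def us_def by (rule z(2))
 note a = admD[OF adm]
 have hpos: "0 < hs m" for m by (rule H_pos[OF a(4)])
 have rho: "0 < \<rho> m" for m
  using big[of m] mult_nonneg_nonneg[OF of_nat_0_le_iff less_imp_le[OF hpos[of m]], of "Suc m"] by linarith
 obtain B where B: "B > 0"
  "!!u f. u \<in> H0 ==> sqint M f ==> nrm M f = N ==> form u u = (LINT x|M. f x * u x) ==> gn u <= B \<and> PI u <= B"
  by (rule apriori[of N]) (rule that)
 have Bu: "gn (us m) <= B \<and> PI (us m) <= B" for m by (rule B(2)[OF a(5,1,2) a(9)[OF a(5)]])
 have Bv: "gn (vs m) <= B \<and> PI (vs m) <= B" for m by (rule B(2)[OF a(8,1,2) a(10)[OF a(7)]])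
 have rho2: "\<rho> m <= 2 * B" for m
  using grad_norm_triangle_diff[OF H01_W1[OF a(8)] H01_W1[OF a(5)], of m m] Bu[of m] Bv[of m] unfolding \<rho>_def by linarith
 \<comment> \<open>Errors are bounded by \<open>2 * B\<close>, so an error above
   \<open>Suc m\<close> times the mesh size forces the mesh size to 0. This is what makes
   \<open>compactness\<close> applicable.\<close>
 have hs0: "hs ----> 0"
 proof (rule tendsto_sandwich[OF _ _ tendsto_const])
  show "\<forall>\<^sub>F m in sequentially. 0 <= hs m" by (intro always_eventually allI less_imp_le hpos)
  have "hs m <= 2 * B * (1 / real (Suc m))" for m
   using big[of m] rho2[of m] by (simp add: field_simps)
  then show "\<forall>\<^sub>F m in sequentially. hs m <= 2 * B * (1 / real (Suc m))" by simp
  show "(%m. 2 * B * (1 / real (Suc m))) ----> 0"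
   using tendsto_mult[OF tendsto_const[of "2 * B"] LIMSEQ_Suc[OF lim_1_over_n]] by simp
 qed
 define wh where "wh m = (%x. (1 / \<rho> m) * (vs m x - us m x))" for m
 have wH: "wh m \<in> H0" for m unfolding wh_def by (rule H01_cmult(1)[OF H01_diff(1)[OF a(8,5)]])
 have wg: "gn (wh m) = 1" for m
  unfolding wh_def grad_norm_cmult[OF H01_W1[OF H01_diff(1)[OF a(8,5)]]] \<rho>_def[symmetric] using rho[of m] by simp
 have wg1: "gn (wh m) <= 1" for m by (simp add: wg)
 have Bu1: "gn (us m) <= B" for m using Bu by blast
 have "\<exists>r w. strict_mono r \<and> L2lim M (%m. us (r m)) w" by (rule compactness[of hs us B, OF a(4) hs0 a(5) Bu1])
 then obtain r1 :: "nat => nat" and u where r1: "strict_mono r1" "L2lim M (%m. us (r1 m)) u" by blast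
 have hs1: "(%m. hs (r1 m)) ----> 0" using LIMSEQ_subseq_LIMSEQ[OF hs0 r1(1)] by (simp add: o_def)
 have "\<exists>r w. strict_mono r \<and> L2lim M (%m. wh (r1 (r m))) w"
  by (rule compactness[of "%m. hs (r1 m)" "%m. wh (r1 m)" 1, OF a(4) hs1 wH wg1])
 then obtain r2 :: "nat => nat" and w where r2: "strict_mono r2" "L2lim M (%m. wh (r1 (r2 m))) w" by blast
 obtain r3 :: "nat => nat" where r3: "strict_mono r3" "AE x in M. (%m. us (r1 (r2 (r3 m))) x) ----> u x"
  using L2lim_AE_subseq[OF L2lim_subseq[OF r1(2) r2(1)]] by blast
 obtain r4 :: "nat => nat" where r4: "strict_mono r4" "AE x in M. (%m. wh (r1 (r2 (r3 (r4 m)))) x) ----> w x"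
  using L2lim_AE_subseq[OF L2lim_subseq[OF r2(2) r3(1)]] by blast
 \<comment> \<open>The limit r of the error norms may well be positive, as convergence of the
   discrete solutions is not known. For this reason the coefficients of the limit equation are
   difference quotients between \<open>u + r * w\<close> and u.\<close>
 have "\<exists>l\<in>{0..2 * B}. \<exists>r. strict_mono r \<and> ((%m. \<rho> (r1 (r2 (r3 (r4 m))))) \<circ> r) ----> l"
  by (rule compact_imp_seq_compact[OF compact_Icc, unfolded seq_compact_def, rule_format])
   (simp add: less_imp_le[OF rho] rho2)
 then obtain r5 :: "nat => nat" and r where r5: "strict_mono r5" "(%m. \<rho> (r1 (r2 (r3 (r4 (r5 m)))))) ----> r"
  by (auto simp: o_def)
 define R where "R m = r1 (r2 (r3 (r4 (r5 m))))" for m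
 have Rm: "strict_mono R"
  using strict_mono_o[OF strict_mono_o[OF strict_mono_o[OF strict_mono_o[OF r1(1) r2(1)] r3(1)] r4(1)] r5(1)]
  by (simp add: R_def[abs_def] o_def)
 have uL: "L2lim M (%m. us (R m)) u" unfolding R_def
  by (rule L2lim_subseq[OF L2lim_subseq[OF L2lim_subseq[OF L2lim_subseq[OF r1(2) r2(1)] r3(1)] r4(1)] r5(1)])
 have wL: "L2lim M (%m. wh (R m)) w" unfolding R_def
  by (rule L2lim_subseq[OF L2lim_subseq[OF L2lim_subseq[OF r2(2) r3(1)] r4(1)] r5(1)])
 have uA: "AE x in M. (%m. us (R m) x) ----> u x"
  using r3(2)
 proof eventually_elim
  case (elim x)
  have "strict_mono (%m. r4 (r5 m))" using r4(1) r5(1) by (simp add: strict_mono_def)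
  from LIMSEQ_subseq_LIMSEQ[OF elim this] show ?case by (simp add: o_def R_def)
 qed
 have wA: "AE x in M. (%m. wh (R m) x) ----> w x"
  using r4(2)
 proof eventually_elim
  case (elim x)
  from LIMSEQ_subseq_LIMSEQ[OF elim r5(1)] show ?case by (simp add: o_def R_def)
 qed
 have hR: "(%m. hs (R m)) ----> 0" using LIMSEQ_subseq_LIMSEQ[OF hs0 Rm] by (simp add: o_def)
 have rR: "(%m. \<rho> (R m)) ----> r" unfolding R_def by (rule r5(2))
 have uH: "u \<in> H0" by (rule weak_closed[of "%m. us (R m)" B, OF a(5) Bu1 uL])
 have wH0: "w \<in> H0" by (rule weak_closed[of "%m. wh (R m)" 1, OF wH wg1 wL])
 define c mm where "c = (%x. cq (u x + r * w x) (u x))" and "mm = (%x. mq (u x + r * w x) (u x))"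
 have PB: "PI (us m) <= B" "PI (vs m) <= B" for m using Bu Bv by blast+
 note ql = quotient_limit[of "%m. us (R m)" "%m. vs (R m)" "%m. \<rho> (R m)" r B u w "%m. wh (R m)" c mm,
   OF a(5) a(8) rho rR PB \<rho>_def[symmetric] uH wH0 uA wh_def wA wL c_def mm_def]
 obtain L where L: "L \<ge> 0" "\<forall>u v e. u \<in> H0 --> v \<in> H0 --> e \<in> H0 --> PI u <= B --> PI v <= B -->
  \<bar>form v e - form u e\<bar> <= L * gn (%x. v x - u x) * gn e" using form_lipschitz[of B] by blast
 \<comment> \<open>Orthogonality replaces \<xi> by its Ritz error, whose gradient tends to 0, and
   the Lipschitz bound is proportional to \<open>\<rho>\<close>.\<close>
 have zero: "(%m. (form (vs (R m)) \<xi> - form (us (R m)) \<xi>) / \<rho> (R m)) ----> 0" if xi: "\<xi> \<in> H0" for \<xi>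
 proof -
  have "\<exists>\<zeta>. \<forall>m. ritz_projection \<Omega> (V (hs (R m))) \<xi> (\<zeta> m)" by (intro choice allI ritz_ex a(4) xi)
  then obtain \<zeta> where \<zeta>: "!!m. ritz_projection \<Omega> (V (hs (R m))) \<xi> (\<zeta> m)" by blast
  have g: "(%m. gn (%x. \<xi> x - \<zeta> m x)) ----> 0"
   by (rule ritz_converges[of "%m. hs (R m)" \<xi> \<zeta>, OF a(4) hR xi \<zeta>])
  have b: "\<bar>(form (vs (R m)) \<xi> - form (us (R m)) \<xi>) / \<rho> (R m)\<bar> <= L * gn (%x. \<xi> x - \<zeta> m x)" for m
  proof -
   have d: "(%x. \<xi> x - \<zeta> m x) \<in> H0" by (rule H01_diff(1)[OF xi ritz_props(2)[OF fd[OF a(4)] xi \<zeta>]])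
   have "\<bar>form (vs (R m)) \<xi> - form (us (R m)) \<xi>\<bar> <= L * \<rho> (R m) * gn (%x. \<xi> x - \<zeta> m x)"
    unfolding galerkin_orthogonality[OF adm xi \<zeta>, symmetric] \<rho>_def using L(2) a(5,8) d PB by blast
   then show ?thesis using rho[of "R m"] by (simp add: pos_divide_le_eq mult_ac)
  qed
  have "(%m. L * gn (%x. \<xi> x - \<zeta> m x)) ----> 0" using tendsto_mult[OF tendsto_const g, of L] by simp
  then show ?thesis by (rule Lim_null_comparison[rotated]) (use b in simp)
 qed
 have lH: "(%x. u x + r * w x) \<in> H0" by (rule H01_add(1)[OF uH H01_cmult(1)[OF wH0]])
 have w0: "AE x in M. w x = 0"
 proof (rule limit_equation_unique[where c = c and m = mm and s = "(2 * \<delta> + 1) / (\<delta> + 1)^2" and \<nu> = \<nu> and a = "\<alpha> / (\<delta> + 1)"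
    and \<beta> = \<beta> and lam = lam and g = "\<beta> * \<gamma>" and b = "\<beta> * (1 + \<gamma>)"])
  show "w \<in> H0" by (rule wH0)
  show "lam * (nrm M v)^2 <= (gn v)^2" if "v \<in> H0" for v
   by (rule sharp_poincare[of hs, OF a(4) hs0 lam(1) that])
  show "sqint M c" unfolding c_def by (rule cq_sqint[OF uH lH])
  show "sqint M (%x. c x * w x)" by (rule ql(1))
  show "mm \<in> borel_measurable M" unfolding mm_def by (rule cq_mq_meas(2)[OF uH lH])
  show "(2 * \<delta> + 1) / (\<delta> + 1)^2 * (c x)^2 <= mm x" for x unfolding c_def mm_def by (rule cq_le_mq)
  show "0 < \<nu>" "0 < \<alpha> / (\<delta> + 1)" "0 < \<beta>" "0 < (2 * \<delta> + 1) / (\<delta> + 1)^2" "0 < lam" "0 <= \<beta> * \<gamma>"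
   using pos gam delta lam(2) by auto
  show "3 * (\<beta> * (1 + \<gamma>))^2 <= \<beta> * ((2 * \<delta> + 1) / (\<delta> + 1)^2) * \<nu> * lam" by (rule small)
  show "integrable M (%x. mm x * w x * \<xi> x)" if "\<xi> \<in> H0" for \<xi> by (rule ql(2)[OF that])
  show "\<nu> * gi w \<xi> - \<alpha> / (\<delta> + 1) * (\<Sum>i\<in>UNIV. (LINT x|M. c x * w x * D i \<xi> x))
    - \<beta> * (1 + \<gamma>) * (LINT x|M. c x * w x * \<xi> x) + \<beta> * \<gamma> * (LINT x|M. w x * \<xi> x) + \<beta> * (LINT x|M. mm x * w x * \<xi> x) = 0"
   if "\<xi> \<in> H0" for \<xi> by (rule LIMSEQ_unique[OF ql(3)[OF that] zero[OF that]])
 qed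
 have nw: "nrm M w = 0" by (rule nrm_AE_zero[OF H01_sqint(1)[OF wH0] w0])
 obtain G where G: "G \<ge> 0" "\<forall>f u h v. adm N f u h v --> \<nu> / 2 * (gn (%x. v x - u x))^2 <=
   G * (h * gn (%x. v x - u x) + (nrm M (%x. v x - u x))^2)" using quasi_garding[of N] by blast
 \<comment> \<open>The quasi-Garding inequality divided by \<open>\<rho>^2\<close>. The choice of
   the sequence bounds \<open>h / \<rho>\<close> by \<open>1 / Suc m\<close>, so with w = 0 the
   right side tends to 0 while the left is \<nu> / 2.\<close>
 have low: "\<nu> / 2 <= G * (1 / real (Suc m) + (nrm M (wh (R m)))^2)" for m
 proof -
  define k where "k = R m"
  have mk: "m <= k" unfolding k_def by (rule seq_suble[OF Rm])
  have "\<nu> / 2 * (\<rho> k)^2 <= G * (hs k * \<rho> k + (nrm M (%x. vs k x - us k x))^2)"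
   using G(2) adm[of k] unfolding \<rho>_def by blast
  also have "(%x. vs k x - us k x) = (%x. \<rho> k * wh k x)" using rho[of k] by (simp add: wh_def)
  also have "nrm M (%x. \<rho> k * wh k x) = \<rho> k * nrm M (wh k)" unfolding nrm_cmult using rho[of k] by simp
  also have "G * (hs k * \<rho> k + (\<rho> k * nrm M (wh k))^2) <= G * ((\<rho> k / real (Suc k)) * \<rho> k + (\<rho> k * nrm M (wh k))^2)"
   using G(1) big[of k] rho[of k]
   by (intro mult_left_mono add_mono mult_right_mono) (auto simp: pos_le_divide_eq mult.commute)
  also have "... = G * (1 / real (Suc k) + (nrm M (wh k))^2) * (\<rho> k)^2"
   by (simp add: distrib_left distrib_right power_mult_distrib power2_eq_square mult_ac)
  finally have "\<nu> / 2 * (\<rho> k)^2 <= G * (1 / real (Suc k) + (nrm M (wh k))^2) * (\<rho> k)^2" .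
  then have "\<nu> / 2 <= G * (1 / real (Suc k) + (nrm M (wh k))^2)"
   by (rule mult_right_le_imp_le) (use rho[of k] in simp)
  also have "... <= G * (1 / real (Suc m) + (nrm M (wh k))^2)"
   using mk G(1) by (intro mult_left_mono add_right_mono) (auto simp: frac_le)
  finally show ?thesis by (simp add: k_def)
 qed
 have "(%m. G * (1 / real (Suc m) + (nrm M (wh (R m)))^2)) ----> G * (0 + (nrm M w)^2)"
  by (intro tendsto_intros LIMSEQ_Suc[OF lim_1_over_n] L2lim_nrm[OF wL])
 then have "\<nu> / 2 <= G * (0 + (nrm M w)^2)" by (rule LIMSEQ_le_const) (use low in blast)
 then show False using pos by (simp add: nw)
qed

text \<open>An eigenfunction is a nonzero element of \<open>H0\<close> with nonzero gradient. Its
  Rayleigh quotient is lam, and a negative constant in the Gagliardo-Nirenberg inequality would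
  bound its norm by a negative number.\<close>

lemma eigenvalue_pos:
 assumes "first_dirichlet_eigenvalue \<Omega> lam" shows "lam > 0" "C\<^sub>G\<^sub>N \<ge> 0"
proof -
 obtain P where P: "P > 0" "!!u. u \<in> H0 ==> nrm M u <= P * gn u" using poincare by blast
 obtain w where w: "w \<in> H0" "\<not> (AE x in M. w x = 0)" "\<forall>v\<in>H0. gi w v = lam * L2_inner \<Omega> w v"
  using assms unfolding first_dirichlet_eigenvalue_def dirichlet_eigenvalue_def by blast
 have "nrm M w ~= 0" using nrm_zero_AE[OF H01_sqint(1)[OF w(1)]] w(2) by blast
 then have n: "nrm M w > 0" using nrm_nonneg[of M w] by (simp add: less_le)
 then have g: "gn w > 0" using P(2)[OF w(1)] P(1) by (smt (verit) mult_nonneg_nonpos)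
 have "(gn w)^2 = lam * (nrm M w)^2"
  using w(3)[rule_format, OF w(1)]
  unfolding grad_inner_self[OF H01_W1[OF w(1)]] L2_inner_def power2_eq_square[of "w _", symmetric] nrm_sq .
 then show "lam > 0" using n g by (metis zero_less_mult_pos2 zero_less_power)
 have L: "Lp_norm \<Omega> 2 w = nrm M w" by (rule Lp_norm_nrm[OF H01_sqint(1)[OF w(1)]])
 note G = gn[unfolded gagliardo_nirenberg_const_def, rule_format, OF w(1)]
 obtain a b where ab: "Lp_norm \<Omega> (2 * (\<delta> + 1)) w <= C\<^sub>G\<^sub>N * (gn w powr a * nrm M w powr b)"
 proof (cases "CARD('n) = 2")
  case True
  from G[unfolded if_P[OF True] L mult.assoc] show thesis by (rule that)
 next
  case False
  from G[unfolded if_not_P[OF False] L mult.assoc] show thesis by (rule that)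
 qed
 have "0 <= Lp_norm \<Omega> (2 * (\<delta> + 1)) w" by (simp add: Lp_norm_def)
 then have "0 <= C\<^sub>G\<^sub>N * (gn w powr a * nrm M w powr b)" using ab by linarith
 moreover have "0 < gn w powr a * nrm M w powr b" using g n by simp
 ultimately show "C\<^sub>G\<^sub>N \<ge> 0" by (metis linorder_not_less mult_neg_pos)
qed

text \<open>The Gagliardo-Nirenberg term is bounded below by 0 and
  \<open>2 powr (2 * \<delta> - 1)\<close> by 2. Multiplication by
  \<open>s = (2 * \<delta> + 1) / (\<delta> + 1)^2 <= 1\<close> cancels
  \<open>(\<delta> + 1)^2\<close> and leaves at least \<open>6 * (1 + \<gamma>)^2\<close> minus
  \<open>s * \<gamma>\<close>; as \<open>s * \<gamma> <= (1 + \<gamma>)^2\<close>, the factor 3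
  required by the limit equation is covered.\<close>

lemma smallness:
 assumes lam: "first_dirichlet_eigenvalue \<Omega> lam"
  and hyp: "\<nu> + \<beta> * \<gamma> / lam > \<beta> / lam * 2 powr (2 * \<delta> - 1) * (1 + \<gamma>)^2 * (\<delta> + 1)^2
       + 2 * C\<^sub>G\<^sub>N * \<alpha> / lam powr \<theta> * sqrt (K_tilde \<Omega> \<nu> \<beta> \<gamma> \<delta> f / \<beta>)"
 shows "3 * (\<beta> * (1 + \<gamma>))^2 <= \<beta> * ((2 * \<delta> + 1) / (\<delta> + 1)^2) * \<nu> * lam"
proof -
 note l = eigenvalue_pos[OF lam]
 have "0 <= K_tilde \<Omega> \<nu> \<beta> \<gamma> \<delta> f" unfolding K_tilde_def using pos delta by simp
 then have "0 <= 2 * C\<^sub>G\<^sub>N * \<alpha> / lam powr \<theta> * sqrt (K_tilde \<Omega> \<nu> \<beta> \<gamma> \<delta> f / \<beta>)"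
  using l pos by (intro mult_nonneg_nonneg divide_nonneg_nonneg) auto
 then have "\<beta> / lam * 2 powr (2 * \<delta> - 1) * (1 + \<gamma>)^2 * (\<delta> + 1)^2 <= \<nu> + \<beta> * \<gamma> / lam" using hyp by linarith
 from mult_left_mono[OF this, of lam] l(1)
 have 1: "\<beta> * (2 powr (2 * \<delta> - 1) * (1 + \<gamma>)^2 * (\<delta> + 1)^2) <= \<nu> * lam + \<beta> * \<gamma>"
  by (simp add: distrib_left mult_ac)
 have "2 powr 1 <= 2 powr (2 * \<delta> - 1)" using delta by (intro powr_mono) auto
 then have "2 * ((1 + \<gamma>)^2 * (\<delta> + 1)^2) <= 2 powr (2 * \<delta> - 1) * ((1 + \<gamma>)^2 * (\<delta> + 1)^2)"
  by (intro mult_right_mono) auto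
 then have "\<beta> * (2 * ((1 + \<gamma>)^2 * (\<delta> + 1)^2)) <= \<beta> * (2 powr (2 * \<delta> - 1) * ((1 + \<gamma>)^2 * (\<delta> + 1)^2))"
  using pos by (intro mult_left_mono) auto
 then have 2: "\<beta> * (2 * ((1 + \<gamma>)^2 * (\<delta> + 1)^2)) - \<beta> * \<gamma> <= \<nu> * lam"
  using 1 unfolding mult.assoc by linarith
 define s where "s = (2 * \<delta> + 1) / (\<delta> + 1)^2"
 have s0: "0 < s" using delta by (simp add: s_def)
 have "0 < (\<delta> + 1)^2" "2 * \<delta> + 1 <= (\<delta> + 1)^2"
  using delta by (simp, simp add: power2_sum)
 then have s1: "s <= 1" unfolding s_def by (simp add: pos_divide_le_eq)
 have sd: "s * (\<delta> + 1)^2 = 2 * \<delta> + 1" using delta by (simp add: s_def)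
 have "s * (\<beta> * (2 * ((1 + \<gamma>)^2 * (\<delta> + 1)^2)) - \<beta> * \<gamma>) <= s * (\<nu> * lam)" using s0 by (intro mult_left_mono 2) auto
 moreover have "s * (\<beta> * (2 * ((1 + \<gamma>)^2 * (\<delta> + 1)^2)) - \<beta> * \<gamma>) = \<beta> * (2 * (1 + \<gamma>)^2 * (s * (\<delta> + 1)^2) - s * \<gamma>)"
  by (simp add: algebra_simps)
 ultimately have 3: "\<beta> * (2 * (1 + \<gamma>)^2 * (2 * \<delta> + 1) - s * \<gamma>) <= s * (\<nu> * lam)" unfolding sd by simp
 have "(1 + \<gamma>)^2 * 3 <= (1 + \<gamma>)^2 * (2 * \<delta> + 1)" using delta by (intro mult_left_mono) auto
 moreover have "s * \<gamma> <= 1 * 1" using s0 s1 gam by (intro mult_mono) auto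
 moreover have "1^2 <= (1 + \<gamma>)^2" using gam by (intro power_mono) auto
 ultimately have "3 * (1 + \<gamma>)^2 <= 2 * (1 + \<gamma>)^2 * (2 * \<delta> + 1) - s * \<gamma>" by simp
 then have "\<beta> * (3 * (1 + \<gamma>)^2) <= \<beta> * (2 * (1 + \<gamma>)^2 * (2 * \<delta> + 1) - s * \<gamma>)"
  using pos by (intro mult_left_mono) auto
 then have "\<beta> * (3 * (1 + \<gamma>)^2) <= s * (\<nu> * lam)" using 3 by linarith
 then have "\<beta> * (\<beta> * (3 * (1 + \<gamma>)^2)) <= \<beta> * (s * (\<nu> * lam))" using pos by (intro mult_left_mono) auto
 then show ?thesis unfolding s_def[symmetric] power_mult_distrib power2_eq_square[of \<beta>] by (simp only: mult_ac)
qed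

end

theorem theorem3p2:
  fixes \<Omega> :: "(real ^ 'n::finite) set"
    and \<nu> \<alpha> \<beta> \<gamma> \<delta> lam\<^sub>1 C\<^sub>G\<^sub>N :: real
    and H :: "real set"
    and \<T> :: "real \<Rightarrow> (real ^ 'n) set set"
    and V :: "real \<Rightarrow> (real ^ 'n \<Rightarrow> real) set"
  assumes "CARD('n) = 2 \<or> CARD('n) = 3"
    and "open \<Omega>" "bounded \<Omega>" "\<Omega> \<noteq> {}" "simply_connected \<Omega>" "lipschitz_boundary \<Omega>"
    and "\<nu> > 0" "\<alpha> > 0" "\<beta> > 0" "0 < \<gamma>" "\<gamma> < 1" "\<delta> \<ge> 1"
    and "CARD('n) = 3 \<Longrightarrow> \<delta> \<le> 2"
    and "first_dirichlet_eigenvalue \<Omega> lam\<^sub>1"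
    and "gagliardo_nirenberg_const \<Omega> \<delta> C\<^sub>G\<^sub>N"
    and "\<And>h. h \<in> H \<Longrightarrow> 0 < h"
    and "shape_regular_meshes \<Omega> H \<T>"
    and "\<And>h. h \<in> H \<Longrightarrow> fin_dim_subspace_H01 \<Omega> (V h)"
    and "approximation_property \<Omega> H V"
  shows "\<exists>C :: real \<Rightarrow> real. \<forall>f u.
           f \<in> L2 \<Omega> \<and>
           \<nu> + \<beta> * \<gamma> / lam\<^sub>1 >
             \<beta> / lam\<^sub>1 * 2 powr (2 * \<delta> - 1) * (1 + \<gamma>)\<^sup>2 * (\<delta> + 1)\<^sup>2
             + 2 * C\<^sub>G\<^sub>N * \<alpha> / lam\<^sub>1 powr gn_theta CARD('n) \<delta> * sqrt (K_tilde \<Omega> \<nu> \<beta> \<gamma> \<delta> f / \<beta>) \<and>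
           strong_solution \<Omega> \<nu> \<alpha> \<beta> \<gamma> \<delta> f u \<longrightarrow>
           (\<forall>h\<in>H. \<forall>u\<^sub>h. galerkin_solution \<Omega> \<nu> \<alpha> \<beta> \<gamma> \<delta> f (V h) u\<^sub>h \<longrightarrow>
              sobolev_norm \<Omega> 1 (\<lambda>x. u\<^sub>h x - u x) \<le> C (Lp_norm \<Omega> 2 f) * h)"
proof -
  interpret galerkin_burgers_huxley \<Omega> H V \<delta> C\<^sub>G\<^sub>N \<nu> \<alpha> \<beta> \<gamma>
    by unfold_locales (use assms in auto)
  obtain P where P: "P > 0" "\<And>u. u \<in> H01 \<Omega> \<Longrightarrow> nrm M u \<le> P * grad_norm \<Omega> u" using poincare by blast
  \<comment> \<open>The constant has to be chosen before f, whereas the smallness assumption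
    contains f through \<open>K_tilde\<close>. \<open>S\<close> is a consequence of it that is free
    of f, so \<open>C N\<close> can be selected under \<open>S\<close> for every norm N.\<close>
  define S where "S \<longleftrightarrow> 3 * (\<beta> * (1 + \<gamma>))\<^sup>2 \<le> \<beta> * ((2 * \<delta> + 1) / (\<delta> + 1)\<^sup>2) * \<nu> * lam\<^sub>1"
  have "\<exists>C. S \<longrightarrow> (\<forall>f u h v. adm N f u h v \<longrightarrow> grad_norm \<Omega> (\<lambda>x. v x - u x) \<le> C * h)" for N
  proof (cases S)
    case True
    from error_bound[OF assms(14) eigenvalue_pos(1)[OF assms(14)] True[unfolded S_def], of N] show ?thesis by simp
  qed simp
  then have "\<exists>C. \<forall>N. S \<longrightarrow> (\<forall>f u h v. adm N f u h v \<longrightarrow> grad_norm \<Omega> (\<lambda>x. v x - u x) \<le> C N * h)"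
    by (intro choice allI)
  then obtain C where C: "\<And>N. S \<Longrightarrow> \<forall>f u h v. adm N f u h v \<longrightarrow> grad_norm \<Omega> (\<lambda>x. v x - u x) \<le> C N * h" by blast
  show ?thesis
  proof (intro exI[of _ "\<lambda>N. (P + real CARD('n)) * C N"] allI impI ballI)
    fix f u h v
    assume A: "f \<in> L2 \<Omega> \<and>
           \<nu> + \<beta> * \<gamma> / lam\<^sub>1 >
             \<beta> / lam\<^sub>1 * 2 powr (2 * \<delta> - 1) * (1 + \<gamma>)\<^sup>2 * (\<delta> + 1)\<^sup>2
             + 2 * C\<^sub>G\<^sub>N * \<alpha> / lam\<^sub>1 powr gn_theta CARD('n) \<delta> * sqrt (K_tilde \<Omega> \<nu> \<beta> \<gamma> \<delta> f / \<beta>) \<and>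
           strong_solution \<Omega> \<nu> \<alpha> \<beta> \<gamma> \<delta> f u"
      and h: "h \<in> H" and v: "galerkin_solution \<Omega> \<nu> \<alpha> \<beta> \<gamma> \<delta> f (V h) v"
    have f: "sqint M f" using A L2_iff by blast
    have S: "S" unfolding S_def by (rule smallness[OF assms(14)]) (use A in blast)
    have adm: "adm (Lp_norm \<Omega> 2 f) f u h v" using A f h v by (simp add: adm_def Lp_norm_nrm)
    note a = admD[OF adm]
    have w: "(\<lambda>x. v x - u x) \<in> H01 \<Omega>" by (rule H01_diff(1)[OF a(8,5)])
    have "sobolev_norm \<Omega> 1 (\<lambda>x. v x - u x) \<le> nrm M (\<lambda>x. v x - u x) + (\<Sum>i\<in>UNIV. nrm M (D i (\<lambda>x. v x - u x)))"
      by (rule sobolev_norm_1_bounds(3)[OF H01_W1[OF w]])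
    also have "\<dots> \<le> P * grad_norm \<Omega> (\<lambda>x. v x - u x) + (\<Sum>i\<in>(UNIV :: 'n set). grad_norm \<Omega> (\<lambda>x. v x - u x))"
      by (intro add_mono sum_mono P(2)[OF w] nrm_D_le H01_W1 w)
    also have "\<dots> = (P + real CARD('n)) * grad_norm \<Omega> (\<lambda>x. v x - u x)" by (simp add: distrib_right)
    also have "\<dots> \<le> (P + real CARD('n)) * (C (Lp_norm \<Omega> 2 f) * h)"
      using C[OF S] adm P(1) by (intro mult_left_mono) auto
    finally show "sobolev_norm \<Omega> 1 (\<lambda>x. v x - u x) \<le> (P + real CARD('n)) * C (Lp_norm \<Omega> 2 f) * h"
      by (simp add: mult.assoc)
  qed
qed

end
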